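(* Let $A=\mathrm{FK}(3)$ be the Fomin–Kirillov algebra on $3$ generators over a field $\Bbbk$ of characteristic different from $2$ and $3$, and let $X_1,\dots,X_{14}\in\operatorname{HH}^\bullet(A)$ be the classes defined in the context. Put $\tau_4=\tau_5=1$ and $\tau_6=-1$. The Gerstenhaber brackets $[X_i,X_j]$ for $i\in\{4,5,6,7\}$ and $j\in\{1,\dots,14\}$ are given by $$[X_i,X_j]=\begin{cases} 0,&\text{if }(i,j)\in(\{4,\dots,7\}\times\{1,\dots,7\})\cup(\{4,5,6\}\times\{9,10,11\}),\\ 2X_i,&\text{if }i\in\{4,\dots,7\},\ j=8,\\ 4X_1X_9,&\text{if }i=7,\ j=9,\\ X_1X_{10},&\text{if }i=7,\ j=10,\\ -X_1(X_9+X_{10}),&\text{if }i=7,\ j=11,\\ 2X_1X_{i+5},&\text{if }i\in\{4,5\},\ j=12,\\ 2X_1(X_9+X_{10}),&\text{if }i=6,\ j=12,\\ X_1X_9,&\text{if }i=7,\ j=12,\\ 8\tau_iX_4X_{10},&\text{if }i\in\{4,5,6\},\ j=13,\\ 4X_1X_{13}-4X_2X_{13}-8X_4X_{12},&\text{if }i=7,\ j=13,\\ \tau_i\big(\tfrac13X_{i+5}^2-\tfrac43X_9X_{10}\big),&\text{if }i\in\{4,5,6\},\ j=14,\\ X_9X_{12},&\text{if }i=7,\ j=14. \end{cases}$$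
   Context: The algebra. $\Bbbk$ is a field of characteristic $\neq2,3$. $A=\mathrm{FK}(3)$ is the $\Bbbk$-algebra generated by $a,b,c$ with relations $a^2=b^2=c^2=0$, $ab+bc+ca=0$, $ba+ac+cb=0$, graded with $a,b,c$ in (internal) degree $1$; a basis is $\{1,a,b,c,ab,bc,ba,ac,aba,abc,bac,abac\}$. Its quadratic dual is $A^!=\Bbbk\langle A,B,C\rangle/(BA-AC,CA-AB,AB-BC,CB-BA)$, where $\{A,B,C\}$ is the basis dual to $\{a,b,c\}$, in internal degree $-1$; $A^!_{-n}$ denotes the component of degree $-n$. $A^!_{-n}$ has basis $\{1\}$ for $n=0$, $\{A,B,C\}$ for $n=1$, and for $n\ge2$ the set $\{A^n,B^n,C^n,A^{n-1}B,A^{n-1}C,A^{n-2}B^2\}$ (for $n=2$ the element $A^0B^2=B^2$ is counted only once). The dual basis of $(A^!_{-n})^*$ is denoted by $\epsilon^!$ for $n=0$; $\alpha,\beta,\gamma$ for $n=1$; $\alpha_2,\beta_2,\gamma_2,\alpha\beta,\alpha\gamma$ for $n=2$; and $\alpha_n,\beta_n,\gamma_n,\alpha_{n-1}\beta,\alpha_{n-1}\gamma,\alpha_{n-2}\beta_2$ for $n\ge3$ (index $1$ omitted), dual in this order to the listed monomials; $(A^!_{-n})^*$ has internal degree $n$. Vertical bars in elements denote tensor products over $\Bbbk$. The resolution. Let $K_n=A\otimes(A^!_{-n})^*\otimes A$ with Koszul differential $d_n:K_n\to K_{n-1}$ the $A$-bimodule map $$d_n(1|u|1)=\sum_{(x,X)\in\{(a,A),(b,B),(c,C)\}}\big((-1)^n\,x|u(X\,\cdot)|1+1|u(\cdot\,X)|x\big),$$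 where $u(X\,\cdot)$ and $u(\cdot\,X)$ are the functionals $w\mapsto u(Xw)$ and $w\mapsto u(wX)$ on $A^!_{-(n-1)}$. Put $p=\alpha\beta_2-2\alpha_3$, $q=\alpha_2\beta-2\beta_3$, $r=\alpha_2\gamma-2\gamma_3$. The minimal projective bimodule resolution of $A$ is $P_n=\bigoplus_{0\le i\le\lfloor n/4\rfloor}\omega_iK_{n-4i}$ ($\omega_i$ a symbol of homological degree $4i$ and internal degree $6i$), with differential $\delta_n\big(\sum_i\omega_i\rho_{n-4i}\big)=\sum_i\big(\omega_id_{n-4i}(\rho_{n-4i})+\omega_{i-1}f_{n-4i}(\rho_{n-4i})\big)$, where $\omega_{-1}=0$, $f_0:K_0\to K_3$ is the bimodule map with $$\begin{aligned}f_0(1|\epsilon^!|1)={}&-1|p|bac-1|q|abc+1|r|aba+a|q|(ba+ac)-a|r|bc+b|p|(ab+bc)-b|r|ac-c|q|ab-c|p|ba\\&-bc|q|a+(ba+ac)|r|a+(ab+bc)|r|b-ac|p|b-ba|q|c-ab|p|c-bac|p|1-abc|q|1+aba|r|1,\end{aligned}$$ and $f_j:K_j\to K_{j+3}$, $j\ge1$, are fixed homogeneous bimodule morphisms (raising internal degree by $6$) making this a resolution, with augmentation $x|\epsilon^!|y\mapsto xy$ ($\omega_0$ is omitted from the notation). The choice of $f_j$ for $j\geq 1$ does not affect the classes below. The classes. For a basis element $u$ of $(A^!_{-n})^*$ and $x\in A$, $u|x$ denotes the bimodule morphism $P_n\to A$ sending $1|u|1\mapsto x$, all other $1|u'|1$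 ($u'$ a basis element of $(A^!_{-n})^*$) to $0$, and vanishing on $\omega_iK_{n-4i}$ for $i\ge1$; $\omega_1^*\epsilon^!|1$ denotes the morphism $P_4\to A$ vanishing on $K_4$ with $\omega_11|\epsilon^!|1\mapsto1$. The $X_i\in\operatorname{HH}^\bullet(A)\cong H^\bullet(\operatorname{Hom}_{A^e}(P_\bullet,A))$ are the classes of the cocycles: $X_1=\epsilon^!|(ab+ba)$, $X_2=\epsilon^!|(ab+bc-ac)$, $X_3=\epsilon^!|abac$ (degree $0$); $X_4=\alpha|bac$, $X_5=\beta|abc$, $X_6=\gamma|aba$, $X_7=\alpha|(aba-abc)$, $X_8=\alpha|a+\beta|b+\gamma|c$ (degree $1$); $X_9=\alpha_2|1$, $X_{10}=\beta_2|1$, $X_{11}=\gamma_2|1$, $X_{12}=(\alpha\beta+\alpha\gamma)|1$ (degree $2$); $X_{13}=\alpha_3|a+\beta_3|b+\gamma_3|c$ (degree $3$); $X_{14}=\omega_1^*\epsilon^!|1$ (degree $4$). They generate the algebra $\operatorname{HH}^\bullet(A)$. Structure on $\operatorname{HH}^\bullet(A)$. Juxtaposition is the cup product, given on the bar resolution by $(f\cup g)(a_1,\dots,a_{m+n})=f(a_1,\dots,a_m)g(a_{m+1},\dots,a_{m+n})$ (no sign). The Gerstenhaber bracket is, for $f\in\operatorname{Hom}_\Bbbk(A^{\otimes m},A)$, $g\in\operatorname{Hom}_\Bbbk(A^{\otimes n},A)$, $[f,g]=f\circ_Gg-(-1)^{(m-1)(n-1)}g\circ_Gf$ with $(f\circ_Gg)(a_1|\dots|a_{m+n-1})=\sum_{i=1}^m(-1)^{(n-1)(i-1)}f(a_1|\dots|a_{i-1}|g(a_i|\dots|a_{i+n-1})|a_{i+n}|\dots|a_{m+n-1})$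 (and $f\circ_Gg=0$ if $m=0$; $g(1)$ is inserted if $n=0$). Here $\operatorname{Hom}_\Bbbk(A^{\otimes n},A)$ is identified with $\operatorname{Hom}_{A^e}(B_n(A),A)$, $B_n(A)=A^{\otimes(n+2)}$ the bar resolution with differential $\sum_j(-1)^ja_0|\dots|a_ja_{j+1}|\dots|a_{n+1}$, via $g\mapsto(a_0|\dots|a_{n+1}\mapsto a_0g(a_1|\dots|a_n)a_{n+1})$, and cohomology is transported to $H^\bullet(\operatorname{Hom}_{A^e}(P_\bullet,A))$ by composing with a morphism $i_\bullet:P_\bullet\to B_\bullet(A)$ of bimodule complexes lifting $\mathrm{id}_A$ (e.g. $i_0(1|\epsilon^!|1)=1|1$, $i_1(1|\alpha|1)=-1|a|1$, $i_1(1|\beta|1)=-1|b|1$, $i_1(1|\gamma|1)=-1|c|1$). *)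

theory Defs
  imports Complex_Main "HOL-Library.Poly_Mapping" "HOL-Library.Function_Algebras"
begin

section \<open>The algebra FK(3) and its quadratic dual\<close>

text \<open>Both algebras are quotients of the free algebra on three letters, which is the monoid
  algebra \<open>word \<Rightarrow>\<^sub>0 'k\<close> of the free monoid (written additively, as \<open>Poly_Mapping\<close> requires).
  The letters \<open>Ga, Gb, Gc\<close> stand for $a,b,c$ in FK(3) and for $A,B,C$ in the quadratic dual.\<close>

datatype gen = Ga | Gb | Gc

datatype word = Word (letters: "gen list")

instantiation word :: monoid_add
begin
definition zero_word where "0 = Word []"
definition plus_word where "v + w = Word (letters v @ letters w)"
instance by standard (auto simp: zero_word_def plus_word_def)
end

definition monom :: "gen list \<Rightarrow> word \<Rightarrow>\<^sub>0 'k::field"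
  where "monom gs = Poly_Mapping.single (Word gs) 1"

inductive_set two_sided_ideal :: "'r::ring_1 set \<Rightarrow> 'r set" for R
  where
    zero: "0 \<in> two_sided_ideal R"
  | gen: "r \<in> R \<Longrightarrow> x * r * y \<in> two_sided_ideal R"
  | add: "r \<in> two_sided_ideal R \<Longrightarrow> s \<in> two_sided_ideal R \<Longrightarrow> r + s \<in> two_sided_ideal R"

lemma two_sided_ideal_mult:
  "r \<in> two_sided_ideal R \<Longrightarrow> x * r * y \<in> two_sided_ideal R"
proof (induction rule: two_sided_ideal.induct)
  case (gen r x' y')
  have "x * (x' * r * y') * y = (x * x') * r * (y' * y)" by (simp add: mult.assoc)
  then show ?case using two_sided_ideal.gen[OF gen] by metis
qed (auto simp: algebra_simps intro: two_sided_ideal.intros)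

lemma two_sided_ideal_lmult: "r \<in> two_sided_ideal R \<Longrightarrow> x * r \<in> two_sided_ideal R"
  using two_sided_ideal_mult[of r R x 1] by simp

lemma two_sided_ideal_rmult: "r \<in> two_sided_ideal R \<Longrightarrow> r * y \<in> two_sided_ideal R"
  using two_sided_ideal_mult[of r R 1 y] by simp

lemma two_sided_ideal_uminus: "r \<in> two_sided_ideal R \<Longrightarrow> - r \<in> two_sided_ideal R"
  using two_sided_ideal_lmult[of r R "- 1"] by simp

lemma equivp_two_sided_ideal: "equivp (\<lambda>p q. p - q \<in> two_sided_ideal R)"
proof (rule equivpI)
  show "reflp (\<lambda>p q. p - q \<in> two_sided_ideal R)"
    by (rule reflpI) (simp add: two_sided_ideal.zero)
  show "symp (\<lambda>p q. p - q \<in> two_sided_ideal R)"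
    by (rule sympI) (metis minus_diff_eq two_sided_ideal_uminus)
  show "transp (\<lambda>p q. p - q \<in> two_sided_ideal R)"
  proof (rule transpI)
    fix p q r assume "p - q \<in> two_sided_ideal R" "q - r \<in> two_sided_ideal R"
    from two_sided_ideal.add[OF this] show "p - r \<in> two_sided_ideal R" by simp
  qed
qed

lemma two_sided_ideal_cong:
  assumes "p - p' \<in> two_sided_ideal R" "q - q' \<in> two_sided_ideal R"
  shows "(p + q) - (p' + q') \<in> two_sided_ideal R" "(p - q) - (p' - q') \<in> two_sided_ideal R"
    "- p - - p' \<in> two_sided_ideal R" "p * q - p' * q' \<in> two_sided_ideal R"
proof -
  have "(p + q) - (p' + q') = (p - p') + (q - q')" by simp
  then show "(p + q) - (p' + q') \<in> two_sided_ideal R"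
    using assms two_sided_ideal.add by metis
  have "(p - q) - (p' - q') = (p - p') + - (q - q')" by simp
  then show "(p - q) - (p' - q') \<in> two_sided_ideal R"
    using assms two_sided_ideal.add two_sided_ideal_uminus by metis
  have "- p - - p' = - (p - p')" by simp
  then show "- p - - p' \<in> two_sided_ideal R"
    using assms two_sided_ideal_uminus by metis
  have "p * q - p' * q' = (p - p') * q + p' * (q - q')" by (simp add: algebra_simps)
  then show "p * q - p' * q' \<in> two_sided_ideal R"
    using assms two_sided_ideal.add two_sided_ideal_lmult two_sided_ideal_rmult by metis
qed

definition free_scale :: "'k \<Rightarrow> ('i \<Rightarrow>\<^sub>0 'k) \<Rightarrow> ('i \<Rightarrow>\<^sub>0 'k::field)"
  where "free_scale c = Poly_Mapping.map ((*) c)"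

lemma lookup_free_scale [simp]: "Poly_Mapping.lookup (free_scale c p) i = c * Poly_Mapping.lookup p i"
  by (auto simp: free_scale_def Poly_Mapping.map.rep_eq when_def)

lemma vector_space_free_scale: "vector_space (free_scale :: 'k::field \<Rightarrow> ('i \<Rightarrow>\<^sub>0 'k) \<Rightarrow> _)"
  by unfold_locales (auto intro!: poly_mapping_eqI simp: lookup_add algebra_simps)

lemma free_scale_conv_mult: "free_scale c p = Poly_Mapping.single 0 c * p"
  for p :: "word \<Rightarrow>\<^sub>0 'k::field"
  by (simp add: free_scale_def mult_map_scale_conv_mult)

lemma free_scalar_central: "p * Poly_Mapping.single 0 c = Poly_Mapping.single 0 c * p"
  for p :: "word \<Rightarrow>\<^sub>0 'k::field"
proof (induction p rule: update_induct)
  case const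
  show ?case by simp
next
  case (update p v a)
  have "Poly_Mapping.update v a p = p + Poly_Mapping.single v a"
    using update by (intro poly_mapping_eqI)
      (auto simp: lookup_update lookup_add lookup_single in_keys_iff when_def)
  then show ?case using update by (simp add: algebra_simps mult_single)
qed

lemma two_sided_ideal_scale:
  fixes p q :: "word \<Rightarrow>\<^sub>0 'k::field"
  assumes "p - q \<in> two_sided_ideal R"
  shows "free_scale c p - free_scale c q \<in> two_sided_ideal R"
  using two_sided_ideal_lmult[OF assms] by (simp add: free_scale_conv_mult algebra_simps)

definition fk_relators :: "(word \<Rightarrow>\<^sub>0 'k::field) set"
  where "fk_relators =
    {monom [Ga, Ga], monom [Gb, Gb], monom [Gc, Gc],
     monom [Ga, Gb] + monom [Gb, Gc] + monom [Gc, Ga],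
     monom [Gb, Ga] + monom [Ga, Gc] + monom [Gc, Gb]}"

definition fkd_relators :: "(word \<Rightarrow>\<^sub>0 'k::field) set"
  where "fkd_relators =
    {monom [Gb, Ga] - monom [Ga, Gc], monom [Gc, Ga] - monom [Ga, Gb],
     monom [Ga, Gb] - monom [Gb, Gc], monom [Gc, Gb] - monom [Gb, Ga]}"

quotient_type (overloaded) 'k fk3 =
  "word \<Rightarrow>\<^sub>0 'k::field" / "\<lambda>p q. p - q \<in> two_sided_ideal fk_relators"
  by (rule equivp_two_sided_ideal)

quotient_type (overloaded) 'k fkd =
  "word \<Rightarrow>\<^sub>0 'k::field" / "\<lambda>p q. p - q \<in> two_sided_ideal fkd_relators"
  by (rule equivp_two_sided_ideal)

lemma one_neq_zero_quotient:
  fixes R :: "(word \<Rightarrow>\<^sub>0 'k::field) set"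
  assumes R: "\<And>r. r \<in> R \<Longrightarrow> \<forall>w. length (letters w) \<noteq> 2 \<longrightarrow> Poly_Mapping.lookup r w = 0"
  shows "1 \<notin> two_sided_ideal R"
proof
  have zero_sum: "(0::word) = v + w \<longleftrightarrow> v = 0 \<and> w = 0" for v w
    by (cases v; cases w) (auto simp: zero_word_def plus_word_def)
  have lk: "Poly_Mapping.lookup (p * q) 0 = Poly_Mapping.lookup p 0 * Poly_Mapping.lookup q 0" for p q :: "word \<Rightarrow>\<^sub>0 'k"
  proof -
    have "Poly_Mapping.lookup (p * q) 0 = (\<Sum>v. Poly_Mapping.lookup p v * (\<Sum>w. Poly_Mapping.lookup q w when 0 = v + w))"
      by (simp add: lookup_mult)
    also have "(\<lambda>v. Poly_Mapping.lookup p v * (\<Sum>w. Poly_Mapping.lookup q w when 0 = v + w)) =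
        (\<lambda>v. Poly_Mapping.lookup p 0 * Poly_Mapping.lookup q 0 when v = 0)"
    proof
      fix v
      have "(\<lambda>w. Poly_Mapping.lookup q w when 0 = v + w) = (\<lambda>w. (Poly_Mapping.lookup q 0 when v = 0) when w = 0)"
        by (intro ext) (simp add: zero_sum when_def)
      then have "(\<Sum>w. Poly_Mapping.lookup q w when 0 = v + w) =
          (\<Sum>w::word. (Poly_Mapping.lookup q 0 when v = 0) when w = 0)"
        by (rule arg_cong[where f = Sum_any])
      also have "\<dots> = (Poly_Mapping.lookup q 0 when v = 0)" by simp
      finally show "Poly_Mapping.lookup p v * (\<Sum>w. Poly_Mapping.lookup q w when 0 = v + w) =
          (Poly_Mapping.lookup p 0 * Poly_Mapping.lookup q 0 when v = 0)"
        by (cases "v = 0") simp_all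
    qed
    finally show ?thesis by simp
  qed
  have R0: "Poly_Mapping.lookup r 0 = 0" if "r \<in> R" for r
    using R[OF that] by (simp add: zero_word_def)
  have "Poly_Mapping.lookup r 0 = 0" if "r \<in> two_sided_ideal R" for r
    using that
    by induction (auto simp: lk lookup_add R0)
  moreover assume "1 \<in> two_sided_ideal R"
  ultimately show False using lookup_one_zero[where ?'a = 'k and ?'b = word] by fastforce
qed

instantiation fk3 :: (field) ring_1
begin
lift_definition zero_fk3 :: "'a fk3" is 0 .
lift_definition one_fk3 :: "'a fk3" is 1 .
lift_definition plus_fk3 :: "'a fk3 \<Rightarrow> 'a fk3 \<Rightarrow> 'a fk3" is "(+)"
  by (rule two_sided_ideal_cong)
lift_definition minus_fk3 :: "'a fk3 \<Rightarrow> 'a fk3 \<Rightarrow> 'a fk3" is "(-)"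
  by (rule two_sided_ideal_cong)
lift_definition uminus_fk3 :: "'a fk3 \<Rightarrow> 'a fk3" is uminus
  by (rule two_sided_ideal_cong(3))
lift_definition times_fk3 :: "'a fk3 \<Rightarrow> 'a fk3 \<Rightarrow> 'a fk3" is "(*)"
  by (rule two_sided_ideal_cong)
instance
proof
  show "(0::'a fk3) \<noteq> 1"
  proof (transfer, rule notI)
    assume "0 - 1 \<in> two_sided_ideal (fk_relators :: (word \<Rightarrow>\<^sub>0 'a) set)"
    then have "1 \<in> two_sided_ideal (fk_relators :: (word \<Rightarrow>\<^sub>0 'a) set)"
      using two_sided_ideal_uminus by fastforce
    then show False
      by (rule one_neq_zero_quotient[THEN notE, rotated])
        (auto simp: fk_relators_def monom_def lookup_add lookup_single when_def)
  qed
qed (transfer; simp add: algebra_simps two_sided_ideal.zero)+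
end

instantiation fkd :: (field) ring_1
begin
lift_definition zero_fkd :: "'a fkd" is 0 .
lift_definition one_fkd :: "'a fkd" is 1 .
lift_definition plus_fkd :: "'a fkd \<Rightarrow> 'a fkd \<Rightarrow> 'a fkd" is "(+)"
  by (rule two_sided_ideal_cong)
lift_definition minus_fkd :: "'a fkd \<Rightarrow> 'a fkd \<Rightarrow> 'a fkd" is "(-)"
  by (rule two_sided_ideal_cong)
lift_definition uminus_fkd :: "'a fkd \<Rightarrow> 'a fkd" is uminus
  by (rule two_sided_ideal_cong(3))
lift_definition times_fkd :: "'a fkd \<Rightarrow> 'a fkd \<Rightarrow> 'a fkd" is "(*)"
  by (rule two_sided_ideal_cong)
instance
proof
  show "(0::'a fkd) \<noteq> 1"
  proof (transfer, rule notI)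
    assume "0 - 1 \<in> two_sided_ideal (fkd_relators :: (word \<Rightarrow>\<^sub>0 'a) set)"
    then have "1 \<in> two_sided_ideal (fkd_relators :: (word \<Rightarrow>\<^sub>0 'a) set)"
      using two_sided_ideal_uminus by fastforce
    then show False
      by (rule one_neq_zero_quotient[THEN notE, rotated])
        (auto simp: fkd_relators_def monom_def lookup_minus lookup_single when_def)
  qed
qed (transfer; simp add: algebra_simps two_sided_ideal.zero)+
end

lift_definition fk_scale :: "'k::field \<Rightarrow> 'k fk3 \<Rightarrow> 'k fk3" is free_scale
  by (rule two_sided_ideal_scale)

lift_definition fkd_scale :: "'k::field \<Rightarrow> 'k fkd \<Rightarrow> 'k fkd" is free_scale
  by (rule two_sided_ideal_scale)

lemma vector_space_fk_scale: "vector_space fk_scale"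
proof -
  interpret vector_space "free_scale :: 'a \<Rightarrow> (word \<Rightarrow>\<^sub>0 'a) \<Rightarrow> _"
    by (rule vector_space_free_scale)
  show ?thesis
    by unfold_locales
      (transfer; simp add: scale_left_distrib scale_right_distrib two_sided_ideal.zero)+
qed

lemma vector_space_fkd_scale: "vector_space fkd_scale"
proof -
  interpret vector_space "free_scale :: 'a \<Rightarrow> (word \<Rightarrow>\<^sub>0 'a) \<Rightarrow> _"
    by (rule vector_space_free_scale)
  show ?thesis
    by unfold_locales
      (transfer; simp add: scale_left_distrib scale_right_distrib two_sided_ideal.zero)+
qed

definition fk_gen :: "gen \<Rightarrow> 'k::field fk3"
  where "fk_gen g = abs_fk3 (monom [g])"

definition fkd_gen :: "gen \<Rightarrow> 'k::field fkd"
  where "fkd_gen g = abs_fkd (monom [g])"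

abbreviation (input) "fk_a \<equiv> fk_gen Ga"
abbreviation (input) "fk_b \<equiv> fk_gen Gb"
abbreviation (input) "fk_c \<equiv> fk_gen Gc"
abbreviation (input) "fkd_A \<equiv> fkd_gen Ga"
abbreviation (input) "fkd_B \<equiv> fkd_gen Gb"
abbreviation (input) "fkd_C \<equiv> fkd_gen Gc"

definition fk_component :: "nat \<Rightarrow> 'k::field fk3 set"
  where "fk_component n = module.span fk_scale {prod_list (map fk_gen gs) |gs. length gs = n}"

text \<open>The component of internal degree $-n$ of the quadratic dual.\<close>

definition fkd_component :: "nat \<Rightarrow> 'k::field fkd set"
  where "fkd_component n = module.span fkd_scale {prod_list (map fkd_gen gs) |gs. length gs = n}"


section \<open>Duals of the components of the quadratic dual\<close>

lemma vector_space_field: "vector_space ((*) :: 'k::field \<Rightarrow> 'k \<Rightarrow> 'k)"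
  by unfold_locales (auto simp: algebra_simps)

lemma linear_fkd_functional_iff:
  "Vector_Spaces.linear fkd_scale (*) u \<longleftrightarrow>
    (\<forall>x y. u (x + y) = u x + u y) \<and> (\<forall>c x. u (fkd_scale c x) = c * u x)"
  for u :: "'k::field fkd \<Rightarrow> 'k"
  by (simp add: Vector_Spaces.linear_iff vector_space_fkd_scale vector_space_field)

typedef (overloaded) 'k fkd_dual =
  "{u :: 'k::field fkd \<Rightarrow> 'k. Vector_Spaces.linear fkd_scale (*) u}"
  morphisms dual_app Abs_fkd_dual
proof
  show "(\<lambda>_. 0) \<in> {u :: 'k fkd \<Rightarrow> 'k. Vector_Spaces.linear fkd_scale (*) u}"
    by (simp add: linear_fkd_functional_iff)
qed

setup_lifting type_definition_fkd_dual

instantiation fkd_dual :: (field) ab_group_add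
begin
lift_definition zero_fkd_dual :: "'a fkd_dual" is "\<lambda>_. 0"
  by (simp add: linear_fkd_functional_iff)
lift_definition plus_fkd_dual :: "'a fkd_dual \<Rightarrow> 'a fkd_dual \<Rightarrow> 'a fkd_dual"
  is "\<lambda>u v w. u w + v w"
  by (simp add: linear_fkd_functional_iff algebra_simps)
lift_definition minus_fkd_dual :: "'a fkd_dual \<Rightarrow> 'a fkd_dual \<Rightarrow> 'a fkd_dual"
  is "\<lambda>u v w. u w - v w"
  by (simp add: linear_fkd_functional_iff algebra_simps)
lift_definition uminus_fkd_dual :: "'a fkd_dual \<Rightarrow> 'a fkd_dual" is "\<lambda>u w. - u w"
  by (simp add: linear_fkd_functional_iff algebra_simps)
instance by standard (transfer; simp add: fun_eq_iff)+
end

lift_definition dual_scale :: "'k::field \<Rightarrow> 'k fkd_dual \<Rightarrow> 'k fkd_dual" is "\<lambda>c u w. c * u w"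
  by (simp add: linear_fkd_functional_iff algebra_simps)

lemma fkd_scale_mult:
  "x * fkd_scale c y = fkd_scale c (x * y)" "fkd_scale c x * y = fkd_scale c (x * y)"
proof -
  show "x * fkd_scale c y = fkd_scale c (x * y)"
    by transfer
      (simp add: free_scale_conv_mult free_scalar_central two_sided_ideal.zero flip: mult.assoc)
  show "fkd_scale c x * y = fkd_scale c (x * y)"
    by transfer (simp add: free_scale_conv_mult two_sided_ideal.zero mult.assoc)
qed

text \<open>\<open>dual_lshift X u\<close> is the functional $u(X\,\cdot)$ and \<open>dual_rshift X u\<close> is $u(\cdot\,X)$.\<close>

definition dual_lshift :: "'k::field fkd \<Rightarrow> 'k fkd_dual \<Rightarrow> 'k fkd_dual"
  where "dual_lshift X u = Abs_fkd_dual (\<lambda>w. dual_app u (X * w))"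

definition dual_rshift :: "'k::field fkd \<Rightarrow> 'k fkd_dual \<Rightarrow> 'k fkd_dual"
  where "dual_rshift X u = Abs_fkd_dual (\<lambda>w. dual_app u (w * X))"

lemma dual_app_shift:
  "dual_app (dual_lshift X u) w = dual_app u (X * w)"
  "dual_app (dual_rshift X u) w = dual_app u (w * X)"
proof -
  have "Vector_Spaces.linear fkd_scale (*) (dual_app u)" using dual_app by blast
  then show "dual_app (dual_lshift X u) w = dual_app u (X * w)"
    "dual_app (dual_rshift X u) w = dual_app u (w * X)"
    unfolding dual_lshift_def dual_rshift_def
    by (subst Abs_fkd_dual_inverse;
        simp add: linear_fkd_functional_iff algebra_simps fkd_scale_mult)+
qed

text \<open>The dual of the component of degree $-n$, as the space of functionals on the whole algebra
  that vanish on all other components.\<close>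

definition dual_component :: "nat \<Rightarrow> 'k::field fkd_dual set"
  where "dual_component n = {u. \<forall>m w. m \<noteq> n \<longrightarrow> w \<in> fkd_component m \<longrightarrow> dual_app u w = 0}"

definition fkd_basis :: "nat \<Rightarrow> 'k::field fkd set"
  where "fkd_basis n =
    (if n = 0 then {1}
     else if n = 1 then {fkd_A, fkd_B, fkd_C}
     else {fkd_A ^ n, fkd_B ^ n, fkd_C ^ n, fkd_A ^ (n - 1) * fkd_B, fkd_A ^ (n - 1) * fkd_C,
           fkd_A ^ (n - 2) * fkd_B ^ 2})"

definition dual_basis :: "nat \<Rightarrow> 'k::field fkd \<Rightarrow> 'k fkd_dual"
  where "dual_basis n w = (THE u. u \<in> dual_component n \<and>
    (\<forall>w'\<in>fkd_basis n. dual_app u w' = (if w' = w then 1 else 0)))"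


section \<open>Tensor products\<close>

text \<open>Tensor products are quotients of the space of formal linear combinations of tuples by the
  multilinearity relations. \<open>lin_comb s \<phi> p\<close> evaluates the formal combination \<open>p\<close> after
  replacing each tuple \<open>i\<close> by \<open>\<phi> i\<close>.\<close>

definition lin_comb :: "('k \<Rightarrow> 'v \<Rightarrow> 'v) \<Rightarrow> ('i \<Rightarrow> 'v) \<Rightarrow> ('i \<Rightarrow>\<^sub>0 'k::field) \<Rightarrow> 'v::ab_group_add"
  where "lin_comb s \<phi> p = (\<Sum>i\<in>Poly_Mapping.keys p. s (Poly_Mapping.lookup p i) (\<phi> i))"

abbreviation free_span :: "('i \<Rightarrow>\<^sub>0 'k::field) set \<Rightarrow> ('i \<Rightarrow>\<^sub>0 'k) set"
  where "free_span \<equiv> module.span free_scale"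

interpretation free: vector_space "free_scale :: 'k::field \<Rightarrow> ('i \<Rightarrow>\<^sub>0 'k) \<Rightarrow> _"
  by (rule vector_space_free_scale)

lemma equivp_free_span: "equivp (\<lambda>p q. p - q \<in> free_span R)"
proof (rule equivpI)
  show "reflp (\<lambda>p q. p - q \<in> free_span R)"
    by (rule reflpI) (simp add: free.span_zero)
  show "symp (\<lambda>p q. p - q \<in> free_span R)"
    by (rule sympI) (metis minus_diff_eq free.span_neg)
  show "transp (\<lambda>p q. p - q \<in> free_span R)"
  proof (rule transpI)
    fix p q r assume "p - q \<in> free_span R" "q - r \<in> free_span R"
    from free.span_add[OF this] show "p - r \<in> free_span R" by simp
  qed
qed

lemma free_span_cong:
  assumes "p - p' \<in> free_span R" "q - q' \<in> free_span R"
  shows "(p + q) - (p' + q') \<in> free_span R" "(p - q) - (p' - q') \<in> free_span R"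
    "- p - - p' \<in> free_span R" "free_scale c p - free_scale c p' \<in> free_span R"
  using free.span_add[OF assms] free.span_diff[OF assms] free.span_neg[OF assms(1)]
    free.span_scale[OF assms(1), of c]
  by (simp_all add: algebra_simps free.scale_right_diff_distrib)

text \<open>\<open>'k kos\<close> is the tensor product of FK(3), the dual of the quadratic dual, and FK(3).\<close>

definition kos_relators :: "('k::field fk3 \<times> 'k fkd_dual \<times> 'k fk3 \<Rightarrow>\<^sub>0 'k) set"
  where "kos_relators =
    {Poly_Mapping.single (fk_scale c x + x', u, y) 1
      - Poly_Mapping.single (x, u, y) c - Poly_Mapping.single (x', u, y) 1 |c x x' u y. True} \<union>
    {Poly_Mapping.single (x, dual_scale c u + u', y) 1
      - Poly_Mapping.single (x, u, y) c - Poly_Mapping.single (x, u', y) 1 |c x u u' y. True} \<union>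
    {Poly_Mapping.single (x, u, fk_scale c y + y') 1
      - Poly_Mapping.single (x, u, y) c - Poly_Mapping.single (x, u, y') 1 |c x u y y'. True}"

quotient_type (overloaded) 'k kos =
  "'k::field fk3 \<times> 'k fkd_dual \<times> 'k fk3 \<Rightarrow>\<^sub>0 'k" / "\<lambda>p q. p - q \<in> free_span kos_relators"
  by (rule equivp_free_span)

text \<open>\<open>'k bar\<close> is the direct sum of all tensor powers of FK(3); a pure tensor is given by the
  list of its factors.\<close>

definition bar_relators :: "('k::field fk3 list \<Rightarrow>\<^sub>0 'k) set"
  where "bar_relators =
    {Poly_Mapping.single (xs @ (fk_scale c x + x') # ys) 1
      - Poly_Mapping.single (xs @ x # ys) c - Poly_Mapping.single (xs @ x' # ys) 1
      |c x x' xs ys. True}"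

quotient_type (overloaded) 'k bar =
  "'k::field fk3 list \<Rightarrow>\<^sub>0 'k" / "\<lambda>p q. p - q \<in> free_span bar_relators"
  by (rule equivp_free_span)

instantiation kos :: (field) ab_group_add
begin
lift_definition zero_kos :: "'a kos" is 0 .
lift_definition plus_kos :: "'a kos \<Rightarrow> 'a kos \<Rightarrow> 'a kos" is "(+)"
  by (rule free_span_cong)
lift_definition minus_kos :: "'a kos \<Rightarrow> 'a kos \<Rightarrow> 'a kos" is "(-)"
  by (rule free_span_cong)
lift_definition uminus_kos :: "'a kos \<Rightarrow> 'a kos" is uminus
  by (rule free_span_cong(3))
instance by standard (transfer; simp add: algebra_simps free.span_zero)+
end

instantiation bar :: (field) ab_group_add
begin
lift_definition zero_bar :: "'a bar" is 0 .
lift_definition plus_bar :: "'a bar \<Rightarrow> 'a bar \<Rightarrow> 'a bar" is "(+)"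
  by (rule free_span_cong)
lift_definition minus_bar :: "'a bar \<Rightarrow> 'a bar \<Rightarrow> 'a bar" is "(-)"
  by (rule free_span_cong)
lift_definition uminus_bar :: "'a bar \<Rightarrow> 'a bar" is uminus
  by (rule free_span_cong(3))
instance by standard (transfer; simp add: algebra_simps free.span_zero)+
end

lift_definition kos_scale :: "'k::field \<Rightarrow> 'k kos \<Rightarrow> 'k kos" is free_scale
  by (rule free_span_cong(4))

lift_definition bar_scale :: "'k::field \<Rightarrow> 'k bar \<Rightarrow> 'k bar" is free_scale
  by (rule free_span_cong(4))

lemma vector_space_kos_scale: "vector_space kos_scale"
  by unfold_locales
    (transfer; simp add: free.scale_left_distrib free.scale_right_distrib free.span_zero)+

lemma vector_space_bar_scale: "vector_space bar_scale"
  by unfold_locales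
    (transfer; simp add: free.scale_left_distrib free.scale_right_distrib free.span_zero)+

definition kos_pure :: "'k::field fk3 \<Rightarrow> 'k fkd_dual \<Rightarrow> 'k fk3 \<Rightarrow> 'k kos"
  where "kos_pure x u y = abs_kos (Poly_Mapping.single (x, u, y) 1)"

definition bar_pure :: "'k::field fk3 list \<Rightarrow> 'k bar"
  where "bar_pure xs = abs_bar (Poly_Mapping.single xs 1)"

text \<open>The linear map that a multilinear \<open>\<phi>\<close> induces on the tensor product; multilinearity makes
  the value independent of the chosen representative.\<close>

definition kos_ext ::
    "('k \<Rightarrow> 'v \<Rightarrow> 'v) \<Rightarrow> ('k fk3 \<Rightarrow> 'k fkd_dual \<Rightarrow> 'k fk3 \<Rightarrow> 'v) \<Rightarrow> 'k::field kos \<Rightarrow> 'v::ab_group_add"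
  where "kos_ext s \<phi> t = lin_comb s (\<lambda>(x, u, y). \<phi> x u y) (rep_kos t)"

definition bar_ext ::
    "('k \<Rightarrow> 'v \<Rightarrow> 'v) \<Rightarrow> ('k fk3 list \<Rightarrow> 'v) \<Rightarrow> 'k::field bar \<Rightarrow> 'v::ab_group_add"
  where "bar_ext s \<phi> t = lin_comb s \<phi> (rep_bar t)"


section \<open>Bimodules over FK(3)\<close>

record (overloaded) ('k::field, 'm) bimod =
  bcarrier :: "'m set"
  lact :: "'k fk3 \<Rightarrow> 'm \<Rightarrow> 'm"
  ract :: "'m \<Rightarrow> 'k fk3 \<Rightarrow> 'm"

text \<open>Morphisms are only constrained on the carrier of their source.\<close>

definition bimod_hom ::
    "('k::field, 'm::plus) bimod \<Rightarrow> ('k, 'n::plus) bimod \<Rightarrow> ('m \<Rightarrow> 'n) set"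
  where "bimod_hom M N = {\<phi>.
    (\<forall>s\<in>bcarrier M. \<phi> s \<in> bcarrier N) \<and>
    (\<forall>s\<in>bcarrier M. \<forall>t\<in>bcarrier M. \<phi> (s + t) = \<phi> s + \<phi> t) \<and>
    (\<forall>s\<in>bcarrier M. \<forall>x. \<phi> (lact M x s) = lact N x (\<phi> s)) \<and>
    (\<forall>s\<in>bcarrier M. \<forall>x. \<phi> (ract M s x) = ract N (\<phi> s) x)}"

definition fk_bimod :: "('k::field, 'k fk3) bimod"
  where "fk_bimod = \<lparr>bcarrier = UNIV, lact = (*), ract = (*)\<rparr>"

definition kos_lact :: "'k::field fk3 \<Rightarrow> 'k kos \<Rightarrow> 'k kos"
  where "kos_lact z = kos_ext kos_scale (\<lambda>x u y. kos_pure (z * x) u y)"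

definition kos_ract :: "'k::field kos \<Rightarrow> 'k fk3 \<Rightarrow> 'k kos"
  where "kos_ract t z = kos_ext kos_scale (\<lambda>x u y. kos_pure x u (y * z)) t"

text \<open>The bimodule $K_n$ and its component of internal degree \<open>m\<close>.\<close>

definition kos_bimod :: "nat \<Rightarrow> ('k::field, 'k kos) bimod"
  where "kos_bimod n =
    \<lparr>bcarrier = module.span kos_scale {kos_pure x u y |x u y. u \<in> dual_component n},
     lact = kos_lact, ract = kos_ract\<rparr>"

definition kos_component :: "nat \<Rightarrow> nat \<Rightarrow> 'k::field kos set"
  where "kos_component n m = module.span kos_scale {kos_pure x u y |x u y i j.
    x \<in> fk_component i \<and> u \<in> dual_component n \<and> y \<in> fk_component j \<and> i + n + j = m}"


section \<open>The projective bimodule resolution\<close>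

definition kos_diff :: "nat \<Rightarrow> 'k::field kos \<Rightarrow> 'k kos"
  where "kos_diff n t =
    (if n = 0 then 0
     else kos_ext kos_scale (\<lambda>x u y. \<Sum>g\<in>{Ga, Gb, Gc}.
       kos_scale ((- 1) ^ n) (kos_pure (x * fk_gen g) (dual_lshift (fkd_gen g) u) y)
       + kos_pure x (dual_rshift (fkd_gen g) u) (fk_gen g * y)) t)"

text \<open>An element $\sum_i\omega_i\rho_{n-4i}$ of $P_n$ is the function mapping $i$ to
  $\rho_{n-4i}$.\<close>

definition res_bimod :: "nat \<Rightarrow> ('k::field, nat \<Rightarrow> 'k kos) bimod"
  where "res_bimod n =
    \<lparr>bcarrier = {\<rho>. \<forall>i. if 4 * i \<le> n then \<rho> i \<in> bcarrier (kos_bimod (n - 4 * i)) else \<rho> i = 0},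
     lact = (\<lambda>x \<rho> i. kos_lact x (\<rho> i)), ract = (\<lambda>\<rho> x i. kos_ract (\<rho> i) x)\<rparr>"

definition res_diff ::
    "(nat \<Rightarrow> 'k kos \<Rightarrow> 'k kos) \<Rightarrow> nat \<Rightarrow> (nat \<Rightarrow> 'k::field kos) \<Rightarrow> nat \<Rightarrow> 'k kos"
  where "res_diff f n \<rho> = (\<lambda>i.
    (if 4 * i \<le> n then kos_diff (n - 4 * i) (\<rho> i) else 0) +
    (if 4 * (i + 1) \<le> n then f (n - 4 * (i + 1)) (\<rho> (i + 1)) else 0))"

definition res_aug :: "(nat \<Rightarrow> 'k::field kos) \<Rightarrow> 'k fk3"
  where "res_aug \<rho> = kos_ext fk_scale (\<lambda>x u y. fk_scale (dual_app u 1) (x * y)) (\<rho> 0)"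

definition f0_value :: "'k::field kos"
  where "f0_value =
    (let a = fk_a; b = fk_b; c = fk_c;
         p = dual_basis 3 (fkd_A * fkd_B ^ 2) - dual_scale 2 (dual_basis 3 (fkd_A ^ 3));
         q = dual_basis 3 (fkd_A ^ 2 * fkd_B) - dual_scale 2 (dual_basis 3 (fkd_B ^ 3));
         r = dual_basis 3 (fkd_A ^ 2 * fkd_C) - dual_scale 2 (dual_basis 3 (fkd_C ^ 3))
     in - kos_pure 1 p (b * a * c) - kos_pure 1 q (a * b * c) + kos_pure 1 r (a * b * a)
        + kos_pure a q (b * a + a * c) - kos_pure a r (b * c) + kos_pure b p (a * b + b * c)
        - kos_pure b r (a * c) - kos_pure c q (a * b) - kos_pure c p (b * a)
        - kos_pure (b * c) q a + kos_pure (b * a + a * c) r a + kos_pure (a * b + b * c) r b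
        - kos_pure (a * c) p b - kos_pure (b * a) q c - kos_pure (a * b) p c
        - kos_pure (b * a * c) p 1 - kos_pure (a * b * c) q 1 + kos_pure (a * b * a) r 1)"

text \<open>\<open>f n\<close> is the morphism $f_n\colon K_n\to K_{n+3}$.\<close>

definition fk_resolution :: "(nat \<Rightarrow> 'k::field kos \<Rightarrow> 'k kos) \<Rightarrow> bool"
  where "fk_resolution f \<longleftrightarrow>
    (\<forall>n. f n \<in> bimod_hom (kos_bimod n) (kos_bimod (n + 3))) \<and>
    (\<forall>n m. f n ` kos_component n m \<subseteq> kos_component (n + 3) (m + 6)) \<and>
    f 0 (kos_pure 1 (dual_basis 0 1) 1) = f0_value \<and>
    (\<forall>n\<ge>1. {\<rho> \<in> bcarrier (res_bimod n). res_diff f n \<rho> = 0} =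
      res_diff f (n + 1) ` bcarrier (res_bimod (n + 1))) \<and>
    {\<rho> \<in> bcarrier (res_bimod 0). res_aug \<rho> = 0} = res_diff f 1 ` bcarrier (res_bimod 1) \<and>
    res_aug ` bcarrier (res_bimod 0) = (UNIV :: 'k fk3 set)"


section \<open>The bar resolution and Hochschild cohomology\<close>

definition bar_lact :: "'k::field fk3 \<Rightarrow> 'k bar \<Rightarrow> 'k bar"
  where "bar_lact z = bar_ext bar_scale (\<lambda>xs. bar_pure ((z * hd xs) # tl xs))"

definition bar_ract :: "'k::field bar \<Rightarrow> 'k fk3 \<Rightarrow> 'k bar"
  where "bar_ract t z = bar_ext bar_scale (\<lambda>xs. bar_pure (butlast xs @ [last xs * z])) t"

definition bar_bimod :: "nat \<Rightarrow> ('k::field, 'k bar) bimod"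
  where "bar_bimod n =
    \<lparr>bcarrier = module.span bar_scale {bar_pure xs |xs. length xs = n + 2},
     lact = bar_lact, ract = bar_ract\<rparr>"

definition bar_diff :: "'k::field bar \<Rightarrow> 'k bar"
  where "bar_diff = bar_ext bar_scale (\<lambda>xs. \<Sum>j<length xs - 1.
    bar_scale ((- 1) ^ j) (bar_pure (take j xs @ (xs ! j * xs ! (j + 1)) # drop (j + 2) xs)))"

definition bar_aug :: "'k::field bar \<Rightarrow> 'k fk3"
  where "bar_aug = bar_ext fk_scale prod_list"

definition fk_comparison ::
    "(nat \<Rightarrow> 'k::field kos \<Rightarrow> 'k kos) \<Rightarrow> (nat \<Rightarrow> (nat \<Rightarrow> 'k kos) \<Rightarrow> 'k bar) \<Rightarrow> bool"
  where "fk_comparison f \<iota> \<longleftrightarrow>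
    (\<forall>n. \<iota> n \<in> bimod_hom (res_bimod n) (bar_bimod n)) \<and>
    (\<forall>n. \<forall>\<rho>\<in>bcarrier (res_bimod (n + 1)).
      bar_diff (\<iota> (n + 1) \<rho>) = \<iota> n (res_diff f (n + 1) \<rho>)) \<and>
    (\<forall>\<rho>\<in>bcarrier (res_bimod 0). bar_aug (\<iota> 0 \<rho>) = res_aug \<rho>)"

text \<open>A Hochschild cochain is a function on lists of elements of FK(3) that is linear in each entry.
  A single such function carries one component for each length of list, so that the functions
  vanishing on all sufficiently long lists form the direct sum of all
  $\mathrm{Hom}(A^{\otimes n},A)$; those of degree \<open>n\<close> vanish on lists of length other than \<open>n\<close>.\<close>

type_synonym 'k cochain = "'k fk3 list \<Rightarrow> 'k fk3"

definition multilinear :: "'k::field cochain \<Rightarrow> bool"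
  where "multilinear g \<longleftrightarrow>
    (\<forall>xs ys. Vector_Spaces.linear fk_scale fk_scale (\<lambda>x. g (xs @ x # ys)))"

definition cochains :: "'k::field cochain set"
  where "cochains = {g. multilinear g \<and> (\<exists>N. \<forall>xs. N < length xs \<longrightarrow> g xs = 0)}"

definition cochains_deg :: "nat \<Rightarrow> 'k::field cochain set"
  where "cochains_deg n = {g. multilinear g \<and> (\<forall>xs. length xs \<noteq> n \<longrightarrow> g xs = 0)}"

text \<open>The bimodule morphism on the bar resolution corresponding to a cochain. Lists with fewer
  than two entries do not occur in the bar resolution.\<close>

definition cochain_ext :: "'k::field cochain \<Rightarrow> 'k bar \<Rightarrow> 'k fk3"
  where "cochain_ext g = bar_ext fk_scale
    (\<lambda>xs. if length xs < 2 then 0 else hd xs * g (butlast (tl xs)) * last xs)"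

definition hoch_diff :: "'k::field cochain \<Rightarrow> 'k cochain"
  where "hoch_diff g = (\<lambda>xs. cochain_ext g (bar_diff (bar_pure (1 # xs @ [1]))))"

definition cocycles :: "'k::field cochain set"
  where "cocycles = {g \<in> cochains. hoch_diff g = 0}"

definition coboundaries :: "'k::field cochain set"
  where "coboundaries = hoch_diff ` cochains"

definition cohomologous :: "'k::field cochain \<Rightarrow> 'k cochain \<Rightarrow> bool"
  where "cohomologous g h \<longleftrightarrow> g \<in> cocycles \<and> h \<in> cocycles \<and> g - h \<in> coboundaries"

lemma linear_fk_iff:
  "Vector_Spaces.linear fk_scale fk_scale u \<longleftrightarrow>
    (\<forall>x y. u (x + y) = u x + u y) \<and> (\<forall>c x. u (fk_scale c x) = fk_scale c (u x))"
  for u :: "'k::field fk3 \<Rightarrow> 'k fk3"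
  by (simp add: Vector_Spaces.linear_iff vector_space_fk_scale)

interpretation fk: vector_space "fk_scale :: 'k::field \<Rightarrow> 'k fk3 \<Rightarrow> _"
  by (rule vector_space_fk_scale)

lemma fk_scale_mult:
  "x * fk_scale c y = fk_scale c (x * y)" "fk_scale c x * y = fk_scale c (x * y)"
proof -
  show "x * fk_scale c y = fk_scale c (x * y)"
    by transfer
      (simp add: free_scale_conv_mult free_scalar_central two_sided_ideal.zero flip: mult.assoc)
  show "fk_scale c x * y = fk_scale c (x * y)"
    by transfer (simp add: free_scale_conv_mult two_sided_ideal.zero mult.assoc)
qed

lemma cochains_zero: "0 \<in> cochains"
  by (auto simp: cochains_def multilinear_def linear_fk_iff)

lemma cochains_add:
  assumes "g \<in> cochains" "h \<in> cochains" shows "g + h \<in> cochains"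
proof -
  obtain M N where "\<forall>xs. M < length xs \<longrightarrow> g xs = 0" "\<forall>xs. N < length xs \<longrightarrow> h xs = 0"
    using assms by (auto simp: cochains_def)
  then have "\<forall>xs. max M N < length xs \<longrightarrow> (g + h) xs = 0" by simp
  then have "\<exists>N. \<forall>xs. N < length xs \<longrightarrow> (g + h) xs = 0" by blast
  moreover have "multilinear (g + h)"
    using assms by (simp add: cochains_def multilinear_def linear_fk_iff algebra_simps)
  ultimately show ?thesis by (simp add: cochains_def)
qed

lemma cochains_scale:
  assumes "g \<in> cochains" shows "(\<lambda>xs. fk_scale c (g xs)) \<in> cochains"
proof -
  obtain N where "\<forall>xs. N < length xs \<longrightarrow> g xs = 0"
    using assms by (auto simp: cochains_def)
  then have "\<exists>N. \<forall>xs. N < length xs \<longrightarrow> fk_scale c (g xs) = 0" by auto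
  then show ?thesis
    using assms
    by (simp add: cochains_def multilinear_def linear_fk_iff fk.scale_right_distrib
        fk.scale_left_commute mult.commute)
qed

lemma cochains_uminus: "g \<in> cochains \<Longrightarrow> - g \<in> cochains"
  using cochains_scale[of g "- 1"] by (simp add: fun_Compl_def)

lemma hoch_diff_add: "hoch_diff (g + h) = hoch_diff g + hoch_diff h"
  by (auto simp: hoch_diff_def cochain_ext_def bar_ext_def lin_comb_def algebra_simps
      fk.scale_right_distrib simp flip: sum.distrib intro!: ext sum.cong)

lemma hoch_diff_scale:
  "hoch_diff (\<lambda>xs. fk_scale c (g xs)) = (\<lambda>xs. fk_scale c (hoch_diff g xs))"
  by (auto simp: hoch_diff_def cochain_ext_def bar_ext_def lin_comb_def fk_scale_mult
      fk.scale_sum_right fk.scale_left_commute intro!: ext sum.cong)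

lemma hoch_diff_zero: "hoch_diff 0 = 0"
  by (auto simp: hoch_diff_def cochain_ext_def bar_ext_def lin_comb_def intro!: ext sum.neutral)

lemma hoch_diff_uminus: "hoch_diff (- g) = - hoch_diff g"
  using hoch_diff_scale[of "- 1" g] by (simp add: fun_Compl_def)

lemma cocycles_closed:
  "0 \<in> cocycles"
  "g \<in> cocycles \<Longrightarrow> h \<in> cocycles \<Longrightarrow> g + h \<in> cocycles"
  "g \<in> cocycles \<Longrightarrow> - g \<in> cocycles"
  "g \<in> cocycles \<Longrightarrow> (\<lambda>xs. fk_scale c (g xs)) \<in> cocycles"
  by (auto simp: cocycles_def cochains_zero cochains_add cochains_uminus cochains_scale
      hoch_diff_zero hoch_diff_add hoch_diff_uminus hoch_diff_scale)

lemma coboundaries_closed: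
  "0 \<in> coboundaries"
  "g \<in> coboundaries \<Longrightarrow> h \<in> coboundaries \<Longrightarrow> g + h \<in> coboundaries"
  "g \<in> coboundaries \<Longrightarrow> - g \<in> coboundaries"
  "g \<in> coboundaries \<Longrightarrow> (\<lambda>xs. fk_scale c (g xs)) \<in> coboundaries"
proof -
  show "0 \<in> coboundaries"
    unfolding coboundaries_def by (metis cochains_zero hoch_diff_zero image_eqI)
  show "g \<in> coboundaries \<Longrightarrow> h \<in> coboundaries \<Longrightarrow> g + h \<in> coboundaries"
    unfolding coboundaries_def by (auto simp flip: hoch_diff_add intro: cochains_add)
  show "g \<in> coboundaries \<Longrightarrow> - g \<in> coboundaries"
    unfolding coboundaries_def by (auto simp flip: hoch_diff_uminus intro: cochains_uminus)
  show "g \<in> coboundaries \<Longrightarrow> (\<lambda>xs. fk_scale c (g xs)) \<in> coboundaries"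
    unfolding coboundaries_def by (auto simp flip: hoch_diff_scale intro: cochains_scale)
qed

text \<open>The type of elements of the Hochschild cohomology of FK(3), all degrees taken together.\<close>

quotient_type (overloaded) 'k hh = "'k::field cochain" / partial: cohomologous
proof (rule part_equivpI)
  show "\<exists>g :: 'k cochain. cohomologous g g"
    using cocycles_closed(1) coboundaries_closed(1) by (auto simp: cohomologous_def)
  show "symp (cohomologous :: 'k cochain \<Rightarrow> _)"
    using coboundaries_closed(3) by (fastforce simp: cohomologous_def intro: sympI)
  show "transp (cohomologous :: 'k cochain \<Rightarrow> _)"
  proof (rule transpI)
    fix g h k :: "'k cochain"
    assume "cohomologous g h" "cohomologous h k"
    then show "cohomologous g k"
      using coboundaries_closed(2)[of "g - h" "h - k"] by (simp add: cohomologous_def)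
  qed
qed

instantiation hh :: (field) ab_group_add
begin
lift_definition zero_hh :: "'a hh" is 0
  by (simp add: cohomologous_def cocycles_closed coboundaries_closed)
lift_definition plus_hh :: "'a hh \<Rightarrow> 'a hh \<Rightarrow> 'a hh" is "(+)"
proof -
  fix g g' h h' :: "'a cochain"
  assume "cohomologous g g'" "cohomologous h h'"
  then show "cohomologous (g + h) (g' + h')"
    using coboundaries_closed(2)[of "g - g'" "h - h'"]
    by (simp add: cohomologous_def cocycles_closed algebra_simps)
qed
lift_definition uminus_hh :: "'a hh \<Rightarrow> 'a hh" is uminus
proof -
  fix g g' :: "'a cochain"
  assume "cohomologous g g'"
  then show "cohomologous (- g) (- g')"
    using coboundaries_closed(3)[of "g - g'"] by (simp add: cohomologous_def cocycles_closed)
qed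
lift_definition minus_hh :: "'a hh \<Rightarrow> 'a hh \<Rightarrow> 'a hh" is "(-)"
proof -
  fix g g' h h' :: "'a cochain"
  assume "cohomologous g g'" "cohomologous h h'"
  then show "cohomologous (g - h) (g' - h')"
    using coboundaries_closed(2)[of "g - g'" "- (h - h')"] coboundaries_closed(3)[of "h - h'"]
      cocycles_closed(2)[of g "- h"] cocycles_closed(2)[of g' "- h'"]
    by (simp add: cohomologous_def cocycles_closed algebra_simps)
qed
instance
proof
  fix x y z :: "'a hh"
  have refl: "cohomologous g g" if "g \<in> cocycles" for g :: "'a cochain"
    using that coboundaries_closed(1) by (simp add: cohomologous_def)
  have cocycle: "cohomologous g g \<Longrightarrow> g \<in> cocycles" for g :: "'a cochain"
    by (simp add: cohomologous_def)
  show "x + y + z = x + (y + z)"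
    by transfer (simp add: add.assoc refl cocycle cocycles_closed)
  show "x + y = y + x"
    by transfer (subst add.commute, simp add: refl cocycle cocycles_closed)
  show "0 + x = x"
    by transfer simp
  show "- x + x = 0"
    by transfer (simp add: refl cocycles_closed)
  show "x - y = x + - y"
    by transfer (simp only: diff_conv_add_uminus refl cocycle cocycles_closed)
qed
end

lift_definition hh_scale :: "'k::field \<Rightarrow> 'k hh \<Rightarrow> 'k hh" (infixr \<open>\<cdot>\<close> 75)
  is "\<lambda>c g xs. fk_scale c (g xs)"
proof -
  fix c and g g' :: "'k cochain"
  assume "cohomologous g g'"
  then show "cohomologous (\<lambda>xs. fk_scale c (g xs)) (\<lambda>xs. fk_scale c (g' xs))"
    using coboundaries_closed(4)[of "g - g'" c]
    by (simp add: cohomologous_def cocycles_closed fun_diff_def fk.scale_right_diff_distrib)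
qed


section \<open>Cup product and Gerstenhaber bracket\<close>

text \<open>The operations on cochains are the bilinear extensions of those on homogeneous cochains:
  the value on a list of given length collects the contributions of all pairs of degrees. On
  classes, they are computed on representatives.\<close>

definition cup :: "'k::field cochain \<Rightarrow> 'k cochain \<Rightarrow> 'k cochain"
  where "cup g h = (\<lambda>xs. \<Sum>m\<le>length xs. g (take m xs) * h (drop m xs))"

text \<open>\<open>circ_G m n g h\<close> is $g\circ_Gh$ for the components of \<open>g\<close> and \<open>h\<close> of degrees \<open>m\<close> and \<open>n\<close>.
  Here the index \<open>i\<close> starts at 0, so the sign $(-1)^{(n-1)(i-1)}$ becomes $(-1)^{(n+1)i}$.\<close>

definition circ_G :: "nat \<Rightarrow> nat \<Rightarrow> 'k::field cochain \<Rightarrow> 'k cochain \<Rightarrow> 'k cochain"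
  where "circ_G m n g h = (\<lambda>xs.
    if length xs + 1 = m + n
    then \<Sum>i<m. (- 1) ^ ((n + 1) * i) * g (take i xs @ h (take n (drop i xs)) # drop (i + n) xs)
    else 0)"

definition bracket_G :: "nat \<Rightarrow> nat \<Rightarrow> 'k::field cochain \<Rightarrow> 'k cochain \<Rightarrow> 'k cochain"
  where "bracket_G m n g h = (\<lambda>xs.
    circ_G m n g h xs - (- 1) ^ ((m + 1) * (n + 1)) * circ_G n m h g xs)"

definition gerstenhaber :: "'k::field cochain \<Rightarrow> 'k cochain \<Rightarrow> 'k cochain"
  where "gerstenhaber g h = (\<lambda>xs.
    \<Sum>m\<le>length xs + 1. bracket_G m (length xs + 1 - m) g h xs)"

instantiation hh :: (field) times
begin
definition times_hh :: "'a hh \<Rightarrow> 'a hh \<Rightarrow> 'a hh"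
  where "x * y = abs_hh (cup (rep_hh x) (rep_hh y))"
instance ..
end

definition hh_bracket :: "'k::field hh \<Rightarrow> 'k hh \<Rightarrow> 'k hh"
  where "hh_bracket x y = abs_hh (gerstenhaber (rep_hh x) (rep_hh y))"


section \<open>The classes\<close>

text \<open>\<open>res_coboundary f n \<phi>\<close>: on $P_n$, \<open>\<phi>\<close> is the coboundary of a morphism on $P_{n-1}$.\<close>

definition res_coboundary ::
    "(nat \<Rightarrow> 'k kos \<Rightarrow> 'k kos) \<Rightarrow> nat \<Rightarrow> ((nat \<Rightarrow> 'k::field kos) \<Rightarrow> 'k fk3) \<Rightarrow> bool"
  where "res_coboundary f n \<phi> \<longleftrightarrow>
    (if n = 0 then \<forall>\<rho>\<in>bcarrier (res_bimod 0). \<phi> \<rho> = 0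
     else \<exists>\<psi>\<in>bimod_hom (res_bimod (n - 1)) fk_bimod.
       \<forall>\<rho>\<in>bcarrier (res_bimod n). \<phi> \<rho> = \<psi> (res_diff f n \<rho>))"

text \<open>The class in Hochschild cohomology that composition with the comparison \<open>\<iota>\<close> sends to the class
  of the cocycle \<open>\<phi>\<close> on $P_n$.\<close>

definition hh_of_res ::
    "(nat \<Rightarrow> 'k kos \<Rightarrow> 'k kos) \<Rightarrow> (nat \<Rightarrow> (nat \<Rightarrow> 'k kos) \<Rightarrow> 'k bar) \<Rightarrow>
     nat \<Rightarrow> ((nat \<Rightarrow> 'k::field kos) \<Rightarrow> 'k fk3) \<Rightarrow> 'k hh"
  where "hh_of_res f \<iota> n \<phi> = (THE x. \<exists>g\<in>cochains_deg n. hoch_diff g = 0 \<and> x = abs_hh g \<and>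
    res_coboundary f n (\<lambda>\<rho>. cochain_ext g (\<iota> n \<rho>) - \<phi> \<rho>))"

text \<open>If $u$ is the element of the dual basis corresponding to the monomial \<open>w\<close>, then the coefficient
  of $u$ in $v$ is $v(w)$; so \<open>res_cochain 0 w x\<close> is the morphism denoted $u|x$, and
  \<open>res_cochain i w x\<close> is its analogue supported on the summand indexed by $\omega_i$.\<close>

definition res_cochain :: "nat \<Rightarrow> 'k::field fkd \<Rightarrow> 'k fk3 \<Rightarrow> (nat \<Rightarrow> 'k kos) \<Rightarrow> 'k fk3"
  where "res_cochain i w x =
    (\<lambda>\<rho>. kos_ext fk_scale (\<lambda>y v z. y * fk_scale (dual_app v w) x * z) (\<rho> i))"

definition X_degree :: "nat \<Rightarrow> nat"
  where "X_degree j =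
    (if j \<le> 3 then 0 else if j \<le> 8 then 1 else if j \<le> 12 then 2 else if j = 13 then 3 else 4)"

definition X_cocycle :: "nat \<Rightarrow> (nat \<Rightarrow> 'k::field kos) \<Rightarrow> 'k fk3"
  where "X_cocycle j =
    (let a = fk_a; b = fk_b; c = fk_c; A = fkd_A; B = fkd_B; C = fkd_C; u = res_cochain 0 in
     if j = 1 then u 1 (a * b + b * a)
     else if j = 2 then u 1 (a * b + b * c - a * c)
     else if j = 3 then u 1 (a * b * a * c)
     else if j = 4 then u A (b * a * c)
     else if j = 5 then u B (a * b * c)
     else if j = 6 then u C (a * b * a)
     else if j = 7 then u A (a * b * a - a * b * c)
     else if j = 8 then u A a + u B b + u C c
     else if j = 9 then u (A ^ 2) 1
     else if j = 10 then u (B ^ 2) 1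
     else if j = 11 then u (C ^ 2) 1
     else if j = 12 then u (A * B) 1 + u (A * C) 1
     else if j = 13 then u (A ^ 3) a + u (B ^ 3) b + u (C ^ 3) c
     else res_cochain 1 1 1)"

definition X_class ::
    "(nat \<Rightarrow> 'k::field kos \<Rightarrow> 'k kos) \<Rightarrow> (nat \<Rightarrow> (nat \<Rightarrow> 'k kos) \<Rightarrow> 'k bar) \<Rightarrow> nat \<Rightarrow> 'k hh"
  where "X_class f \<iota> j = hh_of_res f \<iota> (X_degree j) (X_cocycle j)"

end

theory Submission
  imports Defs
begin

text \<open>
  The bracket with the class of a derivation \<open>D\<close> can be computed on any resolution: if $\delta_\bullet$
  is a lift of \<open>D\<close> to $P_\bullet$, that is a chain map with $\delta(xm)=D(x)m+x\delta(m)$ and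
  $\delta(mx)=mD(x)+\delta(m)x$, then $[D,\varphi]$ is represented by $D\varphi-\varphi\delta_n$. On the
  bar resolution, \<open>D\<close> acts by the sum over all tensor factors, and a comparison map intertwines the two
  actions up to a homotopy of bimodule maps. Likewise, cup products are computed from lifts of a
  cocycle to a chain map $P_{n+\bullet}\to P_\bullet$. Every class of degree one is the class of a
  derivation, which for $X_4,\dots,X_7$ is given explicitly on the generators $a,b,c$. What remains are
  finitely many identities between explicit elements of $P_n$, $n\le4$, and of FK(3), with integral
  coefficients up to a denominator 3 in $\delta_4$.
\<close>


section \<open>Linear extensions\<close>

text \<open>Three obstacles shape the development. The comparison \<open>\<iota>\<close> is
  arbitrary and the classes are definite descriptions over it, so nothing can be computed on
  \<open>\<iota>\<close> itself: the relation \<open>represents\<close> ties a cocycle on P_n to a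
  class, and existence and uniqueness come from a morphism back from the bar resolution, which is
  free. The f_j with j >= 1 are unknown: chain maps are built through degree 4 only, where just f_0
  enters the differential, and the one cocycle condition in degree 5, that of X_14, sees only d_1.
  Bracket and product of classes are computed on arbitrary representatives: both must respect
  coboundaries, which rests on how inserting a cochain into a bar tensor interacts with the
  differential. Each derivation is minus its cocycle on a, b, c, because d_1 and the bar
  differential have opposite signs there. A lift over a derivation is fixed by its values on free
  generators; solving for them in degree 4 produces the denominator 3, and the
  \<omega>_1-coefficients found there are, up to sign, the 1/3 and 4/3 in the brackets with
  X_14.\<close>

lemma lin_comb_superset:
  assumes "vector_space s" "finite S" "Poly_Mapping.keys p \<subseteq> S"
  shows "lin_comb s \<phi> p = (\<Sum>i\<in>S. s (Poly_Mapping.lookup p i) (\<phi> i))"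
proof -
  interpret vector_space s by fact
  show ?thesis
    unfolding lin_comb_def using assms
    by (intro sum.mono_neutral_left) (auto simp: in_keys_iff)
qed

lemma lin_comb_add:
  assumes "vector_space s"
  shows "lin_comb s \<phi> (p + q) = lin_comb s \<phi> p + lin_comb s \<phi> q"
proof -
  interpret vector_space s by fact
  let ?S = "Poly_Mapping.keys p \<union> Poly_Mapping.keys q"
  have "Poly_Mapping.keys (p + q) \<subseteq> ?S" by (rule keys_add)
  then show ?thesis
    by (simp add: lin_comb_superset[OF assms, of ?S] lookup_add scale_left_distrib sum.distrib)
qed

lemma lin_comb_scale:
  assumes "vector_space s"
  shows "lin_comb s \<phi> (free_scale c p) = s c (lin_comb s \<phi> p)"
proof -
  interpret vector_space s by fact
  have "Poly_Mapping.keys (free_scale c p) \<subseteq> Poly_Mapping.keys p" by (auto simp: in_keys_iff)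
  then show ?thesis
    by (simp add: lin_comb_superset[OF assms, of "Poly_Mapping.keys p"] scale_sum_right)
qed

lemma lin_comb_single: "vector_space s \<Longrightarrow> lin_comb s \<phi> (Poly_Mapping.single i c) = s c (\<phi> i)"
  by (simp add: lin_comb_superset[of s "{i}"])

lemma lin_comb_linear: "vector_space s \<Longrightarrow> Vector_Spaces.linear free_scale s (lin_comb s \<phi>)"
  by (simp add: Vector_Spaces.linear_iff vector_space_free_scale lin_comb_add lin_comb_scale)

lemma linear_zero_on_span:
  assumes "Vector_Spaces.linear s1 s2 T" "\<And>r. r \<in> R \<Longrightarrow> T r = 0" "p \<in> module.span s1 R"
  shows "T p = 0"
proof -
  interpret Vector_Spaces.linear s1 s2 T by fact
  show ?thesis
    using assms(3) by (induction rule: vs1.span_induct_alt) (auto simp: assms(2) add scale zero)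
qed

lemma linear_eq_on_span:
  assumes "Vector_Spaces.linear s1 s2 T" "Vector_Spaces.linear s1 s2 T'"
    "\<And>r. r \<in> R \<Longrightarrow> T r = T' r" "p \<in> module.span s1 R"
  shows "T p = T' p"
proof -
  interpret T: Vector_Spaces.linear s1 s2 T by fact
  interpret T': Vector_Spaces.linear s1 s2 T' by fact
  show ?thesis
    using assms(4)
    by (induction rule: T.vs1.span_induct_alt)
      (auto simp: assms(3) T.add T.scale T.zero T'.add T'.scale T'.zero)
qed

lemma poly_mapping_span_single:
  "p \<in> free_span (range (\<lambda>i. Poly_Mapping.single i 1))"
proof (induction p rule: update_induct)
  case const
  show ?case by (simp add: free.span_zero)
next
  case (update p v a)
  have "Poly_Mapping.update v a p = p + free_scale a (Poly_Mapping.single v 1)"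
    using update by (intro poly_mapping_eqI)
      (auto simp: lookup_update lookup_add lookup_single in_keys_iff when_def)
  moreover have "free_scale a (Poly_Mapping.single v 1)
      \<in> free_span (range (\<lambda>i. Poly_Mapping.single i 1 :: 'a \<Rightarrow>\<^sub>0 'b))"
    by (intro free.span_scale free.span_base) auto
  ultimately show ?case using update by (metis free.span_add)
qed

text \<open>The condition under which \<open>bar_ext s \<phi>\<close> does not depend on representatives.\<close>

definition mlin :: "('k::field \<Rightarrow> 'v \<Rightarrow> 'v::ab_group_add) \<Rightarrow> ('k fk3 list \<Rightarrow> 'v) \<Rightarrow> bool"
  where "mlin s \<phi> \<longleftrightarrow> (\<forall>xs c x x' ys.
    \<phi> (xs @ (fk_scale c x + x') # ys) = s c (\<phi> (xs @ x # ys)) + \<phi> (xs @ x' # ys))"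

lemma mlinD: "mlin s \<phi> \<Longrightarrow>
    \<phi> (xs @ (fk_scale c x + x') # ys) = s c (\<phi> (xs @ x # ys)) + \<phi> (xs @ x' # ys)"
  by (simp add: mlin_def)

lemma mlinD': "mlin s \<phi> \<Longrightarrow> \<phi> ((fk_scale c x + x') # ys) = s c (\<phi> (x # ys)) + \<phi> (x' # ys)"
  using mlinD[of s \<phi> "[]"] by simp

text \<open>The combined law suffices: c = 1 gives additivity, hence value 0 at the argument 0, and
  0 in place of x' then gives homogeneity.\<close>

lemma multilinear_iff_mlin: "multilinear g \<longleftrightarrow> mlin fk_scale g"
proof
  assume g: "multilinear g"
  then show "mlin fk_scale g" by (simp add: multilinear_def mlin_def linear_fk_iff)
next
  assume g: "mlin fk_scale g"
  show "multilinear g"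
    unfolding multilinear_def linear_fk_iff
  proof (intro allI conjI)
    fix xs ys c and x y :: "'a fk3"
    show add: "g (xs @ (x + y) # ys) = g (xs @ x # ys) + g (xs @ y # ys)" for x y
      using mlinD[OF g, of xs 1 x y ys] by simp
    have "g (xs @ 0 # ys) = 0" using add[of 0 0] by simp
    then show "g (xs @ fk_scale c x # ys) = fk_scale c (g (xs @ x # ys))"
      using mlinD[OF g, of xs c x 0 ys] by simp
  qed
qed

text \<open>For multilinear \<open>\<phi>\<close> the linear extension kills every relator, so the
  representative picked by \<open>rep_bar\<close> does not matter and any formal combination can be
  evaluated directly.\<close>

lemma bar_ext_abs:
  assumes "vector_space s" "mlin s \<phi>"
  shows "bar_ext s \<phi> (abs_bar p) = lin_comb s \<phi> p"
proof -
  interpret vector_space s by fact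
  interpret L: Vector_Spaces.linear free_scale s "lin_comb s \<phi>" by (rule lin_comb_linear) fact
  have "rep_bar (abs_bar p) - p \<in> free_span bar_relators"
    using rep_abs_rsp_left[OF Quotient3_bar, of p p] by (simp add: free.span_zero)
  then have "lin_comb s \<phi> (rep_bar (abs_bar p) - p) = 0"
  proof (rule linear_zero_on_span[OF lin_comb_linear[OF assms(1)], rotated])
    fix r :: "'a fk3 list \<Rightarrow>\<^sub>0 'a" assume "r \<in> bar_relators"
    then show "lin_comb s \<phi> r = 0"
      using assms(2) by (auto simp: bar_relators_def L.diff lin_comb_single[OF assms(1)] mlin_def)
  qed
  then show ?thesis by (simp add: bar_ext_def L.diff)
qed

lemma bar_ext_pure: "vector_space s \<Longrightarrow> mlin s \<phi> \<Longrightarrow> bar_ext s \<phi> (bar_pure xs) = \<phi> xs"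
  by (simp add: bar_pure_def bar_ext_abs lin_comb_single vector_space.vector_space_assms)

lemma linear_bar_ext:
  assumes "vector_space s" "mlin s \<phi>" shows "Vector_Spaces.linear bar_scale s (bar_ext s \<phi>)"
  unfolding Vector_Spaces.linear_iff
proof (intro conjI allI vector_space_bar_scale assms(1))
  fix t t' :: "'a bar" and c
  obtain p p' where t: "t = abs_bar p" "t' = abs_bar p'"
    using Quotient3_abs_rep[OF Quotient3_bar] by metis
  have "t + t' = abs_bar (p + p')" unfolding t by (simp add: plus_bar.abs_eq)
  then show "bar_ext s \<phi> (t + t') = bar_ext s \<phi> t + bar_ext s \<phi> t'"
    unfolding t by (simp add: bar_ext_abs assms lin_comb_add)
  have "bar_scale c t = abs_bar (free_scale c p)" unfolding t by (simp add: bar_scale.abs_eq)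
  then show "bar_ext s \<phi> (bar_scale c t) = s c (bar_ext s \<phi> t)"
    unfolding t by (simp add: bar_ext_abs assms lin_comb_scale)
qed

interpretation bar: vector_space bar_scale by (rule vector_space_bar_scale)

lemma linear_abs_bar: "Vector_Spaces.linear free_scale bar_scale abs_bar"
  by (simp add: Vector_Spaces.linear_iff vector_space_free_scale vector_space_bar_scale
      plus_bar.abs_eq bar_scale.abs_eq)

lemma bar_span_pure: "t \<in> bar.span (range bar_pure)"
proof -
  interpret L: Vector_Spaces.linear free_scale bar_scale abs_bar by (rule linear_abs_bar)
  obtain p where t: "t = abs_bar p" using Quotient3_abs_rep[OF Quotient3_bar] by metis
  have "abs_bar p \<in> abs_bar ` free_span (range (\<lambda>i. Poly_Mapping.single i 1))"
    using poly_mapping_span_single by blast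
  also have "\<dots> = bar.span (range bar_pure)"
    by (simp add: L.span_image[symmetric] image_image bar_pure_def)
  finally show ?thesis by (simp add: t)
qed

lemma bar_linear_eqI:
  assumes "Vector_Spaces.linear bar_scale s T" "Vector_Spaces.linear bar_scale s T'"
    "\<And>xs. T (bar_pure xs) = T' (bar_pure xs)"
  shows "T t = T' t"
  using linear_eq_on_span[OF assms(1,2) _ bar_span_pure] assms(3) by blast

lemma mlin_bar_pure: "mlin bar_scale bar_pure"
  unfolding mlin_def
proof (intro allI)
  fix xs ys c and x x' :: "'a fk3"
  let ?r = "Poly_Mapping.single (xs @ (fk_scale c x + x') # ys) (1::'a)
      - Poly_Mapping.single (xs @ x # ys) c - Poly_Mapping.single (xs @ x' # ys) 1"
  have "?r \<in> free_span bar_relators"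
    unfolding bar_relators_def by (intro free.span_base CollectI exI) (rule conjI refl TrueI)+
  then have "abs_bar (Poly_Mapping.single (xs @ (fk_scale c x + x') # ys) (1::'a)) =
      abs_bar (free_scale c (Poly_Mapping.single (xs @ x # ys) 1) + Poly_Mapping.single (xs @ x' # ys) 1)"
    by (subst bar.abs_eq_iff) (simp add: algebra_simps free_scale_def)
  then show "bar_pure (xs @ (fk_scale c x + x') # ys)
      = bar_scale c (bar_pure (xs @ x # ys)) + bar_pure (xs @ x' # ys)"
    by (simp add: bar_pure_def plus_bar.abs_eq bar_scale.abs_eq)
qed

lemma mlin_linear: "Vector_Spaces.linear s s' T \<Longrightarrow> mlin s \<phi> \<Longrightarrow> mlin s' (\<lambda>xs. T (\<phi> xs))"
  by (auto simp: mlin_def Vector_Spaces.linear_iff)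

lemma mlin_add: "vector_space s \<Longrightarrow> mlin s \<phi> \<Longrightarrow> mlin s \<psi> \<Longrightarrow> mlin s (\<lambda>xs. \<phi> xs + \<psi> xs)"
  by (simp add: mlin_def vector_space.vector_space_assms algebra_simps)

lemma mlin_zero: "vector_space s \<Longrightarrow> mlin s (\<lambda>xs. 0)"
  by (simp add: mlin_def vector_space.vector_space_assms) (metis module.scale_zero_right module_iff_vector_space)

lemma mlin_scale: "vector_space s \<Longrightarrow> mlin s \<phi> \<Longrightarrow> mlin s (\<lambda>xs. s c (\<phi> xs))"
  by (simp add: mlin_def vector_space.vector_space_assms mult.commute)

lemma mlin_sum: "vector_space s \<Longrightarrow> (\<And>i. i \<in> S \<Longrightarrow> mlin s (\<phi> i)) \<Longrightarrow> mlin s (\<lambda>xs. \<Sum>i\<in>S. \<phi> i xs)"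
  by (induction S rule: infinite_finite_induct) (auto intro: mlin_add mlin_zero)

lemma mlin_pre_post: "mlin s \<phi> \<Longrightarrow> mlin s (\<lambda>xs. \<phi> (pre @ xs @ post))"
  unfolding mlin_def
proof (intro allI)
  fix xs c x x' ys
  assume "\<forall>xs c x x' ys. \<phi> (xs @ (fk_scale c x + x') # ys) = s c (\<phi> (xs @ x # ys)) + \<phi> (xs @ x' # ys)"
  then show "\<phi> (pre @ (xs @ (fk_scale c x + x') # ys) @ post) =
        s c (\<phi> (pre @ (xs @ x # ys) @ post)) + \<phi> (pre @ (xs @ x' # ys) @ post)"
    by (metis append.assoc append_Cons)
qed

lemma mlin_length:
  "vector_space s \<Longrightarrow> mlin s \<phi> \<Longrightarrow> mlin s (\<lambda>xs. if P (length xs) then \<phi> xs else 0)"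
  using mlin_zero[of s] by (auto simp: mlin_def)

section \<open>Operators on the bar construction\<close>

text \<open>The length counts all tensor factors, outer coefficients included: the bimodule B_n is
  \<open>bar_len (Suc (Suc n))\<close>. Shorter tensors arise when outer factors are peeled
  off.\<close>

definition bar_len :: "nat \<Rightarrow> 'k::field bar set"
  where "bar_len n = bar.span {bar_pure xs |xs. length xs = n}"

lemma bar_len_pure [simp]: "length xs = n \<Longrightarrow> bar_pure xs \<in> bar_len n"
  unfolding bar_len_def by (rule bar.span_base) auto

lemma bar_len_closed:
  "0 \<in> bar_len n" "s \<in> bar_len n \<Longrightarrow> t \<in> bar_len n \<Longrightarrow> s + t \<in> bar_len n"
  "s \<in> bar_len n \<Longrightarrow> t \<in> bar_len n \<Longrightarrow> s - t \<in> bar_len n"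
  "t \<in> bar_len n \<Longrightarrow> bar_scale c t \<in> bar_len n" "t \<in> bar_len n \<Longrightarrow> - t \<in> bar_len n"
  by (simp_all add: bar_len_def bar.span_zero bar.span_add bar.span_diff bar.span_scale bar.span_neg)

lemma bar_len_linear_eq:
  assumes "Vector_Spaces.linear bar_scale s T" "Vector_Spaces.linear bar_scale s T'"
    "\<And>xs. length xs = n \<Longrightarrow> T (bar_pure xs) = T' (bar_pure xs)" "t \<in> bar_len n"
  shows "T t = T' t"
  using linear_eq_on_span[OF assms(1,2) _ assms(4)[unfolded bar_len_def]] assms(3) by blast

lemma bar_len_linear_image:
  assumes T: "Vector_Spaces.linear bar_scale bar_scale T"
    and "\<And>xs. length xs = n \<Longrightarrow> T (bar_pure xs) \<in> bar_len m" "t \<in> bar_len n"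
  shows "T t \<in> bar_len m"
proof -
  interpret Vector_Spaces.linear bar_scale bar_scale T by fact
  show ?thesis
    using assms(3) unfolding bar_len_def
  proof (induction rule: bar.span_induct_alt)
    case base
    show ?case by (simp add: zero bar.span_zero)
  next
    case (step c x y)
    then show ?case using assms(2) unfolding bar_len_def
      by (auto simp: add scale intro!: bar.span_add bar.span_scale)
  qed
qed

lemma linear_comp:
  "Vector_Spaces.linear s1 s2 T \<Longrightarrow> Vector_Spaces.linear s2 s3 S \<Longrightarrow>
    Vector_Spaces.linear s1 s3 (\<lambda>t. S (T t))"
  by (auto simp: Vector_Spaces.linear_iff)

lemma linear_plus:
  "Vector_Spaces.linear s1 s2 T \<Longrightarrow> Vector_Spaces.linear s1 s2 S \<Longrightarrow>
    Vector_Spaces.linear s1 s2 (\<lambda>t. T t + S t)"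
  by (auto simp: Vector_Spaces.linear_iff vector_space.vector_space_assms algebra_simps)

lemma linear_smult:
  "Vector_Spaces.linear s1 s2 T \<Longrightarrow> Vector_Spaces.linear s1 s2 (\<lambda>t. s2 c (T t))"
  by (auto simp: Vector_Spaces.linear_iff vector_space.vector_space_assms mult.commute)

lemma linear_minus:
  assumes "Vector_Spaces.linear s1 s2 T" "Vector_Spaces.linear s1 s2 S"
  shows "Vector_Spaces.linear s1 s2 (\<lambda>t. T t - S t)"
proof -
  interpret vector_space s2 using assms by (auto simp: Vector_Spaces.linear_iff)
  show ?thesis using assms
    by (auto simp: Vector_Spaces.linear_iff algebra_simps scale_right_diff_distrib)
qed

lemma linear_id: "vector_space s \<Longrightarrow> Vector_Spaces.linear s s (\<lambda>t. t)"
  by (simp add: Vector_Spaces.linear_iff)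

lemma linear_zero: "vector_space s \<Longrightarrow> vector_space s' \<Longrightarrow> Vector_Spaces.linear s s' (\<lambda>t. 0)"
  using linear_smult[of s s' "\<lambda>t. 0" 0]
  by (simp add: Vector_Spaces.linear_iff) (metis module.scale_zero_right module_iff_vector_space)

lemma linear_fk_mult:
  "Vector_Spaces.linear fk_scale fk_scale (\<lambda>x. y * x)"
  "Vector_Spaces.linear fk_scale fk_scale (\<lambda>x. x * y)"
  by (simp_all add: linear_fk_iff algebra_simps fk_scale_mult)

text \<open>Prepending a factor turns the index sums in the differential and in insertions into
  recursions over the list; most identities on bar tensors below are proved by peeling off the head
  in this way.\<close>

definition bar_cons :: "'k::field fk3 \<Rightarrow> 'k bar \<Rightarrow> 'k bar"
  where "bar_cons x = bar_ext bar_scale (\<lambda>xs. bar_pure (x # xs))"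

lemma mlin_bar_cons: "mlin bar_scale (\<lambda>xs. bar_pure (x # xs))"
  using mlin_pre_post[OF mlin_bar_pure, of "[x]" "[]"] by simp

lemma bar_cons_pure [simp]: "bar_cons x (bar_pure xs) = bar_pure (x # xs)"
  by (simp add: bar_cons_def bar_ext_pure vector_space_bar_scale mlin_bar_cons)

lemma linear_bar_cons: "Vector_Spaces.linear bar_scale bar_scale (bar_cons x)"
  unfolding bar_cons_def by (rule linear_bar_ext[OF vector_space_bar_scale mlin_bar_cons])

lemma linearD:
  assumes "Vector_Spaces.linear s1 s2 T"
  shows "T (x + y) = T x + T y" "T (s1 c x) = s2 c (T x)" "T (x - y) = T x - T y" "T 0 = 0"
    "T (- x) = - T x" "T (\<Sum>i\<in>I. h i) = (\<Sum>i\<in>I. T (h i))"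
proof -
  interpret Vector_Spaces.linear s1 s2 T by fact
  show "T (x + y) = T x + T y" "T (s1 c x) = s2 c (T x)" "T (x - y) = T x - T y" "T 0 = 0"
    "T (- x) = - T x" "T (\<Sum>i\<in>I. h i) = (\<Sum>i\<in>I. T (h i))"
    by (simp_all add: add scale diff zero neg sum)
qed

lemmas bar_cons_simps [simp] = linearD[OF linear_bar_cons]

lemma bar_cons_left:
  "bar_cons (fk_scale c x + x') t = bar_scale c (bar_cons x t) + bar_cons x' t"
  by (rule bar_linear_eqI[OF linear_bar_cons linear_plus[OF linear_smult[OF linear_bar_cons] linear_bar_cons]])
    (simp add: mlinD'[OF mlin_bar_pure])

lemma bar_cons_left_simps:
  "bar_cons (x + x') t = bar_cons x t + bar_cons x' t"
  "bar_cons (fk_scale c x) t = bar_scale c (bar_cons x t)"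
proof -
  show add: "bar_cons (x + x') t = bar_cons x t + bar_cons x' t" for x x'
    using bar_cons_left[of 1 x x' t] by simp
  have "bar_cons 0 t = 0" using add[of 0 0] by simp
  then show "bar_cons (fk_scale c x) t = bar_scale c (bar_cons x t)"
    using bar_cons_left[of c x 0 t] by simp
qed

lemma bar_cons_len: "t \<in> bar_len n \<Longrightarrow> bar_cons x t \<in> bar_len (Suc n)"
  by (rule bar_len_linear_image[OF linear_bar_cons]) (auto intro: bar_len_pure)

lemma mlin_bar_lact: "mlin bar_scale (\<lambda>xs. bar_pure ((z * hd xs) # tl xs))"
  unfolding mlin_def
proof (intro allI)
  fix xs c x x' ys
  show "bar_pure ((z * hd (xs @ (fk_scale c x + x') # ys)) # tl (xs @ (fk_scale c x + x') # ys)) =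
     bar_scale c (bar_pure ((z * hd (xs @ x # ys)) # tl (xs @ x # ys))) +
     bar_pure ((z * hd (xs @ x' # ys)) # tl (xs @ x' # ys))"
    using mlinD[OF mlin_bar_pure, of "(z * hd xs) # tl xs" c x x' ys]
      mlinD'[OF mlin_bar_pure, of c "z * x" "z * x'" ys]
    by (cases xs) (auto simp: algebra_simps fk_scale_mult)
qed

lemma linear_bar_lact: "Vector_Spaces.linear bar_scale bar_scale (bar_lact z)"
  unfolding bar_lact_def by (rule linear_bar_ext[OF vector_space_bar_scale mlin_bar_lact])

lemma bar_lact_pure [simp]: "bar_lact z (bar_pure (x # xs)) = bar_pure ((z * x) # xs)"
  by (simp add: bar_lact_def bar_ext_pure vector_space_bar_scale mlin_bar_lact)

lemmas bar_lact_simps [simp] = linearD[OF linear_bar_lact]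

lemma bar_lact_cons [simp]: "bar_lact z (bar_cons x t) = bar_cons (z * x) t"
  by (rule bar_linear_eqI[OF linear_comp[OF linear_bar_cons linear_bar_lact] linear_bar_cons]) simp

lemma mlin_bar_ract: "mlin bar_scale (\<lambda>xs. bar_pure (butlast xs @ [last xs * z]))"
  unfolding mlin_def
proof (intro allI)
  fix xs c x x' ys
  show "bar_pure (butlast (xs @ (fk_scale c x + x') # ys) @ [last (xs @ (fk_scale c x + x') # ys) * z]) =
     bar_scale c (bar_pure (butlast (xs @ x # ys) @ [last (xs @ x # ys) * z])) +
     bar_pure (butlast (xs @ x' # ys) @ [last (xs @ x' # ys) * z])"
    using mlinD[OF mlin_bar_pure, of xs c x x' "butlast ys @ [last ys * z]"]
      mlinD[OF mlin_bar_pure, of xs c "x * z" "x' * z" "[]"]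
    by (cases ys) (auto simp: algebra_simps fk_scale_mult butlast_append)
qed

lemma linear_bar_ract: "Vector_Spaces.linear bar_scale bar_scale (\<lambda>t. bar_ract t z)"
  unfolding bar_ract_def by (rule linear_bar_ext[OF vector_space_bar_scale mlin_bar_ract])

lemma bar_ract_pure [simp]: "bar_ract (bar_pure (xs @ [x])) z = bar_pure (xs @ [x * z])"
  by (simp add: bar_ract_def bar_ext_pure vector_space_bar_scale mlin_bar_ract)

lemma bar_ract_pure_single [simp]: "bar_ract (bar_pure [x]) z = bar_pure [x * z]"
  using bar_ract_pure[of "[]"] by simp

lemmas bar_ract_simps [simp] = linearD[OF linear_bar_ract]

lemma bar_ract_cons:
  "t \<in> bar_len (Suc n) \<Longrightarrow> bar_ract (bar_cons x t) z = bar_cons x (bar_ract t z)"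
proof (rule bar_len_linear_eq[OF linear_comp[OF linear_bar_cons linear_bar_ract]
      linear_comp[OF linear_bar_ract linear_bar_cons]])
  fix xs :: "'a fk3 list" assume "length xs = Suc n"
  then obtain ys y where "xs = ys @ [y]" by (cases xs rule: rev_cases) auto
  then show "bar_ract (bar_cons x (bar_pure xs)) z = bar_cons x (bar_ract (bar_pure xs) z)"
    using bar_ract_pure[of "x # ys" y z] by simp
qed

lemma bar_lact_len: "t \<in> bar_len (Suc n) \<Longrightarrow> bar_lact x t \<in> bar_len (Suc n)"
  by (rule bar_len_linear_image[OF linear_bar_lact])
    (auto intro: bar_len_pure simp: length_Suc_conv)

lemma bar_ract_len: "t \<in> bar_len (Suc n) \<Longrightarrow> bar_ract t x \<in> bar_len (Suc n)"
proof (rule bar_len_linear_image[OF linear_bar_ract])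
  fix xs :: "'a fk3 list" assume "length xs = Suc n"
  moreover from this obtain ys y where "xs = ys @ [y]" by (cases xs rule: rev_cases) auto
  ultimately show "bar_ract (bar_pure xs) x \<in> bar_len (Suc n)" by (auto intro: bar_len_pure)
qed

section \<open>The bar differential as a recursion\<close>

definition merge :: "nat \<Rightarrow> 'a::times list \<Rightarrow> 'a list"
  where "merge j xs = take j xs @ (xs ! j * xs ! (j + 1)) # drop (j + 2) xs"

lemma merge_0 [simp]: "merge 0 (x # y # xs) = (x * y) # xs"
  by (simp add: merge_def)

lemma merge_Suc [simp]: "merge (Suc j) (x # xs) = x # merge j xs"
  by (simp add: merge_def)

lemma length_merge [simp]: "Suc j < length xs \<Longrightarrow> length (merge j xs) = length xs - 1"
  by (simp add: merge_def)

text \<open>The recursion d(x|y|w) = xy|w - x|d(y|w); its minus sign generates the alternating signs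
  of the bar differential.\<close>

fun diff_list :: "'k::field fk3 list \<Rightarrow> 'k bar" where
  "diff_list (x # y # xs) = bar_pure ((x * y) # xs) - bar_cons x (diff_list (y # xs))"
| "diff_list xs = 0"

lemma diff_list_eq_sum:
  "diff_list xs = (\<Sum>j<length xs - 1. bar_scale ((- 1) ^ j) (bar_pure (merge j xs)))"
  by (induction xs rule: diff_list.induct)
    (simp_all add: sum.lessThan_Suc_shift sum_negf bar.scale_minus_left del: sum.lessThan_Suc)

lemma mlin_diff_list: "mlin bar_scale diff_list"
  unfolding mlin_def
proof (intro allI)
  fix xs ys c and x x' :: "'a fk3"
  have head: "diff_list ((fk_scale c x + x') # ys) = bar_scale c (diff_list (x # ys)) + diff_list (x' # ys)"
    using mlinD'[OF mlin_bar_pure, of c "x * hd ys" "x' * hd ys" "tl ys"]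
    by (cases ys) (auto simp: bar_cons_left_simps algebra_simps fk_scale_mult bar.scale_right_diff_distrib)
  show "diff_list (xs @ (fk_scale c x + x') # ys)
      = bar_scale c (diff_list (xs @ x # ys)) + diff_list (xs @ x' # ys)"
  proof (induction xs rule: diff_list.induct)
    case (1 u v us)
    then show ?case
      using mlinD[OF mlin_bar_pure, of "(u * v) # us" c x x' ys]
      by (simp add: algebra_simps bar.scale_right_diff_distrib)
  next
    case "2_1"
    show ?case using head by simp
  next
    case ("2_2" u)
    show ?case
      using head mlinD'[OF mlin_bar_pure, of c "u * x" "u * x'" ys]
      by (simp add: algebra_simps fk_scale_mult bar.scale_right_diff_distrib)
  qed
qed

lemma bar_diff_conv: "bar_diff = bar_ext bar_scale diff_list"
  unfolding bar_diff_def by (simp add: diff_list_eq_sum[abs_def] merge_def)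

lemma linear_bar_diff: "Vector_Spaces.linear bar_scale bar_scale bar_diff"
  unfolding bar_diff_conv by (rule linear_bar_ext[OF vector_space_bar_scale mlin_diff_list])

lemmas bar_diff_simps [simp] = linearD[OF linear_bar_diff]

lemma bar_diff_pure_list: "bar_diff (bar_pure xs) = diff_list xs"
  by (simp add: bar_diff_conv bar_ext_pure vector_space_bar_scale mlin_diff_list)

lemma bar_diff_pure [simp]:
  "bar_diff (bar_pure []) = 0" "bar_diff (bar_pure [x]) = 0"
  "bar_diff (bar_pure (x # y # xs)) =
    bar_pure ((x * y) # xs) - bar_cons x (bar_diff (bar_pure (y # xs)))"
  by (simp_all add: bar_diff_pure_list)

lemma bar_diff_len: "t \<in> bar_len (Suc n) \<Longrightarrow> bar_diff t \<in> bar_len n"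
proof (rule bar_len_linear_image[OF linear_bar_diff])
  fix xs :: "'a fk3 list" assume "length xs = Suc n"
  then show "bar_diff (bar_pure xs) \<in> bar_len n"
  proof (induction xs arbitrary: n rule: diff_list.induct)
    case (1 x y xs)
    then show ?case by (cases n) (auto intro!: bar_len_closed bar_len_pure bar_cons_len)
  qed (auto intro: bar_len_closed)
qed

text \<open>The recursion again, with the product of the first two factors expressed as a left
  action; \<open>t\<close> needs a factor on which to act.\<close>

lemma bar_diff_cons:
  "t \<in> bar_len (Suc n) \<Longrightarrow> bar_diff (bar_cons x t) = bar_lact x t - bar_cons x (bar_diff t)"
  by (rule bar_len_linear_eq[where n = "Suc n", OF linear_comp[OF linear_bar_cons linear_bar_diff]
        linear_minus[OF linear_bar_lact linear_comp[OF linear_bar_diff linear_bar_cons]]])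
    (auto simp: length_Suc_conv)

lemma bar_diff_lact:
  "t \<in> bar_len (Suc (Suc n)) \<Longrightarrow> bar_diff (bar_lact x t) = bar_lact x (bar_diff t)"
  by (rule bar_len_linear_eq[OF linear_comp[OF linear_bar_lact linear_bar_diff]
        linear_comp[OF linear_bar_diff linear_bar_lact]])
    (auto simp: length_Suc_conv mult.assoc)

lemma bar_diff_ract:
  "t \<in> bar_len (Suc (Suc n)) \<Longrightarrow> bar_diff (bar_ract t z) = bar_ract (bar_diff t) z"
proof (rule bar_len_linear_eq[OF linear_comp[OF linear_bar_ract linear_bar_diff]
        linear_comp[OF linear_bar_diff linear_bar_ract]])
  fix xs :: "'a fk3 list" assume "length xs = Suc (Suc n)"
  then show "bar_diff (bar_ract (bar_pure xs) z) = bar_ract (bar_diff (bar_pure xs)) z"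
  proof (induction n arbitrary: xs)
    case 0
    then obtain x y where xs: "xs = [x, y]" by (auto simp: length_Suc_conv)
    show ?case unfolding xs using bar_ract_pure[of "[x]" y z] by (simp add: mult.assoc)
  next
    case (Suc n)
    then obtain x y ys' where "xs = x # y # ys'" and "ys' \<noteq> []" by (auto simp: length_Suc_conv)
    then obtain ys u where xs: "xs = x # y # ys @ [u]" by (cases ys' rule: rev_cases) auto
    have "bar_pure (y # ys @ [u]) \<in> bar_len (Suc (Suc n))"
      using Suc by (auto simp: xs intro: bar_len_pure)
    then have 1: "bar_diff (bar_pure (y # ys @ [u])) \<in> bar_len (Suc n)" by (rule bar_diff_len)
    have IH: "bar_diff (bar_pure (y # ys @ [u * z])) = bar_ract (bar_diff (bar_pure (y # ys @ [u]))) z"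
      using Suc.IH[of "y # ys @ [u]"] Suc.prems bar_ract_pure[of "y # ys" u z] by (simp add: xs)
    show ?case
      unfolding xs using IH bar_ract_pure[of "x # y # ys" u z] bar_ract_pure[of "(x * y) # ys" u z]
        bar_ract_cons[OF 1, of x z]
      by simp
  qed
qed

text \<open>By the recursion, dd(x|t) = d(xt) - x d(t) + x|dd(t), and the first two terms cancel
  since d is left linear. With two factors, d lands in length 1, where it is 0.\<close>

lemma bar_diff_diff: "t \<in> bar_len n \<Longrightarrow> bar_diff (bar_diff t) = 0"
proof (rule bar_len_linear_eq[OF linear_comp[OF linear_bar_diff linear_bar_diff]
        linear_zero[OF vector_space_bar_scale vector_space_bar_scale]])
  fix xs :: "'a fk3 list"
  show "bar_diff (bar_diff (bar_pure xs)) = 0"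
  proof (induction xs rule: diff_list.induct)
    case (1 x y xs)
    show ?case
    proof (cases xs)
      case (Cons z zs)
      have "bar_diff (bar_pure (y # z # zs)) \<in> bar_len (Suc (length zs))"
        by (intro bar_diff_len bar_len_pure) simp
      from bar_diff_cons[OF this, of x] 1 Cons show ?thesis
        by (simp add: algebra_simps)
    qed simp
  qed simp_all
qed

text \<open>Prepending 1 is the contracting homotopy behind the exactness of the bar
  resolution.\<close>

lemma bar_contraction:
  "t \<in> bar_len (Suc n) \<Longrightarrow> bar_diff (bar_cons 1 t) = t - bar_cons 1 (bar_diff t)"
  using bar_diff_cons[of t n 1] bar_len_linear_eq[OF linear_bar_lact linear_id[OF vector_space_bar_scale], of "Suc n" 1 t]
  by (force simp: length_Suc_conv)

subsection \<open>Inserting a cochain\<close>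

text \<open>A cut at n either leaves the distinguished factor behind or includes it; multilinearity
  of the operators that cut a tensor is proved along this distinction.\<close>

lemma take_drop_mid:
  "n \<le> length xs \<Longrightarrow> take n (xs @ x # ys) = take n xs \<and> drop n (xs @ x # ys) = drop n xs @ x # ys"
  "n > length xs \<Longrightarrow> take n (xs @ x # ys) = xs @ x # take (n - length xs - 1) ys \<and>
    drop n (xs @ x # ys) = drop (n - length xs - 1) ys"
  by (auto simp: take_Cons' drop_Cons' Suc_diff_Suc)

text \<open>The strict inequality keeps at least one factor behind the value of \<open>g\<close>:
  the last factor of a bar tensor is the right coefficient and never an argument.\<close>

definition head_list :: "nat \<Rightarrow> 'k::field cochain \<Rightarrow> 'k fk3 list \<Rightarrow> 'k bar"
  where "head_list n g xs =
    (if n < length xs then bar_pure (g (take n xs) # drop n xs) else 0)"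

lemma mlin_head_list:
  assumes "multilinear g" shows "mlin bar_scale (head_list n g)"
  unfolding mlin_def
proof (intro allI)
  fix xs ys c and x x' :: "'a fk3"
  have g: "mlin fk_scale g" using assms multilinear_iff_mlin by blast
  show "head_list n g (xs @ (fk_scale c x + x') # ys)
      = bar_scale c (head_list n g (xs @ x # ys)) + head_list n g (xs @ x' # ys)"
  proof (cases "n \<le> length xs")
    case True
    then show ?thesis
      using mlinD[OF mlin_bar_pure, of "g (take n xs) # drop n xs" c x x' ys]
      by (auto simp: head_list_def take_drop_mid)
  next
    case False
    then have n: "n > length xs" by simp
    let ?t = "take (n - length xs - 1) ys" let ?d = "drop (n - length xs - 1) ys"
    show ?thesis
      using mlinD'[OF mlin_bar_pure, of c "g (xs @ x # ?t)" "g (xs @ x' # ?t)" ?d]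
      unfolding head_list_def take_drop_mid(2)[OF n, THEN conjunct1] take_drop_mid(2)[OF n, THEN conjunct2]
      by (auto simp: mlinD[OF g])
  qed
qed

definition bar_head :: "nat \<Rightarrow> 'k::field cochain \<Rightarrow> 'k bar \<Rightarrow> 'k bar"
  where "bar_head n g = bar_ext bar_scale (head_list n g)"

text \<open>The signed sum over all positions of replacing n consecutive factors by the value of
  \<open>g\<close>, which is the inner part of the composition of \<open>circ_G\<close>. Passing one
  factor costs (-1)^(n+1), the sign of that composition with positions counted from 0.\<close>

fun insert_list :: "nat \<Rightarrow> 'k::field cochain \<Rightarrow> 'k fk3 list \<Rightarrow> 'k bar" where
  "insert_list n g [] = 0"
| "insert_list n g (x # xs) = head_list n g (x # xs)
    + bar_scale ((- 1) ^ (n + 1)) (bar_cons x (insert_list n g xs))"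

lemma mlin_insert_list:
  assumes "multilinear g" shows "mlin bar_scale (insert_list n g)"
  unfolding mlin_def
proof (intro allI)
  fix xs ys c and x x' :: "'a fk3"
  show "insert_list n g (xs @ (fk_scale c x + x') # ys)
      = bar_scale c (insert_list n g (xs @ x # ys)) + insert_list n g (xs @ x' # ys)"
  proof (induction xs)
    case Nil
    show ?case
      using mlinD'[OF mlin_head_list[OF assms], of n c x x' ys]
      by (simp add: bar_cons_left_simps algebra_simps bar.scale_right_distrib)
  next
    case (Cons z xs)
    then show ?case
      using mlinD[OF mlin_head_list[OF assms], of n "z # xs" c x x' ys]
      by (simp add: algebra_simps bar.scale_right_distrib)
  qed
qed

definition bar_insert :: "nat \<Rightarrow> 'k::field cochain \<Rightarrow> 'k bar \<Rightarrow> 'k bar"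
  where "bar_insert n g = bar_ext bar_scale (insert_list n g)"

text \<open>The last n factors before the right coefficient are fed to \<open>g\<close> and the
  value is multiplied into that coefficient. For a cocycle this is, up to sign, its lift to a chain
  map of the bar resolution. Each factor passed contributes (-1)^n.\<close>

fun tail_list :: "nat \<Rightarrow> 'k::field cochain \<Rightarrow> 'k fk3 list \<Rightarrow> 'k bar" where
  "tail_list n g [] = 0"
| "tail_list n g (x # xs) =
    (if length xs < n then 0
     else if length xs = n then bar_pure [g (take n (x # xs)) * last (x # xs)]
     else bar_scale ((- 1) ^ n) (bar_cons x (tail_list n g xs)))"

lemma mlin_tail_list:
  assumes "multilinear g" shows "mlin bar_scale (tail_list n g)"
  unfolding mlin_def
proof (intro allI)
  fix xs ys c and x x' :: "'a fk3"
  have g: "mlin fk_scale g" using assms multilinear_iff_mlin by blast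
  have eq: "bar_pure [g (take n (xs @ (fk_scale c x + x') # ys)) * last (xs @ (fk_scale c x + x') # ys)]
      = bar_scale c (bar_pure [g (take n (xs @ x # ys)) * last (xs @ x # ys)])
        + bar_pure [g (take n (xs @ x' # ys)) * last (xs @ x' # ys)]"
    if "length xs + length ys = n" for xs
  proof (cases ys rule: rev_cases)
    case Nil
    then show ?thesis
      using that mlinD'[OF mlin_bar_pure, of c "g xs * x" "g xs * x'" "[]"]
      by (simp add: algebra_simps fk_scale_mult)
  next
    case (snoc zs z)
    then have n: "length xs < n" "n - length xs = Suc (length zs)" using that by auto
    show ?thesis
      using mlinD'[OF mlin_bar_pure, of c "g (xs @ x # zs) * z" "g (xs @ x' # zs) * z" "[]"]
      unfolding snoc using n by (simp add: mlinD[OF g] distrib_right fk_scale_mult)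
  qed
  show "tail_list n g (xs @ (fk_scale c x + x') # ys)
      = bar_scale c (tail_list n g (xs @ x # ys)) + tail_list n g (xs @ x' # ys)"
  proof (induction xs)
    case Nil
    show ?case
      using eq[of "[]"] by (auto simp: bar_cons_left_simps algebra_simps bar.scale_right_distrib)
  next
    case (Cons z xs)
    then show ?case
      using eq[of "z # xs"] by (auto simp: algebra_simps bar.scale_right_distrib)
  qed
qed

definition bar_tail :: "nat \<Rightarrow> 'k::field cochain \<Rightarrow> 'k bar \<Rightarrow> 'k bar"
  where "bar_tail n g = bar_ext bar_scale (tail_list n g)"

lemma linear_bar_head: "multilinear g \<Longrightarrow> Vector_Spaces.linear bar_scale bar_scale (bar_head n g)"
  and linear_bar_insert: "multilinear g \<Longrightarrow> Vector_Spaces.linear bar_scale bar_scale (bar_insert n g)"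
  and linear_bar_tail: "multilinear g \<Longrightarrow> Vector_Spaces.linear bar_scale bar_scale (bar_tail n g)"
  unfolding bar_head_def bar_insert_def bar_tail_def
  by (intro linear_bar_ext vector_space_bar_scale mlin_head_list mlin_insert_list mlin_tail_list; assumption)+

lemma bar_op_pure:
  "multilinear g \<Longrightarrow> bar_head n g (bar_pure xs) = head_list n g xs"
  "multilinear g \<Longrightarrow> bar_insert n g (bar_pure xs) = insert_list n g xs"
  "multilinear g \<Longrightarrow> bar_tail n g (bar_pure xs) = tail_list n g xs"
  by (simp_all add: bar_head_def bar_insert_def bar_tail_def bar_ext_pure vector_space_bar_scale
      mlin_head_list mlin_insert_list mlin_tail_list)

lemma bar_insert_cons:
  assumes g: "multilinear g"
  shows "bar_insert n g (bar_cons x t) =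
    bar_head n g (bar_cons x t) + bar_scale ((- 1) ^ (n + 1)) (bar_cons x (bar_insert n g t))"
  by (rule bar_linear_eqI[OF linear_comp[OF linear_bar_cons linear_bar_insert[OF g]]
        linear_plus[OF linear_comp[OF linear_bar_cons linear_bar_head[OF g]]
          linear_smult[OF linear_comp[OF linear_bar_insert[OF g] linear_bar_cons]]]])
    (simp add: bar_op_pure g)

section \<open>Cochains\<close>

text \<open>The cochain with a right coefficient but no left one. This form survives peeling off the
  left coefficient with \<open>bar_cons\<close>; one left multiplication recovers
  \<open>cochain_ext\<close>.\<close>

definition cochain_right :: "'k::field cochain \<Rightarrow> 'k bar \<Rightarrow> 'k fk3"
  where "cochain_right g = bar_ext fk_scale (\<lambda>xs. if xs = [] then 0 else g (butlast xs) * last xs)"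

lemma mlin_cochain_right:
  assumes "multilinear g"
  shows "mlin fk_scale (\<lambda>xs. if xs = [] then 0 else g (butlast xs) * last xs)"
  unfolding mlin_def
proof (intro allI)
  fix xs ys c and x x' :: "'a fk3"
  have g: "mlin fk_scale g" using assms multilinear_iff_mlin by blast
  show "(if xs @ (fk_scale c x + x') # ys = [] then 0
       else g (butlast (xs @ (fk_scale c x + x') # ys)) * last (xs @ (fk_scale c x + x') # ys)) =
      fk_scale c (if xs @ x # ys = [] then 0 else g (butlast (xs @ x # ys)) * last (xs @ x # ys)) +
      (if xs @ x' # ys = [] then 0 else g (butlast (xs @ x' # ys)) * last (xs @ x' # ys))"
    using mlinD[OF g, of xs c x x' "butlast ys"]
    by (cases ys) (auto simp: butlast_append distrib_left distrib_right fk_scale_mult)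
qed

lemma linear_cochain_right:
  "multilinear g \<Longrightarrow> Vector_Spaces.linear bar_scale fk_scale (cochain_right g)"
  unfolding cochain_right_def by (intro linear_bar_ext vector_space_fk_scale mlin_cochain_right)

lemma cochain_right_pure:
  "multilinear g \<Longrightarrow> cochain_right g (bar_pure xs) = (if xs = [] then 0 else g (butlast xs) * last xs)"
  by (simp add: cochain_right_def bar_ext_pure vector_space_fk_scale mlin_cochain_right)

lemma mlin_cochain_ext:
  assumes "multilinear g"
  shows "mlin fk_scale (\<lambda>xs. if length xs < 2 then 0 else hd xs * g (butlast (tl xs)) * last xs)"
proof -
  let ?r = "\<lambda>xs. if xs = [] then 0 else g (butlast xs) * last xs"
  have r: "mlin fk_scale ?r" by (rule mlin_cochain_right[OF assms])
  have eq: "(if length xs < 2 then 0 else hd xs * g (butlast (tl xs)) * last xs) = hd xs * ?r (tl xs)"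
    for xs by (cases xs; cases "tl xs") (auto simp: mult.assoc)
  have "hd (xs @ (fk_scale c x + x') # ys) * ?r (tl (xs @ (fk_scale c x + x') # ys)) =
      fk_scale c (hd (xs @ x # ys) * ?r (tl (xs @ x # ys))) + hd (xs @ x' # ys) * ?r (tl (xs @ x' # ys))"
    for xs ys c and x x' :: "'a fk3"
  proof (cases xs)
    case Nil
    then show ?thesis by (simp add: distrib_right fk_scale_mult)
  next
    case (Cons z zs)
    show ?thesis
      using mlinD[OF r, of zs c x x' ys] unfolding Cons
      by (simp only: append_Cons list.sel distrib_left fk_scale_mult)
  qed
  then show ?thesis unfolding mlin_def eq by blast
qed

lemma linear_cochain_ext:
  "multilinear g \<Longrightarrow> Vector_Spaces.linear bar_scale fk_scale (cochain_ext g)"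
  unfolding cochain_ext_def by (intro linear_bar_ext vector_space_fk_scale mlin_cochain_ext)

lemma cochain_ext_pure:
  assumes "multilinear g"
  shows "cochain_ext g (bar_pure []) = 0"
    "cochain_ext g (bar_pure (x # xs)) = x * cochain_right g (bar_pure xs)"
proof -
  show "cochain_ext g (bar_pure []) = 0"
    "cochain_ext g (bar_pure (x # xs)) = x * cochain_right g (bar_pure xs)"
    by (simp_all add: cochain_ext_def bar_ext_pure vector_space_fk_scale mlin_cochain_ext[OF assms]
        cochain_right_pure[OF assms] mult.assoc)
qed

lemma cochain_ext_cons:
  "multilinear g \<Longrightarrow> cochain_ext g (bar_cons x t) = x * cochain_right g t"
  by (rule bar_linear_eqI[OF linear_comp[OF linear_bar_cons linear_cochain_ext]
        linear_comp[OF linear_cochain_right linear_fk_mult(1)]]) (simp_all add: cochain_ext_pure)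

lemma cochain_ext_lact:
  "multilinear g \<Longrightarrow> t \<in> bar_len (Suc n) \<Longrightarrow> cochain_ext g (bar_lact x t) = x * cochain_ext g t"
  by (rule bar_len_linear_eq[OF linear_comp[OF linear_bar_lact linear_cochain_ext]
        linear_comp[OF linear_cochain_ext linear_fk_mult(1)]])
    (auto simp: cochain_ext_pure length_Suc_conv mult.assoc)

lemma cochain_right_ract:
  "multilinear g \<Longrightarrow> t \<in> bar_len (Suc n) \<Longrightarrow> cochain_right g (bar_ract t x) = cochain_right g t * x"
proof (rule bar_len_linear_eq[OF linear_comp[OF linear_bar_ract linear_cochain_right]
        linear_comp[OF linear_cochain_right linear_fk_mult(2)]]; assumption?)
  fix xs :: "'a fk3 list" assume "length xs = Suc n" "multilinear g"
  moreover from this obtain ys y where "xs = ys @ [y]" by (cases xs rule: rev_cases) auto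
  ultimately show "cochain_right g (bar_ract (bar_pure xs) x) = cochain_right g (bar_pure xs) * x"
    by (simp add: cochain_right_pure mult.assoc)
qed

lemma cochain_ext_ract:
  assumes "multilinear g" "t \<in> bar_len (Suc (Suc n))"
  shows "cochain_ext g (bar_ract t x) = cochain_ext g t * x"
proof (rule bar_len_linear_eq[OF linear_comp[OF linear_bar_ract linear_cochain_ext]
        linear_comp[OF linear_cochain_ext linear_fk_mult(2)] _ assms(2)])
  fix xs :: "'a fk3 list" assume "length xs = Suc (Suc n)"
  moreover from this obtain z u us where "xs = z # u # us" by (auto simp: length_Suc_conv)
  moreover from this obtain ys y where "u # us = ys @ [y]" by (cases "u # us" rule: rev_cases) auto
  ultimately show "cochain_ext g (bar_ract (bar_pure xs) x) = cochain_ext g (bar_pure xs) * x"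
    using bar_ract_pure[of "z # ys" y x]
    by (simp add: cochain_ext_pure assms cochain_right_pure mult.assoc)
qed (use assms in auto)

lemma multilinear_hoch_diff:
  "multilinear g \<Longrightarrow> multilinear (hoch_diff g)"
  unfolding multilinear_iff_mlin hoch_diff_def
  using mlin_linear[OF linear_comp[OF linear_bar_diff linear_cochain_ext]
      mlin_pre_post[OF mlin_bar_pure, of "[1]" "[1]"]]
  by (simp add: multilinear_iff_mlin)

lemma bar_lact_one: "t \<in> bar_len (Suc n) \<Longrightarrow> bar_lact 1 t = t"
  by (rule bar_len_linear_eq[OF linear_bar_lact linear_id[OF vector_space_bar_scale]])
    (auto simp: length_Suc_conv)

text \<open>Peels the left unit off 1|xs|1 inside the bar differential.\<close>

lemma hoch_diff_conv:
  assumes "multilinear g"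
  shows "hoch_diff g xs
    = cochain_ext g (bar_pure (xs @ [1])) - cochain_right g (bar_diff (bar_pure (xs @ [1])))"
proof -
  have "bar_pure (xs @ [1]) \<in> bar_len (Suc (length xs))" by simp
  from bar_diff_cons[OF this, of 1] bar_lact_one[OF this]
  show ?thesis
    by (simp add: hoch_diff_def linearD[OF linear_cochain_ext[OF assms]] cochain_ext_cons[OF assms])
qed

text \<open>For last factor 1 this is \<open>hoch_diff_conv\<close>; the general case follows
  because every term is linear under right multiplication of the last factor.\<close>

lemma cochain_right_hoch_diff:
  assumes "multilinear g" "t \<in> bar_len (Suc n)"
  shows "cochain_right (hoch_diff g) t = cochain_ext g t - cochain_right g (bar_diff t)"
proof (rule bar_len_linear_eq[OF linear_cochain_right[OF multilinear_hoch_diff[OF assms(1)]]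
        linear_minus[OF linear_cochain_ext[OF assms(1)]
          linear_comp[OF linear_bar_diff linear_cochain_right[OF assms(1)]]] _ assms(2)])
  fix xs :: "'a fk3 list" assume "length xs = Suc n"
  then obtain ys x where xs: "xs = ys @ [x]" by (cases xs rule: rev_cases) auto
  have 1: "cochain_ext g (bar_pure (ys @ [1])) * x = cochain_ext g (bar_pure (ys @ [x]))"
    by (cases ys) (simp_all add: cochain_ext_pure cochain_right_pure assms(1) mult.assoc)
  have 2: "cochain_right g (bar_diff (bar_pure (ys @ [1]))) * x
      = cochain_right g (bar_diff (bar_pure (ys @ [x])))"
  proof (cases ys)
    case Nil
    then show ?thesis by (simp add: linearD[OF linear_cochain_right[OF assms(1)]])
  next
    case (Cons z zs)
    then have "bar_pure (ys @ [1]) \<in> bar_len (Suc (Suc (length zs)))" by simp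
    with bar_diff_ract[OF this, of x] bar_diff_len[OF this] show ?thesis
      by (simp add: cochain_right_ract[OF assms(1), symmetric])
  qed
  show "cochain_right (hoch_diff g) (bar_pure xs)
      = cochain_ext g (bar_pure xs) - cochain_right g (bar_diff (bar_pure xs))"
    using 1 2 by (simp add: xs cochain_right_pure multilinear_hoch_diff assms(1)
        hoch_diff_conv[OF assms(1)] algebra_simps)
qed

text \<open>The coboundary of cochains becomes precomposition with the bar differential; peeling off
  the left coefficient reduces this to \<open>cochain_right_hoch_diff\<close>.\<close>

lemma cochain_ext_hoch_diff:
  assumes "multilinear g" "t \<in> bar_len (Suc (Suc n))"
  shows "cochain_ext (hoch_diff g) t = cochain_ext g (bar_diff t)"
proof (rule bar_len_linear_eq[OF linear_cochain_ext[OF multilinear_hoch_diff[OF assms(1)]]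
          linear_comp[OF linear_bar_diff linear_cochain_ext[OF assms(1)]] _ assms(2)])
  fix xs :: "'a fk3 list" assume "length xs = Suc (Suc n)"
  then obtain y ys where xs: "xs = y # ys" "length ys = Suc n" by (auto simp: length_Suc_conv)
  then have ys: "bar_pure ys \<in> bar_len (Suc n)" by simp
  have "cochain_ext g (bar_diff (bar_pure xs)) = cochain_ext g (bar_diff (bar_cons y (bar_pure ys)))"
    by (simp add: xs)
  also have "\<dots> = y * cochain_right (hoch_diff g) (bar_pure ys)"
    unfolding bar_diff_cons[OF ys]
    by (simp add: assms(1) cochain_right_hoch_diff[OF assms(1) ys] cochain_ext_lact[OF assms(1) ys]
        cochain_ext_cons linearD[OF linear_cochain_ext[OF assms(1)]] algebra_simps)
  finally show "cochain_ext (hoch_diff g) (bar_pure xs) = cochain_ext g (bar_diff (bar_pure xs))"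
    by (simp add: xs cochain_ext_pure multilinear_hoch_diff assms(1))
qed

lemma hoch_diff_Nil: "multilinear g \<Longrightarrow> hoch_diff g [] = 0"
  by (simp add: hoch_diff_conv cochain_ext_pure cochain_right_pure linearD[OF linear_cochain_right])

lemma hoch_diff_hoch_diff:
  fixes g :: "'k::field cochain"
  assumes g: "multilinear g" shows "hoch_diff (hoch_diff g) = 0"
proof
  fix xs :: "'k fk3 list"
  have 1: "bar_pure (1 # xs @ [1]) \<in> bar_len (Suc (Suc (length xs)))" by simp
  show "hoch_diff (hoch_diff g) xs = 0 xs"
  proof (cases xs)
    case Nil
    show ?thesis by (simp add: Nil hoch_diff_Nil multilinear_hoch_diff[OF g])
  next
    case (Cons y ys)
    have "bar_diff (bar_pure (1 # xs @ [1])) \<in> bar_len (Suc (Suc (length ys)))"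
      using bar_diff_len[OF 1] Cons by simp
    then show ?thesis
      using bar_diff_diff[OF 1]
      by (subst hoch_diff_def) (simp add: cochain_ext_hoch_diff[OF g] linearD[OF linear_cochain_ext[OF g]])
  qed
qed

lemma merge_append:
  "Suc j < length xs \<Longrightarrow> merge j (xs @ ys) = merge j xs @ ys"
  "merge (length xs + j) (xs @ ys) = xs @ merge j ys"
  by (simp_all add: merge_def nth_append)

text \<open>The classical coboundary formula. The leading unit of 1|xs|1 shifts every face by one,
  whence the minus sign in front of the sum.\<close>

lemma hoch_diff_list:
  assumes g: "multilinear g" and "xs \<noteq> []"
  shows "hoch_diff g xs = hd xs * g (tl xs)
    - (\<Sum>j<length xs - 1. fk_scale ((- 1) ^ j) (g (merge j xs)))
    + fk_scale ((- 1) ^ length xs) (g (butlast xs) * last xs)"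
proof -
  obtain ys y where xs: "xs = ys @ [y]" using \<open>xs \<noteq> []\<close> by (cases xs rule: rev_cases) auto
  have m1: "merge j (xs @ [1]) = merge j xs @ [1]" if "j < length ys" for j
    using that by (intro merge_append) (simp add: xs)
  have m2: "merge (length ys) (xs @ [1]) = xs" using merge_append(2)[of ys 0 "[y, 1]"] by (simp add: xs)
  have "cochain_right g (bar_diff (bar_pure (xs @ [1])))
      = (\<Sum>j<Suc (length ys). fk_scale ((- 1) ^ j) (cochain_right g (bar_pure (merge j (xs @ [1])))))"
    by (simp add: bar_diff_pure_list diff_list_eq_sum xs linearD[OF linear_cochain_right[OF g]] del: sum.lessThan_Suc)
  also have "\<dots> = (\<Sum>j<length ys. fk_scale ((- 1) ^ j) (g (merge j xs)))
      + fk_scale ((- 1) ^ length ys) (g ys * y)"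
    by (simp add: m1 m2 cochain_right_pure[OF g]) (simp add: xs)
  finally have 1: "cochain_right g (bar_diff (bar_pure (xs @ [1])))
      = (\<Sum>j<length ys. fk_scale ((- 1) ^ j) (g (merge j xs)))
      + fk_scale ((- 1) ^ length ys) (g ys * y)" .
  have 2: "cochain_ext g (bar_pure (xs @ [1])) = hd xs * g (tl xs)"
    using \<open>xs \<noteq> []\<close> by (cases xs) (simp_all add: cochain_ext_pure[OF g] cochain_right_pure[OF g])
  have 3: "length xs - 1 = length ys" "butlast xs = ys" "last xs = y" "length xs = Suc (length ys)"
    by (simp_all add: xs)
  show ?thesis
    unfolding hoch_diff_conv[OF g] 1 2 3 by simp
qed

text \<open>Cochains carry all degrees at once. This locality in the length allows a sum whose range
  depends on the degree to be frozen at one degree before the coboundary is taken.\<close>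

lemma hoch_diff_cong:
  assumes "multilinear g" "multilinear h" "\<And>ys. length ys + 1 = length xs \<Longrightarrow> g ys = h ys"
  shows "hoch_diff g xs = hoch_diff h xs"
proof (cases "xs = []")
  case True
  then show ?thesis
    by (simp add: hoch_diff_def linearD[OF linear_cochain_ext] assms(1,2) cochain_ext_pure
        cochain_ext_cons linearD[OF linear_cochain_right] cochain_right_pure)
next
  case False
  have "g (merge j xs) = h (merge j xs)" if "j < length xs - 1" for j
    using that by (intro assms(3)) simp
  moreover have "g (tl xs) = h (tl xs)" "g (butlast xs) = h (butlast xs)"
    using False by (auto intro!: assms(3) simp: Suc_diff_Suc)
  ultimately show ?thesis using False by (simp add: hoch_diff_list assms(1,2))
qed

subsection \<open>Inserting a cochain and the differential\<close>

lemma linear_pure_head: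
  "Vector_Spaces.linear fk_scale bar_scale (\<lambda>a. bar_pure (a # xs))"
  unfolding Vector_Spaces.linear_iff
proof (intro conjI allI vector_space_fk_scale vector_space_bar_scale)
  fix c and x y :: "'a fk3"
  show add: "bar_pure ((x + y) # xs) = bar_pure (x # xs) + bar_pure (y # xs)" for x y
    using mlinD'[OF mlin_bar_pure, of 1 x y xs] by simp
  have "bar_pure (0 # xs) = 0" using add[of 0 0] by simp
  then show "bar_pure (fk_scale c x # xs) = bar_scale c (bar_pure (x # xs))"
    using mlinD'[OF mlin_bar_pure, of c x 0 xs] by simp
qed

lemma sum_lessThan_add:
  fixes f :: "nat \<Rightarrow> 'a::comm_monoid_add"
  shows "(\<Sum>j<m + k. f j) = (\<Sum>j<m. f j) + (\<Sum>j<k. f (m + j))"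
  by (induction k) (simp_all add: add.assoc)

text \<open>The terms of the coboundary of \<open>g\<close> on the first n+1 factors are sorted by
  type. Left multiplication gives the \<open>bar_lact\<close> term; the inner contractions are the
  faces j < n of the differential; right multiplication is the first face of the tensor headed by
  the value of \<open>g\<close>, whose other faces cancel against the faces from n on.\<close>

lemma bar_head_hoch_diff:
  assumes g: "multilinear g" and "n < length xs"
  shows "bar_head (Suc n) (hoch_diff g) (bar_pure (x # xs)) =
    bar_lact x (bar_head n g (bar_pure xs)) - bar_head n g (bar_diff (bar_pure (x # xs)))
    + bar_scale ((- 1) ^ (n + 1)) (bar_diff (bar_head n g (bar_pure (x # xs))))"
proof -
  \<comment> \<open>\<open>A\<close> and \<open>R\<close> cut behind n+1 factors, as
    \<open>hoch_diff g\<close> reads them; \<open>B\<close> and \<open>S\<close> cut behind n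
    factors, as \<open>g\<close> does.\<close>
  define A where "A = x # take n xs"
  define R where "R = drop n xs"
  define B where "B = take n (x # xs)"
  define S where "S = drop n (x # xs)"
  have AR: "x # xs = A @ R" by (simp add: A_def R_def)
  have lA: "length A = Suc n" and R: "R \<noteq> []" using assms(2) by (simp_all add: A_def R_def)
  have BS: "x # xs = B @ S" by (simp add: B_def S_def)
  have lB: "length B = n" and lS: "length S = Suc (length R)"
    using assms(2) by (simp_all add: B_def S_def R_def)
  have S: "S = last A # R" and B: "B = butlast A"
    using assms(2) lA lB AR BS
    by (metis append_butlast_last_id append_eq_append_conv append_Cons append_Nil append.assoc
        diff_Suc_1 length_butlast list.size(3) nat.distinct(1))+
  note g' = multilinear_hoch_diff[OF g]
  note lin = linearD[OF linear_pure_head]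
  have mB: "merge (n + j) (B @ S) = B @ merge j S" for j
    using merge_append(2)[of B j S] lB by simp
  have 1: "bar_head (Suc n) (hoch_diff g) (bar_pure (x # xs)) = bar_pure (hoch_diff g A # R)"
    using assms(2) by (simp add: bar_op_pure[OF g'] head_list_def A_def R_def)
  have 2: "bar_lact x (bar_head n g (bar_pure xs)) = bar_pure ((x * g (take n xs)) # R)"
    using assms(2) by (simp add: bar_op_pure[OF g] head_list_def R_def)
  have 3: "bar_head n g (bar_pure (x # xs)) = bar_pure (g B # S)"
    using assms(2) by (simp add: bar_op_pure[OF g] head_list_def B_def S_def)
  have len: "length xs = n + length R" using assms(2) by (simp add: R_def)
  have "bar_head n g (bar_diff (bar_pure (x # xs)))
      = (\<Sum>j<n + length R. bar_scale ((- 1) ^ j) (head_list n g (merge j (x # xs))))"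
    by (simp add: bar_diff_pure_list diff_list_eq_sum linearD[OF linear_bar_head[OF g]]
        bar_op_pure[OF g] len)
  also have "\<dots> = (\<Sum>j<n. bar_scale ((- 1) ^ j) (head_list n g (merge j (x # xs))))
      + (\<Sum>j<length R. bar_scale ((- 1) ^ (n + j)) (head_list n g (merge (n + j) (x # xs))))"
    by (rule sum_lessThan_add)
  also have "(\<Sum>j<n. bar_scale ((- 1) ^ j) (head_list n g (merge j (x # xs))))
      = (\<Sum>j<n. bar_scale ((- 1) ^ j) (bar_pure (g (merge j A) # R)))"
  proof (intro sum.cong refl arg_cong[where f = "bar_scale _"])
    fix j assume "j \<in> {..<n}"
    then show "head_list n g (merge j (x # xs)) = bar_pure (g (merge j A) # R)"
      using lA R by (simp add: AR merge_append head_list_def)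
  qed
  also have "(\<Sum>j<length R. bar_scale ((- 1) ^ (n + j)) (head_list n g (merge (n + j) (x # xs))))
      = bar_scale ((- 1) ^ n) (bar_cons (g B) (diff_list S))"
    unfolding diff_list_eq_sum lS
    by (simp add: bar.scale_sum_right)
      (intro sum.cong refl, use lB lS R in \<open>simp add: BS mB head_list_def power_add\<close>)
  finally have 4: "bar_head n g (bar_diff (bar_pure (x # xs))) =
      (\<Sum>j<n. bar_scale ((- 1) ^ j) (bar_pure (g (merge j A) # R)))
      + bar_scale ((- 1) ^ n) (bar_cons (g B) (diff_list S))" .
  have 5: "bar_pure (hoch_diff g A # R) = bar_pure ((x * g (take n xs)) # R)
      - (\<Sum>j<n. bar_scale ((- 1) ^ j) (bar_pure (g (merge j A) # R)))
      + bar_scale ((- 1) ^ (n + 1)) (bar_pure ((g B * last A) # R))"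
  proof -
    have "A \<noteq> []" "length A - 1 = n" "hd A = x" "tl A = take n xs" using lA by (auto simp: A_def)
    then show ?thesis by (subst hoch_diff_list[OF g]) (simp_all add: lin lA B)
  qed
  have 6: "bar_diff (bar_pure (g B # S))
      = bar_pure ((g B * last A) # R) - bar_cons (g B) (diff_list S)"
    by (simp add: S bar_diff_pure_list)
  show ?thesis
    unfolding 1 2 3 4 5 6 by (simp add: bar.scale_right_diff_distrib)
qed

lemma head_list_len:
  "head_list n g xs \<in> bar_len (length xs + 1 - n)"
  by (simp add: head_list_def bar_len_closed)

lemma insert_list_short: "length xs \<le> n \<Longrightarrow> insert_list n g xs = 0"
  by (induction xs) (auto simp: head_list_def)

lemma insert_list_len: "insert_list n g xs \<in> bar_len (length xs + 1 - n)"
proof (induction xs)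
  case (Cons x xs)
  show ?case
  proof (cases "length xs < n")
    case True
    then show ?thesis by (simp add: insert_list_short head_list_def bar_len_closed)
  next
    case False
    have "bar_cons x (insert_list n g xs) \<in> bar_len (Suc (length xs + 1 - n))"
      by (rule bar_cons_len[OF Cons])
    also have "Suc (length xs + 1 - n) = length (x # xs) + 1 - n" using False by simp
    finally show ?thesis
      unfolding insert_list.simps by (intro bar_len_closed head_list_len)
  qed
qed (simp add: bar_len_closed)

lemma bar_insert_short:
  "multilinear g \<Longrightarrow> m \<le> n \<Longrightarrow> t \<in> bar_len m \<Longrightarrow> bar_insert n g t = 0"
  by (rule bar_len_linear_eq[OF linear_bar_insert linear_zero[OF vector_space_bar_scale vector_space_bar_scale]])
    (auto simp: bar_op_pure insert_list_short)

lemma bar_insert_len: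
  "multilinear g \<Longrightarrow> t \<in> bar_len m \<Longrightarrow> bar_insert n g t \<in> bar_len (m + 1 - n)"
  by (rule bar_len_linear_image[OF linear_bar_insert, where n = m])
    (use insert_list_len[of n g] in \<open>auto simp: bar_op_pure\<close>)

text \<open>Inserting \<open>g\<close> commutes with the differential up to sign, up to inserting
  the coboundary of \<open>g\<close>, and up to one boundary term: the face that multiplies the
  value of \<open>g\<close> in the last position into the right coefficient has no partner, and this
  is \<open>bar_tail\<close>. Both the behaviour of the bracket on coboundaries and the chain map
  property of \<open>bar_tail\<close> follow from it.\<close>

lemma bar_insert_diff:
  assumes g: "multilinear g"
  shows "bar_diff (bar_insert n g t) = bar_scale ((- 1) ^ (n + 1)) (bar_insert n g (bar_diff t))
    + bar_scale ((- 1) ^ (n + 1)) (bar_insert (Suc n) (hoch_diff g) t) + bar_tail n g t"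
proof (rule bar_linear_eqI[where t = t, OF linear_comp[OF linear_bar_insert[OF g] linear_bar_diff]
      linear_plus[OF linear_plus[OF linear_smult[OF linear_comp[OF linear_bar_diff linear_bar_insert[OF g]]]
          linear_smult[OF linear_bar_insert[OF multilinear_hoch_diff[OF g]]]] linear_bar_tail[OF g]]])
  note g' = multilinear_hoch_diff[OF g]
  note lin = linearD[OF linear_bar_insert[OF g]]
  fix xs
  show "bar_diff (bar_insert n g (bar_pure xs)) =
     bar_scale ((- 1) ^ (n + 1)) (bar_insert n g (bar_diff (bar_pure xs))) +
     bar_scale ((- 1) ^ (n + 1)) (bar_insert (Suc n) (hoch_diff g) (bar_pure xs)) +
     bar_tail n g (bar_pure xs)"
  proof (induction xs rule: diff_list.induct)
    case (1 x y ys)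
    let ?xs = "y # ys"
    have dl: "bar_diff (bar_pure (x # ?xs)) \<in> bar_len (length ?xs)"
      by (rule bar_diff_len) simp
    \<comment> \<open>The tensor has one factor more than \<open>?xs\<close>. With at most n factors
      nothing can be inserted; with n+1 there is one position for \<open>g\<close> and none for its
      coboundary; beyond that the recursion applies.\<close>
    consider "length ?xs < n" | "length ?xs = n" | "length ?xs > n" by linarith
    then show ?case
    proof cases
      case 1
      have "bar_insert n g (bar_diff (bar_pure (x # ?xs))) = 0"
        by (rule bar_insert_short[OF g _ dl]) (use 1 in simp)
      moreover have "bar_insert n g (bar_pure (x # ?xs)) = 0"
        "bar_insert (Suc n) (hoch_diff g) (bar_pure (x # ?xs)) = 0"
        using 1 by (simp_all add: bar_op_pure g g' insert_list_short del: insert_list.simps)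
      ultimately show ?thesis using 1 by (simp add: bar_op_pure g)
    next
      case 2
      have "bar_insert n g (bar_diff (bar_pure (x # ?xs))) = 0"
        by (rule bar_insert_short[OF g _ dl]) (use 2 in simp)
      moreover have "bar_insert (Suc n) (hoch_diff g) (bar_pure (x # ?xs)) = 0"
        using 2 by (simp add: bar_op_pure g' insert_list_short del: insert_list.simps)
      moreover have "drop n (x # ?xs) = [last (x # ?xs)]"
        using 2 by (metis append_butlast_last_id append_eq_conv_conj length_Cons length_butlast
            diff_Suc_1 list.distinct(1))
      then have "head_list n g (x # ?xs) = bar_pure [g (take n (x # ?xs)), last (x # ?xs)]"
        unfolding head_list_def using 2 by simp
      then have "bar_insert n g (bar_pure (x # ?xs)) = bar_pure [g (take n (x # ?xs)), last (x # ?xs)]"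
        unfolding bar_op_pure(2)[OF g] insert_list.simps(2)[of n g x] using 2
        by (simp add: insert_list_short del: insert_list.simps)
      moreover have "bar_tail n g (bar_pure (x # ?xs)) = bar_pure [g (take n (x # ?xs)) * last (x # ?xs)]"
        unfolding bar_op_pure(3)[OF g] tail_list.simps(2)[of n g x] using 2 by simp
      ultimately show ?thesis by simp
    next
      case 3
      have len: "bar_insert n g (bar_pure ?xs) \<in> bar_len (Suc (length ?xs - n))"
        using insert_list_len[of n g ?xs] 3 by (simp add: bar_op_pure g Suc_diff_le del: insert_list.simps)
      have ins: "bar_insert n g (bar_pure (x # ?xs)) = bar_head n g (bar_pure (x # ?xs))
          + bar_scale ((- 1) ^ (n + 1)) (bar_cons x (bar_insert n g (bar_pure ?xs)))"
        using bar_insert_cons[OF g, of n x "bar_pure ?xs"] by simp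
      have ins_xs: "bar_insert n g (bar_pure ?xs) = bar_head n g (bar_pure ?xs)
          + bar_scale ((- 1) ^ (n + 1)) (bar_cons y (bar_insert n g (bar_pure ys)))"
        using bar_insert_cons[OF g, of n y "bar_pure ys"] by simp
      have ins_xy: "bar_insert n g (bar_pure ((x * y) # ys)) = bar_head n g (bar_pure ((x * y) # ys))
          + bar_scale ((- 1) ^ (n + 1)) (bar_cons (x * y) (bar_insert n g (bar_pure ys)))"
        using bar_insert_cons[OF g, of n "x * y" "bar_pure ys"] by simp
      have ins': "bar_insert (Suc n) (hoch_diff g) (bar_pure (x # ?xs))
          = bar_head (Suc n) (hoch_diff g) (bar_pure (x # ?xs))
          + bar_scale ((- 1) ^ n) (bar_cons x (bar_insert (Suc n) (hoch_diff g) (bar_pure ?xs)))"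
        using bar_insert_cons[OF g', of "Suc n" x "bar_pure ?xs"] by simp
      have tail: "bar_tail n g (bar_pure (x # ?xs))
          = bar_scale ((- 1) ^ n) (bar_cons x (bar_tail n g (bar_pure ?xs)))"
        using 3 by (simp add: bar_op_pure g)
      have head: "bar_head n g (bar_diff (bar_pure (x # ?xs)))
          = bar_head n g (bar_pure ((x * y) # ys)) - bar_head n g (bar_cons x (bar_diff (bar_pure ?xs)))"
        by (simp add: linearD[OF linear_bar_head[OF g]])
      have lact: "bar_lact x (bar_insert n g (bar_pure ?xs)) = bar_lact x (bar_head n g (bar_pure ?xs))
          + bar_scale ((- 1) ^ (n + 1)) (bar_cons (x * y) (bar_insert n g (bar_pure ys)))"
        unfolding ins_xs by simp
      have dins: "bar_diff (bar_cons x (bar_insert n g (bar_pure ?xs)))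
          = bar_lact x (bar_insert n g (bar_pure ?xs)) - bar_cons x (bar_diff (bar_insert n g (bar_pure ?xs)))"
        by (rule bar_diff_cons[OF len])
      have insd: "bar_insert n g (bar_diff (bar_pure (x # ?xs)))
          = bar_insert n g (bar_pure ((x * y) # ys)) - bar_insert n g (bar_cons x (bar_diff (bar_pure ?xs)))"
        by (simp add: lin)
      show ?thesis
        unfolding ins bar_diff_simps dins lact 1 insd ins_xy bar_insert_cons[OF g] ins' tail
          bar_head_hoch_diff[OF g 3] head bar_cons_simps
        by (cases "even n") (simp_all add: algebra_simps)
    qed
  next
    case "2_1"
    show ?case by (simp add: bar_op_pure g g' lin)
  next
    case ("2_2" x)
    show ?case by (simp add: bar_op_pure g g' head_list_def lin)
  qed
qed

subsection \<open>The Gerstenhaber bracket and the cup product on cohomology\<close>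

lemma head_list_ract: "head_list n g (xs @ [y * z]) = bar_ract (head_list n g (xs @ [y])) z"
  using bar_ract_pure[of "g (take n xs) # drop n xs" y z] by (auto simp: head_list_def)

lemma insert_list_ract: "insert_list n g (xs @ [y * z]) = bar_ract (insert_list n g (xs @ [y])) z"
proof (induction xs)
  case Nil
  show ?case using head_list_ract[of n g "[]"] by simp
next
  case (Cons x xs)
  have "bar_ract (bar_cons x (insert_list n g (xs @ [y]))) z
      = bar_cons x (bar_ract (insert_list n g (xs @ [y])) z)"
  proof (cases "n \<le> length xs")
    case True
    then have "insert_list n g (xs @ [y]) \<in> bar_len (Suc (Suc (length xs) - n))"
      using insert_list_len[of n g "xs @ [y]"] by (simp add: Suc_diff_le)
    then show ?thesis by (rule bar_ract_cons)
  qed (simp add: insert_list_short)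
  then show ?case using Cons head_list_ract[of n g "x # xs"] by simp
qed

lemma tail_list_append:
  "length xs = m + n \<Longrightarrow>
    tail_list n g (xs @ [y]) = bar_scale ((- 1) ^ (n * m)) (bar_pure (take m xs @ [g (drop m xs) * y]))"
proof (induction m arbitrary: xs)
  case 0
  then show ?case by (cases xs) auto
next
  case (Suc m)
  then obtain x ys where xs: "xs = x # ys" "length ys = m + n" by (cases xs) auto
  with Suc.IH[OF xs(2)] show ?case by (simp add: power_add mult.commute)
qed

lemma insert_list_append:
  "length xs + 1 = m + n \<Longrightarrow> insert_list n g (xs @ [y]) = (\<Sum>i<m. bar_scale ((- 1) ^ ((n + 1) * i))
    (bar_pure (take i xs @ g (take n (drop i xs)) # drop (i + n) xs @ [y])))"
proof (induction m arbitrary: xs)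
  case 0
  then show ?case by (simp add: insert_list_short)
next
  case (Suc m)
  show ?case
  proof (cases xs)
    case Nil
    with Suc show ?thesis by (simp add: head_list_def)
  next
    case (Cons x ys)
    with Suc.prems have "length ys + 1 = m + n" by simp
    note IH = Suc.IH[OF this]
    have head: "head_list n g (xs @ [y]) = bar_pure (g (take n xs) # drop n xs @ [y])"
      using Suc.prems by (simp add: head_list_def)
    have "insert_list n g (xs @ [y]) = head_list n g (xs @ [y])
        + bar_scale ((- 1) ^ (n + 1)) (bar_cons x (insert_list n g (ys @ [y])))"
      by (simp add: Cons)
    also have "bar_scale ((- 1) ^ (n + 1)) (bar_cons x (insert_list n g (ys @ [y])))
        = (\<Sum>i<m. bar_scale ((- 1) ^ ((n + 1) * Suc i)) (bar_pure
            (take (Suc i) xs @ g (take n (drop (Suc i) xs)) # drop (Suc i + n) xs @ [y])))"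
      unfolding IH Cons
      by (simp only: bar_cons_simps bar.scale_sum_right bar.scale_scale power_add[symmetric]
          mult_Suc_right bar_cons_pure take_Suc_Cons drop_Suc_Cons append_Cons add_Suc)
    finally show ?thesis
      unfolding head sum.lessThan_Suc_shift by simp
  qed
qed

text \<open>Composition is insertion into xs|1 followed by evaluation, which makes
  \<open>bar_insert_diff\<close> applicable to brackets.\<close>

lemma circ_G_conv:
  assumes "multilinear g" "multilinear h"
  shows "circ_G m n g h = (\<lambda>xs. if length xs + 1 = m + n
    then cochain_right g (bar_insert n h (bar_pure (xs @ [1]))) else 0)"
proof
  fix xs
  have sgn: "(- 1) ^ k * x = fk_scale ((- 1) ^ k) x" for k and x :: "'a fk3"
    by (cases "even k") (simp_all add: fk.scale_minus_left)
  have "g (take i xs @ h (take n (drop i xs)) # drop (i + n) xs) =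
      cochain_right g (bar_pure (take i xs @ h (take n (drop i xs)) # drop (i + n) xs @ [1]))" for i
    by (simp add: cochain_right_pure assms butlast_append)
  then show "circ_G m n g h xs = (if length xs + 1 = m + n
    then cochain_right g (bar_insert n h (bar_pure (xs @ [1]))) else 0)"
    by (simp add: circ_G_def bar_op_pure assms insert_list_append
        linearD[OF linear_cochain_right[OF assms(1)]] sgn)
qed

lemma multilinear_circ_G:
  assumes "multilinear g" "multilinear h" shows "multilinear (circ_G m n g h)"
  unfolding circ_G_conv[OF assms] multilinear_iff_mlin
  by (rule mlin_length[OF vector_space_fk_scale, where P = "\<lambda>l. l + 1 = m + n"])
    (use mlin_linear[OF linear_comp[OF linear_bar_insert[OF assms(2)] linear_cochain_right[OF assms(1)]]
      mlin_pre_post[OF mlin_bar_pure, of "[]" "[1]"]] in simp)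

lemma cochain_right_circ_G:
  assumes "multilinear g" "multilinear h" "t \<in> bar_len (m + n)"
  shows "cochain_right (circ_G m n g h) t = cochain_right g (bar_insert n h t)"
proof (rule bar_len_linear_eq[OF linear_cochain_right[OF multilinear_circ_G[OF assms(1,2)]]
        linear_comp[OF linear_bar_insert[OF assms(2)] linear_cochain_right[OF assms(1)]] _ assms(3)])
  fix xs :: "'a fk3 list" assume len: "length xs = m + n"
  show "cochain_right (circ_G m n g h) (bar_pure xs) = cochain_right g (bar_insert n h (bar_pure xs))"
  proof (cases xs rule: rev_cases)
    case Nil
    then show ?thesis
      by (simp add: cochain_right_pure multilinear_circ_G assms bar_op_pure linearD[OF linear_cochain_right])
  next
    case (snoc ys y)
    have "cochain_right g (insert_list n h (ys @ [1])) * y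
        = cochain_right g (bar_ract (insert_list n h (ys @ [1])) y)"
    proof (cases "n \<le> length ys")
      case True
      then have "insert_list n h (ys @ [1]) \<in> bar_len (Suc (Suc (length ys) - n))"
        using insert_list_len[of n h "ys @ [1]"] by (simp add: Suc_diff_le)
      then show ?thesis by (simp add: cochain_right_ract assms(1))
    qed (simp add: insert_list_short linearD[OF linear_cochain_right[OF assms(1)]])
    moreover have "cochain_right (circ_G m n g h) (bar_pure xs) = circ_G m n g h ys * y"
      by (simp add: snoc cochain_right_pure multilinear_circ_G assms)
    moreover have "circ_G m n g h ys = cochain_right g (insert_list n h (ys @ [1]))"
      using len by (simp add: circ_G_conv assms bar_op_pure snoc)
    ultimately show ?thesis
      using insert_list_ract[of n h ys 1 y] by (simp add: snoc assms bar_op_pure)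
  qed
qed

lemma multilinear_diff_scale:
  "multilinear g \<Longrightarrow> multilinear h \<Longrightarrow> multilinear (\<lambda>xs. fk_scale c (g xs) - fk_scale d (h xs))"
  using mlin_add[OF vector_space_fk_scale mlin_scale[OF vector_space_fk_scale, of g c]
      mlin_scale[OF vector_space_fk_scale, of h "- d"]]
  by (simp add: multilinear_iff_mlin fk.scale_minus_left)

lemma cochain_ext_zero: "cochain_ext 0 t = 0"
  by (auto simp: cochain_ext_def bar_ext_def lin_comb_def intro!: sum.neutral)

lemma cochain_right_zero: "cochain_right 0 t = 0"
  by (auto simp: cochain_right_def bar_ext_def lin_comb_def intro!: sum.neutral)

text \<open>The two commutator terms of the cup product that occur in the differentials of
  $x\circ_G z$ and $z\circ_G x$ cancel.\<close>

lemma bracket_G_hoch_diff: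
  assumes x: "multilinear x" and z: "multilinear z" and dz: "hoch_diff z = 0"
    and len: "length as = m + n"
  shows "bracket_G (m + 1) n (hoch_diff x) z as =
    fk_scale ((- 1) ^ (n + 1)) (hoch_diff (circ_G m n x z) as)
    - fk_scale ((- 1) ^ (m * (n + 1))) (hoch_diff (circ_G n m z x) as)"
proof -
  note linx = linearD[OF linear_cochain_right[OF x]]
  note linz = linearD[OF linear_cochain_right[OF z]]
  note x' = multilinear_hoch_diff[OF x]
  obtain a Y where aY: "as @ [1] = a # Y" by (cases as) auto
  let ?A = "bar_pure (as @ [1])"
  have A: "?A \<in> bar_len (Suc (m + n))" using len by simp
  have dA: "bar_diff ?A \<in> bar_len (m + n)" by (rule bar_diff_len[OF A])
  have Y: "bar_pure Y \<in> bar_len (m + n)" using len arg_cong[OF aY, of length] by simp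
  \<comment> \<open>The terms that are not part of the coboundary of a composition. Heads and tails
    both evaluate to one of the cup products of \<open>x\<close> and \<open>z\<close>.\<close>
  define hx where "hx = cochain_ext x (bar_head n z ?A)"
  define tx where "tx = cochain_right x (bar_tail n z ?A)"
  define hz where "hz = cochain_ext z (bar_head m x ?A)"
  define tz where "tz = cochain_right z (bar_tail m x ?A)"
  have ext_insert: "cochain_ext g (bar_insert k h ?A) = cochain_ext g (bar_head k h ?A)
      + fk_scale ((- 1) ^ (k + 1)) (a * cochain_right g (bar_insert k h (bar_pure Y)))"
    if "multilinear g" "multilinear h" for g h k
    using bar_insert_cons[OF that(2), of k a "bar_pure Y"]
    by (simp add: aY linearD[OF linear_cochain_ext[OF that(1)]] cochain_ext_cons[OF that(1)])
  have hoch: "hoch_diff (circ_G k l g h) as = a * cochain_right g (bar_insert l h (bar_pure Y))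
      - cochain_right g (bar_insert l h (bar_diff ?A))"
    if "multilinear g" "multilinear h" "k + l = m + n" for g h k l
    unfolding hoch_diff_conv[OF multilinear_circ_G[OF that(1,2)]]
    using cochain_right_circ_G[OF that(1,2) dA[folded that(3)]]
      cochain_right_circ_G[OF that(1,2) Y[folded that(3)]]
    by (simp add: aY cochain_ext_pure[OF multilinear_circ_G[OF that(1,2)]])
  have ins1: "bar_insert n z ?A \<in> bar_len (Suc (Suc m))"
    using bar_insert_len[OF z A, of n] by simp
  have ins2: "bar_insert m x ?A \<in> bar_len (Suc (Suc n))"
    using bar_insert_len[OF x A, of m] by simp
  have zero: "bar_insert k 0 t = 0" for k and t :: "'a bar"
  proof (rule bar_linear_eqI[OF linear_bar_insert linear_zero[OF vector_space_bar_scale vector_space_bar_scale]])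
    show "multilinear (0 :: 'a cochain)" using cochains_zero by (simp add: cochains_def)
    fix xs :: "'a fk3 list"
    have "bar_pure (0 # ys) = 0" for ys :: "'a fk3 list" by (rule linearD(4)[OF linear_pure_head])
    then have "insert_list k 0 xs = 0" by (induction xs) (auto simp: head_list_def)
    then show "bar_insert k 0 (bar_pure xs) = 0"
      using \<open>multilinear (0 :: 'a cochain)\<close> by (simp add: bar_op_pure)
  qed
  have d1: "bar_diff (bar_insert n z ?A)
      = bar_scale ((- 1) ^ (n + 1)) (bar_insert n z (bar_diff ?A)) + bar_tail n z ?A"
    using bar_insert_diff[OF z, of n ?A] by (simp add: dz zero)
  have "circ_G (m + 1) n (hoch_diff x) z as = cochain_right (hoch_diff x) (bar_insert n z ?A)"
    using len by (simp add: circ_G_conv[OF x' z])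
  also have "\<dots> = cochain_ext x (bar_insert n z ?A) - cochain_right x (bar_diff (bar_insert n z ?A))"
    by (rule cochain_right_hoch_diff[OF x ins1])
  finally have 1: "circ_G (m + 1) n (hoch_diff x) z as
      = fk_scale ((- 1) ^ (n + 1)) (hoch_diff (circ_G m n x z) as) + hx - tx"
    unfolding hoch[OF x z refl] d1 ext_insert[OF x z]
    by (simp add: linx hx_def tx_def fk.scale_right_diff_distrib algebra_simps)
  have d2: "bar_insert (Suc m) (hoch_diff x) ?A
      = bar_scale ((- 1) ^ (m + 1)) (bar_diff (bar_insert m x ?A) - bar_tail m x ?A)
        - bar_insert m x (bar_diff ?A)"
    unfolding bar_insert_diff[OF x, of m ?A] by (cases "even m") simp_all
  have "circ_G n (m + 1) z (hoch_diff x) as = cochain_right z (bar_insert (Suc m) (hoch_diff x) ?A)"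
    using len by (simp add: circ_G_conv[OF z x'])
  also have "\<dots> = fk_scale ((- 1) ^ (m + 1)) (cochain_ext z (bar_insert m x ?A) - tz)
      - cochain_right z (bar_insert m x (bar_diff ?A))"
    unfolding d2 using cochain_right_hoch_diff[OF z ins2]
    by (simp add: linz tz_def dz cochain_right_zero)
  finally have 2: "circ_G n (m + 1) z (hoch_diff x) as
      = hoch_diff (circ_G n m z x) as + fk_scale ((- 1) ^ (m + 1)) (hz - tz)"
    unfolding hoch[OF z x add.commute] ext_insert[OF z x]
    by (cases "even m") (simp_all add: hz_def algebra_simps)
  let ?u = "z (take n as) * x (drop n as)" and ?v = "x (take m as) * z (drop m as)"
  have h: "hx = ?u" "hz = ?v"
    using len by (simp_all add: hx_def hz_def bar_op_pure x z head_list_def cochain_ext_pure cochain_right_pure)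
  have t: "tx = fk_scale ((- 1) ^ (n * m)) ?v" "tz = fk_scale ((- 1) ^ (m * n)) ?u"
    using len by (simp_all add: tx_def tz_def bar_op_pure x z tail_list_append[of as m n]
        tail_list_append[of as n m] linx linz cochain_right_pure)
  show ?thesis
    unfolding bracket_G_def 1 2 h t
    by (cases "even m"; cases "even n") (simp_all add: algebra_simps)
qed

lemma circ_G_zero_degree: "circ_G 0 n g h xs = 0"
  by (simp add: circ_G_def)

lemma multilinear_zero_arg: "multilinear g \<Longrightarrow> g (xs @ 0 # ys) = 0"
  unfolding multilinear_def using linearD(4) by fastforce

lemma multilinear_sum:
  "(\<And>i. i \<in> I \<Longrightarrow> multilinear (g i)) \<Longrightarrow> multilinear (\<lambda>xs. \<Sum>i\<in>I. g i xs)"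
  unfolding multilinear_iff_mlin by (rule mlin_sum[OF vector_space_fk_scale])

lemma hoch_diff_sum:
  "finite I \<Longrightarrow> hoch_diff (\<lambda>xs. \<Sum>i\<in>I. g i xs) = (\<lambda>xs. \<Sum>i\<in>I. hoch_diff (g i) xs)"
proof (induction I rule: finite_induct)
  case empty
  show ?case using hoch_diff_zero by (simp add: zero_fun_def)
next
  case (insert i I)
  then show ?case using hoch_diff_add[of "g i" "\<lambda>xs. \<Sum>i\<in>I. g i xs"] by (simp add: plus_fun_def)
qed

lemma hoch_diff_comb:
  "hoch_diff (\<lambda>xs. fk_scale c (g xs) - fk_scale d (h xs))
    = (\<lambda>xs. fk_scale c (hoch_diff g xs) - fk_scale d (hoch_diff h xs))"
proof -
  have "(\<lambda>xs. fk_scale c (g xs) - fk_scale d (h xs))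
      = (\<lambda>xs. fk_scale c (g xs)) + (\<lambda>xs. fk_scale (- d) (h xs))"
    by (simp add: fun_eq_iff fk.scale_minus_left)
  then show ?thesis
    by (simp only: hoch_diff_add hoch_diff_scale) (simp add: fun_eq_iff fk.scale_minus_left)
qed

text \<open>The primitives that \<open>bracket_G_hoch_diff\<close> gives degree by degree are
  assembled into one function \<open>W\<close>; the bounds on the degrees of both arguments make it
  a cochain.\<close>

lemma gerstenhaber_hoch_diff:
  assumes x: "x \<in> cochains" and z: "z \<in> cocycles"
  shows "gerstenhaber (hoch_diff x) z \<in> coboundaries"
proof -
  have mx: "multilinear x" and mz: "multilinear z" and dz: "hoch_diff z = 0"
    using assms by (auto simp: cochains_def cocycles_def)
  obtain M N where M: "\<And>xs. M < length xs \<Longrightarrow> x xs = 0" and N: "\<And>xs. N < length xs \<Longrightarrow> z xs = 0"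
    using assms by (auto simp: cochains_def cocycles_def)
  \<comment> \<open>\<open>L\<close> is one more than the length of the list: a composition of
    degrees m and L - m lives on lists with L - 1 entries, and its coboundary on lists with L
    entries.\<close>
  define U where "U L m = (\<lambda>ys. fk_scale ((- 1) ^ (L - m + 1)) (circ_G m (L - m) x z ys)
    - fk_scale ((- 1) ^ (m * (L - m + 1))) (circ_G (L - m) m z x ys))" for L m
  define W where "W ys = (\<Sum>m\<le>length ys + 1. U (length ys + 1) m ys)" for ys
  have mU: "multilinear (U L m)" for L m
    unfolding U_def by (intro multilinear_diff_scale multilinear_circ_G mx mz)
  have mW: "multilinear W"
    unfolding multilinear_iff_mlin mlin_def
  proof (intro allI)
    fix xs c u u' and ys :: "'a fk3 list"
    have "U L m (xs @ (fk_scale c u + u') # ys)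
        = fk_scale c (U L m (xs @ u # ys)) + U L m (xs @ u' # ys)" for L m
      using mU[unfolded multilinear_iff_mlin] by (rule mlinD)
    then show "W (xs @ (fk_scale c u + u') # ys) = fk_scale c (W (xs @ u # ys)) + W (xs @ u' # ys)"
      unfolding W_def by (simp add: fk.scale_sum_right sum.distrib del: sum.atMost_Suc)
  qed
  \<comment> \<open>On lists longer than K + K' one of the two degrees exceeds its bound. If it is
    the degree of \<open>h\<close>, the value 0 enters \<open>g\<close> as an argument and
    multilinearity gives 0.\<close>
  have circ_zero: "circ_G m n g h ys = 0"
    if "multilinear g" "\<And>xs. K < length xs \<Longrightarrow> g xs = 0" "\<And>xs. K' < length xs \<Longrightarrow> h xs = 0"
      "K + K' < length ys" for K K' m n g h and ys :: "'a fk3 list"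
  proof (cases "length ys + 1 = m + n \<and> \<not> K < m")
    case True
    then have n: "K' < n" using that(4) by linarith
    have "g (take i ys @ h (take n (drop i ys)) # drop (i + n) ys) = 0" if "i < m" for i
    proof -
      have "length (take n (drop i ys)) = n" using True \<open>i < m\<close> by auto
      then have "h (take n (drop i ys)) = 0" using n by (intro \<open>\<And>xs. K' < length xs \<Longrightarrow> h xs = 0\<close>) simp
      then show ?thesis using multilinear_zero_arg[OF \<open>multilinear g\<close>] by simp
    qed
    then show ?thesis by (simp add: circ_G_def)
  next
    case False
    have "g (take i ys @ h (take n (drop i ys)) # drop (i + n) ys) = 0"
      if "i < m" "length ys + 1 = m + n" for i
      using that False by (intro \<open>\<And>xs. K < length xs \<Longrightarrow> g xs = 0\<close>) simp
    then show ?thesis by (simp add: circ_G_def)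
  qed
  have "W ys = 0" if "M + N < length ys" for ys
    using circ_zero[OF mx M N] circ_zero[OF mz N M] that by (simp add: W_def U_def add.commute)
  then have W: "W \<in> cochains" using mW by (auto simp: cochains_def)
  have "gerstenhaber (hoch_diff x) z = hoch_diff W"
  proof
    fix as :: "'a fk3 list"
    let ?L = "length as"
    have "gerstenhaber (hoch_diff x) z as
        = bracket_G 0 (?L + 1) (hoch_diff x) z as
          + (\<Sum>m\<le>?L. bracket_G (m + 1) (?L - m) (hoch_diff x) z as)"
      by (simp add: gerstenhaber_def sum.atMost_Suc_shift del: sum.atMost_Suc)
    \<comment> \<open>A coboundary has no component of degree 0, so this summand vanishes.\<close>
    also have "bracket_G 0 (?L + 1) (hoch_diff x) z as = 0"
      using multilinear_zero_arg[OF mz]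
      by (simp add: bracket_G_def circ_G_zero_degree) (simp add: circ_G_def hoch_diff_Nil mx)
    also have "(\<Sum>m\<le>?L. bracket_G (m + 1) (?L - m) (hoch_diff x) z as)
        = (\<Sum>m\<le>?L. hoch_diff (U ?L m) as)"
    proof (intro sum.cong refl)
      fix m assume "m \<in> {..?L}"
      then have "?L = m + (?L - m)" by simp
      from bracket_G_hoch_diff[OF mx mz dz this]
      show "bracket_G (m + 1) (?L - m) (hoch_diff x) z as = hoch_diff (U ?L m) as"
        by (simp only: U_def hoch_diff_comb)
    qed
    also have "\<dots> = hoch_diff (\<lambda>ys. \<Sum>m\<le>?L. U ?L m ys) as"
      by (simp add: hoch_diff_sum)
    also have "\<dots> = hoch_diff W as"
    proof (rule hoch_diff_cong[OF multilinear_sum[OF mU] mW])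
      fix ys :: "'a fk3 list" assume "length ys + 1 = ?L"
      then show "(\<Sum>m\<le>?L. U ?L m ys) = W ys" unfolding W_def by metis
    qed
    finally show "gerstenhaber (hoch_diff x) z as = hoch_diff W as" by simp
  qed
  then show ?thesis using W by (simp add: coboundaries_def)
qed

text \<open>Only the splitting with degree 1 for \<open>D\<close> survives: in every other one
  \<open>D\<close> is evaluated on a list of the wrong length, which gives 0 or inserts the argument
  0. In degree 1 the sign of the bracket is +1, whence plain antisymmetry.\<close>

lemma gerstenhaber_deg_1:
  assumes D: "D \<in> cochains_deg 1" and h: "multilinear h"
  shows "gerstenhaber D h xs = circ_G 1 (length xs) D h xs - circ_G (length xs) 1 h D xs"
    "gerstenhaber h D xs = - gerstenhaber D h xs"
proof -
  have mD: "multilinear D" and D0: "\<And>xs. length xs \<noteq> 1 \<Longrightarrow> D xs = 0"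
    using D by (auto simp: cochains_deg_def)
  have c1: "circ_G m n D h xs = 0" if "m \<noteq> 1" for m n
    using that by (auto simp: circ_G_def D0)
  have c2: "circ_G n m h D xs = 0" if "m \<noteq> 1" for m n
  proof (cases "length xs + 1 = n + m")
    case True
    have "h (take i xs @ D (take m (drop i xs)) # drop (i + m) xs) = 0" if "i < n" for i
    proof -
      have "length (take m (drop i xs)) = m" using True \<open>i < n\<close> by auto
      then show ?thesis using \<open>m \<noteq> 1\<close> D0 multilinear_zero_arg[OF h] by simp
    qed
    then show ?thesis by (simp add: circ_G_def)
  qed (simp add: circ_G_def)
  have 1: "(\<Sum>m\<le>length xs + 1. bracket_G m (length xs + 1 - m) D h xs) = bracket_G 1 (length xs) D h xs"
    by (subst sum.mono_neutral_right[of _ "{1}"]) (auto simp: bracket_G_def c1 c2)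
  show *: "gerstenhaber D h xs = circ_G 1 (length xs) D h xs - circ_G (length xs) 1 h D xs"
    unfolding gerstenhaber_def 1 by (simp add: bracket_G_def)
  have "(\<Sum>m\<le>length xs + 1. bracket_G m (length xs + 1 - m) h D xs) = bracket_G (length xs) 1 h D xs"
  proof (subst sum.mono_neutral_right[of _ "{length xs}"])
    have "length xs + 1 - m \<noteq> 1" if "m \<le> length xs + 1" "m \<noteq> length xs" for m using that by linarith
    then show "\<forall>m\<in>{..length xs + 1} - {length xs}. bracket_G m (length xs + 1 - m) h D xs = 0"
      by (auto simp: bracket_G_def c1 c2)
  qed auto
  then show "gerstenhaber h D xs = - gerstenhaber D h xs"
    unfolding * unfolding gerstenhaber_def by (simp add: bracket_G_def)
qed


section \<open>Derivations acting on bar tensors\<close>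

fun der_list :: "'k::field cochain \<Rightarrow> 'k fk3 list \<Rightarrow> 'k bar" where
  "der_list D [] = 0"
| "der_list D (x # xs) = bar_pure (D [x] # xs) + bar_cons x (der_list D xs)"

lemma mlin_der_list:
  assumes "multilinear D" shows "mlin bar_scale (der_list D)"
  unfolding mlin_def
proof (intro allI)
  have D: "D [fk_scale c x + x'] = fk_scale c (D [x]) + D [x']" for c x x'
    using mlinD'[of fk_scale D c x x' "[]"] assms by (simp add: multilinear_iff_mlin)
  fix xs ys c and x x' :: "'a fk3"
  show "der_list D (xs @ (fk_scale c x + x') # ys)
      = bar_scale c (der_list D (xs @ x # ys)) + der_list D (xs @ x' # ys)"
  proof (induction xs)
    case Nil
    show ?case
      by (simp add: D linearD[OF linear_pure_head] bar_cons_left_simps bar.scale_right_distrib)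
  next
    case (Cons z zs)
    then show ?case
      using mlinD[OF mlin_bar_pure, of "D [z] # zs" c x x' ys] by (simp add: bar.scale_right_distrib)
  qed
qed

definition bar_der :: "'k::field cochain \<Rightarrow> 'k bar \<Rightarrow> 'k bar"
  where "bar_der D = bar_ext bar_scale (der_list D)"

lemma linear_bar_der: "multilinear D \<Longrightarrow> Vector_Spaces.linear bar_scale bar_scale (bar_der D)"
  unfolding bar_der_def by (intro linear_bar_ext vector_space_bar_scale mlin_der_list)

lemma bar_der_pure: "multilinear D \<Longrightarrow> bar_der D (bar_pure xs) = der_list D xs"
  by (simp add: bar_der_def bar_ext_pure vector_space_bar_scale mlin_der_list)

lemma bar_der_cons:
  assumes D: "multilinear D"
  shows "bar_der D (bar_cons x t) = bar_cons (D [x]) t + bar_cons x (bar_der D t)"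
  by (rule bar_linear_eqI[OF linear_comp[OF linear_bar_cons linear_bar_der[OF D]]
        linear_plus[OF linear_bar_cons linear_comp[OF linear_bar_der[OF D] linear_bar_cons]]])
    (simp add: bar_der_pure D)

lemma der_list_len: "der_list D xs \<in> bar_len (length xs)"
  by (induction xs) (auto intro!: bar_len_closed bar_cons_len)

lemma bar_der_len: "multilinear D \<Longrightarrow> t \<in> bar_len n \<Longrightarrow> bar_der D t \<in> bar_len n"
  by (rule bar_len_linear_image[OF linear_bar_der]) (use der_list_len in \<open>auto simp: bar_der_pure\<close>)

lemma derivation_cocycle:
  assumes "multilinear D" "hoch_diff D = 0"
  shows "D [x * y] = D [x] * y + x * D [y]"
  using hoch_diff_list[OF assms(1), of "[x, y]"] fun_cong[OF assms(2), of "[x, y]"]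
  by (simp add: algebra_simps)

lemma bar_der_lact:
  assumes D: "multilinear D" "hoch_diff D = 0" and t: "t \<in> bar_len (Suc n)"
  shows "bar_der D (bar_lact x t) = bar_lact (D [x]) t + bar_lact x (bar_der D t)"
  by (rule bar_len_linear_eq[OF linear_comp[OF linear_bar_lact linear_bar_der[OF D(1)]]
        linear_plus[OF linear_bar_lact linear_comp[OF linear_bar_der[OF D(1)] linear_bar_lact]] _ t])
    (auto simp: bar_der_pure D length_Suc_conv derivation_cocycle[OF D] bar_cons_left_simps
      linearD[OF linear_pure_head] algebra_simps)

lemma der_list_append: "der_list D (xs @ [y * z])
    = bar_ract (der_list D (xs @ [y])) z + bar_pure (xs @ [y * D [z]])"
  if "\<And>x y. D [x * y] = D [x] * y + x * D [y]"
proof (induction xs)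
  case Nil
  show ?case by (simp add: that linearD[OF linear_pure_head])
next
  case (Cons x xs)
  have "der_list D (xs @ [y]) \<in> bar_len (Suc (length xs))"
    using der_list_len[of D "xs @ [y]"] by simp
  from bar_ract_cons[OF this] Cons show ?case
    using bar_ract_pure[of "D [x] # xs" y z] by simp
qed

lemma bar_der_ract:
  assumes D: "multilinear D" "hoch_diff D = 0" and t: "t \<in> bar_len (Suc n)"
  shows "bar_der D (bar_ract t x) = bar_ract t (D [x]) + bar_ract (bar_der D t) x"
proof (rule bar_len_linear_eq[OF linear_comp[OF linear_bar_ract linear_bar_der[OF D(1)]]
        linear_plus[OF linear_bar_ract linear_comp[OF linear_bar_der[OF D(1)] linear_bar_ract]] _ t])
  fix xs :: "'a fk3 list" assume "length xs = Suc n"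
  then obtain ys y where "xs = ys @ [y]" by (cases xs rule: rev_cases) auto
  then show "bar_der D (bar_ract (bar_pure xs) x)
      = bar_ract (bar_pure xs) (D [x]) + bar_ract (bar_der D (bar_pure xs)) x"
    using der_list_append[of D ys y x] derivation_cocycle[OF D] by (simp add: bar_der_pure D)
qed

text \<open>Merging two neighbouring factors commutes with the sum over all factors by the Leibniz
  rule.\<close>

lemma bar_der_diff:
  assumes D: "multilinear D" "hoch_diff D = 0"
  shows "bar_diff (bar_der D t) = bar_der D (bar_diff t)"
proof (rule bar_linear_eqI[OF linear_comp[OF linear_bar_der[OF D(1)] linear_bar_diff]
      linear_comp[OF linear_bar_diff linear_bar_der[OF D(1)]]])
  note simps = bar_der_pure[OF D(1)] linearD[OF linear_bar_der[OF D(1)]]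
  fix xs
  show "bar_diff (bar_der D (bar_pure xs)) = bar_der D (bar_diff (bar_pure xs))"
  proof (induction xs rule: diff_list.induct)
    case (1 x y ys)
    have len: "bar_der D (bar_pure (y # ys)) \<in> bar_len (Suc (length ys))"
      by (rule bar_der_len[OF D(1)]) simp
    have "bar_diff (bar_der D (bar_pure (x # y # ys)))
        = bar_diff (bar_pure (D [x] # y # ys)) + bar_diff (bar_cons x (bar_der D (bar_pure (y # ys))))"
      by (simp add: simps)
    also have "bar_diff (bar_cons x (bar_der D (bar_pure (y # ys))))
        = bar_lact x (bar_der D (bar_pure (y # ys))) - bar_cons x (bar_der D (bar_diff (bar_pure (y # ys))))"
      using bar_diff_cons[OF len, of x] 1 by simp
    finally show ?case
      by (simp add: simps bar_der_cons[OF D(1)] derivation_cocycle[OF D] bar_cons_left_simps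
          linearD[OF linear_pure_head])
  qed (simp_all add: simps)
qed

lemma der_list_sum:
  "der_list D xs = (\<Sum>i<length xs. bar_pure (take i xs @ D [xs ! i] # drop (Suc i) xs))"
  by (induction xs) (simp_all add: sum.lessThan_Suc_shift del: sum.lessThan_Suc)

lemma cochains_deg_subset: "cochains_deg n \<subseteq> cochains"
  unfolding cochains_def cochains_deg_def by (auto intro!: exI[of _ n])

lemma gerstenhaber_derivation:
  assumes D: "D \<in> cochains_deg 1" and h: "multilinear h"
  shows "gerstenhaber D h xs = D [h xs] - (\<Sum>i<length xs. h (take i xs @ D [xs ! i] # drop (Suc i) xs))"
proof -
  have "take (Suc 0) (drop i xs) = [xs ! i]" if "i < length xs" for i
    using that by (metis Cons_nth_drop_Suc One_nat_def take0 take_Suc_Cons)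
  then show ?thesis
    unfolding gerstenhaber_deg_1(1)[OF D h] by (simp add: circ_G_def)
qed

lemma multilinear_gerstenhaber_derivation:
  assumes D: "D \<in> cochains_deg 1" and h: "multilinear h"
  shows "multilinear (gerstenhaber D h)"
  unfolding multilinear_iff_mlin mlin_def
proof (intro allI)
  fix xs ys c and x x' :: "'a fk3"
  have "multilinear D" using D by (simp add: cochains_deg_def)
  then have "multilinear (circ_G 1 L D h)" "multilinear (circ_G L 1 h D)" for L
    using h by (simp_all add: multilinear_circ_G)
  then have "mlin fk_scale (circ_G 1 L D h)" "mlin fk_scale (circ_G L 1 h D)" for L
    by (simp_all add: multilinear_iff_mlin)
  note m = mlinD[OF this(1), of _ xs c x x' ys] mlinD[OF this(2), of _ xs c x x' ys]
  show "gerstenhaber D h (xs @ (fk_scale c x + x') # ys)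
      = fk_scale c (gerstenhaber D h (xs @ x # ys)) + gerstenhaber D h (xs @ x' # ys)"
    unfolding gerstenhaber_deg_1(1)[OF D h] m by (simp add: m fk.scale_right_diff_distrib del: One_nat_def)
qed

text \<open>In D(x h(w) y) the Leibniz terms at the outer coefficients cancel against the outer
  terms of \<open>bar_der\<close>; what remains is the bracket evaluated on w, between x and
  y.\<close>

lemma cochain_ext_gerstenhaber:
  assumes D: "D \<in> cochains_deg 1" "hoch_diff D = 0" and h: "multilinear h" and t: "t \<in> bar_len (Suc (Suc n))"
  shows "cochain_ext (gerstenhaber D h) t = D [cochain_ext h t] - cochain_ext h (bar_der D t)"
proof -
  have mD: "multilinear D" using D by (simp add: cochains_deg_def)
  have linD: "Vector_Spaces.linear fk_scale fk_scale (\<lambda>x. D [x])"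
    using mD[unfolded multilinear_def, rule_format, of "[]" "[]"] by simp
  show ?thesis
  proof (rule bar_len_linear_eq[OF linear_cochain_ext[OF multilinear_gerstenhaber_derivation[OF D(1) h]]
        linear_minus[OF linear_comp[OF linear_cochain_ext[OF h] linD]
          linear_comp[OF linear_bar_der[OF mD] linear_cochain_ext[OF h]]] _ t])
    fix xs :: "'a fk3 list" assume "length xs = Suc (Suc n)"
    then obtain x ys y where xs: "xs = x # ys @ [y]"
      by (metis length_Suc_conv length_Suc_conv_rev)
    have d: "der_list D (ys @ [y]) = (\<Sum>i<length ys. bar_pure (take i ys @ D [ys ! i] # drop (Suc i) ys @ [y]))
        + bar_pure (ys @ [D [y]])"
      unfolding der_list_sum by (simp add: nth_append)
    have "cochain_ext h (bar_der D (bar_pure xs))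
        = D [x] * (h ys * y) + x * ((\<Sum>i<length ys. h (take i ys @ D [ys ! i] # drop (Suc i) ys) * y) + h ys * D [y])"
      by (simp add: xs bar_der_pure[OF mD] linearD[OF linear_cochain_ext[OF h]] cochain_ext_pure[OF h]
          cochain_ext_cons[OF h] cochain_right_pure[OF h] d linearD[OF linear_cochain_right[OF h]] butlast_append
          distrib_left sum_distrib_left)
    then show "cochain_ext (gerstenhaber D h) (bar_pure xs)
        = D [cochain_ext h (bar_pure xs)] - cochain_ext h (bar_der D (bar_pure xs))"
      by (simp add: xs cochain_ext_pure cochain_right_pure multilinear_gerstenhaber_derivation[OF D(1) h] h
          gerstenhaber_derivation[OF D(1) h] derivation_cocycle[OF mD D(2)] algebra_simps sum_distrib_left sum_distrib_right mult.assoc)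
  qed
qed

lemma gerstenhaber_cocycle:
  assumes D: "D \<in> cochains_deg 1" "hoch_diff D = 0" and h: "h \<in> cocycles"
  shows "gerstenhaber D h \<in> cocycles"
proof -
  have mh: "multilinear h" and dh: "hoch_diff h = 0" using h by (auto simp: cocycles_def cochains_def)
  have mD: "multilinear D" using D by (simp add: cochains_deg_def)
  note mg = multilinear_gerstenhaber_derivation[OF D(1) mh]
  obtain N where N: "\<And>xs. N < length xs \<Longrightarrow> h xs = 0" using h by (auto simp: cocycles_def cochains_def)
  have "gerstenhaber D h xs = 0" if "N < length xs" for xs
    using that multilinear_zero_arg[OF mD, of "[]" "[]"] by (simp add: gerstenhaber_derivation[OF D(1) mh] N)
  then have c: "gerstenhaber D h \<in> cochains" using mg by (auto simp: cochains_def)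
  have "hoch_diff (gerstenhaber D h) = 0"
  proof
    fix as :: "'a fk3 list"
    show "hoch_diff (gerstenhaber D h) as = 0 as"
    proof (cases as)
      case Nil
      then show ?thesis by (simp add: hoch_diff_Nil mg)
    next
      case (Cons u us)
      let ?Y = "bar_pure (1 # as @ [1])"
      have Y: "?Y \<in> bar_len (Suc (Suc (Suc (length us))))" by (simp add: Cons)
      have ext0: "cochain_ext h (bar_diff t) = 0" if "t \<in> bar_len (Suc (Suc n))" for t n
        using cochain_ext_hoch_diff[OF mh that] dh by (simp add: cochain_ext_zero)
      show ?thesis
        using cochain_ext_gerstenhaber[OF D mh bar_diff_len[OF Y]] ext0[OF Y]
          ext0[OF bar_der_len[OF mD Y]] bar_der_diff[OF mD D(2), of ?Y] multilinear_zero_arg[OF mD, of "[]" "[]"]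
        by (simp add: hoch_diff_def)
    qed
  qed
  then show ?thesis using c by (simp add: cocycles_def)
qed

section \<open>Passage of the bracket to cohomology classes\<close>

lemma bracket_G_add:
  assumes "multilinear g" "multilinear g'" "multilinear h"
  shows "bracket_G m n (g + g') h xs = bracket_G m n g h xs + bracket_G m n g' h xs"
    "bracket_G m n h (g + g') xs = bracket_G m n h g xs + bracket_G m n h g' xs"
proof -
  have h: "h (us @ (u + v) # vs) = h (us @ u # vs) + h (us @ v # vs)" for us u v vs
    using mlinD[of fk_scale h us 1 u v vs] assms(3) by (simp add: multilinear_iff_mlin)
  show "bracket_G m n (g + g') h xs = bracket_G m n g h xs + bracket_G m n g' h xs"
    "bracket_G m n h (g + g') xs = bracket_G m n h g xs + bracket_G m n h g' xs"
    by (auto simp: bracket_G_def circ_G_def h distrib_left sum.distrib)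
qed

lemma gerstenhaber_add:
  assumes "multilinear g" "multilinear g'" "multilinear h"
  shows "gerstenhaber (g + g') h = gerstenhaber g h + gerstenhaber g' h"
    "gerstenhaber h (g + g') = gerstenhaber h g + gerstenhaber h g'"
  by (auto simp: gerstenhaber_def fun_eq_iff bracket_G_add[OF assms] sum.distrib)

lemma cohomologous_refl: "g \<in> cocycles \<Longrightarrow> cohomologous g g"
  by (simp add: cohomologous_def coboundaries_closed)

lemma coboundaries_cocycles: "g \<in> coboundaries \<Longrightarrow> g \<in> cocycles"
proof -
  assume "g \<in> coboundaries"
  then obtain x where x: "x \<in> cochains" "g = hoch_diff x" by (auto simp: coboundaries_def)
  then have mx: "multilinear x" and "\<exists>N. \<forall>xs. N < length xs \<longrightarrow> x xs = 0" by (auto simp: cochains_def)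
  then obtain N where N: "\<And>xs. N < length xs \<Longrightarrow> x xs = 0" by auto
  have "hoch_diff x xs = 0" if "Suc N < length xs" for xs
  proof -
    have "hoch_diff x xs = hoch_diff 0 xs"
      by (rule hoch_diff_cong) (use mx cochains_zero N that in \<open>auto simp: cochains_def\<close>)
    then show ?thesis by (simp add: hoch_diff_zero)
  qed
  then have "g \<in> cochains" using multilinear_hoch_diff[OF mx] x by (auto simp: cochains_def)
  then show ?thesis using hoch_diff_hoch_diff[OF mx] x by (simp add: cocycles_def)
qed

lemma abs_hh_eq_iff: "g \<in> cocycles \<Longrightarrow> h \<in> cocycles \<Longrightarrow> abs_hh g = abs_hh h \<longleftrightarrow> g - h \<in> coboundaries"
  using Quotient3_rel[OF Quotient3_hh, of g h] by (auto simp: cohomologous_def coboundaries_closed)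

text \<open>Brackets and products of classes are defined on chosen representatives, so each
  computation starts from the given cocycle plus an unknown coboundary.\<close>

lemma rep_abs_hh:
  assumes "g \<in> cocycles" shows "\<exists>x\<in>cochains. rep_hh (abs_hh g) = g + hoch_diff x"
proof -
  have "cohomologous (rep_hh (abs_hh g)) g"
    using rep_abs_rsp_left[OF Quotient3_hh, of g g] cohomologous_refl[OF assms] by simp
  then obtain x where "x \<in> cochains" "rep_hh (abs_hh g) - g = hoch_diff x"
    by (auto simp: cohomologous_def coboundaries_def)
  then show ?thesis by (metis add.commute diff_add_cancel)
qed

text \<open>Bilinear expansion leaves two error terms, each containing a coboundary. The one with
  the coboundary in the second slot is turned around by antisymmetry in degree 1, so that
  \<open>gerstenhaber_hoch_diff\<close> disposes of both.\<close>

lemma hh_bracket_derivation: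
  assumes D: "D \<in> cochains_deg 1" "hoch_diff D = 0" and h: "h \<in> cocycles"
  shows "hh_bracket (abs_hh D) (abs_hh h) = abs_hh (gerstenhaber D h)"
proof -
  have Dc: "D \<in> cocycles" using D cochains_deg_subset by (auto simp: cocycles_def)
  obtain x where x: "x \<in> cochains" "rep_hh (abs_hh D) = D + hoch_diff x" using rep_abs_hh[OF Dc] by auto
  obtain y where y: "y \<in> cochains" "rep_hh (abs_hh h) = h + hoch_diff y" using rep_abs_hh[OF h] by auto
  let ?h = "h + hoch_diff y"
  have m: "multilinear D" "multilinear h" "multilinear (hoch_diff x)" "multilinear (hoch_diff y)"
    using Dc h x y by (auto simp: cocycles_def cochains_def multilinear_hoch_diff)
  have dy: "hoch_diff y \<in> cocycles" using y by (auto intro: coboundaries_cocycles simp: coboundaries_def)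
  then have h': "?h \<in> cocycles" using h by (simp add: cocycles_closed)
  then have mh': "multilinear ?h" by (simp add: cocycles_def cochains_def)
  have "gerstenhaber D (hoch_diff y) = - gerstenhaber (hoch_diff y) D"
    using gerstenhaber_deg_1(2)[OF D(1) m(4)] by (simp add: fun_eq_iff)
  then have 1: "gerstenhaber D (hoch_diff y) \<in> coboundaries"
    using gerstenhaber_hoch_diff[OF y(1) Dc] by (simp add: coboundaries_closed)
  have 2: "gerstenhaber (hoch_diff x) ?h \<in> coboundaries" by (rule gerstenhaber_hoch_diff[OF x(1) h'])
  have "gerstenhaber (D + hoch_diff x) ?h
      = gerstenhaber D h + (gerstenhaber D (hoch_diff y) + gerstenhaber (hoch_diff x) ?h)"
    by (simp add: gerstenhaber_add(1)[OF m(1,3) mh'] gerstenhaber_add(2)[OF m(2,4,1)] add.assoc)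
  moreover have "gerstenhaber D (hoch_diff y) + gerstenhaber (hoch_diff x) ?h \<in> coboundaries"
    using 1 2 by (rule coboundaries_closed)
  ultimately show ?thesis
    unfolding hh_bracket_def x(2) y(2)
    by (subst abs_hh_eq_iff) (auto intro: gerstenhaber_cocycle D h coboundaries_cocycles cocycles_closed)
qed

section \<open>Cup products: Leibniz rule and passage to classes\<close>

lemma bar_insert_zero: "bar_insert k 0 t = 0"
proof (rule bar_linear_eqI[OF linear_bar_insert linear_zero[OF vector_space_bar_scale vector_space_bar_scale]])
  show m: "multilinear (0 :: 'a cochain)" using cochains_zero by (simp add: cochains_def)
  fix xs :: "'a fk3 list"
  have "bar_pure (0 # ys) = 0" for ys :: "'a fk3 list" by (rule linearD(4)[OF linear_pure_head])
  then have "insert_list k 0 xs = 0" by (induction xs) (auto simp: head_list_def)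
  then show "bar_insert k 0 (bar_pure xs) = 0" using m by (simp add: bar_op_pure)
qed

lemma bar_head_zero: "bar_head k 0 t = 0"
proof (rule bar_linear_eqI[OF linear_bar_head linear_zero[OF vector_space_bar_scale vector_space_bar_scale]])
  show m: "multilinear (0 :: 'a cochain)" using cochains_zero by (simp add: cochains_def)
  fix xs :: "'a fk3 list"
  have "bar_pure (0 # ys) = 0" for ys :: "'a fk3 list" by (rule linearD(4)[OF linear_pure_head])
  then show "bar_head k 0 (bar_pure xs) = 0" using m by (simp add: bar_op_pure head_list_def)
qed

text \<open>For a cocycle, \<open>bar_insert_diff\<close> exhibits \<open>bar_tail\<close> as a
  graded commutator of the differential with an insertion; d d = 0 does the rest.\<close>

lemma bar_tail_diff:
  assumes z: "multilinear z" "hoch_diff z = 0" and t: "t \<in> bar_len k"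
  shows "bar_diff (bar_tail n z t) = bar_scale ((- 1) ^ n) (bar_tail n z (bar_diff t))"
proof -
  have tail: "bar_tail n z u = bar_diff (bar_insert n z u)
      - bar_scale ((- 1) ^ (n + 1)) (bar_insert n z (bar_diff u))" for u
    using bar_insert_diff[OF z(1), of n u] by (simp add: z(2) bar_insert_zero)
  have 1: "bar_diff (bar_diff (bar_insert n z t)) = 0"
    by (rule bar_diff_diff[OF bar_insert_len[OF z(1) t]])
  have "bar_diff (bar_insert n z (bar_diff t)) = bar_tail n z (bar_diff t)"
    using tail[of "bar_diff t"] bar_diff_diff[OF t] by (simp add: linearD[OF linear_bar_insert[OF z(1)]])
  then show ?thesis unfolding tail[of t] by (simp add: 1)
qed

definition cup_deg :: "nat \<Rightarrow> nat \<Rightarrow> 'k::field cochain \<Rightarrow> 'k cochain \<Rightarrow> 'k cochain"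
  where "cup_deg m n g h = (\<lambda>xs. if length xs = m + n then g (take m xs) * h (drop m xs) else 0)"

lemma multilinear_cup_deg:
  assumes "multilinear g" "multilinear h" shows "multilinear (cup_deg m n g h)"
proof -
  have "mlin fk_scale (\<lambda>xs. g (take m xs) * h (drop m xs))"
    unfolding mlin_def
  proof (intro allI)
    fix xs ys c and x x' :: "'a fk3"
    have g: "mlin fk_scale g" and h: "mlin fk_scale h" using assms by (simp_all add: multilinear_iff_mlin)
    show "g (take m (xs @ (fk_scale c x + x') # ys)) * h (drop m (xs @ (fk_scale c x + x') # ys)) =
       fk_scale c (g (take m (xs @ x # ys)) * h (drop m (xs @ x # ys))) +
       g (take m (xs @ x' # ys)) * h (drop m (xs @ x' # ys))"
    proof (cases "m \<le> length xs")
      case True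
      then show ?thesis
        by (simp add: take_drop_mid mlinD[OF h] distrib_left fk_scale_mult)
    next
      case False
      then have m: "m > length xs" by simp
      show ?thesis
        unfolding take_drop_mid(2)[OF m, THEN conjunct1] take_drop_mid(2)[OF m, THEN conjunct2]
        by (simp add: mlinD[OF g] distrib_right fk_scale_mult)
    qed
  qed
  then show ?thesis
    unfolding cup_deg_def multilinear_iff_mlin
    using mlin_length[OF vector_space_fk_scale, where P = "\<lambda>l. l = m + n"] by blast
qed

text \<open>The product read in two ways: first \<open>h\<close> on the end of the tensor, then
  \<open>g\<close> on what is left; or first \<open>g\<close> on the beginning, its value becoming
  the left coefficient for \<open>h\<close>. Each reading serves one half of the Leibniz
  rule.\<close>

lemma cochain_right_cup_deg:
  assumes "multilinear g" "multilinear h" "t \<in> bar_len (Suc (m + n))"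
  shows "cochain_right (cup_deg m n g h) t
      = fk_scale ((- 1) ^ (n * m)) (cochain_right g (bar_tail n h t))"
    "cochain_right (cup_deg m n g h) t = cochain_ext h (bar_head m g t)"
proof -
  note c = linear_cochain_right[OF multilinear_cup_deg[OF assms(1,2)]]
  have "cochain_right (cup_deg m n g h) (bar_pure xs)
      = fk_scale ((- 1) ^ (n * m)) (cochain_right g (bar_tail n h (bar_pure xs))) \<and>
      cochain_right (cup_deg m n g h) (bar_pure xs) = cochain_ext h (bar_head m g (bar_pure xs))"
    if len: "length xs = Suc (m + n)" for xs
  proof -
    obtain ys y where xs: "xs = ys @ [y]" using len by (cases xs rule: rev_cases) auto
    with len have "length ys = m + n" by simp
    moreover from this have "cup_deg m n g h ys = g (take m ys) * h (drop m ys)"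
      by (simp add: cup_deg_def)
    ultimately show ?thesis
      by (cases "even (n * m)")
        (simp_all add: xs cochain_right_pure multilinear_cup_deg assms bar_op_pure tail_list_append
          linearD[OF linear_cochain_right[OF assms(1)]] head_list_def cochain_ext_pure mult.assoc)
  qed
  then show "cochain_right (cup_deg m n g h) t
      = fk_scale ((- 1) ^ (n * m)) (cochain_right g (bar_tail n h t))"
    "cochain_right (cup_deg m n g h) t = cochain_ext h (bar_head m g t)"
    using bar_len_linear_eq[OF c linear_smult[OF linear_comp[OF linear_bar_tail[OF assms(2)]
            linear_cochain_right[OF assms(1)]]] _ assms(3)]
      bar_len_linear_eq[OF c linear_comp[OF linear_bar_head[OF assms(1)]
            linear_cochain_ext[OF assms(2)]] _ assms(3)]
    by blast+
qed

text \<open>Each half of the Leibniz rule is proved with the other factor a cocycle: for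
  \<open>h\<close> a cocycle, \<open>bar_tail\<close> commutes with d up to sign; for
  \<open>g\<close> a cocycle, the coboundary term of \<open>bar_head_hoch_diff\<close> drops
  out.\<close>

lemma hoch_diff_cup_deg:
  assumes m: "multilinear g" "multilinear h" and len: "length as = Suc (m + n)"
  shows "hoch_diff h = 0 \<Longrightarrow> hoch_diff (cup_deg m n g h) as = cup_deg (Suc m) n (hoch_diff g) h as"
    "hoch_diff g = 0 \<Longrightarrow>
      hoch_diff (cup_deg m n g h) as = fk_scale ((- 1) ^ m) (cup_deg m (Suc n) g (hoch_diff h) as)"
proof -
  let ?A = "bar_pure (as @ [1])"
  have A: "?A \<in> bar_len (Suc (Suc (m + n)))" using len by simp
  obtain a us where as: "as = a # us" using len by (cases as) auto
  let ?Y = "bar_pure (us @ [1])"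
  have Y: "?Y \<in> bar_len (Suc (m + n))" using len by (simp add: as)
  have dA: "bar_diff ?A \<in> bar_len (Suc (m + n))" by (rule bar_diff_len[OF A])
  have 1: "hoch_diff (cup_deg m n g h) as = a * cochain_right (cup_deg m n g h) ?Y
      - cochain_right (cup_deg m n g h) (bar_diff ?A)"
    by (simp add: hoch_diff_conv multilinear_cup_deg m as cochain_ext_pure)
  {
    assume dh: "hoch_diff h = 0"
    note m' = multilinear_hoch_diff[OF m(1)]
    have tail_cons: "bar_tail n h ?A = bar_scale ((- 1) ^ n) (bar_cons a (bar_tail n h ?Y))"
      using len by (simp add: as bar_op_pure m)
    have "cup_deg (Suc m) n (hoch_diff g) h as = cochain_right (cup_deg (Suc m) n (hoch_diff g) h) ?A"
      by (simp add: cochain_right_pure multilinear_cup_deg m m')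
    also have "\<dots> = fk_scale ((- 1) ^ (n * Suc m)) (cochain_right (hoch_diff g) (bar_tail n h ?A))"
      by (rule cochain_right_cup_deg) (use m m' A in auto)
    also have "bar_tail n h ?A \<in> bar_len (Suc (Suc m))"
      using tail_list_append[of as "Suc m" n h 1] len m by (simp add: bar_op_pure bar_len_closed)
    from cochain_right_hoch_diff[OF m(1) this]
    have "cochain_right (hoch_diff g) (bar_tail n h ?A)
        = cochain_ext g (bar_tail n h ?A) - cochain_right g (bar_diff (bar_tail n h ?A))" .
    also have "\<dots> = fk_scale ((- 1) ^ n) (a * cochain_right g (bar_tail n h ?Y)
        - cochain_right g (bar_tail n h (bar_diff ?A)))"
      unfolding bar_tail_diff[OF m(2) dh A] unfolding tail_cons
      by (simp add: linearD[OF linear_cochain_ext[OF m(1)]] linearD[OF linear_cochain_right[OF m(1)]]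
          cochain_ext_cons[OF m(1)] fk.scale_right_diff_distrib)
    finally show "hoch_diff (cup_deg m n g h) as = cup_deg (Suc m) n (hoch_diff g) h as"
      unfolding 1 cochain_right_cup_deg(1)[OF m Y] cochain_right_cup_deg(1)[OF m dA]
      by (cases "even n"; cases "even m") (simp_all add: algebra_simps)
  }
  {
    assume dg: "hoch_diff g = 0"
    note m' = multilinear_hoch_diff[OF m(2)]
    have key: "bar_head m g (bar_diff ?A) = bar_lact a (bar_head m g ?Y)
        + bar_scale ((- 1) ^ (m + 1)) (bar_diff (bar_head m g ?A))"
      using bar_head_hoch_diff[OF m(1), of m "us @ [1]" a] len
      by (simp add: as dg bar_head_zero algebra_simps)
    have hY: "bar_head m g ?Y \<in> bar_len (Suc (Suc n))"
      using head_list_len[of m g "us @ [1]"] len by (simp add: bar_op_pure m as)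
    have hA: "bar_head m g ?A \<in> bar_len (Suc (Suc (Suc n)))"
      using head_list_len[of m g "as @ [1]"] len by (simp add: bar_op_pure m eval_nat_numeral)
    have "cup_deg m (Suc n) g (hoch_diff h) as = cochain_right (cup_deg m (Suc n) g (hoch_diff h)) ?A"
      by (simp add: cochain_right_pure multilinear_cup_deg m m')
    also have "\<dots> = cochain_ext (hoch_diff h) (bar_head m g ?A)"
      by (rule cochain_right_cup_deg) (use m m' A in auto)
    also have "\<dots> = cochain_ext h (bar_diff (bar_head m g ?A))"
      by (rule cochain_ext_hoch_diff[OF m(2) hA])
    finally show "hoch_diff (cup_deg m n g h) as
        = fk_scale ((- 1) ^ m) (cup_deg m (Suc n) g (hoch_diff h) as)"
      unfolding 1 cochain_right_cup_deg(2)[OF m Y] cochain_right_cup_deg(2)[OF m dA] key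
      by (simp add: cochain_ext_lact[OF m(2) hY] linearD[OF linear_cochain_ext[OF m(2)]])
  }
qed

lemma cup_conv: "cup g h xs = (\<Sum>m\<le>length xs. cup_deg m (length xs - m) g h xs)"
  by (simp add: cup_def cup_deg_def)

lemma multilinear_by_length:
  assumes "\<And>L. multilinear (G L)" shows "multilinear (\<lambda>xs. G (length xs) xs)"
  unfolding multilinear_iff_mlin mlin_def
  using mlinD[OF assms[unfolded multilinear_iff_mlin]] by simp

lemma multilinear_cup: "multilinear g \<Longrightarrow> multilinear h \<Longrightarrow> multilinear (cup g h)"
  using multilinear_by_length[of "\<lambda>L xs. \<Sum>m\<le>L. cup_deg m (L - m) g h xs"]
  by (simp add: cup_conv[abs_def] multilinear_sum multilinear_cup_deg)

lemma cup_cochains: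
  assumes "g \<in> cochains" "h \<in> cochains" shows "cup g h \<in> cochains"
proof -
  obtain M N where M: "\<And>xs. M < length xs \<Longrightarrow> g xs = 0" and N: "\<And>xs. N < length xs \<Longrightarrow> h xs = 0"
    using assms by (auto simp: cochains_def)
  have "g (take m xs) * h (drop m xs) = 0" if "M + N < length xs" "m \<le> length xs" for m and xs :: "'a fk3 list"
    using that M[of "take m xs"] N[of "drop m xs"] by (cases "M < m") auto
  then have "\<forall>xs. M + N < length xs \<longrightarrow> cup g h xs = 0" by (simp add: cup_def)
  then show ?thesis using assms multilinear_cup by (auto simp: cochains_def)
qed

lemma cup_hoch_diff_left:
  assumes x: "multilinear x" and z: "multilinear z" "hoch_diff z = 0"
  shows "cup (hoch_diff x) z = hoch_diff (cup x z)"
proof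
  fix as :: "'a fk3 list"
  note mx' = multilinear_hoch_diff[OF x]
  show "cup (hoch_diff x) z as = hoch_diff (cup x z) as"
  proof (cases as)
    case Nil
    then show ?thesis by (simp add: hoch_diff_Nil multilinear_cup x z) (simp add: cup_def hoch_diff_Nil x)
  next
    case (Cons u us)
    let ?L = "length us"
    have "cup (hoch_diff x) z as = (\<Sum>m\<le>?L. cup_deg (Suc m) (?L - m) (hoch_diff x) z as)"
      unfolding cup_conv by (simp add: Cons sum.atMost_Suc_shift cup_deg_def hoch_diff_Nil x del: sum.atMost_Suc)
    also have "\<dots> = (\<Sum>m\<le>?L. hoch_diff (cup_deg m (?L - m) x z) as)"
      by (intro sum.cong refl hoch_diff_cup_deg(1)[symmetric] x z) (simp add: Cons)
    also have "\<dots> = hoch_diff (\<lambda>xs. \<Sum>m\<le>?L. cup_deg m (?L - m) x z xs) as"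
      by (simp add: hoch_diff_sum)
    also have "\<dots> = hoch_diff (cup x z) as"
      by (rule hoch_diff_cong) (auto intro!: multilinear_sum multilinear_cup_deg multilinear_cup x z
          simp: cup_conv Cons)
    finally show ?thesis .
  qed
qed

lemma cup_hoch_diff_right:
  assumes z: "z \<in> cocycles" and y: "y \<in> cochains"
  shows "cup z (hoch_diff y) \<in> coboundaries"
proof -
  have mz: "multilinear z" and dz: "hoch_diff z = 0" and my: "multilinear y"
    using z y by (auto simp: cocycles_def cochains_def)
  \<comment> \<open>The sign (-1)^m of the Leibniz rule depends on the degree of the component of
    \<open>z\<close>, so it is absorbed into \<open>z\<close> length by length; then
    \<open>cup z' y\<close> is a primitive.\<close>
  define z' where "z' = (\<lambda>xs. fk_scale ((- 1) ^ length xs) (z xs))"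
  have mz': "multilinear z'"
    unfolding z'_def
    by (rule multilinear_by_length[where G = "\<lambda>L xs. fk_scale ((- 1) ^ L) (z xs)"])
      (use mz mlin_scale[OF vector_space_fk_scale] in \<open>auto simp: multilinear_iff_mlin\<close>)
  have cz': "z' \<in> cochains" using z mz' by (auto simp: cocycles_def cochains_def z'_def)
  have cd: "cup_deg m n z' h = (\<lambda>xs. fk_scale ((- 1) ^ m) (cup_deg m n z h xs))" for m n h
    by (auto simp: cup_deg_def z'_def fk_scale_mult fun_eq_iff)
  have "cup z (hoch_diff y) = hoch_diff (cup z' y)"
  proof
    fix as :: "'a fk3 list"
    show "cup z (hoch_diff y) as = hoch_diff (cup z' y) as"
    proof (cases as)
      case Nil
      then show ?thesis by (simp add: hoch_diff_Nil multilinear_cup my mz') (simp add: cup_def hoch_diff_Nil my)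
    next
      case (Cons u us)
      let ?L = "length us"
      \<comment> \<open>The summand in which \<open>z\<close> takes the whole list meets the
        coboundary of \<open>y\<close> in degree 0, which is 0.\<close>
      have "cup_deg (Suc ?L) 0 z (hoch_diff y) as = 0"
        by (simp add: Cons cup_deg_def hoch_diff_Nil my)
      then have "cup z (hoch_diff y) as = (\<Sum>m\<le>?L. cup_deg m (Suc (?L - m)) z (hoch_diff y) as)"
        unfolding cup_conv by (simp add: Cons Suc_diff_le)
      also have "\<dots> = (\<Sum>m\<le>?L. hoch_diff (cup_deg m (?L - m) z' y) as)"
      proof (intro sum.cong refl)
        fix m assume m: "m \<in> {..?L}"
        have "hoch_diff (cup_deg m (?L - m) z' y) as
            = fk_scale ((- 1) ^ m) (hoch_diff (cup_deg m (?L - m) z y) as)"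
          unfolding cd hoch_diff_scale ..
        also have "hoch_diff (cup_deg m (?L - m) z y) as
            = fk_scale ((- 1) ^ m) (cup_deg m (Suc (?L - m)) z (hoch_diff y) as)"
          by (rule hoch_diff_cup_deg(2)[OF mz my _ dz]) (use m in \<open>simp add: Cons\<close>)
        finally show "cup_deg m (Suc (?L - m)) z (hoch_diff y) as = hoch_diff (cup_deg m (?L - m) z' y) as"
          by (cases "even m") simp_all
      qed
      also have "\<dots> = hoch_diff (\<lambda>xs. \<Sum>m\<le>?L. cup_deg m (?L - m) z' y xs) as"
        by (simp add: hoch_diff_sum)
      also have "\<dots> = hoch_diff (cup z' y) as"
        by (rule hoch_diff_cong) (auto intro!: multilinear_sum multilinear_cup_deg multilinear_cup my mz'
            simp: cup_conv Cons)
      finally show ?thesis .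
    qed
  qed
  then show ?thesis using cup_cochains[OF cz' y] by (simp add: coboundaries_def)
qed

lemma cup_add: "cup (g + g') h = cup g h + cup g' h" "cup g (h + h') = cup g h + cup g h'"
  by (simp_all add: cup_def fun_eq_iff distrib_left distrib_right sum.distrib)

lemma cup_cocycles:
  assumes "g \<in> cocycles" "h \<in> cocycles" shows "cup g h \<in> cocycles"
  using assms cup_cochains[of g h] cup_hoch_diff_left[of g h]
  by (auto simp: cocycles_def cochains_def cup_def[abs_def] zero_fun_def)

lemma hh_times_abs:
  assumes g: "g \<in> cocycles" and h: "h \<in> cocycles"
  shows "abs_hh g * abs_hh h = abs_hh (cup g h)"
proof -
  obtain x where x: "x \<in> cochains" "rep_hh (abs_hh g) = g + hoch_diff x" using rep_abs_hh[OF g] by auto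
  obtain y where y: "y \<in> cochains" "rep_hh (abs_hh h) = h + hoch_diff y" using rep_abs_hh[OF h] by auto
  let ?h = "h + hoch_diff y"
  have h': "?h \<in> cocycles"
    using h y coboundaries_cocycles by (auto intro!: cocycles_closed simp: coboundaries_def)
  have 1: "cup g (hoch_diff y) \<in> coboundaries" by (rule cup_hoch_diff_right[OF g y(1)])
  have "cup (hoch_diff x) ?h = hoch_diff (cup x ?h)"
    using x h' by (intro cup_hoch_diff_left) (auto simp: cocycles_def cochains_def)
  moreover have "cup x ?h \<in> cochains" using x h' by (auto intro: cup_cochains simp: cocycles_def)
  ultimately have 2: "cup (hoch_diff x) ?h \<in> coboundaries" by (simp add: coboundaries_def)
  have "cup (g + hoch_diff x) ?h = cup g h + (cup g (hoch_diff y) + cup (hoch_diff x) ?h)"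
    by (simp only: cup_add(1) cup_add(2)[of g] add.assoc)
  moreover have "cup g (hoch_diff y) + cup (hoch_diff x) ?h \<in> coboundaries"
    using 1 2 by (rule coboundaries_closed)
  ultimately show ?thesis
    unfolding times_hh_def x(2) y(2)
    by (subst abs_hh_eq_iff) (auto intro: cup_cocycles g h coboundaries_cocycles cocycles_closed)
qed

section \<open>Bimodules and comparison of resolutions\<close>

text \<open>The unit and associativity laws, and linearity in the acting element, are required on
  the carrier only: the ambient type holds all degrees at once, and on the bar type the actions have
  no meaning on, say, the empty tensor. Linearity in the module argument holds on the whole
  type.\<close>

locale bimodule =
  fixes s :: "'k::field \<Rightarrow> 'm::ab_group_add \<Rightarrow> 'm" and M :: "('k, 'm) bimod"
  assumes vs: "vector_space s"
    and subspace: "module.subspace s (bcarrier M)"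
    and lact_linear: "Vector_Spaces.linear s s (lact M x)"
    and ract_linear: "Vector_Spaces.linear s s (\<lambda>m. ract M m x)"
    and lact_closed: "m \<in> bcarrier M \<Longrightarrow> lact M x m \<in> bcarrier M"
    and ract_closed: "m \<in> bcarrier M \<Longrightarrow> ract M m x \<in> bcarrier M"
    and lact_left: "m \<in> bcarrier M \<Longrightarrow> Vector_Spaces.linear fk_scale s (\<lambda>x. lact M x m)"
    and ract_right: "m \<in> bcarrier M \<Longrightarrow> Vector_Spaces.linear fk_scale s (\<lambda>x. ract M m x)"
    and lact_assoc: "m \<in> bcarrier M \<Longrightarrow> lact M x (lact M y m) = lact M (x * y) m"
    and ract_assoc: "m \<in> bcarrier M \<Longrightarrow> ract M (ract M m x) y = ract M m (x * y)"
    and lact_ract: "m \<in> bcarrier M \<Longrightarrow> lact M x (ract M m y) = ract M (lact M x m) y"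
    and lact_one: "m \<in> bcarrier M \<Longrightarrow> lact M 1 m = m"
    and ract_one: "m \<in> bcarrier M \<Longrightarrow> ract M m 1 = m"
begin

sublocale V: vector_space s by (rule vs)

lemmas carrier_closed =
  V.subspace_0[OF subspace] V.subspace_add[OF subspace] V.subspace_diff[OF subspace]
  V.subspace_neg[OF subspace] V.subspace_scale[OF subspace] V.subspace_sum[OF subspace]
  lact_closed ract_closed

lemmas act_simps = linearD[OF lact_linear] linearD[OF ract_linear]

lemma scale_conv_lact: "m \<in> bcarrier M \<Longrightarrow> s c m = lact M (fk_scale c 1) m"
  by (simp add: linearD[OF lact_left] lact_one)

end

lemma bimodule_fk: "bimodule fk_scale fk_bimod"
proof -
  have "fk.subspace UNIV" by (rule fk.subspace_UNIV)
  then show ?thesis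
    by unfold_locales (auto simp: fk_bimod_def linear_fk_iff algebra_simps fk_scale_mult
        fk.vector_space_assms)
qed

lemma bimod_homD:
  assumes "\<phi> \<in> bimod_hom M N"
  shows "m \<in> bcarrier M \<Longrightarrow> \<phi> m \<in> bcarrier N"
    "m \<in> bcarrier M \<Longrightarrow> m' \<in> bcarrier M \<Longrightarrow> \<phi> (m + m') = \<phi> m + \<phi> m'"
    "m \<in> bcarrier M \<Longrightarrow> \<phi> (lact M x m) = lact N x (\<phi> m)"
    "m \<in> bcarrier M \<Longrightarrow> \<phi> (ract M m x) = ract N (\<phi> m) x"
  using assms by (auto simp: bimod_hom_def)

lemma bimod_homI:
  assumes "\<And>m. m \<in> bcarrier M \<Longrightarrow> \<phi> m \<in> bcarrier N"
    "\<And>m m'. m \<in> bcarrier M \<Longrightarrow> m' \<in> bcarrier M \<Longrightarrow> \<phi> (m + m') = \<phi> m + \<phi> m'"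
    "\<And>m x. m \<in> bcarrier M \<Longrightarrow> \<phi> (lact M x m) = lact N x (\<phi> m)"
    "\<And>m x. m \<in> bcarrier M \<Longrightarrow> \<phi> (ract M m x) = ract N (\<phi> m) x"
  shows "\<phi> \<in> bimod_hom M N"
  using assms by (auto simp: bimod_hom_def)

text \<open>\<open>bimod_hom\<close> asks for additivity only; scalars act as multiples of 1 in
  FK(3), so compatibility with them follows from the left action.\<close>

lemma bimod_hom_more:
  assumes "bimodule s M" "bimodule s' N" "\<phi> \<in> bimod_hom M N"
  shows "m \<in> bcarrier M \<Longrightarrow> \<phi> (s c m) = s' c (\<phi> m)" "\<phi> 0 = 0"
    "m \<in> bcarrier M \<Longrightarrow> \<phi> (- m) = - \<phi> m"
    "m \<in> bcarrier M \<Longrightarrow> m' \<in> bcarrier M \<Longrightarrow> \<phi> (m - m') = \<phi> m - \<phi> m'"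
proof -
  interpret M: bimodule s M by fact
  interpret N: bimodule s' N by fact
  note h = bimod_homD[OF assms(3)]
  show "\<phi> (s c m) = s' c (\<phi> m)" if "m \<in> bcarrier M" for c m
    using that by (simp add: M.scale_conv_lact N.scale_conv_lact h)
  show z: "\<phi> 0 = 0" using h(2)[of 0 0] M.carrier_closed(1) by simp
  show neg: "\<phi> (- m) = - \<phi> m" if "m \<in> bcarrier M" for m
    using h(2)[OF that M.carrier_closed(4)[OF that]] z by (simp add: eq_neg_iff_add_eq_0 add.commute)
  show "\<phi> (m - m') = \<phi> m - \<phi> m'" if "m \<in> bcarrier M" "m' \<in> bcarrier M"
    using h(2)[OF that(1) M.carrier_closed(4)[OF that(2)]] neg[OF that(2)] by simp
qed

lemma bimod_hom_comp:
  "\<phi> \<in> bimod_hom M N \<Longrightarrow> \<psi> \<in> bimod_hom N L \<Longrightarrow> (\<lambda>m. \<psi> (\<phi> m)) \<in> bimod_hom M L"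
  by (simp add: bimod_hom_def)

lemma bimod_hom_id: "(\<lambda>m. m) \<in> bimod_hom M M"
  by (simp add: bimod_hom_def)

lemma bimod_hom_zero: "bimodule s' N \<Longrightarrow> (\<lambda>m. 0) \<in> bimod_hom M N"
  by (auto intro!: bimod_homI simp: bimodule.carrier_closed bimodule.act_simps)

lemma bimod_hom_diff:
  assumes "bimodule s' N" "\<phi> \<in> bimod_hom M N" "\<psi> \<in> bimod_hom M N"
  shows "(\<lambda>m. \<phi> m - \<psi> m) \<in> bimod_hom M N"
  by (rule bimod_homI) (auto simp: bimod_homD[OF assms(2)] bimod_homD[OF assms(3)]
      bimodule.carrier_closed[OF assms(1)] bimodule.act_simps[OF assms(1)])

lemma bimod_hom_add:
  assumes "bimodule s' N" "\<phi> \<in> bimod_hom M N" "\<psi> \<in> bimod_hom M N"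
  shows "(\<lambda>m. \<phi> m + \<psi> m) \<in> bimod_hom M N"
  by (rule bimod_homI) (auto simp: bimod_homD[OF assms(2)] bimod_homD[OF assms(3)]
      bimodule.carrier_closed[OF assms(1)] bimodule.act_simps[OF assms(1)])

lemma bimod_hom_scale:
  assumes "bimodule s' N" "\<phi> \<in> bimod_hom M N"
  shows "(\<lambda>m. s' c (\<phi> m)) \<in> bimod_hom M N"
proof -
  interpret bimodule s' N by fact
  show ?thesis
    by (rule bimod_homI) (auto simp: bimod_homD[OF assms(2)] carrier_closed act_simps V.scale_right_distrib)
qed

definition bimod_generated :: "('k \<Rightarrow> 'm \<Rightarrow> 'm) \<Rightarrow> ('k::field, 'm::ab_group_add) bimod \<Rightarrow> 'm set \<Rightarrow> bool"
  where "bimod_generated s M G \<longleftrightarrow> G \<subseteq> bcarrier M \<and>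
    bcarrier M \<subseteq> module.span s {lact M x (ract M g y) |x g y. g \<in> G}"

lemma bimod_hom_eq_generated:
  assumes M: "bimodule s M" and N: "bimodule s' N" and G: "bimod_generated s M G"
    and hom: "\<phi> \<in> bimod_hom M N" "\<psi> \<in> bimod_hom M N"
    and eq: "\<And>g. g \<in> G \<Longrightarrow> \<phi> g = \<psi> g" and m: "m \<in> bcarrier M"
  shows "\<phi> m = \<psi> m"
proof -
  interpret M: bimodule s M by fact
  note hs = bimod_homD[OF hom(1)] bimod_homD[OF hom(2)]
    bimod_hom_more[OF M N hom(1)] bimod_hom_more[OF M N hom(2)]
  have "m \<in> module.span s {lact M x (ract M g y) |x g y. g \<in> G}"
    using m G by (auto simp: bimod_generated_def)
  then have "m \<in> bcarrier M \<and> \<phi> m = \<psi> m"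
  proof (induction rule: M.V.span_induct_alt)
    case base
    show ?case by (simp add: M.carrier_closed hs)
  next
    case (step c u v)
    then obtain x g y where u: "u = lact M x (ract M g y)" "g \<in> G" by auto
    with G have "g \<in> bcarrier M" by (auto simp: bimod_generated_def)
    with step u show ?case by (simp add: M.carrier_closed hs eq)
  qed
  then show ?thesis by simp
qed

text \<open>The lifting property for one fixed pair \<open>N'\<close>, \<open>N\<close>: a
  quantification over all bimodules would range over types. The map \<open>e\<close> need only cover
  the image of \<open>T\<close>.\<close>

definition projective_for ::
    "('k::field, 'm::plus) bimod \<Rightarrow> ('k, 'n::plus) bimod \<Rightarrow> ('k, 'l::plus) bimod \<Rightarrow> bool"
  where "projective_for M N' N \<longleftrightarrow> (\<forall>e\<in>bimod_hom N' N. \<forall>T\<in>bimod_hom M N.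
    (\<forall>m\<in>bcarrier M. T m \<in> e ` bcarrier N') \<longrightarrow>
    (\<exists>S\<in>bimod_hom M N'. \<forall>m\<in>bcarrier M. e (S m) = T m))"

lemma projective_forD:
  "projective_for M N' N \<Longrightarrow> e \<in> bimod_hom N' N \<Longrightarrow> T \<in> bimod_hom M N \<Longrightarrow>
    (\<And>m. m \<in> bcarrier M \<Longrightarrow> T m \<in> e ` bcarrier N') \<Longrightarrow>
    (\<And>S. S \<in> bimod_hom M N' \<Longrightarrow> (\<And>m. m \<in> bcarrier M \<Longrightarrow> e (S m) = T m) \<Longrightarrow> thesis) \<Longrightarrow> thesis"
  unfolding projective_for_def by blast

text \<open>Preimages are chosen on the generators and extended freely; the extension is a lift
  because morphisms that agree on generators agree.\<close>

lemma projective_for_free: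
  fixes gen :: "'i \<Rightarrow> 'm::ab_group_add"
  assumes M: "bimodule s M" and N: "bimodule s' N" and G: "bimod_generated s M (gen ` I)"
    and ext: "\<And>v. (\<And>i. i \<in> I \<Longrightarrow> v i \<in> bcarrier N') \<Longrightarrow> \<exists>\<phi>\<in>bimod_hom M N'. \<forall>i\<in>I. \<phi> (gen i) = v i"
  shows "projective_for M N' N"
  unfolding projective_for_def
proof (intro ballI impI)
  fix e T assume e: "e \<in> bimod_hom N' N" and T: "T \<in> bimod_hom M N"
    and img: "\<forall>m\<in>bcarrier M. T m \<in> e ` bcarrier N'"
  have "\<exists>v\<in>bcarrier N'. e v = T (gen i)" if "i \<in> I" for i
    using img G that by (force simp: bimod_generated_def)
  then obtain v where v: "\<And>i. i \<in> I \<Longrightarrow> v i \<in> bcarrier N'" "\<And>i. i \<in> I \<Longrightarrow> e (v i) = T (gen i)"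
    by metis
  have "\<exists>\<phi>\<in>bimod_hom M N'. \<forall>i\<in>I. \<phi> (gen i) = v i" by (rule ext) (rule v(1))
  then obtain S where S: "S \<in> bimod_hom M N'" "\<And>i. i \<in> I \<Longrightarrow> S (gen i) = v i" by auto
  have "e (S m) = T m" if "m \<in> bcarrier M" for m
    by (rule bimod_hom_eq_generated[OF M N G bimod_hom_comp[OF S(1) e] T _ that])
      (auto simp: S v)
  then show "\<exists>S\<in>bimod_hom M N'. \<forall>m\<in>bcarrier M. e (S m) = T m" using S by blast
qed

text \<open>Here \<open>d n\<close> leads from degree n+1 to degree n, one off from
  \<open>res_diff f n\<close>.\<close>

locale bimod_complex =
  fixes s :: "'k::field \<Rightarrow> 'm::ab_group_add \<Rightarrow> 'm" and M :: "nat \<Rightarrow> ('k, 'm) bimod"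
    and d :: "nat \<Rightarrow> 'm \<Rightarrow> 'm"
  assumes bimod: "bimodule s (M n)" and d_hom: "d n \<in> bimod_hom (M (Suc n)) (M n)"
    and d_d: "m \<in> bcarrier (M (Suc (Suc n))) \<Longrightarrow> d n (d (Suc n) m) = 0"

locale resolution = bimod_complex s M d
  for s :: "'k::field \<Rightarrow> 'm::ab_group_add \<Rightarrow> 'm" and M d +
  fixes aug :: "'m \<Rightarrow> 'k fk3"
  assumes aug_hom: "aug \<in> bimod_hom (M 0) fk_bimod"
    and aug_d: "m \<in> bcarrier (M (Suc 0)) \<Longrightarrow> aug (d 0 m) = 0"
    and exact: "m \<in> bcarrier (M (Suc n)) \<Longrightarrow> d n m = 0 \<Longrightarrow> m \<in> d (Suc n) ` bcarrier (M (Suc (Suc n)))"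
    and exact_0: "m \<in> bcarrier (M 0) \<Longrightarrow> aug m = 0 \<Longrightarrow> m \<in> d 0 ` bcarrier (M (Suc 0))"
    and aug_surj: "aug ` bcarrier (M 0) = UNIV"

text \<open>A lift of a cocycle of degree n starts at P_n, so the homotopies for cup products run
  over the shifted complex.\<close>

lemma bimod_complex_shift: "bimod_complex s M d \<Longrightarrow> bimod_complex s (\<lambda>k. M (n + k)) (\<lambda>k. d (n + k))"
  by (simp add: bimod_complex_def)

text \<open>A null homotopy, in the form in which it is used: composed with a cocycle.\<close>

lemma null_homotopic:
  fixes M :: "nat \<Rightarrow> ('k::field, 'm::ab_group_add) bimod" and N :: "nat \<Rightarrow> ('k, 'n::ab_group_add) bimod"
  assumes M: "bimod_complex s M d" and N: "resolution s' N d' aug"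
    and proj: "\<And>k. k < m \<Longrightarrow> projective_for (M k) (N (Suc k)) (N k)"
    and T: "\<And>k. k \<le> m \<Longrightarrow> T k \<in> bimod_hom (M k) (N k)"
    and chain: "\<And>k x. k < m \<Longrightarrow> x \<in> bcarrier (M (Suc k)) \<Longrightarrow> d' k (T (Suc k) x) = T k (d k x)"
    and aug: "\<And>x. x \<in> bcarrier (M 0) \<Longrightarrow> aug (T 0 x) = 0"
    and g: "g \<in> bimod_hom (N m) fk_bimod" "\<And>y. y \<in> bcarrier (N (Suc m)) \<Longrightarrow> g (d' m y) = 0"
  shows "m = 0 \<Longrightarrow> x \<in> bcarrier (M 0) \<Longrightarrow> g (T 0 x) = 0"
    "m = Suc l \<Longrightarrow> \<exists>\<psi>\<in>bimod_hom (M l) fk_bimod. \<forall>x\<in>bcarrier (M m). g (T m x) = \<psi> (d l x)"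
proof -
  interpret M: bimod_complex s M d by fact
  interpret N: resolution s' N d' aug by fact
  note dM = bimod_homD[OF M.d_hom] and dN = bimod_hom_more[OF N.bimod N.bimod N.d_hom]
  have N_diff: "a - b \<in> bcarrier (N k)" if "a \<in> bcarrier (N k)" "b \<in> bcarrier (N k)" for a b k
    using bimodule.carrier_closed(3)[OF N.bimod] that .
  show "g (T 0 x) = 0" if "m = 0" "x \<in> bcarrier (M 0)" for x
    using N.exact_0[OF bimod_homD(1)[OF T[of 0]]] that aug g by (metis imageE le0)
  \<comment> \<open>Only the current homotopy map is kept: that T - h d takes values in cycles is
    exactly what the next lifting, or the final evaluation by \<open>g\<close>, requires.\<close>
  have step: "\<exists>h\<in>bimod_hom (M k) (N (Suc k)).
      \<forall>x\<in>bcarrier (M (Suc k)). d' k (T (Suc k) x - h (d k x)) = 0" if "k < m" for k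
    using that
  proof (induction k)
    case 0
    have 1: "T 0 x \<in> d' 0 ` bcarrier (N (Suc 0))" if "x \<in> bcarrier (M 0)" for x
      using that bimod_homD(1)[OF T[of 0]] aug by (intro N.exact_0) auto
    from projective_forD[OF proj[OF 0] N.d_hom T[of 0, simplified] 1]
    obtain h where h: "h \<in> bimod_hom (M 0) (N (Suc 0))" "\<And>m. m \<in> bcarrier (M 0) \<Longrightarrow> d' 0 (h m) = T 0 m"
      by blast
    have "d' 0 (T (Suc 0) x - h (d 0 x)) = 0" if "x \<in> bcarrier (M (Suc 0))" for x
      using that 0 chain[OF 0 that] h bimod_homD(1)[OF T[of "Suc 0"]] bimod_homD(1)[OF h(1)]
      by (subst dN(4)) (auto simp: dM)
    then show ?case using h by blast
  next
    case (Suc k)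
    then obtain h where h: "h \<in> bimod_hom (M k) (N (Suc k))"
      "\<And>x. x \<in> bcarrier (M (Suc k)) \<Longrightarrow> d' k (T (Suc k) x - h (d k x)) = 0" by auto
    let ?S = "\<lambda>x. T (Suc k) x - h (d k x)"
    have S: "?S \<in> bimod_hom (M (Suc k)) (N (Suc k))"
      by (intro bimod_hom_diff[OF N.bimod] T bimod_hom_comp[OF M.d_hom h(1)]) (use Suc in simp)
    have 1: "?S x \<in> d' (Suc k) ` bcarrier (N (Suc (Suc k)))" if "x \<in> bcarrier (M (Suc k))" for x
      by (rule N.exact[OF bimod_homD(1)[OF S that] h(2)[OF that]])
    from projective_forD[OF proj[OF Suc.prems] N.d_hom S 1]
    obtain h' where h': "h' \<in> bimod_hom (M (Suc k)) (N (Suc (Suc k)))"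
      "\<And>m. m \<in> bcarrier (M (Suc k)) \<Longrightarrow> d' (Suc k) (h' m) = ?S m" by blast
    have "d' (Suc k) (T (Suc (Suc k)) x - h' (d (Suc k) x)) = 0"
      if x: "x \<in> bcarrier (M (Suc (Suc k)))" for x
    proof -
      have "d' (Suc k) (T (Suc (Suc k)) x - h' (d (Suc k) x)) = T (Suc k) (d (Suc k) x) - ?S (d (Suc k) x)"
        using x Suc.prems bimod_homD(1)[OF T[of "Suc (Suc k)"]] bimod_homD(1)[OF h'(1)]
        by (subst dN(4)) (auto simp: dM chain h')
      also have "\<dots> = 0"
        using x by (simp add: M.d_d bimod_hom_more(2)[OF M.bimod N.bimod h(1)])
      finally show ?thesis .
    qed
    then show ?case using h' by blast
  qed
  show "\<exists>\<psi>\<in>bimod_hom (M l) fk_bimod. \<forall>x\<in>bcarrier (M m). g (T m x) = \<psi> (d l x)" if "m = Suc l"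
  proof -
    from step[of l] that obtain h where h: "h \<in> bimod_hom (M l) (N m)"
      "\<And>x. x \<in> bcarrier (M m) \<Longrightarrow> d' l (T m x - h (d l x)) = 0" by auto
    have "g (T m x) = g (h (d l x))" if x: "x \<in> bcarrier (M m)" for x
    proof -
      have 1: "T m x \<in> bcarrier (N m)" "h (d l x) \<in> bcarrier (N m)"
        using x \<open>m = Suc l\<close> bimod_homD(1)[OF T[of m]] bimod_homD(1)[OF h(1)] by (auto simp: dM)
      then have "T m x - h (d l x) \<in> d' m ` bcarrier (N (Suc m))"
        using N.exact[of _ l] N_diff h(2)[OF x] \<open>m = Suc l\<close> by auto
      then have "g (T m x - h (d l x)) = 0" using g(2) by auto
      then show ?thesis using bimod_hom_more(4)[OF N.bimod bimodule_fk g(1) 1] by simp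
    qed
    then show ?thesis
      by (intro bexI[OF _ bimod_hom_comp[OF h(1) g(1)]]) auto
  qed
qed

lemma chain_map_exists:
  fixes M :: "nat \<Rightarrow> ('k::field, 'm::ab_group_add) bimod" and N :: "nat \<Rightarrow> ('k, 'n::ab_group_add) bimod"
  assumes M: "resolution s M d augM" and N: "resolution s' N d' aug"
    and proj: "\<And>k. projective_for (M (Suc k)) (N (Suc k)) (N k)" "projective_for (M 0) (N 0) fk_bimod"
  shows "\<exists>T. (\<forall>k. T k \<in> bimod_hom (M k) (N k)) \<and>
    (\<forall>k. \<forall>x\<in>bcarrier (M (Suc k)). d' k (T (Suc k) x) = T k (d k x)) \<and>
    (\<forall>x\<in>bcarrier (M 0). aug (T 0 x) = augM x)"
proof -
  interpret M: resolution s M d augM by fact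
  interpret N: resolution s' N d' aug by fact
  have "augM x \<in> aug ` bcarrier (N 0)" for x using N.aug_surj by simp
  from projective_forD[OF proj(2) N.aug_hom M.aug_hom this]
  obtain T0 where T0: "T0 \<in> bimod_hom (M 0) (N 0)" "\<And>m. m \<in> bcarrier (M 0) \<Longrightarrow> aug (T0 m) = augM m"
    by blast
  \<comment> \<open>A partial lift is recorded together with the fact that its composite with d
    takes values in the boundaries of the target. This invariant allows one more step and feeds
    dependent choice.\<close>
  define good where "good k T \<longleftrightarrow> T \<in> bimod_hom (M k) (N k) \<and>
    (\<forall>x\<in>bcarrier (M (Suc k)). T (d k x) \<in> d' k ` bcarrier (N (Suc k)))" for k T
  have base: "good 0 T0"
    unfolding good_def
  proof (intro conjI T0(1) ballI N.exact_0)
    fix x assume x: "x \<in> bcarrier (M (Suc 0))"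
    have dx: "d 0 x \<in> bcarrier (M 0)" by (rule bimod_homD(1)[OF M.d_hom x])
    show "T0 (d 0 x) \<in> bcarrier (N 0)" by (rule bimod_homD(1)[OF T0(1) dx])
    show "aug (T0 (d 0 x)) = 0" using T0(2)[OF dx] M.aug_d[OF x] by simp
  qed
  have step: "\<exists>T'. good (Suc k) T' \<and> (\<forall>x\<in>bcarrier (M (Suc k)). d' k (T' x) = T (d k x))"
    if "good k T" for k T
  proof -
    have T: "T \<in> bimod_hom (M k) (N k)"
      and img: "\<And>x. x \<in> bcarrier (M (Suc k)) \<Longrightarrow> T (d k x) \<in> d' k ` bcarrier (N (Suc k))"
      using that by (auto simp: good_def)
    from projective_forD[OF proj(1) N.d_hom bimod_hom_comp[OF M.d_hom T] img]
    obtain T' where T': "T' \<in> bimod_hom (M (Suc k)) (N (Suc k))"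
      "\<And>m. m \<in> bcarrier (M (Suc k)) \<Longrightarrow> d' k (T' m) = T (d k m)" by blast
    have "T' (d (Suc k) x) \<in> d' (Suc k) ` bcarrier (N (Suc (Suc k)))"
      if x: "x \<in> bcarrier (M (Suc (Suc k)))" for x
    proof (rule N.exact)
      have dx: "d (Suc k) x \<in> bcarrier (M (Suc k))" by (rule bimod_homD(1)[OF M.d_hom x])
      show "T' (d (Suc k) x) \<in> bcarrier (N (Suc k))" by (rule bimod_homD(1)[OF T'(1) dx])
      show "d' k (T' (d (Suc k) x)) = 0"
        using T'(2)[OF dx] M.d_d[OF x] bimod_hom_more(2)[OF M.bimod N.bimod T] by simp
    qed
    then show ?thesis using T' by (auto simp: good_def)
  qed
  obtain T where T: "\<And>k. good k (T k)" "\<And>k. \<forall>x\<in>bcarrier (M (Suc k)). d' k (T (Suc k) x) = T k (d k x)"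
    "T 0 = T0"
  proof -
    have "\<exists>F. \<forall>k. (good k (F k) \<and> (k = 0 \<longrightarrow> F k = T0)) \<and>
        (\<forall>x\<in>bcarrier (M (Suc k)). d' k (F (Suc k) x) = F k (d k x))"
      by (rule dependent_nat_choice) (use base step in auto)
    then show ?thesis using that by metis
  qed
  show ?thesis
    using T T0(2) by (intro exI[of _ T]) (auto simp: good_def)
qed

subsection \<open>The bar resolution\<close>

lemma bar_bimod_simps [simp]:
  "bcarrier (bar_bimod n) = bar_len (Suc (Suc n))" "lact (bar_bimod n) = bar_lact"
  "ract (bar_bimod n) = bar_ract"
  by (simp_all add: bar_bimod_def bar_len_def)

lemma bar_act_left:
  assumes "t \<in> bar_len (Suc n)"
  shows "Vector_Spaces.linear fk_scale bar_scale (\<lambda>x. bar_lact x t)"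
    "Vector_Spaces.linear fk_scale bar_scale (\<lambda>x. bar_ract t x)"
proof -
  have "bar_lact (x + y) t = bar_lact x t + bar_lact y t" for x y
    by (rule bar_len_linear_eq[OF linear_bar_lact linear_plus[OF linear_bar_lact linear_bar_lact] _ assms])
      (auto simp: length_Suc_conv distrib_right linearD[OF linear_pure_head])
  moreover have "bar_lact (fk_scale c x) t = bar_scale c (bar_lact x t)" for c x
    by (rule bar_len_linear_eq[OF linear_bar_lact linear_smult[OF linear_bar_lact] _ assms])
      (auto simp: length_Suc_conv fk_scale_mult linearD[OF linear_pure_head])
  ultimately show "Vector_Spaces.linear fk_scale bar_scale (\<lambda>x. bar_lact x t)"
    by (simp add: Vector_Spaces.linear_iff vector_space_fk_scale vector_space_bar_scale)
  have snoc: "\<exists>ys y. xs = ys @ [y]" if "length xs = Suc n" for xs :: "'a fk3 list"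
    using that by (metis length_Suc_conv_rev)
  have lin: "bar_pure (ys @ [fk_scale c x + y]) = bar_scale c (bar_pure (ys @ [x])) + bar_pure (ys @ [y])"
    for ys c and x y :: "'a fk3"
    using mlinD[OF mlin_bar_pure, of ys c x y "[]"] by simp
  have *: "bar_ract t (fk_scale c x + y) = bar_scale c (bar_ract t x) + bar_ract t y" for c x y
  proof (rule bar_len_linear_eq[OF linear_bar_ract linear_plus[OF linear_smult[OF linear_bar_ract] linear_bar_ract] _ assms])
    fix xs :: "'a fk3 list" assume "length xs = Suc n"
    from snoc[OF this] show "bar_ract (bar_pure xs) (fk_scale c x + y)
        = bar_scale c (bar_ract (bar_pure xs) x) + bar_ract (bar_pure xs) y"
      by (auto simp: distrib_left fk_scale_mult lin)
  qed
  have 0: "bar_ract t 0 = 0" using *[of 1 0 0] by simp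
  have "bar_ract t (x + y) = bar_ract t x + bar_ract t y"
    "bar_ract t (fk_scale c x) = bar_scale c (bar_ract t x)" for c x y
    using *[of 1 x y] *[of c x 0] by (simp_all add: 0)
  then show "Vector_Spaces.linear fk_scale bar_scale (\<lambda>x. bar_ract t x)"
    by (simp add: Vector_Spaces.linear_iff vector_space_fk_scale vector_space_bar_scale)
qed

lemma bar_act_assoc:
  assumes t: "t \<in> bar_len (Suc n)"
  shows "bar_lact x (bar_lact y t) = bar_lact (x * y) t"
    "bar_ract (bar_ract t x) y = bar_ract t (x * y)"
    "n \<noteq> 0 \<Longrightarrow> bar_lact x (bar_ract t y) = bar_ract (bar_lact x t) y"
    "bar_ract t 1 = t"
proof -
  show "bar_lact x (bar_lact y t) = bar_lact (x * y) t"
    by (rule bar_len_linear_eq[OF linear_comp[OF linear_bar_lact linear_bar_lact] linear_bar_lact _ t])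
      (auto simp: length_Suc_conv mult.assoc)
  have snoc: "\<exists>ys y. xs = ys @ [y] \<and> length ys = n" if "length xs = Suc n" for xs :: "'a fk3 list"
    using that by (metis length_Suc_conv_rev)
  show "bar_ract (bar_ract t x) y = bar_ract t (x * y)"
    by (rule bar_len_linear_eq[OF linear_comp[OF linear_bar_ract linear_bar_ract] linear_bar_ract _ t])
      (auto dest!: snoc simp: mult.assoc)
  show "bar_lact x (bar_ract t y) = bar_ract (bar_lact x t) y" if "n \<noteq> 0"
  proof (rule bar_len_linear_eq[OF linear_comp[OF linear_bar_ract linear_bar_lact]
        linear_comp[OF linear_bar_lact linear_bar_ract] _ t])
    fix xs :: "'a fk3 list" assume "length xs = Suc n"
    with snoc \<open>n \<noteq> 0\<close> obtain z ys u where "xs = z # ys @ [u]" by (metis append_Cons length_0_conv neq_Nil_conv)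
    then show "bar_lact x (bar_ract (bar_pure xs) y) = bar_ract (bar_lact x (bar_pure xs)) y"
      using bar_ract_pure[of "z # ys" u y] bar_ract_pure[of "(x * z) # ys" u y] by simp
  qed
  show "bar_ract t 1 = t"
    by (rule bar_len_linear_eq[OF linear_bar_ract linear_id[OF vector_space_bar_scale] _ t])
      (auto dest!: snoc)
qed

lemma bimodule_bar: "bimodule bar_scale (bar_bimod n)"
proof -
  have "bar.subspace (bar_len k)" for k
    unfolding bar_len_def by (rule bar.subspace_span)
  then show ?thesis
    by (intro bimodule.intro)
      (auto intro: vector_space_bar_scale linear_bar_lact linear_bar_ract bar_lact_len bar_ract_len
        bar_act_left bar_act_assoc bar_lact_one)
qed

lemma bar_diff_hom: "bar_diff \<in> bimod_hom (bar_bimod (Suc n)) (bar_bimod n)"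
  by (rule bimod_homI) (auto simp: bar_diff_len bar_diff_lact bar_diff_ract)

lemma mlin_prod_list: "mlin fk_scale prod_list"
  by (simp add: mlin_def algebra_simps fk_scale_mult)

lemma linear_bar_aug: "Vector_Spaces.linear bar_scale fk_scale bar_aug"
  unfolding bar_aug_def by (rule linear_bar_ext[OF vector_space_fk_scale mlin_prod_list])

lemma bar_aug_pure [simp]: "bar_aug (bar_pure xs) = prod_list xs"
  by (simp add: bar_aug_def bar_ext_pure vector_space_fk_scale mlin_prod_list)

lemma bar_aug_hom: "bar_aug \<in> bimod_hom (bar_bimod 0) fk_bimod"
proof (rule bimod_homI)
  fix t :: "'a bar" and x assume t: "t \<in> bcarrier (bar_bimod 0)"
  show "bar_aug (lact (bar_bimod 0) x t) = lact fk_bimod x (bar_aug t)"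
    by (simp add: fk_bimod_def, rule bar_len_linear_eq[OF linear_comp[OF linear_bar_lact linear_bar_aug]
        linear_comp[OF linear_bar_aug linear_fk_mult(1)] _ t[simplified]])
      (auto simp: length_Suc_conv mult.assoc)
  show "bar_aug (ract (bar_bimod 0) t x) = ract fk_bimod (bar_aug t) x"
    by (simp add: fk_bimod_def, rule bar_len_linear_eq[OF linear_comp[OF linear_bar_ract linear_bar_aug]
        linear_comp[OF linear_bar_aug linear_fk_mult(2)] _ t[simplified]])
      (auto simp: length_Suc_conv mult.assoc bar_ract_pure[of "[x]" for x, simplified])
qed (simp_all add: fk_bimod_def linearD[OF linear_bar_aug])

lemma resolution_bar:
  "resolution (bar_scale :: 'k::field \<Rightarrow> _) bar_bimod (\<lambda>n. bar_diff) bar_aug"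
proof (intro resolution.intro bimod_complex.intro resolution_axioms.intro bimodule_bar)
  show "bar_diff (bar_diff m) = 0" if "m \<in> bcarrier (bar_bimod (Suc (Suc n)))" for m :: "'k bar" and n
    using that by (auto intro: bar_diff_diff)
  show "bar_aug (bar_diff m) = 0" if "m \<in> bcarrier (bar_bimod (Suc 0))" for m :: "'k bar"
    using that bar_len_linear_eq[OF linear_comp[OF linear_bar_diff linear_bar_aug]
        linear_zero[OF vector_space_bar_scale vector_space_fk_scale], of "Suc (Suc (Suc 0))" m]
    by (force simp: length_Suc_conv linearD[OF linear_bar_aug] mult.assoc)
  show "m \<in> bar_diff ` bcarrier (bar_bimod (Suc (Suc n)))"
    if "m \<in> bcarrier (bar_bimod (Suc n))" "bar_diff m = 0" for m :: "'k bar" and n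
    using that bar_cons_len[of m _ 1] bar_contraction[of m "Suc (Suc n)"]
    by (force intro!: image_eqI[of _ _ "bar_cons 1 m"])
  show "m \<in> bar_diff ` bcarrier (bar_bimod (Suc 0))"
    if m: "m \<in> bcarrier (bar_bimod 0)" "bar_aug m = 0" for m :: "'k bar"
  proof -
    \<comment> \<open>On two factors the differential is multiplication, that is the augmentation,
      so prepending 1 also gives exactness in degree 0.\<close>
    have "bar_cons 1 (bar_diff m) = bar_cons 1 (bar_pure [bar_aug m])"
      by (rule bar_len_linear_eq[OF linear_comp[OF linear_bar_diff linear_bar_cons]
          linear_comp[OF linear_bar_aug linear_comp[OF linear_pure_head linear_bar_cons]] _ m(1)[simplified]])
        (auto simp: length_Suc_conv)
    also have "\<dots> = 0"
      using m by (simp add: linearD[OF linear_pure_head] del: bar_cons_pure)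
    finally have "bar_diff (bar_cons 1 m) = m" using m by (simp add: bar_contraction[of m "Suc 0"])
    then show ?thesis using m bar_cons_len[of m _ 1] by (force intro!: image_eqI[of _ _ "bar_cons 1 m"])
  qed
  have "x \<in> bar_aug ` bar_len (Suc (Suc 0))" for x :: "'k fk3"
    by (rule image_eqI[of _ _ "bar_pure [1, x]"]) simp_all
  then show "bar_aug ` bcarrier (bar_bimod 0) = (UNIV :: 'k fk3 set)" by auto
qed (simp_all add: bimodule_bar bar_diff_hom bar_aug_hom)

section \<open>Multilinear extension and freeness of the bar bimodules\<close>

lemma lin_comb_mem:
  assumes "vector_space s" "module.subspace s C" "\<And>i. h i \<in> C"
  shows "lin_comb s h p \<in> C"
proof -
  interpret vector_space s by fact
  show ?thesis unfolding lin_comb_def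
    by (intro subspace_sum subspace_scale assms)
qed

lemma lin_comb_fun:
  assumes "vector_space s"
  shows "lin_comb s (\<lambda>i. s c (h i) + h' i) p = s c (lin_comb s h p) + lin_comb s h' p"
proof -
  interpret vector_space s by fact
  show ?thesis
    by (simp add: lin_comb_def scale_right_distrib sum.distrib scale_sum_right mult.commute)
qed

definition coords :: "'k::field fk3 set \<Rightarrow> 'k fk3 \<Rightarrow> ('k fk3 \<Rightarrow>\<^sub>0 'k)"
  where "coords B x = Abs_poly_mapping (fk.representation B x)"

lemma lookup_coords: "Poly_Mapping.lookup (coords B x) b = fk.representation B x b"
  unfolding coords_def by (subst Abs_poly_mapping_inverse) (auto simp: fk.finite_representation)

lemma coords_simps:
  assumes "fk.independent B" "fk.span B = UNIV"
  shows "coords B (fk_scale c x + y) = free_scale c (coords B x) + coords B y"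
    "b \<in> B \<Longrightarrow> coords B b = Poly_Mapping.single b 1"
  using assms
  by (auto intro!: poly_mapping_eqI simp: lookup_coords lookup_add fk.representation_add
      fk.representation_scale fk.representation_basis lookup_single when_def)

text \<open>Induction on the number of arguments: the first one is expanded in coordinates, and each
  basis vector has its own extension for the rest. The subspace \<open>C\<close> is carried along
  because a carrier is only part of its type.\<close>

lemma multilinear_extension:
  fixes s :: "'k::field \<Rightarrow> 'm::ab_group_add \<Rightarrow> 'm"
  assumes vs: "vector_space s" and C: "module.subspace s C"
    and B: "fk.independent B" "fk.span B = UNIV"
  shows "(\<And>ws. v ws \<in> C) \<Longrightarrow> \<exists>F. mlin s F \<and> (\<forall>xs. F xs \<in> C) \<and>
    (\<forall>ws. length ws = n \<longrightarrow> set ws \<subseteq> B \<longrightarrow> F ws = v ws)"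
proof (induction n arbitrary: v)
  case 0
  interpret vector_space s by fact
  show ?case
    by (rule exI[of _ "\<lambda>xs. if xs = [] then v [] else 0"])
      (auto simp: mlin_def 0 subspace_0[OF C])
next
  case (Suc n)
  have "\<exists>F. mlin s F \<and> (\<forall>xs. F xs \<in> C) \<and> (\<forall>ws. length ws = n \<longrightarrow> set ws \<subseteq> B \<longrightarrow> F ws = v (b # ws))" for b
    by (rule Suc.IH) (rule Suc.prems)
  then obtain F where F: "\<And>b. mlin s (F b)" "\<And>b xs. F b xs \<in> C"
    "\<And>b ws. length ws = n \<Longrightarrow> set ws \<subseteq> B \<Longrightarrow> F b ws = v (b # ws)" by metis
  interpret vector_space s by fact
  define G where "G xs = (case xs of [] \<Rightarrow> 0 | x # ys \<Rightarrow> lin_comb s (\<lambda>b. F b ys) (coords B x))" for xs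
  have "mlin s G"
    unfolding mlin_def
  proof (intro allI)
    fix xs ys c x x'
    show "G (xs @ (fk_scale c x + x') # ys) = s c (G (xs @ x # ys)) + G (xs @ x' # ys)"
      by (cases xs) (simp_all add: G_def coords_simps[OF B] lin_comb_add vs lin_comb_scale
          mlinD[OF F(1)] lin_comb_fun[OF vs])
  qed
  moreover have "G xs \<in> C" for xs
    by (cases xs) (auto simp: G_def subspace_0[OF C] intro!: lin_comb_mem vs C F)
  moreover have "G ws = v ws" if "length ws = Suc n" "set ws \<subseteq> B" for ws
    using that by (auto simp: length_Suc_conv G_def coords_simps[OF B] lin_comb_single vs F)
  ultimately show ?case by blast
qed

lemma bar_free:
  fixes N :: "('k::field, 'm::ab_group_add) bimod"
  assumes N: "bimodule s N" and B: "fk.independent B" "fk.span B = UNIV"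
    and v: "\<And>ws. length ws = n \<Longrightarrow> set ws \<subseteq> B \<Longrightarrow> v ws \<in> bcarrier N"
  shows "\<exists>\<phi>\<in>bimod_hom (bar_bimod n) N.
    \<forall>ws. length ws = n \<longrightarrow> set ws \<subseteq> B \<longrightarrow> \<phi> (bar_pure (1 # ws @ [1])) = v ws"
proof -
  interpret N: bimodule s N by fact
  \<comment> \<open>Prescribed values off the basis words of length n are set to 0, so that all of
    them lie in the carrier as the extension lemma demands.\<close>
  have "\<exists>F. mlin s F \<and> (\<forall>xs. F xs \<in> bcarrier N) \<and>
      (\<forall>ws. length ws = n \<longrightarrow> set ws \<subseteq> B \<longrightarrow> F ws = (if length ws = n \<and> set ws \<subseteq> B then v ws else 0))"
    by (rule multilinear_extension[OF N.vs N.subspace B]) (auto simp: v N.carrier_closed)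
  then obtain F where F: "mlin s F" "\<And>xs. F xs \<in> bcarrier N"
    "\<And>ws. length ws = n \<Longrightarrow> set ws \<subseteq> B \<Longrightarrow> F ws = v ws" by auto
  define \<phi> where "\<phi> xs = (if length xs = Suc (Suc n)
    then lact N (hd xs) (ract N (F (butlast (tl xs))) (last xs)) else 0)" for xs
  have phi: "\<phi> (x # zs @ [y]) = lact N x (ract N (F zs) y)" if "length zs = n" for x zs y
    using that by (simp add: \<phi>_def)
  note lin = N.act_simps linearD[OF N.lact_left] linearD[OF N.ract_right] N.carrier_closed
  have "mlin s \<phi>"
    unfolding mlin_def
  proof (intro allI)
    fix xs ys c x x'
    show "\<phi> (xs @ (fk_scale c x + x') # ys) = s c (\<phi> (xs @ x # ys)) + \<phi> (xs @ x' # ys)"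
    proof (cases "length xs + length ys = Suc n")
      case False
      then show ?thesis by (simp add: \<phi>_def)
    next
      case len: True
      show ?thesis
      proof (cases xs)
        case Nil
        then obtain zs y where "ys = zs @ [y]" "length zs = n" using len by (metis add_0 length_Suc_conv_rev list.size(3))
        then show ?thesis using phi by (simp add: Nil lin F)
      next
        case (Cons u us)
        show ?thesis
        proof (cases ys rule: rev_cases)
          case Nil
          then have "length us = n" using len Cons by simp
          then show ?thesis using phi[of us] by (simp add: Cons Nil lin F)
        next
          case (snoc zs y)
          then have "length (us @ w # zs) = n" for w using len Cons by simp
          from phi[OF this] show ?thesis
            using mlinD[OF F(1), of us c x x' zs] by (simp add: Cons snoc lin F)
        qed
      qed
    qed
  qed
  note ext = bar_ext_pure[OF N.vs this] and linear = linear_bar_ext[OF N.vs this]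
  have dest: "\<exists>x zs y. xs = x # zs @ [y] \<and> length zs = n" if "length xs = Suc (Suc n)" for xs :: "'k fk3 list"
    using that by (metis length_Suc_conv length_Suc_conv_rev)
  have "bar_ext s \<phi> \<in> bimod_hom (bar_bimod n) N"
  proof (rule bimod_homI)
    fix t t' :: "'k bar" and x assume "t \<in> bcarrier (bar_bimod n)"
    then have t: "t \<in> bar_len (Suc (Suc n))" by simp
    show "bar_ext s \<phi> (t + t') = bar_ext s \<phi> t + bar_ext s \<phi> t'" by (rule linearD(1)[OF linear])
    show "bar_ext s \<phi> t \<in> bcarrier N"
      unfolding bar_ext_def by (rule lin_comb_mem[OF N.vs N.subspace]) (auto simp: \<phi>_def lin F)
    have "bar_ext s \<phi> (bar_lact x t) = lact N x (bar_ext s \<phi> t)"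
    proof (rule bar_len_linear_eq[OF linear_comp[OF linear_bar_lact linear]
          linear_comp[OF linear N.lact_linear] _ t])
      fix xs :: "'k fk3 list" assume "length xs = Suc (Suc n)"
      from dest[OF this] show "bar_ext s \<phi> (bar_lact x (bar_pure xs)) = lact N x (bar_ext s \<phi> (bar_pure xs))"
        by (auto simp: ext phi N.lact_assoc F lin)
    qed
    then show "bar_ext s \<phi> (lact (bar_bimod n) x t) = lact N x (bar_ext s \<phi> t)" by simp
    have "bar_ext s \<phi> (bar_ract t x) = ract N (bar_ext s \<phi> t) x"
    proof (rule bar_len_linear_eq[OF linear_comp[OF linear_bar_ract linear]
          linear_comp[OF linear N.ract_linear] _ t])
      fix xs :: "'k fk3 list" assume "length xs = Suc (Suc n)"
      from dest[OF this] obtain u zs y where xs: "xs = u # zs @ [y]" "length zs = n" by auto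
      have "bar_ract (bar_pure xs) x = bar_pure (u # zs @ [y * x])"
        using bar_ract_pure[of "u # zs" y x] by (simp add: xs)
      then show "bar_ext s \<phi> (bar_ract (bar_pure xs) x) = ract N (bar_ext s \<phi> (bar_pure xs)) x"
        by (simp add: ext xs phi N.ract_assoc N.lact_ract[symmetric] F lin)
    qed
    then show "bar_ext s \<phi> (ract (bar_bimod n) t x) = ract N (bar_ext s \<phi> t) x" by simp
  qed
  moreover have "bar_ext s \<phi> (bar_pure (1 # ws @ [1])) = v ws" if "length ws = n" "set ws \<subseteq> B" for ws
    using that phi[of ws] by (simp add: ext N.lact_one N.ract_one F v)
  ultimately show ?thesis by blast
qed

lemma bar_generated:
  assumes B: "fk.span B = (UNIV :: 'k::field fk3 set)"
  shows "bimod_generated bar_scale (bar_bimod n)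
    ((\<lambda>ws. bar_pure (1 # ws @ [1])) ` {ws. length ws = n \<and> set ws \<subseteq> B})"
proof -
  let ?G = "(\<lambda>ws. bar_pure (1 # ws @ [1])) ` {ws. length ws = n \<and> set ws \<subseteq> B}"
  let ?S = "{lact (bar_bimod n) x (ract (bar_bimod n) g y) |x g y. g \<in> ?G}"
  \<comment> \<open>The inner factors are expanded from left to right; \<open>us\<close> are those
    already replaced by basis elements.\<close>
  have span: "bar_pure (x # us @ zs @ [y]) \<in> bar.span ?S"
    if "set us \<subseteq> B" "length us + length zs = n" for us zs x y
    using that
  proof (induction zs arbitrary: us)
    case Nil
    have "bar_pure (x # us @ [] @ [y]) = bar_lact x (bar_ract (bar_pure (1 # us @ [1])) y)"
      using bar_ract_pure[of "1 # us" 1 y] by simp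
    also have "\<dots> \<in> ?S" using Nil by force
    finally show ?case by (rule bar.span_base)
  next
    case (Cons z zs)
    have "z \<in> fk.span B" using B by simp
    then show ?case
    proof (induction rule: fk.span_induct_alt)
      case base
      have "bar_pure (x # us @ (0 # zs) @ [y]) = 0"
        using mlinD[OF mlin_bar_pure, of "x # us" 1 0 0 "zs @ [y]"] by simp
      then show ?case by (simp add: bar.span_zero)
    next
      case (step c b w)
      have "bar_pure (x # (us @ [b]) @ zs @ [y]) \<in> bar.span ?S"
        by (rule Cons.IH) (use Cons.prems step in auto)
      then have "bar_scale c (bar_pure (x # us @ (b # zs) @ [y])) \<in> bar.span ?S"
        by (intro bar.span_scale) simp
      then show ?case
        using bar.span_add[OF _ step(2)] mlinD[OF mlin_bar_pure, of "x # us" c b w "zs @ [y]"] by simp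
    qed
  qed
  have "bar_len (Suc (Suc n)) \<subseteq> bar.span ?S"
    unfolding bar_len_def
  proof (rule bar.span_minimal[OF _ bar.subspace_span], clarify)
    fix xs :: "'k fk3 list" assume "length xs = Suc (Suc n)"
    then obtain x zs y where "xs = x # zs @ [y]" "length zs = n" by (metis length_Suc_conv length_Suc_conv_rev)
    then show "bar_pure xs \<in> bar.span ?S" using span[of "[]" zs x y] by simp
  qed
  then show ?thesis by (auto simp: bimod_generated_def)
qed

text \<open>B_n is free on the words of length n in a basis of FK(3), which is taken from a maximal
  independent set.\<close>

lemma projective_bar:
  assumes "bimodule s N" "bimodule s' N'"
  shows "projective_for (bar_bimod n) N' (N :: ('k::field, _) bimod)"
proof -
  obtain B where B: "fk.independent B" "fk.span B = (UNIV :: 'k fk3 set)"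
    using fk.maximal_independent_subset[of UNIV] by (metis top.extremum_uniqueI)
  show ?thesis
  proof (rule projective_for_free[OF bimodule_bar assms(1) bar_generated[OF B(2)]])
    fix v assume "\<And>ws. ws \<in> {ws. length ws = n \<and> set ws \<subseteq> B} \<Longrightarrow> v ws \<in> bcarrier N'"
    then have "\<exists>\<phi>\<in>bimod_hom (bar_bimod n) N'.
        \<forall>ws. length ws = n \<longrightarrow> set ws \<subseteq> B \<longrightarrow> \<phi> (bar_pure (1 # ws @ [1])) = v ws"
      by (intro bar_free[OF assms(2) B]) simp
    then show "\<exists>\<phi>\<in>bimod_hom (bar_bimod n) N'. \<forall>ws\<in>{ws. length ws = n \<and> set ws \<subseteq> B}.
        \<phi> (bar_pure (1 # ws @ [1])) = v ws" by (simp add: imp_conjL)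
  qed
qed

lemma cochain_ext_hom:
  "multilinear g \<Longrightarrow> cochain_ext g \<in> bimod_hom (bar_bimod n) fk_bimod"
  by (rule bimod_homI)
    (auto simp: fk_bimod_def linearD[OF linear_cochain_ext] cochain_ext_lact cochain_ext_ract)

text \<open>The inverse of the passage from cochains to morphisms on B_n: restriction to tensors
  1|xs|1.\<close>

lemma cochain_of_hom:
  assumes G: "G \<in> bimod_hom (bar_bimod n) fk_bimod"
  shows "\<exists>g\<in>cochains_deg n. \<forall>t\<in>bar_len (Suc (Suc n)). cochain_ext g t = G t"
proof -
  define g where "g xs = (if length xs = n then G (bar_pure (1 # xs @ [1])) else 0)" for xs
  note h = bimod_homD[OF G] bimod_hom_more[OF bimodule_bar bimodule_fk G]
  have "mlin fk_scale g"
    unfolding mlin_def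
  proof (intro allI)
    fix xs ys c and x x' :: "'a fk3"
    show "g (xs @ (fk_scale c x + x') # ys) = fk_scale c (g (xs @ x # ys)) + g (xs @ x' # ys)"
      using mlinD[OF mlin_bar_pure, of "1 # xs" c x x' "ys @ [1]"] by (auto simp: g_def h bar_len_closed)
  qed
  then have m: "multilinear g" by (simp add: multilinear_iff_mlin)
  have "cochain_ext g t = G t" if t: "t \<in> bar_len (Suc (Suc n))" for t
  proof (rule bimod_hom_eq_generated[OF bimodule_bar bimodule_fk bar_generated cochain_ext_hom[OF m] G])
    show "fk.span UNIV = (UNIV :: 'a fk3 set)" by simp
    show "t \<in> bcarrier (bar_bimod n)" using t by simp
  qed (auto simp: cochain_ext_pure m cochain_right_pure g_def)
  moreover have "g \<in> cochains_deg n" using m by (simp add: cochains_deg_def g_def)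
  ultimately show ?thesis by blast
qed

section \<open>The dual of the quadratic dual\<close>

lemma free_scale_mult:
  "free_scale c x * y = free_scale c (x * y)" "x * free_scale c y = free_scale c (x * y)"
  for x y :: "word \<Rightarrow>\<^sub>0 'k::field"
  by (simp_all add: free_scale_conv_mult free_scalar_central mult.assoc flip: mult.assoc[of x])

lemma linear_free_mult:
  "Vector_Spaces.linear free_scale free_scale (\<lambda>x. x * y)"
  "Vector_Spaces.linear free_scale free_scale (\<lambda>x. y * x)"
  for y :: "word \<Rightarrow>\<^sub>0 'k::field"
  by (simp_all add: Vector_Spaces.linear_iff vector_space_free_scale free_scale_mult
      distrib_left distrib_right)

text \<open>By linearity in each, the two multipliers of a relator may be taken to be words.\<close>

lemma linear_zero_on_ideal:
  fixes T :: "(word \<Rightarrow>\<^sub>0 'k::field) \<Rightarrow> 'v::ab_group_add"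
  assumes T: "Vector_Spaces.linear free_scale s T"
    and R: "\<And>v w r. r \<in> R \<Longrightarrow> T (Poly_Mapping.single v 1 * r * Poly_Mapping.single w 1) = 0"
    and p: "p \<in> two_sided_ideal R"
  shows "T p = 0"
  using p
proof induction
  case (gen r x y)
  have lin: "Vector_Spaces.linear free_scale s (\<lambda>x. T (x * r * y))"
    "Vector_Spaces.linear free_scale s (\<lambda>y. T (x * r * y))" for x y
    using linear_comp[OF linear_comp[OF linear_free_mult(1) linear_free_mult(1)] T]
      linear_comp[OF linear_free_mult(2) T] by auto
  have "T (Poly_Mapping.single v 1 * r * y) = 0" for v y
    by (rule linear_zero_on_span[OF lin(2) _ poly_mapping_span_single]) (auto simp: R gen)
  then show ?case
    using linear_zero_on_span[OF lin(1) _ poly_mapping_span_single, of y x] by blast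
qed (simp_all add: linearD[OF T])

fun letter_index :: "gen \<Rightarrow> int" where
  "letter_index Ga = 0" | "letter_index Gb = 1" | "letter_index Gc = 2"

fun alternating :: "gen list \<Rightarrow> int" where
  "alternating [] = 0" | "alternating (g # w) = letter_index g - alternating w"

text \<open>Under $A,B,C\mapsto$ the reflections $x\mapsto k-x$ of $\mathbb Z/3$, the alternating sum of
  the indices is the image of a word. The quadratic dual is the algebra of a monoid in which
  two words are equal iff they have the same length and image and either both or none of them are
  powers of a letter.\<close>

definition word_class :: "gen list \<Rightarrow> nat \<times> gen option \<times> int"
  where "word_class w = (length w,
    if w \<noteq> [] \<and> list_all (\<lambda>g. g = hd w) w then Some (hd w) else None, alternating w mod 3)"

lemma alternating_append: "alternating (u @ v) = alternating u + (- 1) ^ length u * alternating v"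
  by (induction u) auto

text \<open>Both words contain two distinct adjacent letters, so neither is a power of a letter; the
  alternating sums agree mod 3 because the two-letter pieces do and sit at the same place.\<close>

lemma word_class_cong:
  assumes "alternating [p, q] mod 3 = alternating [p', q'] mod 3" "p \<noteq> q" "p' \<noteq> q'"
  shows "word_class (u @ [p, q] @ v) = word_class (u @ [p', q'] @ v)"
proof -
  have "\<not> list_all (\<lambda>g. g = hd (u @ [p, q] @ v)) (u @ [p, q] @ v)"
    if "p \<noteq> q" for p q
    using that by (auto simp: list_all_iff)
  moreover have "alternating (u @ [p, q] @ v) mod 3 = alternating (u @ [p', q'] @ v) mod 3"
    using assms(1) unfolding alternating_append
    by (intro mod_add_cong mod_mult_cong refl) (auto intro: mod_add_cong)
  ultimately show ?thesis using assms(2,3) unfolding word_class_def by simp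
qed

definition words_basis :: "nat \<Rightarrow> gen list list"
  where "words_basis n =
    (if n = 0 then [[]]
     else if n = 1 then [[Ga], [Gb], [Gc]]
     else [replicate n Ga, replicate n Gb, replicate n Gc,
       replicate (n - 1) Ga @ [Gb], replicate (n - 1) Ga @ [Gc]]
       @ (if n = 2 then [] else [replicate (n - 2) Ga @ [Gb, Gb]]))"

definition basis_size :: "nat \<Rightarrow> nat"
  where "basis_size n = length (words_basis n)"

definition fkd_word :: "gen list \<Rightarrow> 'k::field fkd"
  where "fkd_word w = abs_fkd (monom w)"

lemma monom_append: "monom (u @ v) = monom u * monom v"
  by (simp add: monom_def mult_single plus_word_def)

lemma fkd_word_simps:
  "fkd_word [] = 1" "fkd_word (g # w) = fkd_gen g * fkd_word w" "fkd_word (u @ v) = fkd_word u * fkd_word v"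
proof -
  show "fkd_word [] = 1"
    by (simp add: fkd_word_def monom_def one_fkd.abs_eq flip: zero_word_def)
  show app: "fkd_word (u @ v) = fkd_word u * fkd_word v" for u v
    by (simp add: fkd_word_def monom_append times_fkd.abs_eq)
  show "fkd_word (g # w) = fkd_gen g * fkd_word w"
    using app[of "[g]" w] by (simp add: fkd_word_def fkd_gen_def)
qed

lemma fkd_word_prod: "fkd_word w = prod_list (map fkd_gen w)"
  by (induction w) (simp_all add: fkd_word_simps)

lemma linear_abs_fkd: "Vector_Spaces.linear free_scale fkd_scale abs_fkd"
  by (simp add: Vector_Spaces.linear_iff vector_space_free_scale vector_space_fkd_scale
      plus_fkd.abs_eq fkd_scale.abs_eq)

lemma fkd_span: "x \<in> module.span fkd_scale (range fkd_word)"
proof -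
  interpret L: Vector_Spaces.linear free_scale fkd_scale abs_fkd by (rule linear_abs_fkd)
  obtain p where x: "x = abs_fkd p" using Quotient3_abs_rep[OF Quotient3_fkd] by metis
  have "abs_fkd p \<in> abs_fkd ` free_span (range (\<lambda>i. Poly_Mapping.single i 1))"
    using poly_mapping_span_single by blast
  also have "\<dots> = module.span fkd_scale ((\<lambda>w. abs_fkd (Poly_Mapping.single w 1)) ` UNIV)"
    by (simp add: L.span_image[symmetric] image_image)
  also have "(UNIV :: word set) = range Word" by (metis UNIV_eq_I rangeI word.exhaust)
  finally show ?thesis by (simp add: x image_image fkd_word_def monom_def)
qed

lemma linear_dual_app: "Vector_Spaces.linear fkd_scale (*) (dual_app u)"
  using dual_app by blast

lemma fkd_dual_eqI:
  assumes "\<And>w. dual_app u (fkd_word w) = dual_app v (fkd_word w)" shows "u = v"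
proof -
  have "dual_app u x = dual_app v x" for x
    by (rule linear_eq_on_span[OF linear_dual_app linear_dual_app _ fkd_span]) (auto simp: assms)
  then show ?thesis by (metis dual_app_inverse ext)
qed

text \<open>The functional that adds up the coefficients of all words in the class of
  \<open>w\<close>. Being constant on classes it descends to the quadratic dual; such functionals
  prove the independence of the basis words.\<close>

definition dual_word :: "gen list \<Rightarrow> 'k::field fkd_dual"
  where "dual_word w = Abs_fkd_dual (\<lambda>x.
    lin_comb (*) (\<lambda>v. if word_class (letters v) = word_class w then 1 else 0) (rep_fkd x))"

text \<open>What has to be checked is that the functional kills the ideal: each relator is a
  difference of two words with distinct letters and equal alternating sum mod 3, and by
  \<open>word_class_cong\<close> this persists inside longer words.\<close>

lemma dual_app_dual_word:
  "dual_app (dual_word w) (fkd_word v) = (if word_class v = word_class w then 1 else 0)"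
proof -
  let ?h = "\<lambda>v. if word_class (letters v) = word_class w then 1 else (0::'a)"
  let ?T = "lin_comb (*) ?h"
  have T: "Vector_Spaces.linear free_scale (*) ?T" by (rule lin_comb_linear[OF vector_space_field])
  have zero: "?T p = 0" if "p \<in> two_sided_ideal fkd_relators" for p
  proof (rule linear_zero_on_ideal[OF T _ that])
    fix v v' and r :: "word \<Rightarrow>\<^sub>0 'a" assume "r \<in> fkd_relators"
    then obtain p q p' q' where r: "r = monom [p, q] - monom [p', q']" "p \<noteq> q" "p' \<noteq> q'"
      "alternating [p, q] mod 3 = alternating [p', q'] mod 3"
      by (auto simp: fkd_relators_def)
    have "?T (Poly_Mapping.single v 1 * monom [p, q] * Poly_Mapping.single v' 1) = ?h (v + Word [p, q] + v')" for p q
      by (simp add: monom_def mult_single lin_comb_single vector_space_field)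
    moreover have "?h (v + Word [p, q] + v') = ?h (v + Word [p', q'] + v')"
      using word_class_cong[OF r(4,2,3), of "letters v" "letters v'"] by (simp add: plus_word_def)
    ultimately show "?T (Poly_Mapping.single v 1 * r * Poly_Mapping.single v' 1) = 0"
      by (simp add: r(1) algebra_simps linearD[OF T])
  qed
  have abs: "?T (rep_fkd (abs_fkd p)) = ?T p" for p
  proof -
    have "rep_fkd (abs_fkd p) - p \<in> two_sided_ideal fkd_relators"
      using rep_abs_rsp_left[OF Quotient3_fkd, of p p] by (simp add: two_sided_ideal.zero)
    from zero[OF this] show ?thesis by (simp add: linearD[OF T])
  qed
  have "Vector_Spaces.linear fkd_scale (*) (\<lambda>x. ?T (rep_fkd x))"
    unfolding linear_fkd_functional_iff
  proof (intro conjI allI)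
    fix x y :: "'a fkd" and c
    obtain p q where x: "x = abs_fkd p" "y = abs_fkd q" using Quotient3_abs_rep[OF Quotient3_fkd] by metis
    have "x + y = abs_fkd (p + q)" "fkd_scale c x = abs_fkd (free_scale c p)"
      by (simp_all add: x plus_fkd.abs_eq fkd_scale.abs_eq)
    then show "?T (rep_fkd (x + y)) = ?T (rep_fkd x) + ?T (rep_fkd y)"
      "?T (rep_fkd (fkd_scale c x)) = c * ?T (rep_fkd x)"
      by (simp_all add: x abs linearD[OF T])
  qed
  then have "dual_app (dual_word w) (fkd_word v) = ?T (rep_fkd (fkd_word v))"
    unfolding dual_word_def by (subst Abs_fkd_dual_inverse) simp_all
  also have "\<dots> = (if word_class v = word_class w then 1 else 0)"
    unfolding fkd_word_def abs by (simp add: monom_def lin_comb_single vector_space_field)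
  finally show ?thesis .
qed

lemma fkd_component_word: "length w = n \<Longrightarrow> fkd_word w \<in> fkd_component n"
proof -
  interpret vector_space fkd_scale by (rule vector_space_fkd_scale)
  show "length w = n \<Longrightarrow> fkd_word w \<in> fkd_component n"
    unfolding fkd_component_def fkd_word_prod by (rule span_base) auto
qed

text \<open>Words span the components, so the degree of a functional can be tested on words.\<close>

lemma dual_component_iff:
  "u \<in> dual_component n \<longleftrightarrow> (\<forall>w. length w \<noteq> n \<longrightarrow> dual_app u (fkd_word w) = 0)"
proof
  assume u: "\<forall>w. length w \<noteq> n \<longrightarrow> dual_app u (fkd_word w) = 0"
  have "dual_app u x = 0" if "x \<in> fkd_component m" "m \<noteq> n" for m x
    by (rule linear_zero_on_span[OF linear_dual_app _ that(1)[unfolded fkd_component_def]])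
      (use u that(2) in \<open>auto simp flip: fkd_word_prod\<close>)
  then show "u \<in> dual_component n" by (auto simp: dual_component_def)
qed (auto simp: dual_component_def fkd_component_word)

lemma dual_word_component: "length w = n \<Longrightarrow> dual_word w \<in> dual_component n"
  by (auto simp: dual_component_iff dual_app_dual_word word_class_def)

lemma dual_app_simps:
  "dual_app (u + v) x = dual_app u x + dual_app v x" "dual_app 0 x = 0"
  "dual_app (u - v) x = dual_app u x - dual_app v x" "dual_app (- u) x = - dual_app u x"
  "dual_app (dual_scale c u) x = c * dual_app u x"
  by (simp_all add: plus_fkd_dual.rep_eq zero_fkd_dual.rep_eq minus_fkd_dual.rep_eq
      uminus_fkd_dual.rep_eq dual_scale.rep_eq)

lemma dual_app_sum: "dual_app (\<Sum>i\<in>I. u i) x = (\<Sum>i\<in>I. dual_app (u i) x)"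
  by (induction I rule: infinite_finite_induct) (simp_all add: dual_app_simps)

lemma fkd_relations:
  "fkd_C * fkd_A = fkd_A * (fkd_B :: 'k::field fkd)" "fkd_B * fkd_C = fkd_A * (fkd_B :: 'k fkd)"
  "fkd_B * fkd_A = fkd_A * (fkd_C :: 'k fkd)" "fkd_C * fkd_B = fkd_A * (fkd_C :: 'k fkd)"
proof -
  have eq: "fkd_gen p * fkd_gen q = (fkd_gen p' * fkd_gen q' :: 'k fkd)"
    if "monom [p, q] - monom [p', q'] \<in> (fkd_relators :: (word \<Rightarrow>\<^sub>0 'k) set)" for p q p' q'
  proof -
    have "monom [p, q] - monom [p', q'] \<in> two_sided_ideal (fkd_relators :: (word \<Rightarrow>\<^sub>0 'k) set)"
      using two_sided_ideal.gen[OF that, of 1 1] by simp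
    then have "fkd_word [p, q] = (fkd_word [p', q'] :: 'k fkd)"
      by (simp add: fkd_word_def fkd.abs_eq_iff)
    then show ?thesis by (simp add: fkd_word_simps)
  qed
  show 1: "fkd_C * fkd_A = fkd_A * (fkd_B :: 'k fkd)" by (rule eq) (simp add: fkd_relators_def)
  show 2: "fkd_B * fkd_C = fkd_A * (fkd_B :: 'k fkd)"
    by (rule eq[symmetric]) (simp add: fkd_relators_def)
  show 3: "fkd_B * fkd_A = fkd_A * (fkd_C :: 'k fkd)" by (rule eq) (simp add: fkd_relators_def)
  have "fkd_C * fkd_B = fkd_B * (fkd_A :: 'k fkd)" by (rule eq) (simp add: fkd_relators_def)
  with 3 show "fkd_C * fkd_B = fkd_A * (fkd_C :: 'k fkd)" by simp
qed

lemma fkd_assoc: "x * y = z \<Longrightarrow> x * (y * u) = z * (u :: 'k::field fkd)"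
  by (simp flip: mult.assoc)

lemma fkd_relations_assoc:
  fixes x :: "'k::field fkd"
  shows "fkd_C * (fkd_A * x) = fkd_A * (fkd_B * x)" "fkd_B * (fkd_C * x) = fkd_A * (fkd_B * x)"
    "fkd_B * (fkd_A * x) = fkd_A * (fkd_C * x)" "fkd_C * (fkd_B * x) = fkd_A * (fkd_C * x)"
  by (simp_all add: fkd_relations[THEN fkd_assoc] mult.assoc)

text \<open>Consequences of the quadratic relations, obtained by rewriting overlaps in two ways.
  With them every word of length at most 4 reduces to a basis word.\<close>

lemma fkd_relations_more:
  "fkd_A * (fkd_C * fkd_C) = fkd_A * (fkd_B * (fkd_B :: 'k::field fkd))"
  "fkd_A * (fkd_B * (fkd_B * fkd_B)) = fkd_A * (fkd_A * (fkd_A * (fkd_B :: 'k fkd)))"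
  "fkd_A * (fkd_C * (fkd_C * fkd_C)) = fkd_A * (fkd_A * (fkd_A * (fkd_C :: 'k fkd)))"
proof -
  let ?A = "fkd_A :: 'k fkd" and ?B = "fkd_B :: 'k fkd" and ?C = "fkd_C :: 'k fkd"
  have "?A * (?C * ?C) = ?B * (?A * ?C)" by (simp only: fkd_relations_assoc)
  also have "?A * ?C = ?C * ?B" by (simp only: fkd_relations)
  also have "?B * (?C * ?B) = ?A * (?B * ?B)" by (simp only: fkd_relations_assoc)
  finally show 1: "?A * (?C * ?C) = ?A * (?B * ?B)" .
  have "?A * (?B * (?B * ?B)) = ?C * (?A * (?B * ?B))" by (simp only: fkd_relations_assoc)
  also have "?A * (?B * ?B) = ?A * (?C * ?C)" by (simp only: 1)
  also have "?C * (?A * (?C * ?C)) = ?A * (?A * (?B * ?C))" by (simp only: fkd_relations_assoc)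
  also have "?B * ?C = ?A * ?B" by (simp only: fkd_relations)
  finally show "?A * (?B * (?B * ?B)) = ?A * (?A * (?A * ?B))" .
  have "?A * (?C * (?C * ?C)) = ?A * (?B * (?B * ?C))"
    using arg_cong[OF 1, of "\<lambda>x. x * ?C"] by (simp only: mult.assoc)
  also have "?B * (?B * ?C) = ?A * (?A * ?C)" by (simp only: fkd_relations fkd_relations_assoc)
  finally show "?A * (?C * (?C * ?C)) = ?A * (?A * (?A * ?C))" .
qed

section \<open>Bases and dual bases in degrees at most 4\<close>

lemma all_less_5: "n \<le> 4 \<longleftrightarrow> n = 0 \<or> n = 1 \<or> n = 2 \<or> n = 3 \<or> n = (4::nat)"
  by auto

lemma words_basis_small:
  "words_basis 0 = [[]]" "words_basis (Suc 0) = [[Ga], [Gb], [Gc]]"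
  "words_basis 2 = [[Ga, Ga], [Gb, Gb], [Gc, Gc], [Ga, Gb], [Ga, Gc]]"
  "words_basis 3 = [[Ga, Ga, Ga], [Gb, Gb, Gb], [Gc, Gc, Gc], [Ga, Ga, Gb], [Ga, Ga, Gc], [Ga, Gb, Gb]]"
  "words_basis 4 = [[Ga, Ga, Ga, Ga], [Gb, Gb, Gb, Gb], [Gc, Gc, Gc, Gc], [Ga, Ga, Ga, Gb],
    [Ga, Ga, Ga, Gc], [Ga, Ga, Gb, Gb]]"
  by (simp_all add: words_basis_def eval_nat_numeral)

lemma words_basis_length: "n \<le> 4 \<Longrightarrow> w \<in> set (words_basis n) \<Longrightarrow> length w = n"
  unfolding all_less_5 by (auto simp: words_basis_small)

lemma words_basis_distinct:
  "n \<le> 4 \<Longrightarrow> i < basis_size n \<Longrightarrow> j < basis_size n \<Longrightarrow>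
    word_class (words_basis n ! i) = word_class (words_basis n ! j) \<longleftrightarrow> i = j"
proof -
  have "list_all (\<lambda>n. distinct (map word_class (words_basis n))) [0, 1, 2, 3, 4]" by code_simp
  then have "n \<le> 4 \<Longrightarrow> distinct (map word_class (words_basis n))"
    unfolding all_less_5 by auto
  then show "n \<le> 4 \<Longrightarrow> i < basis_size n \<Longrightarrow> j < basis_size n \<Longrightarrow>
      word_class (words_basis n ! i) = word_class (words_basis n ! j) \<longleftrightarrow> i = j"
    using nth_eq_iff_index_eq[of "map word_class (words_basis n)" i j] by (simp add: basis_size_def)
qed

text \<open>Up to degree 4 the reduction is a finite check, one case for each letter and each basis
  word.\<close>

lemma fkd_word_basis_step:
  assumes "n \<le> 3" "w \<in> set (words_basis n)"
  shows "\<exists>v\<in>set (words_basis (Suc n)). fkd_word (g # w) = (fkd_word v :: 'k::field fkd)"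
proof -
  have "n = 0 \<or> n = 1 \<or> n = 2 \<or> n = 3" using assms(1) by auto
  then show ?thesis
    using assms(2)
    by (elim disjE; cases g;
        auto simp: words_basis_small words_basis_small(3)[unfolded numeral_2_eq_2] fkd_word_simps fkd_relations fkd_relations_assoc fkd_relations_more)
qed

lemma fkd_word_basis:
  "length w \<le> 4 \<Longrightarrow> \<exists>v\<in>set (words_basis (length w)). fkd_word w = (fkd_word v :: 'k::field fkd)"
proof (induction w)
  case Nil
  show ?case by (simp add: words_basis_small)
next
  case (Cons g w)
  then obtain v where v: "v \<in> set (words_basis (length w))" "fkd_word w = (fkd_word v :: 'k fkd)" by auto
  have "fkd_word (g # w) = (fkd_word (g # v) :: 'k fkd)" by (simp add: fkd_word_simps v)
  with fkd_word_basis_step[OF _ v(1), of g] Cons.prems show ?case by simp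
qed

text \<open>The index is the position in \<open>words_basis n\<close>. For n >= 2, positions 0, 1, 2
  are \<alpha>_n, \<beta>_n, \<gamma>_n, then come \<alpha>_(n-1)\<beta>, \<alpha>_(n-1)\<gamma>
  and, for n >= 3, \<alpha>_(n-2)\<beta>_2. All tables below use these positions.\<close>

definition dual_gen :: "nat \<Rightarrow> nat \<Rightarrow> 'k::field fkd_dual"
  where "dual_gen n i = dual_word (words_basis n ! i)"

lemma dual_gen_component: "n \<le> 4 \<Longrightarrow> i < basis_size n \<Longrightarrow> dual_gen n i \<in> dual_component n"
  unfolding dual_gen_def basis_size_def by (intro dual_word_component words_basis_length nth_mem)

lemma dual_gen_app:
  "n \<le> 4 \<Longrightarrow> i < basis_size n \<Longrightarrow> j < basis_size n \<Longrightarrow>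
    dual_app (dual_gen n i) (fkd_word (words_basis n ! j)) = (if i = j then 1 else 0)"
  by (auto simp: dual_gen_def dual_app_dual_word words_basis_distinct)

lemma dual_component_eqI:
  assumes n: "n \<le> 4" and "u \<in> dual_component n" "v \<in> dual_component n"
    "\<And>i. i < basis_size n \<Longrightarrow> dual_app u (fkd_word (words_basis n ! i)) = dual_app v (fkd_word (words_basis n ! i))"
  shows "u = (v :: 'k::field fkd_dual)"
proof (rule fkd_dual_eqI)
  fix w
  show "dual_app u (fkd_word w) = dual_app v (fkd_word w)"
  proof (cases "length w = n")
    case True
    then obtain x where "x \<in> set (words_basis n)" "fkd_word w = (fkd_word x :: 'k fkd)"
      using fkd_word_basis[of w] n by blast
    then show ?thesis using assms(4) by (auto simp: in_set_conv_nth basis_size_def)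
  next
    case False
    then show ?thesis using assms(2,3) by (simp add: dual_component_iff)
  qed
qed

lemma dual_component_closed:
  "u \<in> dual_component n \<Longrightarrow> v \<in> dual_component n \<Longrightarrow> u + v \<in> dual_component n"
  "u \<in> dual_component n \<Longrightarrow> v \<in> dual_component n \<Longrightarrow> u - v \<in> dual_component n"
  "0 \<in> dual_component n"
  "u \<in> dual_component n \<Longrightarrow> dual_scale c u \<in> dual_component n"
  by (simp_all add: dual_component_iff dual_app_simps)

lemma dual_component_sum:
  "(\<And>i. i \<in> I \<Longrightarrow> u i \<in> dual_component n) \<Longrightarrow> (\<Sum>i\<in>I. u i) \<in> dual_component n"
  by (induction I rule: infinite_finite_induct) (simp_all add: dual_component_closed)

lemma dual_component_expand:
  assumes n: "n \<le> 4" and u: "u \<in> dual_component n"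
  shows "u = (\<Sum>i<basis_size n. dual_scale (dual_app u (fkd_word (words_basis n ! i))) (dual_gen n i))"
proof (rule dual_component_eqI[OF n u])
  fix j assume j: "j < basis_size n"
  have "(\<Sum>i<basis_size n. dual_app u (fkd_word (words_basis n ! i)) * (if i = j then 1 else 0))
      = dual_app u (fkd_word (words_basis n ! j))"
    using j by (subst sum.mono_neutral_right[of _ "{j}"]) auto
  then show "dual_app u (fkd_word (words_basis n ! j)) = dual_app
     (\<Sum>i<basis_size n. dual_scale (dual_app u (fkd_word (words_basis n ! i))) (dual_gen n i))
     (fkd_word (words_basis n ! j))"
    using n j by (simp add: dual_app_sum dual_app_simps dual_gen_app cong: sum.cong_simp)
qed (auto intro!: dual_component_sum dual_component_closed dual_gen_component n)

lemma fkd_gen_word: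
  "fkd_gen g * fkd_word w = fkd_word (g # w)" "fkd_word w * fkd_gen g = fkd_word (w @ [g])"
  by (simp_all add: fkd_word_simps)

lemma dual_shift_component:
  "u \<in> dual_component (Suc n) \<Longrightarrow> dual_lshift (fkd_gen g) u \<in> dual_component n"
  "u \<in> dual_component (Suc n) \<Longrightarrow> dual_rshift (fkd_gen g) u \<in> dual_component n"
  by (auto simp: dual_component_iff dual_app_shift fkd_gen_word)

lemma sum_list_filter_upt:
  "(\<Sum>i<n. if P i then h i else 0) = sum_list (map h (filter P [0..<n]))"
  for h :: "nat \<Rightarrow> 'a::comm_monoid_add"
  by (induction n) (auto simp: add.commute)

text \<open>The quadratic dual is a monoid algebra, so a shifted basis functional has coefficients 0
  and 1 in the dual basis and is described by the list of positions with coefficient 1.\<close>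

definition lshift_index :: "nat \<Rightarrow> gen \<Rightarrow> nat \<Rightarrow> nat list"
  where "lshift_index n g i = filter (\<lambda>j. word_class (g # words_basis n ! j)
    = word_class (words_basis (Suc n) ! i)) [0..<basis_size n]"

definition rshift_index :: "nat \<Rightarrow> gen \<Rightarrow> nat \<Rightarrow> nat list"
  where "rshift_index n g i = filter (\<lambda>j. word_class (words_basis n ! j @ [g])
    = word_class (words_basis (Suc n) ! i)) [0..<basis_size n]"

lemma dual_scale_if: "dual_scale (if P then 1 else 0) u = (if P then u else 0)"
  by (auto intro: fkd_dual_eqI simp: dual_app_simps)

lemma dual_shift_gen:
  assumes n: "Suc n \<le> 4" and i: "i < basis_size (Suc n)"
  shows "dual_lshift (fkd_gen g) (dual_gen (Suc n) i) = sum_list (map (dual_gen n) (lshift_index n g i))"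
    "dual_rshift (fkd_gen g) (dual_gen (Suc n) i) = sum_list (map (dual_gen n) (rshift_index n g i))"
proof -
  have n': "n \<le> 4" using n by simp
  note c = dual_shift_component[OF dual_gen_component[OF n i], of g]
  show "dual_lshift (fkd_gen g) (dual_gen (Suc n) i) = sum_list (map (dual_gen n) (lshift_index n g i))"
    "dual_rshift (fkd_gen g) (dual_gen (Suc n) i) = sum_list (map (dual_gen n) (rshift_index n g i))"
    unfolding lshift_index_def rshift_index_def sum_list_filter_upt[symmetric]
    by (subst dual_component_expand[OF n' c(1)] dual_component_expand[OF n' c(2)],
        simp only: dual_app_shift fkd_gen_word dual_gen_def[of "Suc n"] dual_app_dual_word dual_scale_if)+
qed

section \<open>The Koszul bimodules and the resolution\<close>

definition tlin :: "('k::field \<Rightarrow> 'v \<Rightarrow> 'v::ab_group_add) \<Rightarrow>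
    ('k fk3 \<Rightarrow> 'k fkd_dual \<Rightarrow> 'k fk3 \<Rightarrow> 'v) \<Rightarrow> bool"
  where "tlin s \<phi> \<longleftrightarrow>
    (\<forall>c x x' u y. \<phi> (fk_scale c x + x') u y = s c (\<phi> x u y) + \<phi> x' u y) \<and>
    (\<forall>c x u u' y. \<phi> x (dual_scale c u + u') y = s c (\<phi> x u y) + \<phi> x u' y) \<and>
    (\<forall>c x u y y'. \<phi> x u (fk_scale c y + y') = s c (\<phi> x u y) + \<phi> x u y')"

lemma kos_ext_abs:
  assumes "vector_space s" "tlin s \<phi>"
  shows "kos_ext s \<phi> (abs_kos p) = lin_comb s (\<lambda>(x, u, y). \<phi> x u y) p"
proof -
  let ?T = "lin_comb s (\<lambda>(x, u, y). \<phi> x u y)"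
  note L = linearD[OF lin_comb_linear[OF assms(1)]]
  have "rep_kos (abs_kos p) - p \<in> free_span kos_relators"
    using rep_abs_rsp_left[OF Quotient3_kos, of p p] by (simp add: free.span_zero)
  then have "?T (rep_kos (abs_kos p) - p) = 0"
  proof (rule linear_zero_on_span[OF lin_comb_linear[OF assms(1)], rotated])
    fix r :: "'a fk3 \<times> 'a fkd_dual \<times> 'a fk3 \<Rightarrow>\<^sub>0 'a" assume "r \<in> kos_relators"
    then show "?T r = 0"
      using assms by (auto simp: kos_relators_def L lin_comb_single tlin_def vector_space.vector_space_assms)
  qed
  then show ?thesis by (simp add: kos_ext_def L)
qed

lemma kos_ext_pure: "vector_space s \<Longrightarrow> tlin s \<phi> \<Longrightarrow> kos_ext s \<phi> (kos_pure x u y) = \<phi> x u y"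
  by (simp add: kos_pure_def kos_ext_abs lin_comb_single vector_space.vector_space_assms)

lemma linear_kos_ext:
  assumes "vector_space s" "tlin s \<phi>" shows "Vector_Spaces.linear kos_scale s (kos_ext s \<phi>)"
  unfolding Vector_Spaces.linear_iff
proof (intro conjI allI vector_space_kos_scale assms(1))
  fix t t' :: "'a kos" and c
  obtain p p' where t: "t = abs_kos p" "t' = abs_kos p'"
    using Quotient3_abs_rep[OF Quotient3_kos] by metis
  have "t + t' = abs_kos (p + p')" "kos_scale c t = abs_kos (free_scale c p)"
    unfolding t by (simp_all add: plus_kos.abs_eq kos_scale.abs_eq)
  then show "kos_ext s \<phi> (t + t') = kos_ext s \<phi> t + kos_ext s \<phi> t'"
    "kos_ext s \<phi> (kos_scale c t) = s c (kos_ext s \<phi> t)"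
    unfolding t by (simp_all add: kos_ext_abs assms lin_comb_add lin_comb_scale)
qed

interpretation kos: vector_space kos_scale by (rule vector_space_kos_scale)

lemma linear_abs_kos: "Vector_Spaces.linear free_scale kos_scale abs_kos"
  by (simp add: Vector_Spaces.linear_iff vector_space_free_scale vector_space_kos_scale
      plus_kos.abs_eq kos_scale.abs_eq)

lemma kos_span_pure: "t \<in> kos.span {kos_pure x u y |x u y. True}"
proof -
  interpret L: Vector_Spaces.linear free_scale kos_scale abs_kos by (rule linear_abs_kos)
  obtain p where t: "t = abs_kos p" using Quotient3_abs_rep[OF Quotient3_kos] by metis
  have "abs_kos p \<in> abs_kos ` free_span (range (\<lambda>i. Poly_Mapping.single i 1))"
    using poly_mapping_span_single by blast
  also have "\<dots> = kos.span ((\<lambda>i. abs_kos (Poly_Mapping.single i 1)) ` UNIV)"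
    by (simp add: L.span_image[symmetric] image_image)
  also have "(\<lambda>i. abs_kos (Poly_Mapping.single i 1)) ` UNIV = {kos_pure x u y |x u y. True}"
    by (auto simp: kos_pure_def image_iff)
  finally show ?thesis by (simp add: t)
qed

lemma kos_linear_eqI:
  assumes "Vector_Spaces.linear kos_scale s T" "Vector_Spaces.linear kos_scale s T'"
    "\<And>x u y. T (kos_pure x u y) = T' (kos_pure x u y)"
  shows "T t = T' t"
  by (rule linear_eq_on_span[OF assms(1,2) _ kos_span_pure]) (auto simp: assms(3))

lemma tlin_kos_pure: "tlin kos_scale kos_pure"
proof -
  have eq: "abs_kos a = kos_scale c (abs_kos b) + abs_kos b'"
    if "a - free_scale c b - b' \<in> kos_relators" for a b b' :: "'a fk3 \<times> 'a fkd_dual \<times> 'a fk3 \<Rightarrow>\<^sub>0 'a" and c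
  proof -
    have "a - (free_scale c b + b') \<in> free_span kos_relators"
      using free.span_base[OF that] by (simp add: algebra_simps)
    then have "abs_kos a = abs_kos (free_scale c b + b')" by (subst kos.abs_eq_iff)
    then show ?thesis by (simp add: plus_kos.abs_eq kos_scale.abs_eq)
  qed
  have s: "free_scale c (Poly_Mapping.single i 1) = Poly_Mapping.single i c" for c :: 'a and i :: "'a fk3 \<times> 'a fkd_dual \<times> 'a fk3"
    by (intro poly_mapping_eqI) (simp add: lookup_single when_def)
  show ?thesis
    unfolding tlin_def kos_pure_def
    by (intro conjI allI eq; unfold s kos_relators_def; blast)
qed

lemma tlinD:
  assumes "tlin s \<phi>"
  shows "\<phi> (fk_scale c x + x') u y = s c (\<phi> x u y) + \<phi> x' u y"
    "\<phi> x (dual_scale c u + u') y = s c (\<phi> x u y) + \<phi> x u' y"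
    "\<phi> x u (fk_scale c y + y') = s c (\<phi> x u y) + \<phi> x u y'"
  using assms by (simp_all add: tlin_def)

lemma linear_from_comb:
  assumes v: "vector_space s" "vector_space s'"
    and T: "\<And>c x y. T (s c x + y) = s' c (T x) + T y"
  shows "Vector_Spaces.linear s s' T"
proof -
  interpret s: vector_space s by fact
  interpret s': vector_space s' by fact
  have 0: "T 0 = 0" using T[of 1 0 0] by simp
  show ?thesis
    using T[of 1] T[of _ _ 0] by (simp add: Vector_Spaces.linear_iff v 0)
qed

lemma vector_space_dual_scale: "vector_space dual_scale"
  by unfold_locales (auto intro!: fkd_dual_eqI simp: dual_app_simps algebra_simps)

lemma kos_pure_linear:
  "Vector_Spaces.linear fk_scale kos_scale (\<lambda>x. kos_pure x u y)"
  "Vector_Spaces.linear dual_scale kos_scale (\<lambda>u. kos_pure x u y)"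
  "Vector_Spaces.linear fk_scale kos_scale (\<lambda>y. kos_pure x u y)"
  by (intro linear_from_comb vector_space_fk_scale vector_space_dual_scale vector_space_kos_scale
      tlinD[OF tlin_kos_pure])+

lemmas kos_pure_simps = linearD[OF kos_pure_linear(1)] linearD[OF kos_pure_linear(2)]
  linearD[OF kos_pure_linear(3)]

lemma tlin_kos_pure_mult: "tlin kos_scale (\<lambda>x u y. kos_pure (z * x * z') u (w * y * w'))"
  by (simp add: tlin_def kos_pure_simps algebra_simps fk_scale_mult)

lemma kos_act_pure [simp]:
  "kos_lact z (kos_pure x u y) = kos_pure (z * x) u y"
  "kos_ract (kos_pure x u y) z = kos_pure x u (y * z)"
  using kos_ext_pure[OF vector_space_kos_scale tlin_kos_pure_mult[of z 1 1 1], of x u y]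
    kos_ext_pure[OF vector_space_kos_scale tlin_kos_pure_mult[of 1 1 1 z], of x u y]
  by (simp_all add: kos_lact_def kos_ract_def)

lemma linear_kos_act:
  "Vector_Spaces.linear kos_scale kos_scale (kos_lact z)"
  "Vector_Spaces.linear kos_scale kos_scale (\<lambda>t. kos_ract t z)"
  using linear_kos_ext[OF vector_space_kos_scale tlin_kos_pure_mult[of z 1 1 1]]
    linear_kos_ext[OF vector_space_kos_scale tlin_kos_pure_mult[of 1 1 1 z]]
  by (simp_all add: kos_lact_def[abs_def] kos_ract_def[abs_def])

lemmas kos_act_simps [simp] = linearD[OF linear_kos_act(1)] linearD[OF linear_kos_act(2)]

lemma kos_act_laws:
  "kos_lact x (kos_lact y t) = kos_lact (x * y) t" "kos_ract (kos_ract t x) y = kos_ract t (x * y)"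
  "kos_lact x (kos_ract t y) = kos_ract (kos_lact x t) y" "kos_lact 1 t = t" "kos_ract t 1 = t"
  "kos_lact (fk_scale c x + y) t = kos_scale c (kos_lact x t) + kos_lact y t"
  "kos_ract t (fk_scale c x + y) = kos_scale c (kos_ract t x) + kos_ract t y"
proof -
  note l = linear_kos_act(1) and r = linear_kos_act(2)
  show "kos_lact x (kos_lact y t) = kos_lact (x * y) t"
    by (rule kos_linear_eqI[OF linear_comp[OF l l] l]) (simp add: mult.assoc)
  show "kos_ract (kos_ract t x) y = kos_ract t (x * y)"
    by (rule kos_linear_eqI[OF linear_comp[OF r r] r]) (simp add: mult.assoc)
  show "kos_lact x (kos_ract t y) = kos_ract (kos_lact x t) y"
    by (rule kos_linear_eqI[OF linear_comp[OF r l] linear_comp[OF l r]]) simp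
  show "kos_lact 1 t = t" by (rule kos_linear_eqI[OF l linear_id[OF vector_space_kos_scale]]) simp
  show "kos_ract t 1 = t" by (rule kos_linear_eqI[OF r linear_id[OF vector_space_kos_scale]]) simp
  show "kos_lact (fk_scale c x + y) t = kos_scale c (kos_lact x t) + kos_lact y t"
    by (rule kos_linear_eqI[OF l linear_plus[OF linear_smult[OF l] l]])
      (simp add: distrib_right fk_scale_mult kos_pure_simps)
  show "kos_ract t (fk_scale c x + y) = kos_scale c (kos_ract t x) + kos_ract t y"
    by (rule kos_linear_eqI[OF r linear_plus[OF linear_smult[OF r] r]])
      (simp add: distrib_left fk_scale_mult kos_pure_simps)
qed

lemma kos_act_linear:
  "Vector_Spaces.linear fk_scale kos_scale (\<lambda>x. kos_lact x t)"
  "Vector_Spaces.linear fk_scale kos_scale (\<lambda>x. kos_ract t x)"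
  by (intro linear_from_comb vector_space_fk_scale vector_space_kos_scale kos_act_laws)+

lemma bimodule_kos: "bimodule (kos_scale :: 'k::field \<Rightarrow> _) (kos_bimod n)"
proof -
  let ?S = "{kos_pure x u y |x u y. u \<in> (dual_component n :: 'k fkd_dual set)}"
  have closed: "kos_lact z t \<in> kos.span ?S" "kos_ract t z \<in> kos.span ?S" if "t \<in> kos.span ?S" for z t
    using that
  proof (induction rule: kos.span_induct_alt)
    case (step c s t)
    then obtain x u y where "s = kos_pure x u y" "u \<in> dual_component n" by auto
    then have "kos_lact z s \<in> kos.span ?S" "kos_ract s z \<in> kos.span ?S"
      by (auto intro!: kos.span_base)
    with step show "kos_lact z (kos_scale c s + t) \<in> kos.span ?S"
      "kos_ract (kos_scale c s + t) z \<in> kos.span ?S"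
      by (simp_all add: kos.span_add kos.span_scale)
  qed (simp_all add: kos.span_zero)
  have C: "bcarrier (kos_bimod n) = kos.span ?S"
    and act: "lact (kos_bimod n) = kos_lact" "ract (kos_bimod n) = kos_ract"
    by (simp_all only: kos_bimod_def bimod.simps)
  show ?thesis
    by (rule bimodule.intro)
      (simp_all only: C act closed kos_act_laws(1-5) linear_kos_act kos_act_linear
        vector_space_kos_scale kos.subspace_span)
qed

lemma kos_act_closed:
  "t \<in> bcarrier (kos_bimod n) \<Longrightarrow> kos_lact x t \<in> bcarrier (kos_bimod n)"
  "t \<in> bcarrier (kos_bimod n) \<Longrightarrow> kos_ract t x \<in> bcarrier (kos_bimod n)"
  using bimodule.carrier_closed(7,8)[OF bimodule_kos, of t n x] by (simp_all add: kos_bimod_def)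

definition res_scale :: "'k::field \<Rightarrow> (nat \<Rightarrow> 'k kos) \<Rightarrow> nat \<Rightarrow> 'k kos"
  where "res_scale c \<rho> = (\<lambda>i. kos_scale c (\<rho> i))"

lemma vector_space_res_scale: "vector_space res_scale"
  by unfold_locales (auto simp: res_scale_def fun_eq_iff kos.scale_right_distrib kos.scale_left_distrib)

lemma bimodule_res: "bimodule res_scale (res_bimod n)"
proof (rule bimodule.intro)
  interpret vector_space res_scale by (rule vector_space_res_scale)
  note k = bimodule.carrier_closed[OF bimodule_kos]
  show "subspace (bcarrier (res_bimod n :: ('a, _) bimod))"
    unfolding subspace_def by (auto simp: res_bimod_def res_scale_def k)
qed (auto simp: res_bimod_def res_scale_def Vector_Spaces.linear_iff fun_eq_iff kos_act_laws(1-5)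
    kos_act_closed vector_space_res_scale vector_space_fk_scale linearD[OF kos_act_linear(1)]
    linearD[OF kos_act_linear(2)])

lemma kos_carrier: "u \<in> dual_component n \<Longrightarrow> kos_pure x u y \<in> bcarrier (kos_bimod n)"
  unfolding kos_bimod_def by (auto intro!: kos.span_base)

lemma kos_generated:
  assumes n: "n \<le> 4"
  shows "bimod_generated (kos_scale :: 'k::field \<Rightarrow> _) (kos_bimod n)
    ((\<lambda>i. kos_pure 1 (dual_gen n i) 1) ` {..<basis_size n})"
proof -
  let ?G = "(\<lambda>i. kos_pure 1 (dual_gen n i) (1 :: 'k fk3)) ` {..<basis_size n}"
  let ?S = "{lact (kos_bimod n) x (ract (kos_bimod n) g y) |x g y. g \<in> ?G}"
  have gen: "kos_pure x (dual_gen n i) y \<in> kos.span ?S" if "i < basis_size n" for x y i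
  proof (rule kos.span_base)
    have "kos_pure x (dual_gen n i) y = lact (kos_bimod n) x (ract (kos_bimod n) (kos_pure 1 (dual_gen n i) 1) y)"
      by (simp add: kos_bimod_def)
    then show "kos_pure x (dual_gen n i) y \<in> ?S" using that by blast
  qed
  have "kos_pure x u y \<in> kos.span ?S" if "u \<in> dual_component n" for x u y
    by (subst dual_component_expand[OF n that], unfold kos_pure_simps)
      (intro kos.span_sum kos.span_scale gen, simp)
  then have "kos.span {kos_pure x u y |x u y. u \<in> dual_component n} \<subseteq> kos.span ?S"
    by (intro kos.span_minimal kos.subspace_span) blast
  then have "bcarrier (kos_bimod n) \<subseteq> kos.span ?S"
    by (simp only: kos_bimod_def bimod.simps)
  then show ?thesis
    using n by (auto simp: bimod_generated_def intro!: kos_carrier dual_gen_component)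
qed

text \<open>The morphism with value \<open>v i\<close> on the generator 1|u_i|1 of the free bimodule
  K_n: the coefficient of the i-th dual basis element in u is the value of u at the i-th basis
  word.\<close>

definition kos_hom :: "('k::field \<Rightarrow> 'm \<Rightarrow> 'm) \<Rightarrow> ('k, 'm) bimod \<Rightarrow> nat \<Rightarrow> (nat \<Rightarrow> 'm) \<Rightarrow> 'k kos \<Rightarrow> 'm::ab_group_add"
  where "kos_hom s N n v = kos_ext s (\<lambda>x u y. \<Sum>i<basis_size n.
    s (dual_app u (fkd_word (words_basis n ! i))) (lact N x (ract N (v i) y)))"

lemma kos_hom:
  assumes N: "bimodule s N" and n: "n \<le> 4" and v: "\<And>i. i < basis_size n \<Longrightarrow> v i \<in> bcarrier N"
  shows "kos_hom s N n v \<in> bimod_hom (kos_bimod n) N"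
    "i < basis_size n \<Longrightarrow> kos_hom s N n v (kos_pure x (dual_gen n i) y) = lact N x (ract N (v i) y)"
    "Vector_Spaces.linear kos_scale s (kos_hom s N n v)"
proof -
  interpret N: bimodule s N by fact
  let ?\<phi> = "\<lambda>x u y. \<Sum>i<basis_size n.
    s (dual_app u (fkd_word (words_basis n ! i))) (lact N x (ract N (v i) y))"
  note lin = N.act_simps linearD[OF N.lact_left] linearD[OF N.ract_right] N.carrier_closed
  have t: "tlin s ?\<phi>"
    unfolding tlin_def
    by (auto simp: dual_app_simps lin v N.V.scale_right_distrib N.V.scale_left_distrib sum.distrib
        N.V.scale_sum_right mult.commute intro!: sum.cong)
  note ext = kos_ext_pure[OF N.vs t] and L = linear_kos_ext[OF N.vs t]
  show L': "Vector_Spaces.linear kos_scale s (kos_hom s N n v)"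
    using L unfolding kos_hom_def .
  have lact: "kos_hom s N n v (kos_lact z t) = lact N z (kos_hom s N n v t)" for z t
    unfolding kos_hom_def
    by (rule kos_linear_eqI[OF linear_comp[OF linear_kos_act(1) L] linear_comp[OF L N.lact_linear]])
      (unfold kos_act_pure ext, simp add: lin v N.lact_assoc)
  have ract: "kos_hom s N n v (kos_ract t z) = ract N (kos_hom s N n v t) z" for z t
    unfolding kos_hom_def
    by (rule kos_linear_eqI[OF linear_comp[OF linear_kos_act(2) L] linear_comp[OF L N.ract_linear]])
      (unfold kos_act_pure ext, simp add: lin v N.ract_assoc[symmetric] N.lact_ract)
  show "kos_hom s N n v \<in> bimod_hom (kos_bimod n) N"
  proof (rule bimod_homI)
    fix t t' :: "'a kos" and z
    show "kos_hom s N n v t \<in> bcarrier N"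
      unfolding kos_hom_def kos_ext_def
      by (rule lin_comb_mem[OF N.vs N.subspace]) (auto intro!: N.carrier_closed v)
    show "kos_hom s N n v (t + t') = kos_hom s N n v t + kos_hom s N n v t'" by (rule linearD(1)[OF L'])
  qed (simp_all add: kos_bimod_def lact ract)
  show "kos_hom s N n v (kos_pure x (dual_gen n i) y) = lact N x (ract N (v i) y)" if i: "i < basis_size n"
  proof -
    have "kos_hom s N n v (kos_pure x (dual_gen n i) y)
        = (\<Sum>j<basis_size n. s (if i = j then 1 else 0) (lact N x (ract N (v j) y)))"
      unfolding kos_hom_def ext by (intro sum.cong refl) (use n i in \<open>simp add: dual_gen_app\<close>)
    also have "\<dots> = lact N x (ract N (v i) y)"
      using i by (subst sum.mono_neutral_right[of _ "{i}"]) auto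
    finally show ?thesis .
  qed
qed

definition res_gen :: "nat \<Rightarrow> nat \<Rightarrow> nat \<Rightarrow> 'k::field fk3 \<Rightarrow> 'k fk3 \<Rightarrow> nat \<Rightarrow> 'k kos"
  where "res_gen n k i x y = (\<lambda>l. if l = k then kos_pure x (dual_gen (n - 4 * k) i) y else 0)"

definition res_index :: "nat \<Rightarrow> (nat \<times> nat) set"
  where "res_index n = {(k, i). 4 * k \<le> n \<and> i < basis_size (n - 4 * k)}"

lemma res_gen_carrier: "n \<le> 4 \<Longrightarrow> (k, i) \<in> res_index n \<Longrightarrow> res_gen n k i x y \<in> bcarrier (res_bimod n)"
  using bimodule.carrier_closed(1)[OF bimodule_kos]
  by (auto simp: res_gen_def res_index_def res_bimod_def intro!: kos_carrier dual_gen_component)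

lemma res_gen_act:
  "lact (res_bimod m) z (res_gen n k i x y) = res_gen n k i (z * x) y"
  "ract (res_bimod m) (res_gen n k i x y) z = res_gen n k i x (y * z)"
  by (simp_all add: res_bimod_def res_gen_def fun_eq_iff)

lemma res_generated:
  assumes n: "n \<le> 4"
  shows "bimod_generated (res_scale :: 'k::field \<Rightarrow> _) (res_bimod n)
    ((\<lambda>(k, i). res_gen n k i 1 1) ` res_index n)"
proof -
  interpret V: vector_space "res_scale :: 'k \<Rightarrow> _" by (rule vector_space_res_scale)
  let ?G = "(\<lambda>(k, i). res_gen n k i 1 (1 :: 'k fk3)) ` res_index n"
  let ?S = "{lact (res_bimod n) x (ract (res_bimod n) g y) |x g y. g \<in> ?G}"
  define single where "single k t = (\<lambda>l. if l = k then t else 0)" for k :: nat and t :: "'k kos"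
  have single: "single k t \<in> V.span ?S" if k: "4 * k \<le> n" and t: "t \<in> bcarrier (kos_bimod (n - 4 * k))" for k t
  proof -
    have "t \<in> kos.span {lact (kos_bimod (n - 4 * k)) x (ract (kos_bimod (n - 4 * k)) g y) |x g y.
        g \<in> (\<lambda>i. kos_pure 1 (dual_gen (n - 4 * k) i) 1) ` {..<basis_size (n - 4 * k)}}"
      by (rule subsetD[OF kos_generated[unfolded bimod_generated_def, THEN conjunct2] t]) (use n in simp)
    then show ?thesis
    proof (induction rule: kos.span_induct_alt)
      case base
      have "single k 0 = 0" by (auto simp: single_def)
      then show ?case by (simp only: V.span_zero)
    next
      case (step c u t)
      then obtain x i y where u: "u = kos_pure x (dual_gen (n - 4 * k) i) y" "i < basis_size (n - 4 * k)"
        by (auto simp: kos_bimod_def)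
      have "single k u = lact (res_bimod n) x (ract (res_bimod n) (res_gen n k i 1 1) y)"
        by (simp add: res_gen_act) (simp add: single_def res_gen_def u)
      moreover have "(k, i) \<in> res_index n" using u k by (simp add: res_index_def)
      ultimately have "single k u \<in> V.span ?S" by (intro V.span_base) force
      moreover have "single k (kos_scale c u + t) = res_scale c (single k u) + single k t"
        by (auto simp: single_def res_scale_def)
      ultimately show ?case using step(2) by (simp only: V.span_add V.span_scale)
    qed
  qed
  have "\<rho> \<in> V.span ?S" if \<rho>: "\<rho> \<in> bcarrier (res_bimod n)" for \<rho>
  proof -
    \<comment> \<open>The range k \<le> n is longer than the support; components with 4k > n are
      0.\<close>
    have "\<rho> = (\<Sum>k\<le>n. single k (\<rho> k))"
    proof
      fix l
      have "(\<Sum>k\<le>n. single k (\<rho> k)) l = (\<Sum>k\<le>n. single k (\<rho> k) l)"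
        by (induction n) simp_all
      also have "\<dots> = \<rho> l" using \<rho> by (auto simp: single_def res_bimod_def)
      finally show "\<rho> l = (\<Sum>k\<le>n. single k (\<rho> k)) l" by simp
    qed
    also have "\<dots> \<in> V.span ?S"
    proof (rule V.span_sum)
      fix k
      show "single k (\<rho> k) \<in> V.span ?S"
      proof (cases "4 * k \<le> n")
        case True
        then show ?thesis using \<rho> by (intro single) (auto simp: res_bimod_def split: if_splits)
      next
        case False
        then have "single k (\<rho> k) = 0" using \<rho> by (auto simp: res_bimod_def single_def split: if_splits)
        then show ?thesis by (simp add: V.span_zero)
      qed
    qed
    finally show ?thesis .
  qed
  then show ?thesis using n by (auto simp: bimod_generated_def intro: res_gen_carrier)
qed

definition res_hom :: "('k::field \<Rightarrow> 'm \<Rightarrow> 'm) \<Rightarrow> ('k, 'm) bimod \<Rightarrow> nat \<Rightarrow> (nat \<Rightarrow> nat \<Rightarrow> 'm) \<Rightarrow>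
    (nat \<Rightarrow> 'k kos) \<Rightarrow> 'm::ab_group_add"
  where "res_hom s N n v \<rho> = (\<Sum>k\<le>n div 4. kos_hom s N (n - 4 * k) (v k) (\<rho> k))"

lemma res_hom:
  assumes N: "bimodule s N" and n: "n \<le> 4" and v: "\<And>k i. (k, i) \<in> res_index n \<Longrightarrow> v k i \<in> bcarrier N"
  shows "res_hom s N n v \<in> bimod_hom (res_bimod n) N"
    "(k, i) \<in> res_index n \<Longrightarrow> res_hom s N n v (res_gen n k i x y) = lact N x (ract N (v k i) y)"
proof -
  interpret N: bimodule s N by fact
  have v': "v k i \<in> bcarrier N" if "k \<le> n div 4" "i < basis_size (n - 4 * k)" for k i
    using that by (intro v) (auto simp: res_index_def)
  have n': "n - 4 * k \<le> 4" for k using n by simp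
  have K: "kos_hom s N (n - 4 * k) (v k) \<in> bimod_hom (kos_bimod (n - 4 * k)) N"
    "i < basis_size (n - 4 * k) \<Longrightarrow> kos_hom s N (n - 4 * k) (v k) (kos_pure x (dual_gen (n - 4 * k) i) y)
      = lact N x (ract N (v k i) y)"
    "Vector_Spaces.linear kos_scale s (kos_hom s N (n - 4 * k) (v k))"
    if "k \<le> n div 4" for k i x y
    using kos_hom[OF N n'[of k] v'[OF that]] by auto
  note H = bimod_homD[OF K(1)]
  show "res_hom s N n v \<in> bimod_hom (res_bimod n) N"
  proof (rule bimod_homI)
    fix \<rho> \<rho>' :: "nat \<Rightarrow> 'a kos" and z assume \<rho>: "\<rho> \<in> bcarrier (res_bimod n)"
    have c: "\<rho> k \<in> bcarrier (kos_bimod (n - 4 * k))" if "k \<le> n div 4" for k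
    proof -
      have "4 * k \<le> n" using that by simp
      then show ?thesis using \<rho> by (auto simp: res_bimod_def split: if_splits)
    qed
    show "res_hom s N n v \<rho> \<in> bcarrier N"
      unfolding res_hom_def by (intro N.carrier_closed(6)) (use H(1) c in auto)
    show "res_hom s N n v (\<rho> + \<rho>') = res_hom s N n v \<rho> + res_hom s N n v \<rho>'"
      unfolding res_hom_def sum.distrib[symmetric]
      by (intro sum.cong refl) (use linearD(1)[OF K(3)] in auto)
    have "kos_hom s N (n - 4 * k) (v k) (kos_lact z (\<rho> k)) = lact N z (kos_hom s N (n - 4 * k) (v k) (\<rho> k))"
      "kos_hom s N (n - 4 * k) (v k) (kos_ract (\<rho> k) z) = ract N (kos_hom s N (n - 4 * k) (v k) (\<rho> k)) z"
      if "k \<le> n div 4" for k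
      using H(3)[OF that c[OF that]] H(4)[OF that c[OF that]] by (simp_all add: kos_bimod_def)
    then show "res_hom s N n v (lact (res_bimod n) z \<rho>) = lact N z (res_hom s N n v \<rho>)"
      "res_hom s N n v (ract (res_bimod n) \<rho> z) = ract N (res_hom s N n v \<rho>) z"
      unfolding res_hom_def by (simp_all add: res_bimod_def N.act_simps)
  qed
  show "res_hom s N n v (res_gen n k i x y) = lact N x (ract N (v k i) y)" if "(k, i) \<in> res_index n"
  proof -
    have k: "k \<le> n div 4" and i: "i < basis_size (n - 4 * k)" using that by (auto simp: res_index_def)
    have "res_hom s N n v (res_gen n k i x y)
        = (\<Sum>l\<in>{k}. kos_hom s N (n - 4 * l) (v l) (res_gen n k i x y l))"
      unfolding res_hom_def
      by (rule sum.mono_neutral_right) (use k linearD(4)[OF K(3)] in \<open>auto simp: res_gen_def\<close>)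
    then show ?thesis using K(2)[OF k i] by (simp add: res_gen_def)
  qed
qed

text \<open>P_n is free on the elements \<omega>_k 1|u|1; the bound 4 is that of the explicit dual
  bases.\<close>

lemma projective_res:
  assumes "n \<le> 4" "bimodule s N" "bimodule s' N'"
  shows "projective_for (res_bimod n) N' (N :: ('k::field, _) bimod)"
proof (rule projective_for_free[OF bimodule_res assms(2) res_generated[OF assms(1)]])
  fix v assume v: "\<And>i. i \<in> res_index n \<Longrightarrow> v i \<in> bcarrier N'"
  interpret N': bimodule s' N' by fact
  note h = res_hom[OF assms(3,1), of "\<lambda>k i. v (k, i)", OF v]
  show "\<exists>\<phi>\<in>bimod_hom (res_bimod n) N'. \<forall>i\<in>res_index n. \<phi> (case i of (k, i) \<Rightarrow> res_gen n k i 1 1) = v i"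
    by (rule bexI[OF _ h(1)]) (auto simp: h(2) v N'.lact_one N'.ract_one)
qed

subsection \<open>The differential\<close>

lemma tlin_kos_diff:
  "tlin kos_scale (\<lambda>x u y. \<Sum>g\<in>{Ga, Gb, Gc}.
    kos_scale c (kos_pure (x * fk_gen g) (dual_lshift (fkd_gen g) u) y)
    + kos_pure x (dual_rshift (fkd_gen g) u) (fk_gen g * y))"
proof -
  have "dual_lshift X (dual_scale d u + v) = dual_scale d (dual_lshift X u) + dual_lshift X v"
    "dual_rshift X (dual_scale d u + v) = dual_scale d (dual_rshift X u) + dual_rshift X v" for X :: "'a fkd" and d u v
    by (auto intro!: fkd_dual_eqI simp: dual_app_simps dual_app_shift)
  then show ?thesis
    by (simp add: tlin_def kos_pure_simps distrib_left distrib_right fk_scale_mult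
        kos.scale_right_distrib mult.commute algebra_simps)
qed

lemma kos_diff_pure:
  "kos_diff (Suc n) (kos_pure x u y) = (\<Sum>g\<in>{Ga, Gb, Gc}.
    kos_scale ((- 1) ^ Suc n) (kos_pure (x * fk_gen g) (dual_lshift (fkd_gen g) u) y)
    + kos_pure x (dual_rshift (fkd_gen g) u) (fk_gen g * y))"
  by (simp only: kos_diff_def nat.distinct simp_thms if_False kos_ext_pure[OF vector_space_kos_scale tlin_kos_diff])

lemma linear_kos_diff: "Vector_Spaces.linear kos_scale kos_scale (kos_diff n)"
proof (cases n)
  case 0
  then show ?thesis
    using linear_zero[OF vector_space_kos_scale vector_space_kos_scale] by (simp add: kos_diff_def[abs_def])
next
  case (Suc m)
  show ?thesis
    unfolding kos_diff_def[abs_def] Suc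
    using linear_kos_ext[OF vector_space_kos_scale tlin_kos_diff[of "(- 1) ^ Suc m"]]
    by (simp only: nat.distinct simp_thms if_False)
qed

lemma kos_diff_act:
  "kos_diff n (kos_lact z t) = kos_lact z (kos_diff n t)"
  "kos_diff n (kos_ract t z) = kos_ract (kos_diff n t) z"
proof -
  note l = linear_kos_act(1) and r = linear_kos_act(2)
  show "kos_diff n (kos_lact z t) = kos_lact z (kos_diff n t)"
    by (rule kos_linear_eqI[OF linear_comp[OF l linear_kos_diff] linear_comp[OF linear_kos_diff l]])
      (cases n, simp add: kos_diff_def, simp add: kos_diff_pure mult.assoc)
  show "kos_diff n (kos_ract t z) = kos_ract (kos_diff n t) z"
    by (rule kos_linear_eqI[OF linear_comp[OF r linear_kos_diff] linear_comp[OF linear_kos_diff r]])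
      (cases n, simp add: kos_diff_def, simp add: kos_diff_pure mult.assoc)
qed

lemma tlin_aug: "tlin fk_scale (\<lambda>x u y. fk_scale (dual_app u 1) (x * y))"
  by (simp add: tlin_def dual_app_simps algebra_simps fk_scale_mult fk.scale_right_distrib
      fk.scale_left_distrib)

lemma res_aug_hom: "res_aug \<in> bimod_hom (res_bimod 0) fk_bimod"
proof (rule bimod_homI)
  note L = linear_kos_ext[OF vector_space_fk_scale tlin_aug]
  note ext = kos_ext_pure[OF vector_space_fk_scale tlin_aug]
  fix \<rho> \<rho>' :: "nat \<Rightarrow> 'a kos" and x
  show "res_aug (\<rho> + \<rho>') = res_aug \<rho> + res_aug \<rho>'" by (simp add: res_aug_def linearD[OF L])
  show "res_aug (lact (res_bimod 0) x \<rho>) = lact fk_bimod x (res_aug \<rho>)"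
    unfolding res_aug_def res_bimod_def fk_bimod_def bimod.simps
    by (rule kos_linear_eqI[OF linear_comp[OF linear_kos_act(1) L] linear_comp[OF L linear_fk_mult(1)]])
      (simp add: ext mult.assoc fk_scale_mult)
  show "res_aug (ract (res_bimod 0) \<rho> x) = ract fk_bimod (res_aug \<rho>) x"
    unfolding res_aug_def res_bimod_def fk_bimod_def bimod.simps
    by (rule kos_linear_eqI[OF linear_comp[OF linear_kos_act(2) L] linear_comp[OF L linear_fk_mult(2)]])
      (simp add: ext mult.assoc fk_scale_mult)
qed (simp add: fk_bimod_def)

lemma resolution_res:
  assumes f: "fk_resolution (f :: nat \<Rightarrow> 'k::field kos \<Rightarrow> 'k kos)"
  shows "resolution res_scale res_bimod (\<lambda>n. res_diff f (Suc n)) res_aug"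
proof -
  have ex: "{\<rho> \<in> bcarrier (res_bimod (Suc n)). res_diff f (Suc n) \<rho> = 0}
      = res_diff f (Suc (Suc n)) ` bcarrier (res_bimod (Suc (Suc n)))" for n
    using f by (simp add: fk_resolution_def del: res_diff_def)
  have ex0: "{\<rho> \<in> bcarrier (res_bimod 0). res_aug \<rho> = 0} = res_diff f (Suc 0) ` bcarrier (res_bimod (Suc 0))"
    and surj: "res_aug ` bcarrier (res_bimod 0) = (UNIV :: 'k fk3 set)"
    and fh: "\<And>n. f n \<in> bimod_hom (kos_bimod n) (kos_bimod (n + 3))"
    using f by (simp_all add: fk_resolution_def)
  have hom: "res_diff f (Suc n) \<in> bimod_hom (res_bimod (Suc n)) (res_bimod n)" for n
  proof (rule bimod_homI)
    fix \<rho> :: "nat \<Rightarrow> 'k kos" assume \<rho>: "\<rho> \<in> bcarrier (res_bimod (Suc n))"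
    \<comment> \<open>That the differential lands in the carrier is read off from exactness, its
      image being a kernel.\<close>
    show "res_diff f (Suc n) \<rho> \<in> bcarrier (res_bimod n)"
      using \<rho> ex[of "n - 1"] ex0 by (cases n) auto
    have c: "\<rho> i \<in> bcarrier (kos_bimod (Suc n - 4 * i))" if "\<rho> \<in> bcarrier (res_bimod (Suc n))" "4 * i \<le> Suc n" for \<rho> i
      using that by (auto simp: res_bimod_def split: if_splits)
    show "res_diff f (Suc n) (\<rho> + \<rho>') = res_diff f (Suc n) \<rho> + res_diff f (Suc n) \<rho>'"
      if "\<rho>' \<in> bcarrier (res_bimod (Suc n))" for \<rho>'
    proof
      fix i
      show "res_diff f (Suc n) (\<rho> + \<rho>') i = (res_diff f (Suc n) \<rho> + res_diff f (Suc n) \<rho>') i"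
        using bimod_homD(2)[OF fh c[OF \<rho>, of "i + 1"] c[OF that, of "i + 1"]]
        by (simp add: res_diff_def linearD[OF linear_kos_diff])
    qed
    show "res_diff f (Suc n) (lact (res_bimod (Suc n)) x \<rho>) = lact (res_bimod n) x (res_diff f (Suc n) \<rho>)" for x
    proof
      fix i
      show "res_diff f (Suc n) (lact (res_bimod (Suc n)) x \<rho>) i = (lact (res_bimod n) x (res_diff f (Suc n) \<rho>)) i"
        using bimod_homD(3)[OF fh c[OF \<rho>, of "i + 1"], of x]
        by (simp add: res_diff_def kos_diff_act res_bimod_def kos_bimod_def)
    qed
    show "res_diff f (Suc n) (ract (res_bimod (Suc n)) \<rho> x) = ract (res_bimod n) (res_diff f (Suc n) \<rho>) x" for x
    proof
      fix i
      show "res_diff f (Suc n) (ract (res_bimod (Suc n)) \<rho> x) i = (ract (res_bimod n) (res_diff f (Suc n) \<rho>) x) i"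
        using bimod_homD(4)[OF fh c[OF \<rho>, of "i + 1"], of x]
        by (simp add: res_diff_def kos_diff_act res_bimod_def kos_bimod_def)
    qed
  qed
  show ?thesis
  proof (intro resolution.intro bimod_complex.intro resolution_axioms.intro bimodule_res hom res_aug_hom surj)
    show "res_diff f (Suc n) (res_diff f (Suc (Suc n)) m) = 0"
      if "m \<in> bcarrier (res_bimod (Suc (Suc n)))" for m n
      using ex[of n] that by blast
    show "res_aug (res_diff f (Suc 0) m) = 0" if "m \<in> bcarrier (res_bimod (Suc 0))" for m
      using ex0 that by blast
    show "m \<in> res_diff f (Suc (Suc n)) ` bcarrier (res_bimod (Suc (Suc n)))"
      if "m \<in> bcarrier (res_bimod (Suc n))" "res_diff f (Suc n) m = 0" for m n
      using ex[of n] that by blast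
    show "m \<in> res_diff f (Suc 0) ` bcarrier (res_bimod (Suc 0))"
      if "m \<in> bcarrier (res_bimod 0)" "res_aug m = 0" for m
      using ex0 that by blast
  qed
qed

section \<open>Classes represented on the resolution\<close>

locale comparison =
  fixes f :: "nat \<Rightarrow> 'k::field kos \<Rightarrow> 'k kos" and \<iota> :: "nat \<Rightarrow> (nat \<Rightarrow> 'k kos) \<Rightarrow> 'k bar"
  assumes res: "fk_resolution f" and comp: "fk_comparison f \<iota>"
begin

sublocale P: resolution res_scale res_bimod "\<lambda>n. res_diff f (Suc n)" res_aug
  by (rule resolution_res[OF res])

sublocale B: resolution bar_scale bar_bimod "\<lambda>n. bar_diff" bar_aug
  by (rule resolution_bar)

lemma iota_hom: "\<iota> n \<in> bimod_hom (res_bimod n) (bar_bimod n)"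
  and iota_diff: "\<rho> \<in> bcarrier (res_bimod (Suc n)) \<Longrightarrow>
    bar_diff (\<iota> (Suc n) \<rho>) = \<iota> n (res_diff f (Suc n) \<rho>)"
  and iota_aug: "\<rho> \<in> bcarrier (res_bimod 0) \<Longrightarrow> bar_aug (\<iota> 0 \<rho>) = res_aug \<rho>"
  using comp by (auto simp: fk_comparison_def)

lemma iota_len: "\<rho> \<in> bcarrier (res_bimod n) \<Longrightarrow> \<iota> n \<rho> \<in> bar_len (Suc (Suc n))"
  using bimod_homD(1)[OF iota_hom] by simp

abbreviation cob where "cob \<equiv> res_coboundary f"

lemma cob_0: "cob 0 \<phi> \<longleftrightarrow> (\<forall>\<rho>\<in>bcarrier (res_bimod 0). \<phi> \<rho> = 0)"
  and cob_Suc: "cob (Suc n) \<phi> \<longleftrightarrow> (\<exists>\<psi>\<in>bimod_hom (res_bimod n) fk_bimod.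
    \<forall>\<rho>\<in>bcarrier (res_bimod (Suc n)). \<phi> \<rho> = \<psi> (res_diff f (Suc n) \<rho>))"
  by (simp_all add: res_coboundary_def)

lemma cobI: "\<psi> \<in> bimod_hom (res_bimod n) fk_bimod \<Longrightarrow>
    (\<And>\<rho>. \<rho> \<in> bcarrier (res_bimod (Suc n)) \<Longrightarrow> \<phi> \<rho> = \<psi> (res_diff f (Suc n) \<rho>)) \<Longrightarrow> cob (Suc n) \<phi>"
  unfolding cob_Suc by (rule bexI) simp_all

lemma cobE:
  assumes "cob (Suc n) \<phi>"
  obtains \<psi> where "\<psi> \<in> bimod_hom (res_bimod n) fk_bimod"
    "\<And>\<rho>. \<rho> \<in> bcarrier (res_bimod (Suc n)) \<Longrightarrow> \<phi> \<rho> = \<psi> (res_diff f (Suc n) \<rho>)"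
  using assms unfolding cob_Suc by (elim bexE) (rule that; simp)

lemma cob_cong:
  "(\<And>\<rho>. \<rho> \<in> bcarrier (res_bimod n) \<Longrightarrow> \<phi> \<rho> = \<phi>' \<rho>) \<Longrightarrow> cob n \<phi> \<longleftrightarrow> cob n \<phi>'"
  by (cases n) (simp_all add: cob_0 cob_Suc)

lemma cob_zero: "cob n (\<lambda>\<rho>. 0)"
proof (cases n)
  case 0
  then show ?thesis by (simp add: cob_0)
next
  case (Suc l)
  show ?thesis unfolding Suc by (rule cobI[OF bimod_hom_zero[OF bimodule_fk]]) simp
qed

lemma cob_add: "cob n \<phi> \<Longrightarrow> cob n \<phi>' \<Longrightarrow> cob n (\<lambda>\<rho>. \<phi> \<rho> + \<phi>' \<rho>)"
proof (cases n)
  case (Suc l)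
  assume "cob n \<phi>" "cob n \<phi>'"
  then obtain \<psi> \<psi>' where "\<psi> \<in> bimod_hom (res_bimod l) fk_bimod" "\<psi>' \<in> bimod_hom (res_bimod l) fk_bimod"
    "\<And>\<rho>. \<rho> \<in> bcarrier (res_bimod (Suc l)) \<Longrightarrow> \<phi> \<rho> = \<psi> (res_diff f (Suc l) \<rho>)"
    "\<And>\<rho>. \<rho> \<in> bcarrier (res_bimod (Suc l)) \<Longrightarrow> \<phi>' \<rho> = \<psi>' (res_diff f (Suc l) \<rho>)"
    unfolding Suc by (metis cobE)
  then show ?thesis unfolding Suc by (intro cobI[OF bimod_hom_add[OF bimodule_fk]]) simp_all
qed (simp add: cob_0)

lemma cob_scale: "cob n \<phi> \<Longrightarrow> cob n (\<lambda>\<rho>. fk_scale c (\<phi> \<rho>))"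
proof (cases n)
  case (Suc l)
  assume "cob n \<phi>"
  then obtain \<psi> where "\<psi> \<in> bimod_hom (res_bimod l) fk_bimod"
    "\<And>\<rho>. \<rho> \<in> bcarrier (res_bimod (Suc l)) \<Longrightarrow> \<phi> \<rho> = \<psi> (res_diff f (Suc l) \<rho>)"
    unfolding Suc by (metis cobE)
  then show ?thesis unfolding Suc by (intro cobI[OF bimod_hom_scale[OF bimodule_fk]]) simp_all
qed (simp add: cob_0)

lemma cob_diff: "cob n \<phi> \<Longrightarrow> cob n \<phi>' \<Longrightarrow> cob n (\<lambda>\<rho>. \<phi> \<rho> - \<phi>' \<rho>)"
  using cob_add[OF _ cob_scale[of n \<phi>' "- 1"], of \<phi>] by (simp add: fk.scale_minus_left)

text \<open>The predicate under the definite description of \<open>hh_of_res\<close>. As a relation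
  it can be carried through sums, brackets and products, and uniqueness is invoked only at the
  end.\<close>

definition represents :: "nat \<Rightarrow> ((nat \<Rightarrow> 'k kos) \<Rightarrow> 'k fk3) \<Rightarrow> 'k hh \<Rightarrow> bool"
  where "represents n \<phi> x \<longleftrightarrow> (\<exists>g\<in>cochains_deg n. hoch_diff g = 0 \<and> x = abs_hh g \<and>
    cob n (\<lambda>\<rho>. cochain_ext g (\<iota> n \<rho>) - \<phi> \<rho>))"

lemma cochains_deg_multilinear: "g \<in> cochains_deg n \<Longrightarrow> multilinear g"
  by (simp add: cochains_deg_def)

lemma cocycle_deg: "g \<in> cochains_deg n \<Longrightarrow> hoch_diff g = 0 \<Longrightarrow> g \<in> cocycles"
  using cochains_deg_subset by (auto simp: cocycles_def)

lemma cocycle_ext: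
  assumes "g \<in> cochains_deg n" "hoch_diff g = 0" "t \<in> bar_len (Suc (Suc m))"
  shows "cochain_ext g (bar_diff t) = 0"
  using cochain_ext_hoch_diff[OF cochains_deg_multilinear[OF assms(1)] assms(3)] assms(2)
  by (simp add: cochain_ext_zero)

lemma cochain_ext_diff:
  "cochain_ext (\<lambda>xs. g xs - h xs) t = cochain_ext g t - cochain_ext h t"
  "cochain_ext (\<lambda>xs. g xs + h xs) t = cochain_ext g t + cochain_ext h t"
  "cochain_ext (\<lambda>xs. fk_scale c (g xs)) t = fk_scale c (cochain_ext g t)"
  by (auto simp: cochain_ext_def bar_ext_def lin_comb_def algebra_simps fk.scale_right_distrib
      fk.scale_right_diff_distrib fk_scale_mult fk.scale_sum_right mult.commute
      simp flip: sum.distrib sum_subtractf intro!: sum.cong)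

lemma cochain_ext_eqD:
  assumes "g \<in> cochains_deg n" "h \<in> cochains_deg n"
    "\<And>t. t \<in> bar_len (Suc (Suc n)) \<Longrightarrow> cochain_ext g t = cochain_ext h t"
  shows "g = h"
proof
  fix xs
  show "g xs = h xs"
  proof (cases "length xs = n")
    case True
    then show ?thesis
      using assms(3)[of "bar_pure (1 # xs @ [1])"] assms(1,2)
      by (simp add: cochains_deg_def cochain_ext_pure cochain_right_pure)
  next
    case False
    then show ?thesis using assms(1,2) by (simp add: cochains_deg_def)
  qed
qed

lemma hoch_diff_cochains_deg:
  assumes "g \<in> cochains_deg n" shows "hoch_diff g \<in> cochains_deg (Suc n)"
proof -
  have "hoch_diff g xs = 0" if len: "length xs \<noteq> Suc n" for xs
  proof -
    have "hoch_diff g xs = hoch_diff 0 xs"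
      by (rule hoch_diff_cong) (use assms cochains_zero len in \<open>auto simp: cochains_deg_def cochains_def\<close>)
    then show ?thesis by (simp add: hoch_diff_zero)
  qed
  then show ?thesis using assms by (simp add: cochains_deg_def multilinear_hoch_diff)
qed

text \<open>A comparison back to P, available because the bar resolution is free in every degree.
  Both composites with \<open>\<iota>\<close> lift the identity, so each differs from it by a map
  lifting 0, to which \<open>null_homotopic\<close> applies.\<close>

lemma retraction:
  obtains \<pi> where "\<And>k. \<pi> k \<in> bimod_hom (bar_bimod k) (res_bimod k)"
    "\<And>k t. t \<in> bar_len (Suc (Suc (Suc k))) \<Longrightarrow> res_diff f (Suc k) (\<pi> (Suc k) t) = \<pi> k (bar_diff t)"
    "\<And>t. t \<in> bar_len (Suc (Suc 0)) \<Longrightarrow> res_aug (\<pi> 0 t) = bar_aug t"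
proof -
  obtain T where "(\<forall>k. T k \<in> bimod_hom (bar_bimod k) (res_bimod k)) \<and>
      (\<forall>k. \<forall>x\<in>bcarrier (bar_bimod (Suc k)). res_diff f (Suc k) (T (Suc k) x) = T k (bar_diff x)) \<and>
      (\<forall>x\<in>bcarrier (bar_bimod 0). res_aug (T 0 x) = bar_aug x)"
    using chain_map_exists[OF resolution_bar resolution_res[OF res] projective_bar projective_bar,
        OF bimodule_res bimodule_res bimodule_fk bimodule_res] by blast
  then show thesis by (intro that[of T]) auto
qed

text \<open>Injectivity of composition with \<open>\<iota>\<close>: h is the difference of
  h\<iota>\<pi> and h(\<iota>\<pi> - 1). The first is a coboundary by assumption, the second because
  \<iota>\<pi> - 1 lifts 0.\<close>

lemma cocycle_cob_imp_coboundary: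
  assumes h: "h \<in> cochains_deg n" "hoch_diff h = 0" and c: "cob n (\<lambda>\<rho>. cochain_ext h (\<iota> n \<rho>))"
  shows "h \<in> coboundaries"
proof -
  obtain \<pi> where \<pi>: "\<And>k. \<pi> k \<in> bimod_hom (bar_bimod k) (res_bimod k)"
    "\<And>k t. t \<in> bar_len (Suc (Suc (Suc k))) \<Longrightarrow> res_diff f (Suc k) (\<pi> (Suc k) t) = \<pi> k (bar_diff t)"
    "\<And>t. t \<in> bar_len (Suc (Suc 0)) \<Longrightarrow> res_aug (\<pi> 0 t) = bar_aug t" by (rule retraction) blast
  have hm: "multilinear h" using h(1) by (rule cochains_deg_multilinear)
  let ?T = "\<lambda>k t. \<iota> k (\<pi> k t) - t"
  have T: "?T k \<in> bimod_hom (bar_bimod k) (bar_bimod k)" for k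
    by (intro bimod_hom_diff[OF bimodule_bar] bimod_hom_comp[OF \<pi>(1) iota_hom] bimod_hom_id)
  have pc: "t \<in> bar_len (Suc (Suc k)) \<Longrightarrow> \<pi> k t \<in> bcarrier (res_bimod k)" for k t
    using bimod_homD(1)[OF \<pi>(1)] by simp
  have chain: "bar_diff (?T (Suc k) t) = ?T k (bar_diff t)" if "t \<in> bcarrier (bar_bimod (Suc k))" for k t
    using that by (simp add: iota_diff pc \<pi>)
  have aug: "bar_aug (?T 0 t) = 0" if "t \<in> bcarrier (bar_bimod 0)" for t
    using that by (simp add: linearD[OF linear_bar_aug] iota_aug pc \<pi>)
  have c0: "cochain_ext h (bar_diff y) = 0" if "y \<in> bcarrier (bar_bimod (Suc n))" for y
    using that cocycle_ext[OF h, of y "Suc n"] by simp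
  have null1: "cochain_ext h (?T 0 x) = 0" if "n = 0" "x \<in> bcarrier (bar_bimod 0)" for x
    by (rule null_homotopic(1)[where m = n and T = ?T and M = bar_bimod and N = bar_bimod,
          OF B.bimod_complex_axioms resolution_bar];
        (assumption | rule that projective_bar[OF bimodule_bar bimodule_bar] T chain aug cochain_ext_hom[OF hm] c0)+)
  have null2: "\<exists>\<psi>\<in>bimod_hom (bar_bimod l) fk_bimod.
      \<forall>x\<in>bcarrier (bar_bimod n). cochain_ext h (?T n x) = \<psi> (bar_diff x)" if "n = Suc l" for l
    by (rule null_homotopic(2)[where m = n and T = ?T and M = bar_bimod and N = bar_bimod,
          OF B.bimod_complex_axioms resolution_bar];
        (assumption | rule that projective_bar[OF bimodule_bar bimodule_bar] T chain aug cochain_ext_hom[OF hm] c0)+)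
  have split: "cochain_ext h t = cochain_ext h (\<iota> n (\<pi> n t)) - cochain_ext h (?T n t)" for t
    by (simp add: linearD[OF linear_cochain_ext[OF hm]])
  show ?thesis
  proof (cases n)
    case 0
    have "cochain_ext h t = 0" if "t \<in> bar_len (Suc (Suc 0))" for t
      using that null1[OF 0, of t] c split[of t] by (simp add: 0 cob_0 pc)
    moreover have "0 \<in> cochains_deg n"
      using cochains_zero by (simp add: cochains_deg_def cochains_def)
    ultimately have "h = 0"
      using h(1) by (intro cochain_ext_eqD[of h n 0]) (simp_all add: 0 cochain_ext_zero)
    then show ?thesis by (simp add: coboundaries_closed)
  next
    case (Suc l)
    obtain \<psi> where \<psi>: "\<psi> \<in> bimod_hom (bar_bimod l) fk_bimod"
      "\<And>t. t \<in> bar_len (Suc (Suc n)) \<Longrightarrow> cochain_ext h (?T n t) = \<psi> (bar_diff t)"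
      using null2[OF Suc] by auto
    obtain \<chi> where \<chi>: "\<chi> \<in> bimod_hom (res_bimod l) fk_bimod"
      "\<And>\<rho>. \<rho> \<in> bcarrier (res_bimod n) \<Longrightarrow> cochain_ext h (\<iota> n \<rho>) = \<chi> (res_diff f n \<rho>)"
      using c unfolding Suc by (elim cobE) blast
    have "(\<lambda>t. \<chi> (\<pi> l t) - \<psi> t) \<in> bimod_hom (bar_bimod l) fk_bimod"
      by (intro bimod_hom_diff[OF bimodule_fk] bimod_hom_comp[OF \<pi>(1) \<chi>(1)] \<psi>(1))
    from cochain_of_hom[OF this] obtain g where g: "g \<in> cochains_deg l"
      "\<And>t. t \<in> bar_len (Suc (Suc l)) \<Longrightarrow> cochain_ext g t = \<chi> (\<pi> l t) - \<psi> t" by auto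
    have "h = hoch_diff g"
    proof (rule cochain_ext_eqD[OF h(1)])
      show "hoch_diff g \<in> cochains_deg n" unfolding Suc by (rule hoch_diff_cochains_deg[OF g(1)])
      fix t :: "'k bar" assume t: "t \<in> bar_len (Suc (Suc n))"
      then have dt: "bar_diff t \<in> bar_len (Suc (Suc l))" unfolding Suc by (rule bar_diff_len)
      have "cochain_ext h t = \<chi> (res_diff f n (\<pi> n t)) - \<psi> (bar_diff t)"
        using split[of t] \<psi>(2)[OF t] \<chi>(2)[OF pc[OF t]] by simp
      also have "res_diff f n (\<pi> n t) = \<pi> l (bar_diff t)" using \<pi>(2) t by (simp add: Suc)
      also have "\<chi> (\<pi> l (bar_diff t)) - \<psi> (bar_diff t) = cochain_ext (hoch_diff g) t"
        using cochain_ext_hoch_diff[OF cochains_deg_multilinear[OF g(1)] t] g(2)[OF dt] by simp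
      finally show "cochain_ext h t = cochain_ext (hoch_diff g) t" .
    qed
    then show ?thesis using g(1) cochains_deg_subset by (auto simp: coboundaries_def)
  qed
qed

lemma cochains_deg_diff:
  assumes "g \<in> cochains_deg n" "h \<in> cochains_deg n"
  shows "(\<lambda>xs. g xs - h xs) \<in> cochains_deg n" "(\<lambda>xs. g xs + h xs) \<in> cochains_deg n"
    "(\<lambda>xs. fk_scale c (g xs)) \<in> cochains_deg n"
  using assms multilinear_diff_scale[of g h 1 1] multilinear_diff_scale[of g h 1 "- 1"]
    multilinear_diff_scale[of g h c 0]
  by (simp_all add: cochains_deg_def fk.scale_minus_left)

lemma represents_unique:
  assumes "represents n \<phi> x" "represents n \<psi> y" "cob n (\<lambda>\<rho>. \<phi> \<rho> - \<psi> \<rho>)"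
  shows "x = y"
proof -
  obtain g where g: "g \<in> cochains_deg n" "hoch_diff g = 0" "x = abs_hh g"
    "cob n (\<lambda>\<rho>. cochain_ext g (\<iota> n \<rho>) - \<phi> \<rho>)" using assms(1) by (auto simp: represents_def)
  obtain h where h: "h \<in> cochains_deg n" "hoch_diff h = 0" "y = abs_hh h"
    "cob n (\<lambda>\<rho>. cochain_ext h (\<iota> n \<rho>) - \<psi> \<rho>)" using assms(2) by (auto simp: represents_def)
  have gh: "(\<lambda>xs. g xs - h xs) = g - h" by (simp add: fun_diff_def)
  have 1: "(\<lambda>xs. g xs - h xs) \<in> cochains_deg n" by (rule cochains_deg_diff[OF g(1) h(1)])
  have "hoch_diff (\<lambda>xs. g xs - h xs) = 0"
    using hoch_diff_comb[of 1 g 1 h] g(2) h(2) by (simp add: zero_fun_def)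
  moreover have "cob n (\<lambda>\<rho>. cochain_ext (\<lambda>xs. g xs - h xs) (\<iota> n \<rho>))"
    using cob_add[OF cob_diff[OF g(4) h(4)] assms(3)] by (simp add: cochain_ext_diff algebra_simps)
  ultimately have "g - h \<in> coboundaries" using cocycle_cob_imp_coboundary[OF 1] gh by simp
  then show ?thesis using g h by (simp add: abs_hh_eq_iff cocycle_deg)
qed

lemma represents_cob: "represents n \<phi> x \<Longrightarrow> cob n (\<lambda>\<rho>. \<phi> \<rho> - \<psi> \<rho>) \<Longrightarrow> represents n \<psi> x"
  unfolding represents_def using cob_add[of n _ "\<lambda>\<rho>. \<phi> \<rho> - \<psi> \<rho>"] by fastforce

lemma represents_cong:
  "represents n \<phi> x \<Longrightarrow> (\<And>\<rho>. \<rho> \<in> bcarrier (res_bimod n) \<Longrightarrow> \<phi> \<rho> = \<psi> \<rho>) \<Longrightarrow> represents n \<psi> x"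
  by (erule represents_cob) (use cob_zero cob_cong[of n "\<lambda>\<rho>. \<phi> \<rho> - \<psi> \<rho>" "\<lambda>\<rho>. 0"] in simp)

lemma abs_hh_ops:
  "g \<in> cocycles \<Longrightarrow> h \<in> cocycles \<Longrightarrow> abs_hh g + abs_hh h = abs_hh (\<lambda>xs. g xs + h xs)"
  "g \<in> cocycles \<Longrightarrow> c \<cdot> abs_hh g = abs_hh (\<lambda>xs. fk_scale c (g xs))"
  by (simp_all add: plus_hh.abs_eq hh_scale.abs_eq cohomologous_refl plus_fun_def)

lemma represents_add:
  assumes "represents n \<phi> x" "represents n \<psi> y"
  shows "represents n (\<lambda>\<rho>. \<phi> \<rho> + \<psi> \<rho>) (x + y)"
proof -
  obtain g where g: "g \<in> cochains_deg n" "hoch_diff g = 0" "x = abs_hh g"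
    "cob n (\<lambda>\<rho>. cochain_ext g (\<iota> n \<rho>) - \<phi> \<rho>)" using assms(1) by (auto simp: represents_def)
  obtain h where h: "h \<in> cochains_deg n" "hoch_diff h = 0" "y = abs_hh h"
    "cob n (\<lambda>\<rho>. cochain_ext h (\<iota> n \<rho>) - \<psi> \<rho>)" using assms(2) by (auto simp: represents_def)
  have "hoch_diff (\<lambda>xs. g xs + h xs) = 0"
    using hoch_diff_add[of g h] g(2) h(2) by (simp add: plus_fun_def zero_fun_def)
  moreover have "cob n (\<lambda>\<rho>. cochain_ext (\<lambda>xs. g xs + h xs) (\<iota> n \<rho>) - (\<phi> \<rho> + \<psi> \<rho>))"
    using cob_add[OF g(4) h(4)] by (simp add: cochain_ext_diff algebra_simps)
  ultimately show ?thesis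
    unfolding represents_def using cochains_deg_diff[OF g(1) h(1)] g h
    by (intro bexI[of _ "\<lambda>xs. g xs + h xs"]) (simp_all add: abs_hh_ops cocycle_deg)
qed

lemma represents_scale:
  assumes "represents n \<phi> x" shows "represents n (\<lambda>\<rho>. fk_scale c (\<phi> \<rho>)) (c \<cdot> x)"
proof -
  obtain g where g: "g \<in> cochains_deg n" "hoch_diff g = 0" "x = abs_hh g"
    "cob n (\<lambda>\<rho>. cochain_ext g (\<iota> n \<rho>) - \<phi> \<rho>)" using assms by (auto simp: represents_def)
  have "hoch_diff (\<lambda>xs. fk_scale c (g xs)) = 0"
    using hoch_diff_scale[of c g] g(2) by (simp add: zero_fun_def)
  moreover have "cob n (\<lambda>\<rho>. cochain_ext (\<lambda>xs. fk_scale c (g xs)) (\<iota> n \<rho>) - fk_scale c (\<phi> \<rho>))"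
    using cob_scale[OF g(4), of c] by (simp add: cochain_ext_diff fk.scale_right_diff_distrib)
  ultimately show ?thesis
    unfolding represents_def using cochains_deg_diff[OF g(1) g(1)] g
    by (intro bexI[of _ "\<lambda>xs. fk_scale c (g xs)"]) (simp_all add: abs_hh_ops cocycle_deg)
qed

lemma represents_zero: "represents n (\<lambda>\<rho>. 0) 0"
proof -
  have "0 \<in> cochains_deg n" using cochains_zero by (simp add: cochains_deg_def cochains_def)
  then show ?thesis
    unfolding represents_def using cob_zero
    by (intro bexI[of _ 0]) (simp_all add: hoch_diff_zero zero_hh_def cochain_ext_zero)
qed

text \<open>Surjectivity of composition with \<open>\<iota>\<close>: the preimage is \<phi>\<pi>,
  and \<phi>(\<pi>\<iota> - 1) is a coboundary since \<pi>\<iota> - 1 lifts 0 on P. This uses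
  projectivity of P_k for k < n, whence the bound on n.\<close>

lemma represents_exists:
  assumes n: "n \<le> 4" and \<phi>: "\<phi> \<in> bimod_hom (res_bimod n) fk_bimod"
    and cocycle: "\<And>\<rho>. \<rho> \<in> bcarrier (res_bimod (Suc n)) \<Longrightarrow> \<phi> (res_diff f (Suc n) \<rho>) = 0"
  shows "\<exists>x. represents n \<phi> x"
proof -
  obtain \<pi> where \<pi>: "\<And>k. \<pi> k \<in> bimod_hom (bar_bimod k) (res_bimod k)"
    "\<And>k t. t \<in> bar_len (Suc (Suc (Suc k))) \<Longrightarrow> res_diff f (Suc k) (\<pi> (Suc k) t) = \<pi> k (bar_diff t)"
    "\<And>t. t \<in> bar_len (Suc (Suc 0)) \<Longrightarrow> res_aug (\<pi> 0 t) = bar_aug t" by (rule retraction) blast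
  have pc: "t \<in> bar_len (Suc (Suc k)) \<Longrightarrow> \<pi> k t \<in> bcarrier (res_bimod k)" for k t
    using bimod_homD(1)[OF \<pi>(1)] by simp
  obtain g where g: "g \<in> cochains_deg n" "\<And>t. t \<in> bar_len (Suc (Suc n)) \<Longrightarrow> cochain_ext g t = \<phi> (\<pi> n t)"
    using cochain_of_hom[OF bimod_hom_comp[OF \<pi>(1) \<phi>]] by auto
  have "hoch_diff g = 0"
  proof (rule cochain_ext_eqD[OF hoch_diff_cochains_deg[OF g(1)]])
    show "0 \<in> cochains_deg (Suc n)" using cochains_zero by (simp add: cochains_deg_def cochains_def)
    fix t :: "'k bar" assume t: "t \<in> bar_len (Suc (Suc (Suc n)))"
    have "cochain_ext (hoch_diff g) t = \<phi> (\<pi> n (bar_diff t))"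
      using cochain_ext_hoch_diff[OF cochains_deg_multilinear[OF g(1)] t] g(2)[OF bar_diff_len[OF t]] by simp
    also have "\<dots> = 0" using cocycle[OF pc[OF t]] \<pi>(2)[OF t] by simp
    finally show "cochain_ext (hoch_diff g) t = cochain_ext 0 t" by (simp add: cochain_ext_zero)
  qed
  moreover have "cob n (\<lambda>\<rho>. cochain_ext g (\<iota> n \<rho>) - \<phi> \<rho>)"
  proof -
    let ?T = "\<lambda>k \<rho>. \<pi> k (\<iota> k \<rho>) - \<rho>"
    have T: "?T k \<in> bimod_hom (res_bimod k) (res_bimod k)" for k
      by (intro bimod_hom_diff[OF bimodule_res] bimod_hom_comp[OF iota_hom \<pi>(1)] bimod_hom_id)
    note dm = bimod_hom_more(4)[OF bimodule_res bimodule_res P.d_hom]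
      bimod_hom_more(4)[OF bimodule_res bimodule_fk res_aug_hom]
    have chain: "res_diff f (Suc k) (?T (Suc k) \<rho>) = ?T k (res_diff f (Suc k) \<rho>)"
      if "\<rho> \<in> bcarrier (res_bimod (Suc k))" for k \<rho>
      using that by (simp add: dm pc iota_len \<pi>(2) iota_diff)
    have aug: "res_aug (?T 0 \<rho>) = 0" if "\<rho> \<in> bcarrier (res_bimod 0)" for \<rho>
      using that by (simp add: dm pc iota_len \<pi>(3) iota_aug)
    have proj: "projective_for (res_bimod k) (res_bimod (Suc k)) (res_bimod k :: ('k, _) bimod)" if "k < n" for k
      using that n by (intro projective_res[OF _ bimodule_res bimodule_res]) simp
    have null1: "\<phi> (?T 0 x) = 0" if "n = 0" "x \<in> bcarrier (res_bimod 0)" for x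
      by (rule null_homotopic(1)[where m = n and T = ?T and M = res_bimod and N = res_bimod,
            OF P.bimod_complex_axioms resolution_res[OF res]];
          (assumption | rule that proj T chain aug \<phi> cocycle)+)
    have null2: "\<exists>\<psi>\<in>bimod_hom (res_bimod l) fk_bimod.
        \<forall>x\<in>bcarrier (res_bimod n). \<phi> (?T n x) = \<psi> (res_diff f (Suc l) x)" if "n = Suc l" for l
      by (rule null_homotopic(2)[where m = n and T = ?T and M = res_bimod and N = res_bimod,
            OF P.bimod_complex_axioms resolution_res[OF res]];
          (assumption | rule that proj T chain aug \<phi> cocycle)+)
    have split: "cochain_ext g (\<iota> n \<rho>) - \<phi> \<rho> = \<phi> (?T n \<rho>)" if "\<rho> \<in> bcarrier (res_bimod n)" for \<rho>
      using that g(2)[OF iota_len[OF that]]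
      by (simp add: bimod_hom_more(4)[OF bimodule_res bimodule_fk \<phi>] pc iota_len)
    show ?thesis
    proof (cases n)
      case 0
      have "\<phi> (?T 0 \<rho>) = 0" if "\<rho> \<in> bcarrier (res_bimod 0)" for \<rho>
        by (rule null1[OF 0 that])
      then show ?thesis using split unfolding 0 cob_0 by metis
    next
      case (Suc l)
      then show ?thesis using split null2[OF Suc] unfolding Suc cob_Suc by metis
    qed
  qed
  ultimately have "represents n \<phi> (abs_hh g)" using g(1) by (auto simp: represents_def)
  then show ?thesis ..
qed

lemma hh_of_res_eq: "represents n \<phi> x \<Longrightarrow> hh_of_res f \<iota> n \<phi> = x"
proof -
  assume x: "represents n \<phi> x"
  have c: "cob n (\<lambda>\<rho>. \<phi> \<rho> - \<phi> \<rho>)" using cob_zero by simp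
  show ?thesis
    unfolding hh_of_res_def represents_def[symmetric]
    by (rule the_equality[where P = "represents n \<phi>", OF x]) (rule represents_unique[OF _ x c])
qed

lemma represents_hh_of_res:
  assumes "n \<le> 4" "\<phi> \<in> bimod_hom (res_bimod n) fk_bimod"
    "\<And>\<rho>. \<rho> \<in> bcarrier (res_bimod (Suc n)) \<Longrightarrow> \<phi> (res_diff f (Suc n) \<rho>) = 0"
  shows "represents n \<phi> (hh_of_res f \<iota> n \<phi>)"
  using represents_exists[OF assms] hh_of_res_eq by auto

end

subsection \<open>Brackets with derivations and cup products\<close>

definition res_der :: "'k::field cochain \<Rightarrow> nat \<Rightarrow> ((nat \<Rightarrow> 'k kos) \<Rightarrow> nat \<Rightarrow> 'k kos) \<Rightarrow> bool"
  where "res_der D n T \<longleftrightarrow> (\<forall>\<rho>\<in>bcarrier (res_bimod n). T \<rho> \<in> bcarrier (res_bimod n) \<and>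
    (\<forall>\<rho>'\<in>bcarrier (res_bimod n). T (\<rho> + \<rho>') = T \<rho> + T \<rho>') \<and>
    (\<forall>x. T (lact (res_bimod n) x \<rho>) = lact (res_bimod n) (D [x]) \<rho> + lact (res_bimod n) x (T \<rho>)) \<and>
    (\<forall>x. T (ract (res_bimod n) \<rho> x) = ract (res_bimod n) \<rho> (D [x]) + ract (res_bimod n) (T \<rho>) x))"

lemma res_derD:
  assumes "res_der D n T"
  shows "\<rho> \<in> bcarrier (res_bimod n) \<Longrightarrow> T \<rho> \<in> bcarrier (res_bimod n)"
    "\<rho> \<in> bcarrier (res_bimod n) \<Longrightarrow> \<rho>' \<in> bcarrier (res_bimod n) \<Longrightarrow> T (\<rho> + \<rho>') = T \<rho> + T \<rho>'"
    "\<rho> \<in> bcarrier (res_bimod n) \<Longrightarrow>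
      T (lact (res_bimod n) x \<rho>) = lact (res_bimod n) (D [x]) \<rho> + lact (res_bimod n) x (T \<rho>)"
    "\<rho> \<in> bcarrier (res_bimod n) \<Longrightarrow>
      T (ract (res_bimod n) \<rho> x) = ract (res_bimod n) \<rho> (D [x]) + ract (res_bimod n) (T \<rho>) x"
  using assms by (simp_all add: res_der_def)

lemma fk_bimod_simps [simp]: "bcarrier fk_bimod = UNIV" "lact fk_bimod = (*)" "ract fk_bimod = (*)"
  by (simp_all add: fk_bimod_def)

lemma derivation_linear:
  assumes "multilinear D" shows "Vector_Spaces.linear fk_scale fk_scale (\<lambda>x. D [x])"
  using assms[unfolded multilinear_def, rule_format, of "[]" "[]"] by simp

text \<open>The terms with D applied to the acting element cancel, so the commutator of a morphism
  with a lift of D is again a bimodule morphism.\<close>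

lemma res_der_commutator_hom:
  assumes D: "multilinear D" "hoch_diff D = 0" and T: "res_der D n T"
    and \<psi>: "\<psi> \<in> bimod_hom (res_bimod n) fk_bimod"
  shows "(\<lambda>\<rho>. D [\<psi> \<rho>] - \<psi> (T \<rho>)) \<in> bimod_hom (res_bimod n) fk_bimod"
proof -
  note C = bimodule.carrier_closed[OF bimodule_res]
  show ?thesis
    by (rule bimod_homI)
      (simp_all add: bimod_homD[OF \<psi>] res_derD[OF T] C linearD[OF derivation_linear[OF D(1)]]
        derivation_cocycle[OF D] algebra_simps)
qed

context comparison
begin

text \<open>Two coboundaries arise. The difference of \<open>\<iota>\<close> after
  \<open>\<delta>\<close> and \<open>bar_der D\<close> after \<open>\<iota>\<close> is a chain map
  of bimodules lifting 0. The error c of \<open>g\<close> composed with \<open>\<iota>\<close>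
  against \<open>\<phi>\<close> has the form \<psi>d, and its commutator with
  \<open>\<delta>\<close> is the coboundary of the commutator of \<psi>.\<close>

lemma bracket_represents:
  assumes D: "D \<in> cochains_deg 1" "hoch_diff D = 0" and n: "n \<le> 4"
    and \<delta>: "\<And>k. k \<le> n \<Longrightarrow> res_der D k (\<delta> k)"
    and chain: "\<And>k \<rho>. k < n \<Longrightarrow> \<rho> \<in> bcarrier (res_bimod (Suc k)) \<Longrightarrow>
      res_diff f (Suc k) (\<delta> (Suc k) \<rho>) = \<delta> k (res_diff f (Suc k) \<rho>)"
    and aug: "\<And>\<rho>. \<rho> \<in> bcarrier (res_bimod 0) \<Longrightarrow> res_aug (\<delta> 0 \<rho>) = D [res_aug \<rho>]"
    and \<phi>: "\<phi> \<in> bimod_hom (res_bimod n) fk_bimod" and y: "represents n \<phi> y"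
  shows "represents n (\<lambda>\<rho>. D [\<phi> \<rho>] - \<phi> (\<delta> n \<rho>)) (hh_bracket (abs_hh D) y)"
proof -
  obtain g where g: "g \<in> cochains_deg n" "hoch_diff g = 0" "y = abs_hh g"
    "cob n (\<lambda>\<rho>. cochain_ext g (\<iota> n \<rho>) - \<phi> \<rho>)" using y by (auto simp: represents_def)
  have mD: "multilinear D" and mg: "multilinear g" using D g by (simp_all add: cochains_deg_def)
  note linD = linearD[OF derivation_linear[OF mD]] and ling = linearD[OF linear_cochain_ext[OF mg]]
  let ?G = "gerstenhaber D g"
  have G_deg: "?G \<in> cochains_deg n"
  proof -
    have "?G xs = 0" if "length xs \<noteq> n" for xs
      using that g(1) multilinear_zero_arg[OF mD, of "[]" "[]"]
      by (simp add: gerstenhaber_derivation[OF D(1) mg] cochains_deg_def)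
    then show ?thesis by (simp add: cochains_deg_def multilinear_gerstenhaber_derivation[OF D(1) mg])
  qed
  have "hoch_diff ?G = 0"
    using gerstenhaber_cocycle[OF D cocycle_deg[OF g(1,2)]] by (simp add: cocycles_def)
  moreover have "hh_bracket (abs_hh D) y = abs_hh ?G"
    unfolding g(3) by (rule hh_bracket_derivation[OF D cocycle_deg[OF g(1,2)]])
  moreover have "cob n (\<lambda>\<rho>. cochain_ext ?G (\<iota> n \<rho>) - (D [\<phi> \<rho>] - \<phi> (\<delta> n \<rho>)))"
  proof -
    let ?T = "\<lambda>k \<rho>. \<iota> k (\<delta> k \<rho>) - bar_der D (\<iota> k \<rho>)"
    note I = bimod_homD[OF iota_hom] bimod_hom_more[OF bimodule_res bimodule_bar iota_hom]
    note C = bimodule.carrier_closed[OF bimodule_res]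
    have T: "?T k \<in> bimod_hom (res_bimod k) (bar_bimod k)" if k: "k \<le> n" for k
    proof (rule bimod_homI)
      fix \<rho> \<rho>' :: "nat \<Rightarrow> 'k kos" and x
      assume \<rho>: "\<rho> \<in> bcarrier (res_bimod k)" and \<rho>': "\<rho>' \<in> bcarrier (res_bimod k)"
      note d = res_derD[OF \<delta>[OF k] ]
      show "?T k \<rho> \<in> bcarrier (bar_bimod k)"
        using \<rho> by (simp add: d iota_len bar_der_len[OF mD] bar_len_closed)
      show "?T k (\<rho> + \<rho>') = ?T k \<rho> + ?T k \<rho>'"
        using \<rho> \<rho>' by (simp add: d I linearD[OF linear_bar_der[OF mD]])
    next
      fix \<rho> :: "nat \<Rightarrow> 'k kos" and x
      assume \<rho>: "\<rho> \<in> bcarrier (res_bimod k)"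
      note d = res_derD[OF \<delta>[OF k] ]
      show "?T k (lact (res_bimod k) x \<rho>) = lact (bar_bimod k) x (?T k \<rho>)"
        using \<rho> by (simp add: d I C bar_der_lact[OF mD D(2) iota_len])
      show "?T k (ract (res_bimod k) \<rho> x) = ract (bar_bimod k) (?T k \<rho>) x"
        using \<rho> by (simp add: d I C bar_der_ract[OF mD D(2) iota_len])
    qed
    have chainT: "bar_diff (?T (Suc k) \<rho>) = ?T k (res_diff f (Suc k) \<rho>)"
      if "k < n" "\<rho> \<in> bcarrier (res_bimod (Suc k))" for k \<rho>
      using that res_derD(1)[OF \<delta>[of "Suc k"]] by (simp add: iota_diff bar_der_diff[OF mD D(2)] chain)
    have augT: "bar_aug (?T 0 \<rho>) = 0" if "\<rho> \<in> bcarrier (res_bimod 0)" for \<rho>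
    proof -
      have "bar_aug (bar_der D t) = D [bar_aug t]" if "t \<in> bar_len (Suc (Suc 0))" for t
        by (rule bar_len_linear_eq[OF linear_comp[OF linear_bar_der[OF mD] linear_bar_aug]
              linear_comp[OF linear_bar_aug derivation_linear[OF mD]] _ that])
          (auto simp: length_Suc_conv bar_der_pure[OF mD] linearD[OF linear_bar_aug] derivation_cocycle[OF mD D(2)]
            linD multilinear_zero_arg[OF mD, of "[]" "[]", simplified])
      then show ?thesis
        using that res_derD(1)[OF \<delta>[of 0]] by (simp add: linearD[OF linear_bar_aug] iota_aug iota_len aug)
    qed
    have c0: "cochain_ext g (bar_diff y) = 0" if "y \<in> bcarrier (bar_bimod (Suc n))" for y
      using that cocycle_ext[OF g(1,2), of y "Suc n"] by simp
    have proj: "projective_for (res_bimod k) (bar_bimod (Suc k)) (bar_bimod k :: ('k, _) bimod)" if "k < n" for k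
      using that n by (intro projective_res[OF _ bimodule_bar bimodule_bar]) simp
    have null1: "cochain_ext g (?T 0 x) = 0" if "n = 0" "x \<in> bcarrier (res_bimod 0)" for x
      by (rule null_homotopic(1)[where m = n and T = ?T and M = res_bimod and N = bar_bimod,
            OF P.bimod_complex_axioms resolution_bar];
          (assumption | rule that proj T chainT augT cochain_ext_hom[OF mg] c0)+)
    have null2: "\<exists>\<psi>\<in>bimod_hom (res_bimod l) fk_bimod.
        \<forall>x\<in>bcarrier (res_bimod n). cochain_ext g (?T n x) = \<psi> (res_diff f (Suc l) x)" if "n = Suc l" for l
      by (rule null_homotopic(2)[where m = n and T = ?T and M = res_bimod and N = bar_bimod,
            OF P.bimod_complex_axioms resolution_bar];
          (assumption | rule that proj T chainT augT cochain_ext_hom[OF mg] c0)+)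
    let ?c = "\<lambda>\<rho>. cochain_ext g (\<iota> n \<rho>) - \<phi> \<rho>"
    have cobT: "cob n (\<lambda>\<rho>. cochain_ext g (?T n \<rho>))"
    proof (cases n)
      case 0
      have "cochain_ext g (?T 0 x) = 0" if "x \<in> bcarrier (res_bimod 0)" for x by (rule null1[OF 0 that])
      then show ?thesis unfolding 0 cob_0 by blast
    next
      case (Suc l)
      from null2[OF Suc] show ?thesis unfolding Suc cob_Suc .
    qed
    moreover have "cob n (\<lambda>\<rho>. D [?c \<rho>] - ?c (\<delta> n \<rho>))"
    proof (cases n)
      case 0
      show ?thesis
        using g(4) res_derD(1)[OF \<delta>[of 0]] linD(4) unfolding 0 cob_0 by simp
    next
      case (Suc l)
      obtain \<psi> where \<psi>: "\<psi> \<in> bimod_hom (res_bimod l) fk_bimod"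
        "\<And>\<rho>. \<rho> \<in> bcarrier (res_bimod (Suc l)) \<Longrightarrow> ?c \<rho> = \<psi> (res_diff f (Suc l) \<rho>)"
        using g(4) unfolding Suc by (elim cobE) blast
      have dl: "res_der D l (\<delta> l)" by (rule \<delta>) (simp add: Suc)
      show ?thesis
        unfolding Suc
      proof (rule cobI[OF res_der_commutator_hom[OF mD D(2) dl \<psi>(1)]])
        fix \<rho> :: "nat \<Rightarrow> 'k kos" assume \<rho>: "\<rho> \<in> bcarrier (res_bimod (Suc l))"
        have d\<rho>: "\<delta> (Suc l) \<rho> \<in> bcarrier (res_bimod (Suc l))"
          using res_derD(1)[OF \<delta>[of "Suc l"] \<rho>] Suc by simp
        show "D [cochain_ext g (\<iota> (Suc l) \<rho>) - \<phi> \<rho>] - (cochain_ext g (\<iota> (Suc l) (\<delta> (Suc l) \<rho>)) - \<phi> (\<delta> (Suc l) \<rho>))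
            = D [\<psi> (res_diff f (Suc l) \<rho>)] - \<psi> (\<delta> l (res_diff f (Suc l) \<rho>))"
          using \<psi>(2)[OF \<rho>] \<psi>(2)[OF d\<rho>] chain[OF _ \<rho>] by (simp add: Suc)
      qed
    qed
    ultimately have "cob n (\<lambda>\<rho>. cochain_ext g (?T n \<rho>) + (D [?c \<rho>] - ?c (\<delta> n \<rho>)))" by (rule cob_add)
    moreover have "cochain_ext ?G (\<iota> n \<rho>) - (D [\<phi> \<rho>] - \<phi> (\<delta> n \<rho>))
        = cochain_ext g (?T n \<rho>) + (D [?c \<rho>] - ?c (\<delta> n \<rho>))" if "\<rho> \<in> bcarrier (res_bimod n)" for \<rho>
      using cochain_ext_gerstenhaber[OF D mg iota_len[OF that]] by (simp add: ling linD algebra_simps)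
    ultimately show ?thesis using cob_cong[of n] by (metis (no_types, lifting))
  qed
  ultimately show ?thesis using G_deg by (auto simp: represents_def)
qed

text \<open>\<open>H\<close> lifts \<open>h\<close> on the bar resolution and \<open>\<Psi>\<close>
  lifts \<open>\<psi>\<close> on P; both are compared through \<open>\<iota>\<close>. The cup
  product is \<open>g\<close> after \<open>H\<close>, hence up to coboundaries \<open>\<phi>\<close>
  after \<open>\<Psi>\<close>: the right factor is lifted and the left one evaluated.\<close>

lemma cup_represents:
  assumes x: "represents m \<phi> x" "\<phi> \<in> bimod_hom (res_bimod m) fk_bimod"
    and y: "represents n \<psi> y" and mn: "n + m \<le> 4"
    and \<Psi>: "\<And>k. k \<le> m \<Longrightarrow> \<Psi> k \<in> bimod_hom (res_bimod (n + k)) (res_bimod k)"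
    and chain: "\<And>k \<rho>. k < m \<Longrightarrow> \<rho> \<in> bcarrier (res_bimod (Suc (n + k))) \<Longrightarrow>
      res_diff f (Suc k) (\<Psi> (Suc k) \<rho>) = \<Psi> k (res_diff f (Suc (n + k)) \<rho>)"
    and aug: "\<And>\<rho>. \<rho> \<in> bcarrier (res_bimod n) \<Longrightarrow> res_aug (\<Psi> 0 \<rho>) = \<psi> \<rho>"
  shows "represents (n + m) (\<lambda>\<rho>. \<phi> (\<Psi> m \<rho>)) (x * y)"
proof -
  obtain g where g: "g \<in> cochains_deg m" "hoch_diff g = 0" "x = abs_hh g"
    "cob m (\<lambda>\<rho>. cochain_ext g (\<iota> m \<rho>) - \<phi> \<rho>)" using x by (auto simp: represents_def)
  obtain h where h: "h \<in> cochains_deg n" "hoch_diff h = 0" "y = abs_hh h"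
    "cob n (\<lambda>\<rho>. cochain_ext h (\<iota> n \<rho>) - \<psi> \<rho>)" using y by (auto simp: represents_def)
  have mg: "multilinear g" and mh: "multilinear h" using g h by (simp_all add: cochains_deg_def)
  note tl = linear_bar_tail[OF mh, of n] and ling = linearD[OF linear_cochain_ext[OF mg]]
  \<comment> \<open>The factor cancels the sign of \<open>bar_tail\<close> for the k+1 factors
    passed, left coefficient included; thus \<open>H\<close> commutes with the differential, and
    \<open>g\<close> after \<open>H m\<close> is the cup product without a sign.\<close>
  define H where "H k t = bar_scale ((- 1) ^ (n * (k + 1))) (bar_tail n h t)" for k t
  have linH: "Vector_Spaces.linear bar_scale bar_scale (H k)" for k
    unfolding H_def by (rule linear_smult[OF tl])
  have H_pure: "H k (bar_pure (xs @ [y])) = bar_pure (take (k + 1) xs @ [h (drop (k + 1) xs) * y])"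
    if "length xs = n + k + 1" for k xs y
    using that by (cases "even (n * (k + 1))") (simp_all add: H_def bar_op_pure mh tail_list_append[of xs "k + 1" n h y])
  have dest: "\<exists>u zs v. xs = u # zs @ [v] \<and> length zs = k" if "length xs = Suc (Suc k)" for xs :: "'k fk3 list" and k
    using that by (metis length_Suc_conv length_Suc_conv_rev)
  have H_hom: "H k \<in> bimod_hom (bar_bimod (n + k)) (bar_bimod k)" for k
  proof (rule bimod_homI)
    fix t t' :: "'k bar" and z assume "t \<in> bcarrier (bar_bimod (n + k))"
    then have t: "t \<in> bar_len (Suc (Suc (n + k)))" by simp
    have "H k t \<in> bar_len (Suc (Suc k))"
    proof (rule bar_len_linear_image[OF linH _ t])
      fix xs :: "'k fk3 list" assume "length xs = Suc (Suc (n + k))"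
      from dest[OF this] show "H k (bar_pure xs) \<in> bar_len (Suc (Suc k))"
        using H_pure[of "_ # _" k] by (auto simp del: append.simps(2) simp: append.simps(2)[symmetric])
    qed
    then show "H k t \<in> bcarrier (bar_bimod k)" by simp
    show "H k (t + t') = H k t + H k t'" by (rule linearD(1)[OF linH])
    have "H k (bar_lact z t) = bar_lact z (H k t)"
    proof (rule bar_len_linear_eq[OF linear_comp[OF linear_bar_lact linH] linear_comp[OF linH linear_bar_lact] _ t])
      fix xs :: "'k fk3 list" assume "length xs = Suc (Suc (n + k))"
      from dest[OF this] obtain u zs v where "xs = u # zs @ [v]" "length zs = n + k" by auto
      then show "H k (bar_lact z (bar_pure xs)) = bar_lact z (H k (bar_pure xs))"
        using H_pure[of "u # zs" k v] H_pure[of "(z * u) # zs" k v] by simp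
    qed
    then show "H k (lact (bar_bimod (n + k)) z t) = lact (bar_bimod k) z (H k t)" by simp
    have "H k (bar_ract t z) = bar_ract (H k t) z"
    proof (rule bar_len_linear_eq[OF linear_comp[OF linear_bar_ract linH] linear_comp[OF linH linear_bar_ract] _ t])
      fix xs :: "'k fk3 list" assume "length xs = Suc (Suc (n + k))"
      from dest[OF this] obtain u zs v where "xs = (u # zs) @ [v]" "length (u # zs) = n + k + 1" by auto
      then show "H k (bar_ract (bar_pure xs) z) = bar_ract (H k (bar_pure xs)) z"
        using H_pure[of "u # zs" k] by (simp only: bar_ract_pure mult.assoc)
    qed
    then show "H k (ract (bar_bimod (n + k)) t z) = ract (bar_bimod k) (H k t) z" by simp
  qed
  have H_diff: "bar_diff (H (Suc k) t) = H k (bar_diff t)" if "t \<in> bar_len (Suc (Suc (Suc (n + k))))" for k t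
    using bar_tail_diff[OF mh h(2) that, of n] unfolding H_def
    by (cases "even n"; cases "even k") simp_all
  have H_aug: "bar_aug (H 0 t) = cochain_ext h t" if t: "t \<in> bar_len (Suc (Suc n))" for t
  proof (rule bar_len_linear_eq[OF linear_comp[OF linH linear_bar_aug] linear_cochain_ext[OF mh] _ t])
    fix xs :: "'k fk3 list" assume "length xs = Suc (Suc n)"
    from dest[OF this] obtain u zs v where "xs = u # zs @ [v]" "length zs = n" by auto
    then show "bar_aug (H 0 (bar_pure xs)) = cochain_ext h (bar_pure xs)"
      using H_pure[of "u # zs" 0 v] by (simp add: cochain_ext_pure mh cochain_right_pure)
  qed
  note I = bimod_homD[OF iota_hom] bimod_hom_more[OF bimodule_res bimodule_bar iota_hom]
  \<comment> \<open>On P_n, \<open>h\<close> agrees with \<open>\<psi>\<close> only up to a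
    coboundary, so the two lifts differ already under the augmentation. The bounding morphism is
    lifted through the augmentation of the bar resolution.\<close>
  obtain h0 where h0: "\<And>l. n = Suc l \<Longrightarrow> h0 \<in> bimod_hom (res_bimod l) (bar_bimod 0)"
    "\<And>l \<rho>. n = Suc l \<Longrightarrow> \<rho> \<in> bcarrier (res_bimod n) \<Longrightarrow>
      cochain_ext h (\<iota> n \<rho>) - \<psi> \<rho> = bar_aug (h0 (res_diff f n \<rho>))"
  proof (cases n)
    case 0
    then show ?thesis using that by simp
  next
    case (Suc l)
    obtain \<chi> where \<chi>: "\<chi> \<in> bimod_hom (res_bimod l) fk_bimod"
      "\<And>\<rho>. \<rho> \<in> bcarrier (res_bimod n) \<Longrightarrow> cochain_ext h (\<iota> n \<rho>) - \<psi> \<rho> = \<chi> (res_diff f n \<rho>)"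
      using h(4) unfolding Suc by (elim cobE) blast
    have pr: "projective_for (res_bimod l) (bar_bimod 0) (fk_bimod :: ('k, _) bimod)"
      using mn Suc by (intro projective_res[OF _ bimodule_fk bimodule_bar]) simp
    have img: "\<chi> \<rho> \<in> bar_aug ` bcarrier (bar_bimod 0)" for \<rho> by (simp only: B.aug_surj UNIV_I)
    from projective_forD[OF pr bar_aug_hom \<chi>(1) img] obtain S where
      S: "S \<in> bimod_hom (res_bimod l) (bar_bimod 0)" "\<And>m. m \<in> bcarrier (res_bimod l) \<Longrightarrow> bar_aug (S m) = \<chi> m"
      by blast
    have hS: "cochain_ext h (\<iota> n \<rho>) - \<psi> \<rho> = bar_aug (S (res_diff f n \<rho>))" if "\<rho> \<in> bcarrier (res_bimod n)" for \<rho>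
      using \<chi>(2)[OF that] S(2)[OF bimod_homD(1)[OF P.d_hom]] that Suc by simp
    show ?thesis by (rule that[of S]) (use S(1) hS Suc in auto)
  qed
  \<comment> \<open>Subtracting this in degree 0 makes the difference of the two lifts a lift of 0.
    It vanishes on boundaries, so it can be taken to be 0 in higher degrees.\<close>
  define E where "E k \<rho> = (if k = 0 \<and> n \<noteq> 0 then h0 (res_diff f n \<rho>) else 0)" for k :: nat and \<rho>
  have E_hom: "E k \<in> bimod_hom (res_bimod (n + k)) (bar_bimod k)" for k
  proof (cases "k = 0 \<and> n \<noteq> 0")
    case True
    then obtain l where l: "n = Suc l" by (cases n) auto
    show ?thesis using True bimod_hom_comp[OF P.d_hom h0(1)[OF l]] unfolding E_def by (simp add: l)
  next
    case False
    then show ?thesis unfolding E_def using bimod_hom_zero[OF bimodule_bar] by (simp only: if_False)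
  qed
  let ?T = "\<lambda>k \<rho>. H k (\<iota> (n + k) \<rho>) - \<iota> k (\<Psi> k \<rho>) - E k \<rho>"
  have T: "?T k \<in> bimod_hom (res_bimod (n + k)) (bar_bimod k)" if "k \<le> m" for k
    using that by (intro bimod_hom_diff[OF bimodule_bar] E_hom bimod_hom_comp[OF iota_hom H_hom]
        bimod_hom_comp[OF \<Psi> iota_hom])
  have chainT: "bar_diff (?T (Suc k) \<rho>) = ?T k (res_diff f (Suc (n + k)) \<rho>)"
    if k: "k < m" and \<rho>: "\<rho> \<in> bcarrier (res_bimod (Suc (n + k)))" for k \<rho>
  proof -
    have "E k (res_diff f (Suc (n + k)) \<rho>) = 0"
    proof (cases "k = 0 \<and> n \<noteq> 0")
      case True
      then obtain l where l: "n = Suc l" by (cases n) auto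
      show ?thesis
        using True P.d_d[of \<rho> l] \<rho> bimod_hom_more(2)[OF bimodule_res bimodule_bar h0(1)[OF l]]
        unfolding E_def by (simp add: l)
    next
      case False
      then show ?thesis by (auto simp: E_def)
    qed
    moreover have "\<Psi> (Suc k) \<rho> \<in> bcarrier (res_bimod (Suc k))"
      using bimod_homD(1)[OF \<Psi>[of "Suc k"]] k \<rho> by simp
    ultimately show ?thesis
      using H_diff[OF iota_len[OF \<rho>]] chain[OF k \<rho>] \<rho>
      by (simp add: iota_diff E_def)
  qed
  have augT: "bar_aug (?T 0 \<rho>) = 0" if \<rho>: "\<rho> \<in> bcarrier (res_bimod (n + 0))" for \<rho>
  proof -
    have "bar_aug (?T 0 \<rho>) = cochain_ext h (\<iota> n \<rho>) - \<psi> \<rho> - bar_aug (E 0 \<rho>)"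
      using \<rho> bimod_homD(1)[OF \<Psi>[of 0]] by (simp add: linearD[OF linear_bar_aug] H_aug iota_len iota_aug aug)
    also have "\<dots> = 0"
    proof (cases n)
      case 0
      then show ?thesis using h(4) \<rho> by (simp add: E_def linearD[OF linear_bar_aug] cob_0)
    next
      case (Suc l)
      then show ?thesis using h0(2)[OF Suc, of \<rho>] \<rho> by (simp add: E_def)
    qed
    finally show ?thesis .
  qed
  have c0: "cochain_ext g (bar_diff y) = 0" if "y \<in> bcarrier (bar_bimod (Suc m))" for y
    using that cocycle_ext[OF g(1,2), of y "Suc m"] by simp
  have proj: "projective_for (res_bimod (n + k)) (bar_bimod (Suc k)) (bar_bimod k :: ('k, _) bimod)" if "k < m" for k
    using that mn by (intro projective_res[OF _ bimodule_bar bimodule_bar]) simp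
  have shift: "bimod_complex res_scale (\<lambda>k. res_bimod (n + k)) (\<lambda>k. res_diff f (Suc (n + k)))"
    by (rule bimod_complex_shift[OF P.bimod_complex_axioms])
  have T': "?T k \<in> bimod_hom ((\<lambda>k. res_bimod (n + k)) k) (bar_bimod k)" if "k \<le> m" for k
    using T[OF that] .
  have chainT': "bar_diff (?T (Suc k) \<rho>) = ?T k ((\<lambda>k. res_diff f (Suc (n + k))) k \<rho>)"
    if "k < m" "\<rho> \<in> bcarrier ((\<lambda>k. res_bimod (n + k)) (Suc k))" for k \<rho>
    using chainT[of k \<rho>] that by simp
  have null1: "cochain_ext g (?T 0 \<rho>) = 0" if "m = 0" "\<rho> \<in> bcarrier (res_bimod (n + 0))" for \<rho>
    by (rule null_homotopic(1)[where m = m and T = ?T and M = "\<lambda>k. res_bimod (n + k)" and N = bar_bimod,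
          OF shift resolution_bar];
        (assumption | rule that proj T' chainT' augT cochain_ext_hom[OF mg] c0)+)
  have null2: "\<exists>\<psi>\<in>bimod_hom (res_bimod (n + l)) fk_bimod.
      \<forall>\<rho>\<in>bcarrier (res_bimod (n + m)). cochain_ext g (?T m \<rho>) = \<psi> (res_diff f (Suc (n + l)) \<rho>)" if "m = Suc l" for l
    by (rule null_homotopic(2)[where m = m and T = ?T and M = "\<lambda>k. res_bimod (n + k)" and N = bar_bimod,
          OF shift resolution_bar];
        (assumption | rule that proj T' chainT' augT cochain_ext_hom[OF mg] c0)+)
  have cobT: "cob (n + m) (\<lambda>\<rho>. cochain_ext g (?T m \<rho>))"
  proof (cases m)
    case 0
    have z: "cochain_ext g (?T 0 \<rho>) = 0" if "\<rho> \<in> bcarrier (res_bimod (n + 0))" for \<rho>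
      by (rule null1[OF 0 that])
    show ?thesis
      unfolding 0 using cob_cong[of "n + 0" "\<lambda>\<rho>. cochain_ext g (?T 0 \<rho>)" "\<lambda>\<rho>. 0"] z cob_zero by blast
  next
    case (Suc l)
    from null2[OF Suc] show ?thesis unfolding Suc add_Suc_right cob_Suc .
  qed
  have cob_E: "cob (n + m) (\<lambda>\<rho>. cochain_ext g (E m \<rho>))"
  proof (cases "m = 0 \<and> n \<noteq> 0")
    case True
    then obtain l where l: "n = Suc l" by (cases n) auto
    have "cob (Suc l) (\<lambda>\<rho>. cochain_ext g (h0 (res_diff f n \<rho>)))"
      by (rule cobI[OF bimod_hom_comp[OF h0(1)[OF l] cochain_ext_hom[OF mg]]]) (simp add: l)
    then show ?thesis using True by (simp add: E_def l)
  next
    case False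
    then show ?thesis using cob_zero unfolding E_def by (simp only: if_False ling)
  qed
  have cobg: "cob (n + m) (\<lambda>\<rho>. cochain_ext g (\<iota> m (\<Psi> m \<rho>)) - \<phi> (\<Psi> m \<rho>))"
  proof (cases m)
    case 0
    have "cochain_ext g (\<iota> m (\<Psi> m \<rho>)) - \<phi> (\<Psi> m \<rho>) = 0" if "\<rho> \<in> bcarrier (res_bimod (n + m))" for \<rho>
      using g(4) bimod_homD(1)[OF \<Psi>[of m]] that by (simp add: 0 cob_0)
    then show ?thesis using cob_cong[of "n + m" _ "\<lambda>\<rho>. 0"] cob_zero by (metis (no_types, lifting))
  next
    case (Suc l)
    obtain \<chi> where \<chi>: "\<chi> \<in> bimod_hom (res_bimod l) fk_bimod"
      "\<And>\<rho>. \<rho> \<in> bcarrier (res_bimod (Suc l)) \<Longrightarrow> cochain_ext g (\<iota> (Suc l) \<rho>) - \<phi> \<rho> = \<chi> (res_diff f (Suc l) \<rho>)"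
      using g(4) unfolding Suc by (elim cobE) blast
    show ?thesis
      unfolding Suc add_Suc_right
    proof (rule cobI[OF bimod_hom_comp[OF \<Psi>[of l] \<chi>(1)]])
      fix \<rho> :: "nat \<Rightarrow> 'k kos" assume \<rho>: "\<rho> \<in> bcarrier (res_bimod (Suc (n + l)))"
      show "cochain_ext g (\<iota> (Suc l) (\<Psi> (Suc l) \<rho>)) - \<phi> (\<Psi> (Suc l) \<rho>) = \<chi> (\<Psi> l (res_diff f (Suc (n + l)) \<rho>))"
        using \<chi>(2)[OF bimod_homD(1)[OF \<Psi>[of "Suc l"]]] \<rho> chain[of l \<rho>] Suc by simp
    qed (simp add: Suc)
  qed
  have cd: "cup g h = cup_deg m n g h"
  proof
    fix xs
    have "cup g h xs = (\<Sum>k\<in>(if length xs = m + n then {m} else {}). g (take k xs) * h (drop k xs))"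
      unfolding cup_def
    proof (intro sum.mono_neutral_right ballI)
      fix k assume k: "k \<in> {..length xs} - (if length xs = m + n then {m} else {})"
      show "g (take k xs) * h (drop k xs) = 0"
      proof (cases "k = m")
        case True
        then have "length (drop k xs) \<noteq> n" using k by (auto split: if_splits)
        then show ?thesis using h(1) by (simp add: cochains_deg_def)
      next
        case False
        then have "length (take k xs) \<noteq> m" using k by auto
        then show ?thesis using g(1) by (simp add: cochains_deg_def)
      qed
    qed auto
    then show "cup g h xs = cup_deg m n g h xs" by (simp add: cup_deg_def)
  qed
  have ext: "cochain_ext (cup g h) t = cochain_ext g (H m t)" if t: "t \<in> bar_len (Suc (Suc (n + m)))" for t
    unfolding cd
  proof (rule bar_len_linear_eq[OF linear_cochain_ext[OF multilinear_cup_deg[OF mg mh]]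
        linear_comp[OF linH linear_cochain_ext[OF mg]] _ t])
    fix xs :: "'k fk3 list" assume "length xs = Suc (Suc (n + m))"
    from dest[OF this] obtain u zs v where xs: "xs = u # zs @ [v]" "length zs = n + m" by auto
    have "cochain_ext (cup_deg m n g h) (bar_pure xs) = u * (cup_deg m n g h zs * v)"
      by (simp add: xs cochain_ext_pure mg mh multilinear_cup_deg cochain_right_pure)
    then show "cochain_ext (cup_deg m n g h) (bar_pure xs) = cochain_ext g (H m (bar_pure xs))"
      using H_pure[of "u # zs" m v] xs
      by (simp add: cochain_ext_pure mg cochain_right_pure cup_deg_def mult.assoc)
  qed
  have "cup g h \<in> cochains_deg (n + m)"
    unfolding cd using multilinear_cup_deg[OF mg mh] by (auto simp: cochains_deg_def cup_deg_def)
  moreover have "hoch_diff (cup g h) = 0"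
    using cup_cocycles[OF cocycle_deg[OF g(1,2)] cocycle_deg[OF h(1,2)]] by (simp add: cocycles_def)
  moreover have "x * y = abs_hh (cup g h)"
    unfolding g(3) h(3) by (rule hh_times_abs[OF cocycle_deg[OF g(1,2)] cocycle_deg[OF h(1,2)]])
  moreover have "cob (n + m) (\<lambda>\<rho>. cochain_ext (cup g h) (\<iota> (n + m) \<rho>) - \<phi> (\<Psi> m \<rho>))"
  proof -
    have "cochain_ext (cup g h) (\<iota> (n + m) \<rho>) - \<phi> (\<Psi> m \<rho>) = cochain_ext g (?T m \<rho>) + cochain_ext g (E m \<rho>)
        + (cochain_ext g (\<iota> m (\<Psi> m \<rho>)) - \<phi> (\<Psi> m \<rho>))" if "\<rho> \<in> bcarrier (res_bimod (n + m))" for \<rho>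
      using ext[OF iota_len[OF that]] by (simp add: ling)
    then show ?thesis
      using cob_add[OF cob_add[OF cobT cob_E] cobg] cob_cong[of "n + m"] by (metis (no_types, lifting))
  qed
  ultimately show ?thesis by (auto simp: represents_def)
qed

end

section \<open>Computing with lists of terms\<close>

text \<open>Identities in FK(3) and in the bimodules are checked on integer linear combinations of basis
  elements, represented as lists of pairs of a coefficient and an index.\<close>

definition eval_terms :: "('k::field \<Rightarrow> 'v \<Rightarrow> 'v) \<Rightarrow> ('t \<Rightarrow> 'v) \<Rightarrow> (int \<times> 't) list \<Rightarrow> 'v::ab_group_add"
  where "eval_terms s b L = (\<Sum>(c, t)\<leftarrow>L. s (of_int c) (b t))"

definition scale_terms :: "int \<Rightarrow> (int \<times> 't) list \<Rightarrow> (int \<times> 't) list"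
  where "scale_terms c L = map (\<lambda>(d, t). (c * d, t)) L"

lemma eval_terms_simps:
  "eval_terms s b [] = 0" "eval_terms s b ((c, t) # L) = s (of_int c) (b t) + eval_terms s b L"
  "eval_terms s b (L @ M) = eval_terms s b L + eval_terms s b M"
  by (simp_all add: eval_terms_def)

lemma eval_scale_terms:
  assumes "vector_space s"
  shows "eval_terms s b (scale_terms c L) = s (of_int c) (eval_terms s b L)"
proof -
  interpret vector_space s by fact
  show ?thesis
    by (induction L) (auto simp: eval_terms_simps scale_terms_def scale_right_distrib)
qed

text \<open>Merge sort adding up the coefficients of equal indices; correctness does not depend on \<open>l\<close>.\<close>

fun merge_terms :: "('t \<Rightarrow> 't \<Rightarrow> bool) \<Rightarrow> (int \<times> 't) list \<Rightarrow> (int \<times> 't) list \<Rightarrow> (int \<times> 't) list" where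
  "merge_terms l [] ys = ys"
| "merge_terms l xs [] = xs"
| "merge_terms l ((c, s) # xs) ((d, t) # ys) =
    (if l s t then (c, s) # merge_terms l xs ((d, t) # ys)
     else if s = t then
       (let e = c + d in if e = 0 then merge_terms l xs ys else (e, s) # merge_terms l xs ys)
     else (d, t) # merge_terms l ((c, s) # xs) ys)"

fun merge_pairs :: "('t \<Rightarrow> 't \<Rightarrow> bool) \<Rightarrow> (int \<times> 't) list list \<Rightarrow> (int \<times> 't) list list" where
  "merge_pairs l (xs # ys # zs) = merge_terms l xs ys # merge_pairs l zs"
| "merge_pairs l zs = zs"

lemma length_merge_pairs [simp]: "length (merge_pairs l xs) = (length xs + 1) div 2"
  by (induction l xs rule: merge_pairs.induct) auto

function merge_all :: "('t \<Rightarrow> 't \<Rightarrow> bool) \<Rightarrow> (int \<times> 't) list list \<Rightarrow> (int \<times> 't) list" where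
  "merge_all l [] = []"
| "merge_all l [xs] = xs"
| "merge_all l (xs # ys # zs) = merge_all l (merge_pairs l (xs # ys # zs))"
  by pat_completeness auto
termination by (relation "measure (\<lambda>(l, xs). length xs)") auto

definition vanishes :: "('t \<Rightarrow> 't \<Rightarrow> bool) \<Rightarrow> (int \<times> 't) list \<Rightarrow> bool"
  where "vanishes l L \<longleftrightarrow> merge_all l (map (\<lambda>t. [t]) L) = []"

text \<open>Merging and cancelling leave the value unchanged, so an empty result forces the value
  0.\<close>

lemma eval_vanishes:
  assumes "vector_space s" "vanishes l L" shows "eval_terms s b L = 0"
proof -
  interpret vector_space s by fact
  have 1: "eval_terms s b (merge_terms l xs ys) = eval_terms s b xs + eval_terms s b ys" for l xs ys
  proof (induction l xs ys rule: merge_terms.induct)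
    case (3 l c v xs d t ys)
    have "c + d = 0 \<Longrightarrow> s (of_int c) (b v) + s (of_int d) (b v) = 0"
      using scale_left_distrib[of "of_int c" "of_int d" "b v"] by (simp flip: of_int_add)
    then show ?case
      using 3 scale_left_distrib[of "of_int c" "of_int d" "b v"]
      by (auto simp: eval_terms_simps Let_def algebra_simps)
  qed (auto simp: eval_terms_simps)
  have 2: "(\<Sum>xs\<leftarrow>merge_pairs l xss. eval_terms s b xs) = (\<Sum>xs\<leftarrow>xss. eval_terms s b xs)" for l xss
    by (induction l xss rule: merge_pairs.induct) (auto simp: 1 add.assoc)
  have 3: "eval_terms s b (merge_all l xss) = (\<Sum>xs\<leftarrow>xss. eval_terms s b xs)" for l xss
  proof (induction l xss rule: merge_all.induct)
    case (3 l xs ys zs)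
    then show ?case using 2[of l "xs # ys # zs"] by simp
  qed (auto simp: eval_terms_simps)
  have "eval_terms s b L = eval_terms s b (merge_all l (map (\<lambda>t. [t]) L))"
    unfolding 3 by (induction L) (auto simp: eval_terms_simps)
  then show ?thesis using assms(2) by (simp add: vanishes_def eval_terms_simps)
qed

section \<open>Multiplication in FK(3)\<close>

definition fk_basis :: "nat \<Rightarrow> 'k::field fk3"
  where "fk_basis i = prod_list (map fk_gen ([[], [Ga], [Gb], [Gc], [Ga, Gb], [Gb, Gc],
    [Gb, Ga], [Ga, Gc], [Ga, Gb, Ga], [Ga, Gb, Gc], [Gb, Ga, Gc], [Ga, Gb, Ga, Gc]] ! i))"

definition eval_fk :: "(int \<times> nat) list \<Rightarrow> 'k::field fk3"
  where "eval_fk = eval_terms fk_scale fk_basis"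

text \<open>The relations as rewriting rules towards the twelve basis words. The braid relation bab
  = aba is not a relator; it results from caa = 0 by rewriting ca twice.\<close>

lemma fk_relations:
  "fk_a * fk_a = (0 :: 'k::field fk3)" "fk_b * fk_b = (0 :: 'k fk3)" "fk_c * fk_c = (0 :: 'k fk3)"
  "fk_c * fk_a = - (fk_a * fk_b) - fk_b * (fk_c :: 'k fk3)"
  "fk_c * fk_b = - (fk_b * fk_a) - fk_a * (fk_c :: 'k fk3)"
  "fk_b * (fk_a * fk_b) = fk_a * (fk_b * (fk_a :: 'k fk3))"
proof -
  have gen: "abs_fk3 (monom [p, q]) = (fk_gen p * fk_gen q :: 'k fk3)" for p q
  proof -
    have "(monom [p, q] :: word \<Rightarrow>\<^sub>0 'k) = monom [p] * monom [q]"
      using monom_append[of "[p]" "[q]"] by simp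
    then show ?thesis by (simp add: fk_gen_def times_fk3.abs_eq)
  qed
  have rel: "abs_fk3 r = (0 :: 'k fk3)" if "r \<in> fk_relators" for r
    using two_sided_ideal.gen[OF that, of 1 1] by (simp add: zero_fk3_def fk3.abs_eq_iff)
  show sq: "fk_a * fk_a = (0 :: 'k fk3)" "fk_b * fk_b = (0 :: 'k fk3)" "fk_c * fk_c = (0 :: 'k fk3)"
    by (simp_all add: rel fk_relators_def flip: gen)
  have "abs_fk3 (monom [Ga, Gb] + monom [Gb, Gc] + monom [Gc, Ga]) = (0 :: 'k fk3)"
    "abs_fk3 (monom [Gb, Ga] + monom [Ga, Gc] + monom [Gc, Gb]) = (0 :: 'k fk3)"
    by (simp_all add: rel fk_relators_def)
  then have "fk_a * fk_b + fk_b * fk_c + fk_c * fk_a = (0 :: 'k fk3)"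
    "fk_b * fk_a + fk_a * fk_c + fk_c * fk_b = (0 :: 'k fk3)"
    by (simp_all add: gen flip: plus_fk3.abs_eq)
  moreover have "z = - x - y" if "x + y + z = 0" for x y z :: "'k fk3"
    using that by (simp add: algebra_simps eq_neg_iff_add_eq_0)
  ultimately show ca: "fk_c * fk_a = - (fk_a * fk_b) - fk_b * (fk_c :: 'k fk3)"
    and "fk_c * fk_b = - (fk_b * fk_a) - fk_a * (fk_c :: 'k fk3)"
    by blast+
  have "0 = fk_c * (fk_a * (fk_a :: 'k fk3))" by (simp add: sq)
  also have "\<dots> = (- (fk_a * fk_b) - fk_b * fk_c) * fk_a" by (simp add: ca flip: mult.assoc)
  also have "\<dots> = - (fk_a * (fk_b * fk_a)) - fk_b * (fk_c * fk_a)" by (simp add: algebra_simps)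
  also have "\<dots> = - (fk_a * (fk_b * fk_a)) + fk_b * (fk_a * fk_b) + (fk_b * fk_b) * fk_c"
    unfolding ca by (simp add: algebra_simps)
  finally show "fk_b * (fk_a * fk_b) = fk_a * (fk_b * (fk_a :: 'k fk3))" by (simp add: sq)
qed

lemma fk_relations_assoc:
  fixes x :: "'k::field fk3"
  shows "fk_a * (fk_a * x) = 0" "fk_b * (fk_b * x) = 0" "fk_c * (fk_c * x) = 0"
    "fk_c * (fk_a * x) = - (fk_a * (fk_b * x)) - fk_b * (fk_c * x)"
    "fk_c * (fk_b * x) = - (fk_b * (fk_a * x)) - fk_a * (fk_c * x)"
    "fk_b * (fk_a * (fk_b * x)) = fk_a * (fk_b * (fk_a * x))"
proof -
  have "fk_b * (fk_a * (fk_b * x)) = (fk_b * (fk_a * fk_b)) * x" by (simp only: mult.assoc)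
  also have "\<dots> = fk_a * (fk_b * (fk_a * x))" unfolding fk_relations by (simp only: mult.assoc)
  finally show "fk_b * (fk_a * (fk_b * x)) = fk_a * (fk_b * (fk_a * x))" .
qed (simp_all add: fk_relations algebra_simps flip: mult.assoc)

lemmas fk_normal = fk_relations fk_relations_assoc mult.assoc

text \<open>Row i, column j holds the product of the basis elements i and j in the order of
  \<open>fk_basis\<close>; \<open>fk_times\<close> verifies it from the relations.\<close>

definition fk_table :: "(int \<times> nat) list list list"
  where "fk_table = [[[(1, 0)], [(1, 1)], [(1, 2)], [(1, 3)], [(1, 4)], [(1, 5)], [(1, 6)], [(1,
    7)], [(1, 8)], [(1, 9)], [(1, 10)], [(1, 11)]],
    [[(1, 1)], [], [(1, 4)], [(1, 7)], [], [(1, 9)], [(1, 8)], [], [], [], [(1, 11)], []],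
    [[(1, 2)], [(1, 6)], [], [(1, 5)], [(1, 8)], [], [], [(1, 10)], [], [(1, 11)], [], []],
    [[(1, 3)], [(- 1, 4), (- 1, 5)], [(- 1, 6), (- 1, 7)], [], [(1, 10)], [(- 1, 10)], [(1, 9)],
    [(- 1, 9)], [(- 1, 11)], [], [], []],
    [[(1, 4)], [(1, 8)], [], [(1, 9)], [], [], [], [(1, 11)], [], [], [], []],
    [[(1, 5)], [(- 1, 8)], [(- 1, 10)], [], [], [], [(1, 11)], [(- 1, 11)], [], [], [], []],
    [[(1, 6)], [], [(1, 8)], [(1, 10)], [], [(1, 11)], [], [], [], [], [], []],
    [[(1, 7)], [(- 1, 9)], [(- 1, 8)], [], [(1, 11)], [(- 1, 11)], [], [], [], [], [], []],
    [[(1, 8)], [], [], [(1, 11)], [], [], [], [], [], [], [], []],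
    [[(1, 9)], [], [(- 1, 11)], [], [], [], [], [], [], [], [], []],
    [[(1, 10)], [(- 1, 11)], [], [], [], [], [], [], [], [], [], []],
    [[(1, 11)], [], [], [], [], [], [], [], [], [], [], []]]"

definition fk_times :: "nat \<Rightarrow> nat \<Rightarrow> (int \<times> nat) list"
  where "fk_times i j = fk_table ! i ! j"

lemma less_12: "i < 12 \<longleftrightarrow> i = 0 \<or> i = 1 \<or> i = 2 \<or> i = 3 \<or> i = 4 \<or> i = 5 \<or> i = 6 \<or> i = 7 \<or>
    i = 8 \<or> i = 9 \<or> i = 10 \<or> i = (11 :: nat)"
  by presburger

lemma fk_basis_simps [simp]:
  "fk_basis 0 = 1" "fk_basis 1 = fk_a" "fk_basis (Suc 0) = fk_a" "fk_basis 2 = fk_b" "fk_basis 3 = fk_c"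
  "fk_basis 4 = fk_a * fk_b" "fk_basis 5 = fk_b * fk_c" "fk_basis 6 = fk_b * fk_a"
  "fk_basis 7 = fk_a * fk_c" "fk_basis 8 = fk_a * (fk_b * fk_a)" "fk_basis 9 = fk_a * (fk_b * fk_c)"
  "fk_basis 10 = fk_b * (fk_a * fk_c)" "fk_basis 11 = fk_a * (fk_b * (fk_a * fk_c))"
  by (simp_all add: fk_basis_def)

lemma eval_fk_simps:
  "eval_fk [] = 0" "eval_fk ((c, t) # L) = fk_scale (of_int c) (fk_basis t) + eval_fk L"
  "eval_fk (L @ M) = eval_fk L + eval_fk M" "eval_fk (scale_terms c L) = fk_scale (of_int c) (eval_fk L)"
  by (simp_all add: eval_fk_def eval_terms_simps eval_scale_terms vector_space_fk_scale)

lemma fk_times: "i < 12 \<Longrightarrow> j < 12 \<Longrightarrow> fk_basis i * fk_basis j = (eval_fk (fk_times i j) :: 'k::field fk3)"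
  unfolding less_12
  by (elim disjE; simp add: fk_times_def fk_table_def eval_fk_simps; simp add: fk_normal algebra_simps)

subsection \<open>Terms in the resolution\<close>

declare plus_fun_apply [simp del] zero_fun_apply [simp del]

type_synonym res_index = "nat \<times> nat \<times> nat \<times> nat"

text \<open>The index \<open>(k, i, u, j)\<close> stands for the element $\omega_k\,x_i|u|x_j$ of $P_n$.\<close>

definition res_term :: "nat \<Rightarrow> res_index \<Rightarrow> nat \<Rightarrow> 'k::field kos"
  where "res_term n = (\<lambda>(k, i, u, j). res_gen n k u (fk_basis i) (fk_basis j))"

abbreviation "eval_res n \<equiv> eval_terms res_scale (res_term n)"

fun res_less :: "res_index \<Rightarrow> res_index \<Rightarrow> bool" where
  "res_less (k, i, u, j) (k', i', u', j') \<longleftrightarrow>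
    (if i = i' then if j = j' then if u = u' then k < k' else u < u' else j < j' else i < i')"

definition valid_terms :: "nat \<Rightarrow> (int \<times> res_index) list \<Rightarrow> bool"
  where "valid_terms n = list_all (\<lambda>(c, k, i, u, j).
    4 * k \<le> n \<and> u < basis_size (n - 4 * k) \<and> i < 12 \<and> j < 12)"

definition index_list :: "nat \<Rightarrow> (nat \<times> nat) list"
  where "index_list n = concat (map (\<lambda>k. map (Pair k) [0..<basis_size (n - 4 * k)]) [0..<n div 4 + 1])"

lemma index_list: "(k, u) \<in> set (index_list n) \<longleftrightarrow> (k, u) \<in> res_index n"
proof -
  have "4 * k \<le> n \<longleftrightarrow> k < n div 4 + 1" by linarith
  moreover have "(k, u) \<in> set (index_list n) \<longleftrightarrow> k < n div 4 + 1 \<and> u < basis_size (n - 4 * k)"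
    unfolding index_list_def set_concat set_map set_upt by (auto intro!: bexI[of _ k])
  ultimately show ?thesis by (simp add: res_index_def)
qed

text \<open>A table assigns to the generator $\omega_k\,1|u|1$ a list of terms.\<close>

type_synonym 't table = "nat \<Rightarrow> nat \<Rightarrow> (int \<times> 't) list"

definition valid_table :: "nat \<Rightarrow> nat \<Rightarrow> res_index table \<Rightarrow> bool"
  where "valid_table n m G \<longleftrightarrow> list_all (\<lambda>(k, u). valid_terms m (G k u)) (index_list n)"

lemma valid_tableD: "valid_table n m G \<Longrightarrow> (k, u) \<in> res_index n \<Longrightarrow> valid_terms m (G k u)"
  unfolding valid_table_def list_all_iff using index_list by fastforce

definition act_terms :: "nat \<Rightarrow> nat \<Rightarrow> int \<Rightarrow> (int \<times> res_index) list \<Rightarrow> (int \<times> res_index) list"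
  where "act_terms i j c L = concat (map (\<lambda>(e, k, i', u, j').
    concat (map (\<lambda>(p, i''). map (\<lambda>(q, j''). (c * e * p * q, k, i'', u, j'')) (fk_times j' j)) (fk_times i i'))) L)"

definition map_terms :: "res_index table \<Rightarrow> (int \<times> res_index) list \<Rightarrow> (int \<times> res_index) list"
  where "map_terms G L = concat (map (\<lambda>(c, k, i, u, j). act_terms i j c (G k u)) L)"

text \<open>Evaluates T(x|u|y) = x T(1|u|1) y + D(x)|u|y + x|u|D(y) for a lift T of the derivation
  D, from the table of T on generators and that of D on the basis of FK(3).\<close>

definition der_terms :: "(nat \<Rightarrow> (int \<times> nat) list) \<Rightarrow> res_index table \<Rightarrow>
    (int \<times> res_index) list \<Rightarrow> (int \<times> res_index) list"
  where "der_terms D G L = concat (map (\<lambda>(c, k, i, u, j). act_terms i j c (G k u)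
    @ map (\<lambda>(d, i'). (c * d, k, i', u, j)) (D i) @ map (\<lambda>(d, j'). (c * d, k, i, u, j')) (D j)) L)"

definition map_fk :: "nat table \<Rightarrow> (int \<times> res_index) list \<Rightarrow> (int \<times> nat) list"
  where "map_fk G L = concat (map (\<lambda>(c, k, i, u, j). concat (map (\<lambda>(e, l).
    concat (map (\<lambda>(p, m). map (\<lambda>(q, t). (c * e * p * q, t)) (fk_times m j)) (fk_times i l))) (G k u))) L)"

definition der_fk :: "(nat \<Rightarrow> (int \<times> nat) list) \<Rightarrow> (int \<times> nat) list \<Rightarrow> (int \<times> nat) list"
  where "der_fk D L = concat (map (\<lambda>(c, i). scale_terms c (D i)) L)"

definition valid_fk :: "(int \<times> nat) list \<Rightarrow> bool"
  where "valid_fk = list_all (\<lambda>(c, i). i < 12)"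

definition valid_fk_table :: "nat \<Rightarrow> nat table \<Rightarrow> bool"
  where "valid_fk_table n G \<longleftrightarrow> list_all (\<lambda>(k, u). valid_fk (G k u)) (index_list n)"

lemma valid_fk_tableD: "valid_fk_table n G \<Longrightarrow> (k, u) \<in> res_index n \<Longrightarrow> valid_fk (G k u)"
  unfolding valid_fk_table_def list_all_iff using index_list by fastforce

lemma fk_times_valid: "i < 12 \<Longrightarrow> j < 12 \<Longrightarrow> valid_fk (fk_times i j)"
proof -
  have "list_all (\<lambda>i. list_all (\<lambda>j. valid_fk (fk_times i j)) [0..<12]) [0..<12]" by code_simp
  then show "i < 12 \<Longrightarrow> j < 12 \<Longrightarrow> valid_fk (fk_times i j)" by (simp add: list_all_iff)
qed

lemma valid_fk_simps:
  "valid_fk []" "valid_fk ((c, i) # L) \<longleftrightarrow> i < 12 \<and> valid_fk L"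
  by (simp_all add: valid_fk_def)

lemma valid_terms_simps:
  "valid_terms n []" "valid_terms n ((c, k, i, u, j) # L) \<longleftrightarrow>
    (k, u) \<in> res_index n \<and> i < 12 \<and> j < 12 \<and> valid_terms n L"
  by (auto simp: valid_terms_def res_index_def)

lemma res_gen_linear:
  "Vector_Spaces.linear fk_scale res_scale (\<lambda>x. res_gen n k u x y)"
  "Vector_Spaces.linear fk_scale res_scale (\<lambda>y. res_gen n k u x y)"
  by (intro linear_from_comb vector_space_fk_scale vector_space_res_scale;
      simp add: res_gen_def res_scale_def fun_eq_iff kos_pure_simps plus_fun_apply)+

lemma eval_terms_linear:
  assumes "Vector_Spaces.linear s s' T"
  shows "T (eval_terms s b L) = eval_terms s' (\<lambda>t. T (b t)) L"
  by (induction L) (auto simp: eval_terms_simps linearD[OF assms])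

lemma module_res_scale: "module res_scale"
  using vector_space_res_scale by (simp add: module_iff_vector_space)

lemma eval_terms_map:
  assumes "vector_space s"
  shows "eval_terms s b (map (\<lambda>(q, t). (c * q, h t)) L) = s (of_int c) (eval_terms s (\<lambda>t. b (h t)) L)"
proof -
  interpret vector_space s by fact
  show ?thesis by (induction L) (auto simp: eval_terms_simps scale_right_distrib)
qed

lemmas res_scale_simps = module.scale_zero_right[OF module_res_scale]
  module.scale_right_distrib[OF module_res_scale] module.scale_scale[OF module_res_scale]

lemmas eval_res_map = eval_terms_map[OF vector_space_res_scale]

lemma eval_act_single:
  assumes "i < 12" "i' < 12" "j < 12" "j' < 12"
  shows "eval_res n (concat (map (\<lambda>(p, i''). map (\<lambda>(q, j''). (c * p * q, k, i'', u, j'')) (fk_times j' j))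
      (fk_times i i'))) = res_scale (of_int c) (res_gen n k u (fk_basis i * fk_basis i') (fk_basis j' * fk_basis j))"
proof -
  have "eval_res n (concat (map (\<lambda>(p, i''). map (\<lambda>(q, j''). (c * p * q, k, i'', u, j'')) M) L))
      = res_scale (of_int c) (res_gen n k u (eval_fk L) (eval_fk M))" for L M
  proof (induction L)
    case Nil
    show ?case by (simp add: eval_terms_simps eval_fk_simps linearD[OF res_gen_linear(1)] res_scale_simps)
  next
    case (Cons a L)
    obtain p i'' where a: "a = (p, i'')" by (cases a)
    have "eval_res n (map (\<lambda>(q, j''). (c * p * q, k, i'', u, j'')) M)
        = res_scale (of_int (c * p)) (res_gen n k u (fk_basis i'') (eval_fk M))"
      unfolding eval_res_map[of "res_term n" "c * p" "\<lambda>j. (k, i'', u, j)"] eval_fk_def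
      by (simp add: eval_terms_linear[OF res_gen_linear(2)] res_term_def)
    then show ?case
      using Cons by (simp add: a eval_terms_simps eval_fk_simps linearD[OF res_gen_linear(1)]
          res_scale_simps)
  qed
  then show ?thesis using assms by (simp add: fk_times)
qed

lemma res_term_act:
  "lact (res_bimod m) x (ract (res_bimod m) (res_term n (k, i, u, j)) y)
    = res_gen n k u (x * fk_basis i) (fk_basis j * y)"
  by (simp add: res_term_def res_gen_act)

lemma eval_act_terms:
  assumes "valid_terms n L" "i < 12" "j < 12"
  shows "eval_res n (act_terms i j c L) = res_scale (of_int c)
    (lact (res_bimod n) (fk_basis i) (ract (res_bimod n) (eval_res n L) (fk_basis j)))"
  using assms(1)
proof (induction L)
  case Nil
  show ?case
    by (simp add: act_terms_def eval_terms_simps bimodule.act_simps[OF bimodule_res] res_scale_simps)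
next
  case (Cons a L)
  obtain e k i' u j' where a: "a = (e, k, i', u, j')" by (metis prod_cases5)
  have v: "i' < 12" "j' < 12" "valid_terms n L" using Cons.prems by (simp_all add: a valid_terms_simps)
  have 1: "eval_res n (act_terms i j c (a # L)) = eval_res n (concat (map (\<lambda>(p, i''). map (\<lambda>(q, j''). (c * e * p * q, k, i'', u, j''))
      (fk_times j' j)) (fk_times i i'))) + eval_res n (act_terms i j c L)"
    by (simp add: act_terms_def a eval_terms_simps)
  show ?case
    unfolding 1 eval_act_single[OF assms(2) v(1) assms(3) v(2), of n "c * e" k u] Cons.IH[OF v(3)]
    by (simp add: a eval_terms_simps bimodule.act_simps[OF bimodule_res] res_term_act
        res_scale_simps)
qed

lemma valid_terms_carrier:
  "n \<le> 4 \<Longrightarrow> valid_terms n L \<Longrightarrow> (eval_res n L :: nat \<Rightarrow> 'k::field kos) \<in> bcarrier (res_bimod n)"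
proof (induction L)
  case (Cons a L)
  obtain c k i u j where a: "a = (c, k, i, u, j)" by (metis prod_cases5)
  have "(res_term n (k, i, u, j) :: nat \<Rightarrow> 'k kos) \<in> bcarrier (res_bimod n)"
    "(eval_res n L :: nat \<Rightarrow> 'k kos) \<in> bcarrier (res_bimod n)"
    using Cons by (simp_all add: a valid_terms_simps res_term_def res_gen_carrier)
  then show ?case
    unfolding a eval_terms_simps(2) by (intro bimodule.carrier_closed[OF bimodule_res])
qed (simp add: eval_terms_simps bimodule.carrier_closed[OF bimodule_res])

lemma res_gen_conv:
  "res_gen n k u x y = lact (res_bimod n) x (ract (res_bimod n) (res_gen n k u 1 1) y)"
  by (simp add: res_gen_act)

lemma eval_map_terms:
  fixes \<phi> :: "(nat \<Rightarrow> 'k::field kos) \<Rightarrow> (nat \<Rightarrow> 'k kos)"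
  assumes n: "n \<le> 4" and \<phi>: "\<phi> \<in> bimod_hom (res_bimod n) (res_bimod m)"
    and gen: "\<And>k u. (k, u) \<in> res_index n \<Longrightarrow> res_scale N (\<phi> (res_gen n k u 1 1)) = eval_res m (G k u)"
    and G: "valid_table n m G" and L: "valid_terms n L"
  shows "res_scale N (\<phi> (eval_res n L)) = eval_res m (map_terms G L)"
  using L
proof (induction L)
  case Nil
  show ?case
    by (simp add: map_terms_def eval_terms_simps bimod_hom_more(2)[OF bimodule_res bimodule_res \<phi>]
      res_scale_simps)
next
  case (Cons a L)
  obtain c k i u j where a: "a = (c, k, i, u, j)" by (metis prod_cases5)
  have v: "(k, u) \<in> res_index n" "i < 12" "j < 12" "valid_terms n L"
    using Cons.prems by (simp_all add: a valid_terms_simps)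
  note act = bimodule.act_simps[OF bimodule_res]
  have g: "(res_gen n k u 1 1 :: nat \<Rightarrow> 'k kos) \<in> bcarrier (res_bimod n)" using n v by (simp add: res_gen_carrier)
  have t: "(res_term n (k, i, u, j) :: nat \<Rightarrow> 'k kos) \<in> bcarrier (res_bimod n)"
    using n v by (simp add: res_term_def res_gen_carrier)
  have "\<phi> (res_term n (k, i, u, j))
      = lact (res_bimod m) (fk_basis i) (ract (res_bimod m) (\<phi> (res_gen n k u 1 1)) (fk_basis j))"
    unfolding res_term_def prod.case res_gen_conv[of n k u "fk_basis i"]
    using g by (simp add: bimod_homD[OF \<phi>] bimodule.carrier_closed[OF bimodule_res])
  then have 1: "res_scale N (\<phi> (res_term n (k, i, u, j)))
      = lact (res_bimod m) (fk_basis i) (ract (res_bimod m) (eval_res m (G k u)) (fk_basis j))"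
    by (simp add: act gen[OF v(1), symmetric])
  have "\<phi> (eval_res n (a # L)) = res_scale (of_int c) (\<phi> (res_term n (k, i, u, j))) + \<phi> (eval_res n L)"
    using t n v(4) by (simp add: a eval_terms_simps bimod_homD[OF \<phi>] valid_terms_carrier
        bimod_hom_more[OF bimodule_res bimodule_res \<phi>] bimodule.carrier_closed[OF bimodule_res])
  then have "res_scale N (\<phi> (eval_res n (a # L)))
      = res_scale (of_int c) (res_scale N (\<phi> (res_term n (k, i, u, j)))) + res_scale N (\<phi> (eval_res n L))"
    by (simp add: res_scale_simps mult.commute)
  also have "\<dots> = eval_res m (act_terms i j c (G k u)) + eval_res m (map_terms G L)"
    by (simp add: 1 Cons.IH[OF v(4)] eval_act_terms[OF valid_tableD[OF G v(1)] v(2,3)])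
  finally show ?case by (simp add: map_terms_def a eval_terms_simps)
qed

lemma eval_der_terms:
  fixes T :: "(nat \<Rightarrow> 'k::field kos) \<Rightarrow> (nat \<Rightarrow> 'k kos)"
  assumes n: "n \<le> 4" and D: "multilinear D" "hoch_diff D = 0" and T: "res_der D n T"
    and Dt: "\<And>i. i < 12 \<Longrightarrow> D [fk_basis i] = eval_fk (Dt i)"
    and gen: "\<And>k u. (k, u) \<in> res_index n \<Longrightarrow> T (res_gen n k u 1 1) = eval_res n (G k u)"
    and G: "valid_table n n G" and L: "valid_terms n L"
  shows "T (eval_res n L) = eval_res n (der_terms Dt G L)"
  using L
proof (induction L)
  case Nil
  have "T 0 = 0" using res_derD(2)[OF T, of 0 0] by (simp add: bimodule.carrier_closed[OF bimodule_res])
  then show ?case by (simp add: der_terms_def eval_terms_simps)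
next
  case (Cons a L)
  obtain c k i u j where a: "a = (c, k, i, u, j)" by (metis prod_cases5)
  have v: "(k, u) \<in> res_index n" "i < 12" "j < 12" "valid_terms n L"
    using Cons.prems by (simp_all add: a valid_terms_simps)
  note C = bimodule.carrier_closed[OF bimodule_res]
  have g: "res_gen n k u x y \<in> bcarrier (res_bimod n)" for x y :: "'k fk3" using n v by (simp add: res_gen_carrier)
  have D1: "D [1] = 0" using derivation_cocycle[OF D, of 1 1] by simp
  \<comment> \<open>\<open>res_der\<close> demands additivity only; scalars act as multiples of 1,
    which D kills, so T commutes with them.\<close>
  have scaleT: "T (res_scale d \<rho>) = res_scale d (T \<rho>)" if "\<rho> \<in> bcarrier (res_bimod n)" for d \<rho>
    using that res_derD(3)[OF T that, of "fk_scale d 1"] res_derD(1)[OF T that]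
    by (simp add: bimodule.scale_conv_lact[OF bimodule_res] linearD[OF derivation_linear[OF D(1)]] D1
        linearD(4)[OF bimodule.lact_left[OF bimodule_res]])
  have "T (res_term n (k, i, u, j)) =
      res_gen n k u (D [fk_basis i]) (fk_basis j) + res_gen n k u (fk_basis i) (D [fk_basis j])
      + lact (res_bimod n) (fk_basis i) (ract (res_bimod n) (eval_res n (G k u)) (fk_basis j))"
    unfolding gen[OF v(1), symmetric]
    unfolding res_term_def prod.case res_gen_conv[of n k u "fk_basis i" "fk_basis j"]
    using g by (simp add: res_derD[OF T] C bimodule.act_simps[OF bimodule_res])
      (simp add: res_gen_act)
  moreover have "eval_res n (map (\<lambda>(d, i'). (c * d, k, i', u, j)) (Dt i))
      = res_scale (of_int c) (res_gen n k u (D [fk_basis i]) (fk_basis j))"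
    "eval_res n (map (\<lambda>(d, j'). (c * d, k, i, u, j')) (Dt j))
      = res_scale (of_int c) (res_gen n k u (fk_basis i) (D [fk_basis j]))"
    unfolding eval_res_map[of "res_term n" c "\<lambda>i. (k, i, u, j)"] eval_res_map[of "res_term n" c "\<lambda>j. (k, i, u, j)"]
      Dt[OF v(2)] Dt[OF v(3)] eval_fk_def
    by (simp_all add: eval_terms_linear[OF res_gen_linear(1)] eval_terms_linear[OF res_gen_linear(2)]
        res_term_def)
  moreover have "(res_term n (k, i, u, j) :: nat \<Rightarrow> 'k kos) \<in> bcarrier (res_bimod n)"
    using g by (simp add: res_term_def)
  then have "T (eval_res n (a # L)) = res_scale (of_int c) (T (res_term n (k, i, u, j))) + T (eval_res n L)"
    using n v(4) by (simp add: a eval_terms_simps res_derD[OF T] valid_terms_carrier C scaleT)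
  ultimately show ?case
    by (simp add: der_terms_def a eval_terms_simps Cons.IH[OF v(4), unfolded der_terms_def] res_scale_simps
        eval_act_terms[OF valid_tableD[OF G v(1)] v(2,3)])
qed

lemma eval_map_fk:
  fixes \<phi> :: "(nat \<Rightarrow> 'k::field kos) \<Rightarrow> 'k fk3"
  assumes n: "n \<le> 4" and \<phi>: "\<phi> \<in> bimod_hom (res_bimod n) fk_bimod"
    and gen: "\<And>k u. (k, u) \<in> res_index n \<Longrightarrow> \<phi> (res_gen n k u 1 1) = eval_fk (G k u)"
    and G: "valid_fk_table n G" and L: "valid_terms n L"
  shows "\<phi> (eval_res n L) = eval_fk (map_fk G L)"
  using L
proof (induction L)
  case Nil
  show ?case
    by (simp add: map_fk_def eval_terms_simps eval_fk_simps bimod_hom_more(2)[OF bimodule_res bimodule_fk \<phi>]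
     )
next
  case (Cons a L)
  obtain c k i u j where a: "a = (c, k, i, u, j)" by (metis prod_cases5)
  have v: "(k, u) \<in> res_index n" "i < 12" "j < 12" "valid_terms n L"
    using Cons.prems by (simp_all add: a valid_terms_simps)
  have g: "(res_gen n k u 1 1 :: nat \<Rightarrow> 'k kos) \<in> bcarrier (res_bimod n)" using n v by (simp add: res_gen_carrier)
  have inner: "eval_fk (map (\<lambda>(q, t). (d * q, t)) M) = fk_scale (of_int d) (eval_fk M)" for d M
    using eval_terms_map[OF vector_space_fk_scale, of fk_basis d "\<lambda>t. t" M] by (simp add: eval_fk_def)
  have mid: "eval_fk (concat (map (\<lambda>(p, m). map (\<lambda>(q, t). (d * p * q, t)) (fk_times m j)) P))
      = fk_scale (of_int d) (eval_fk P * fk_basis j)" if "valid_fk P" for d P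
    using that
  proof (induction P)
    case (Cons b P)
    then show ?case
      using v(3) by (cases b) (auto simp: eval_fk_simps valid_fk_simps inner fk_times[symmetric] distrib_right
          fk_scale_mult fk.scale_right_distrib)
  qed (simp add: eval_fk_simps)
  have outer: "eval_fk (concat (map (\<lambda>(e, l). concat (map (\<lambda>(p, m). map (\<lambda>(q, t). (c * e * p * q, t))
      (fk_times m j)) (fk_times i l))) P)) = fk_scale (of_int c) (fk_basis i * eval_fk P * fk_basis j)"
    if "valid_fk P" for P
    using that
  proof (induction P)
    case (Cons b P)
    obtain e l where b: "b = (e, l)" by (cases b)
    have l: "l < 12" "valid_fk P" using Cons.prems by (simp_all add: b valid_fk_simps)
    show ?case
      unfolding b list.map concat.simps prod.case eval_fk_simps Cons.IH[OF l(2)]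
        mid[OF fk_times_valid[OF v(2) l(1)], of "c * e"] fk_times[OF v(2) l(1), symmetric]
      by (simp add: distrib_left distrib_right fk_scale_mult fk.scale_right_distrib)
  qed (simp add: eval_fk_simps)
  have "\<phi> (res_term n (k, i, u, j)) = fk_basis i * eval_fk (G k u) * fk_basis j"
    unfolding res_term_def prod.case res_gen_conv[of n k u "fk_basis i"] gen[OF v(1), symmetric]
    using g by (simp add: bimod_homD[OF \<phi>] bimodule.carrier_closed[OF bimodule_res] mult.assoc)
  moreover have "(res_term n (k, i, u, j) :: nat \<Rightarrow> 'k kos) \<in> bcarrier (res_bimod n)"
    using n v by (simp add: res_term_def res_gen_carrier)
  then have "\<phi> (eval_res n (a # L)) = fk_scale (of_int c) (\<phi> (res_term n (k, i, u, j))) + \<phi> (eval_res n L)"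
    using n v(4) by (simp add: a eval_terms_simps bimod_homD[OF \<phi>] valid_terms_carrier
        bimod_hom_more[OF bimodule_res bimodule_fk \<phi>] bimodule.carrier_closed[OF bimodule_res])
  ultimately show ?case
    using Cons.IH[OF v(4)] unfolding map_fk_def a list.map concat.simps prod.case eval_fk_simps
      outer[OF valid_fk_tableD[OF G v(1)]] by simp
qed

lemma eval_der_fk:
  assumes D: "multilinear D" and Dt: "\<And>i. i < 12 \<Longrightarrow> D [fk_basis i] = eval_fk (Dt i)" and L: "valid_fk L"
  shows "D [eval_fk L] = eval_fk (der_fk Dt L)"
  using L
proof (induction L)
  case Nil
  show ?case by (simp add: der_fk_def eval_fk_simps linearD[OF derivation_linear[OF D]])
next
  case (Cons a L)
  then show ?case
    by (cases a) (simp add: der_fk_def eval_fk_simps linearD[OF derivation_linear[OF D]] valid_fk_simps Dt)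
qed

subsection \<open>The differential of the resolution\<close>

definition kos_embed :: "'k::field kos \<Rightarrow> nat \<Rightarrow> 'k kos"
  where "kos_embed t = (\<lambda>l. if l = 0 then t else 0)"

lemma linear_kos_embed: "Vector_Spaces.linear kos_scale res_scale kos_embed"
  by (intro linear_from_comb vector_space_kos_scale vector_space_res_scale)
    (auto simp: kos_embed_def res_scale_def fun_eq_iff plus_fun_apply)

lemma res_gen_embed: "res_gen n 0 u x y = kos_embed (kos_pure x (dual_gen n u) y)"
  by (auto simp: res_gen_def kos_embed_def fun_eq_iff)

definition diff_terms :: "nat \<Rightarrow> nat \<Rightarrow> (int \<times> res_index) list"
  where "diff_terms n u = concat (map (\<lambda>(g, i). map (\<lambda>j. ((- 1) ^ Suc n, 0, i, j, 0)) (lshift_index n g u)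
    @ map (\<lambda>j. (1, 0, 0, j, i)) (rshift_index n g u)) [(Ga, 1), (Gb, 2), (Gc, 3)])"

lemma res_diff_gen:
  assumes f: "\<And>m. f m 0 = 0" and n: "Suc n \<le> 4" and u: "u < basis_size (Suc n)"
  shows "res_diff f (Suc n) (res_gen (Suc n) 0 u 1 1) = eval_res n (diff_terms n u)"
proof -
  have l: "eval_res n (map (\<lambda>j. (c, 0, i, j, 0)) L)
      = kos_embed (kos_scale (of_int c) (kos_pure (fk_basis i) (sum_list (map (dual_gen n) L)) 1))"
    "eval_res n (map (\<lambda>j. (c, 0, 0, j, i)) L)
      = kos_embed (kos_scale (of_int c) (kos_pure 1 (sum_list (map (dual_gen n) L)) (fk_basis i)))" for c i L
    by (induction L) (simp_all add: eval_terms_simps res_term_def res_gen_embed linearD[OF linear_kos_embed]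
        kos_pure_simps kos.scale_right_distrib)
  have "res_diff f (Suc n) (res_gen (Suc n) 0 u 1 1)
      = kos_embed (kos_diff (Suc n) (kos_pure 1 (dual_gen (Suc n) u) 1))"
    by (auto simp: res_diff_def res_gen_def kos_embed_def fun_eq_iff f linearD[OF linear_kos_diff])
  then show ?thesis
    by (simp add: kos_diff_pure dual_shift_gen[OF n u] diff_terms_def eval_terms_simps l
        linearD[OF linear_kos_embed] add.assoc)
qed

text \<open>The differentials in degrees 1 to 4 on generators as literal lists, so that later
  evaluations need not recompute shifts. The second row in degree 4 is f_0(1|\<epsilon>|1)
  multiplied out; the entry for degree 0 is a placeholder.\<close>

definition diff_table :: "nat \<Rightarrow> res_index table"
  where "diff_table n k u = [[],
   [[[(1, 0, 0, 0, 1), (- 1, 0, 1, 0, 0)],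
    [(1, 0, 0, 0, 2), (- 1, 0, 2, 0, 0)],
    [(1, 0, 0, 0, 3), (- 1, 0, 3, 0, 0)]]],
   [[[(1, 0, 0, 0, 1), (1, 0, 1, 0, 0)],
    [(1, 0, 0, 1, 2), (1, 0, 2, 1, 0)],
    [(1, 0, 0, 2, 3), (1, 0, 3, 2, 0)],
    [(1, 0, 0, 0, 2), (1, 0, 0, 1, 3), (1, 0, 0, 2, 1), (1, 0, 1, 1, 0), (1, 0, 2, 2, 0), (1, 0, 3,
    0, 0)],
    [(1, 0, 0, 0, 3), (1, 0, 0, 1, 1), (1, 0, 0, 2, 2), (1, 0, 1, 2, 0), (1, 0, 2, 0, 0), (1, 0, 3,
    1, 0)]]],
   [[[(1, 0, 0, 0, 1), (- 1, 0, 1, 0, 0)],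
    [(1, 0, 0, 1, 2), (- 1, 0, 2, 1, 0)],
    [(1, 0, 0, 2, 3), (- 1, 0, 3, 2, 0)],
    [(1, 0, 0, 0, 2), (1, 0, 0, 2, 2), (1, 0, 0, 3, 3), (1, 0, 0, 4, 1), (- 1, 0, 1, 3, 0), (- 1,
    0, 2, 0, 0), (- 1, 0, 2, 2, 0), (- 1, 0, 3, 4, 0)],
    [(1, 0, 0, 0, 3), (1, 0, 0, 1, 3), (1, 0, 0, 3, 1), (1, 0, 0, 4, 2), (- 1, 0, 1, 4, 0), (- 1,
    0, 2, 3, 0), (- 1, 0, 3, 0, 0), (- 1, 0, 3, 1, 0)],
    [(1, 0, 0, 1, 1), (1, 0, 0, 2, 1), (1, 0, 0, 3, 2), (1, 0, 0, 4, 3), (- 1, 0, 1, 1, 0), (- 1,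
    0, 1, 2, 0), (- 1, 0, 2, 4, 0), (- 1, 0, 3, 3, 0)]]],
   [[[(1, 0, 0, 0, 1), (1, 0, 1, 0, 0)],
    [(1, 0, 0, 1, 2), (1, 0, 2, 1, 0)],
    [(1, 0, 0, 2, 3), (1, 0, 3, 2, 0)],
    [(1, 0, 0, 0, 2), (1, 0, 0, 1, 3), (1, 0, 0, 2, 1), (1, 0, 0, 3, 3), (1, 0, 0, 4, 1), (1, 0, 0,
    5, 2), (1, 0, 1, 1, 0), (1, 0, 1, 3, 0), (1, 0, 2, 2, 0), (1, 0, 2, 4, 0), (1, 0, 3, 0, 0), (1,
    0, 3, 5, 0)],
    [(1, 0, 0, 0, 3), (1, 0, 0, 1, 1), (1, 0, 0, 2, 2), (1, 0, 0, 3, 1), (1, 0, 0, 4, 2), (1, 0, 0,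
    5, 3), (1, 0, 1, 2, 0), (1, 0, 1, 4, 0), (1, 0, 2, 0, 0), (1, 0, 2, 5, 0), (1, 0, 3, 1, 0), (1,
    0, 3, 3, 0)],
    [(1, 0, 0, 3, 2), (1, 0, 0, 4, 3), (1, 0, 0, 5, 1), (1, 0, 1, 5, 0), (1, 0, 2, 3, 0), (1, 0, 3,
    4, 0)]],
   [[(2, 0, 0, 0, 10), (2, 0, 0, 1, 9), (- 2, 0, 0, 2, 8), (- 1, 0, 0, 3, 9), (1, 0, 0, 4, 8), (-
    1, 0, 0, 5, 10), (- 2, 0, 1, 1, 6), (- 2, 0, 1, 1, 7), (2, 0, 1, 2, 5), (1, 0, 1, 3, 6), (1, 0,
    1, 3, 7), (- 1, 0, 1, 4, 5), (- 2, 0, 2, 0, 4), (- 2, 0, 2, 0, 5), (2, 0, 2, 2, 7), (- 1, 0, 2,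
    4, 7), (1, 0, 2, 5, 4), (1, 0, 2, 5, 5), (2, 0, 3, 0, 6), (2, 0, 3, 1, 4), (- 1, 0, 3, 3, 4),
    (- 1, 0, 3, 5, 6), (2, 0, 4, 0, 3), (- 2, 0, 4, 2, 2), (1, 0, 4, 4, 2), (- 1, 0, 4, 5, 3), (2,
    0, 5, 1, 1), (- 2, 0, 5, 2, 2), (- 1, 0, 5, 3, 1), (1, 0, 5, 4, 2), (2, 0, 6, 1, 3), (- 2, 0,
    6, 2, 1), (- 1, 0, 6, 3, 3), (1, 0, 6, 4, 1), (2, 0, 7, 0, 2), (- 2, 0, 7, 2, 1), (1, 0, 7, 4,
    1), (- 1, 0, 7, 5, 2), (- 2, 0, 8, 2, 0), (1, 0, 8, 4, 0), (2, 0, 9, 1, 0), (- 1, 0, 9, 3, 0),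
    (2, 0, 10, 0, 0), (- 1, 0, 10, 5, 0)]]]] ! n ! k ! u"

text \<open>Replaces the definite description \<open>dual_basis\<close> by an explicit functional:
  an element of the component is determined by its values on basis words.\<close>

lemma dual_basis_conv:
  assumes n: "n \<le> 4" and b: "(fkd_basis n :: 'k::field fkd set) = fkd_word ` set (words_basis n)" and i: "i < basis_size n"
  shows "dual_basis n (fkd_word (words_basis n ! i)) = (dual_gen n i :: 'k fkd_dual)"
proof -
  have inj: "(fkd_word (words_basis n ! j) :: 'k fkd) = fkd_word (words_basis n ! i) \<longleftrightarrow> i = j"
    if "j < basis_size n" for j
  proof
    assume eq: "(fkd_word (words_basis n ! j) :: 'k fkd) = fkd_word (words_basis n ! i)"
    have "(if i = j then 1 else 0) = (if i = i then 1 else (0 :: 'k))"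
      unfolding dual_gen_app[OF n i that, symmetric] dual_gen_app[OF n i i, symmetric] eq ..
    then show "i = j" by (simp split: if_splits)
  qed simp
  show ?thesis
    unfolding dual_basis_def
  proof (rule the_equality)
    show "(dual_gen n i :: 'k fkd_dual) \<in> dual_component n \<and> (\<forall>w'\<in>fkd_basis n. dual_app (dual_gen n i :: 'k fkd_dual) w'
        = (if w' = fkd_word (words_basis n ! i) then 1 else 0))"
    proof (intro conjI ballI dual_gen_component[OF n i])
      fix w' :: "'k fkd" assume "w' \<in> fkd_basis n"
      then obtain j where j: "w' = fkd_word (words_basis n ! j)" "j < basis_size n"
        unfolding b basis_size_def by (auto simp: in_set_conv_nth)
      show "dual_app (dual_gen n i :: 'k fkd_dual) w' = (if w' = fkd_word (words_basis n ! i) then 1 else 0)"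
        unfolding j(1) inj[OF j(2)] dual_gen_app[OF n i j(2)] ..
    qed
  next
    fix v :: "'k fkd_dual"
    assume v: "v \<in> dual_component n \<and> (\<forall>w'\<in>fkd_basis n. dual_app v w'
        = (if w' = fkd_word (words_basis n ! i) then 1 else 0))"
    show "v = dual_gen n i"
    proof (rule dual_component_eqI[OF n])
      fix j assume j: "j < basis_size n"
      then have "words_basis n ! j \<in> set (words_basis n)" by (simp add: basis_size_def)
      then have "(fkd_word (words_basis n ! j) :: 'k fkd) \<in> fkd_basis n" by (simp add: b)
      then have "dual_app v (fkd_word (words_basis n ! j))
          = (if fkd_word (words_basis n ! j) = (fkd_word (words_basis n ! i) :: 'k fkd) then 1 else 0)"
        using v by blast
      then show "dual_app v (fkd_word (words_basis n ! j)) = dual_app (dual_gen n i) (fkd_word (words_basis n ! j))"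
        unfolding inj[OF j] dual_gen_app[OF n i j] .
    qed (use v dual_gen_component[OF n i] in auto)
  qed
qed

lemma dual_basis_small:
  "dual_basis 0 1 = (dual_gen 0 0 :: 'k::field fkd_dual)"
  "dual_basis 3 (fkd_A ^ 3) = (dual_gen 3 0 :: 'k fkd_dual)"
  "dual_basis 3 (fkd_B ^ 3) = (dual_gen 3 1 :: 'k fkd_dual)"
  "dual_basis 3 (fkd_C ^ 3) = (dual_gen 3 2 :: 'k fkd_dual)"
  "dual_basis 3 (fkd_A ^ 2 * fkd_B) = (dual_gen 3 3 :: 'k fkd_dual)"
  "dual_basis 3 (fkd_A ^ 2 * fkd_C) = (dual_gen 3 4 :: 'k fkd_dual)"
  "dual_basis 3 (fkd_A * fkd_B ^ 2) = (dual_gen 3 5 :: 'k fkd_dual)"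
proof -
  have b: "fkd_basis 3 = (fkd_word ` set (words_basis 3) :: 'k fkd set)"
    by (simp add: fkd_basis_def words_basis_small fkd_word_simps power2_eq_square power3_eq_cube mult.assoc)
  have s: "basis_size 3 = 6" by (simp add: basis_size_def words_basis_small)
  note c = dual_basis_conv[OF _ b, unfolded s, simplified]
  show "dual_basis 3 (fkd_A ^ 3) = (dual_gen 3 0 :: 'k fkd_dual)" "dual_basis 3 (fkd_B ^ 3) = (dual_gen 3 1 :: 'k fkd_dual)"
    "dual_basis 3 (fkd_C ^ 3) = (dual_gen 3 2 :: 'k fkd_dual)"
    "dual_basis 3 (fkd_A ^ 2 * fkd_B) = (dual_gen 3 3 :: 'k fkd_dual)"
    "dual_basis 3 (fkd_A ^ 2 * fkd_C) = (dual_gen 3 4 :: 'k fkd_dual)"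
    "dual_basis 3 (fkd_A * fkd_B ^ 2) = (dual_gen 3 5 :: 'k fkd_dual)"
    using c[of 0] c[of 1] c[of 2] c[of 3] c[of 4] c[of 5]
    by (simp_all add: words_basis_small fkd_word_simps power2_eq_square power3_eq_cube mult.assoc)
  have "fkd_basis 0 = (fkd_word ` set (words_basis 0) :: 'k fkd set)"
    by (simp add: fkd_basis_def words_basis_small fkd_word_simps)
  from dual_basis_conv[OF _ this, of 0] show "dual_basis 0 1 = (dual_gen 0 0 :: 'k fkd_dual)"
    by (simp add: basis_size_def words_basis_small fkd_word_simps)
qed

definition tensor_terms :: "(int \<times> nat) list \<Rightarrow> (int \<times> nat) list \<Rightarrow> (int \<times> nat) list \<Rightarrow> (int \<times> res_index) list"
  where "tensor_terms X U Y = concat (map (\<lambda>(c, i). concat (map (\<lambda>(d, u).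
    map (\<lambda>(e, j). (c * d * e, 0, i, u, j)) Y) U)) X)"

abbreviation "eval_kos n \<equiv> eval_terms kos_scale (\<lambda>(k, i, u, j). kos_pure (fk_basis i) (dual_gen n u) (fk_basis j))"

lemma eval_tensor_terms:
  "eval_kos n (tensor_terms X U Y) = kos_pure (eval_fk X) (eval_terms dual_scale (dual_gen n) U) (eval_fk Y)"
proof -
  have 1: "eval_kos n (map (\<lambda>(e, j). (c * e, 0, i, u, j)) Y)
      = kos_scale (of_int c) (kos_pure (fk_basis i) (dual_gen n u) (eval_fk Y))" for c i u
    unfolding eval_terms_map[OF vector_space_kos_scale, of _ c "\<lambda>j. (0, i, u, j)"] eval_fk_def
    by (simp add: eval_terms_linear[OF kos_pure_linear(3)])
  have 2: "eval_kos n (concat (map (\<lambda>(d, u). map (\<lambda>(e, j). (c * d * e, 0, i, u, j)) Y) U))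
      = kos_scale (of_int c) (kos_pure (fk_basis i) (eval_terms dual_scale (dual_gen n) U) (eval_fk Y))" for c i
  proof (induction U)
    case (Cons a U)
    then show ?case
      by (cases a) (simp add: eval_terms_simps 1 kos_pure_simps kos.scale_right_distrib)
  qed (simp add: eval_terms_simps kos_pure_simps)
  show ?thesis
    unfolding tensor_terms_def
  proof (induction X)
    case (Cons a X)
    then show ?case
      by (cases a) (simp add: eval_terms_simps eval_fk_simps 2 kos_pure_simps)
  qed (simp add: eval_terms_simps eval_fk_simps kos_pure_simps)
qed

text \<open>Ordered and bracketed exactly like the sum in \<open>f0_value\<close>, so that unfolding
  matches the two. The middle lists are p = [(1,5),(-2,0)], q = [(1,3),(-2,1)] and r =
  [(1,4),(-2,2)].\<close>

definition f0_terms :: "(int \<times> res_index) list"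
  where "f0_terms =
     (((((((((((((((((scale_terms (- 1) (tensor_terms [(1, 0)] [(1, 5), (- 2, 0)] [(1, 10)])) @
     scale_terms (- 1) (tensor_terms [(1, 0)] [(1, 3), (- 2, 1)] [(1, 9)])) @
     tensor_terms [(1, 0)] [(1, 4), (- 2, 2)] [(1, 8)]) @
     tensor_terms [(1, 1)] [(1, 3), (- 2, 1)] [(1, 6), (1, 7)]) @
     scale_terms (- 1) (tensor_terms [(1, 1)] [(1, 4), (- 2, 2)] [(1, 5)])) @
     tensor_terms [(1, 2)] [(1, 5), (- 2, 0)] [(1, 4), (1, 5)]) @
     scale_terms (- 1) (tensor_terms [(1, 2)] [(1, 4), (- 2, 2)] [(1, 7)])) @
     scale_terms (- 1) (tensor_terms [(1, 3)] [(1, 3), (- 2, 1)] [(1, 4)])) @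
     scale_terms (- 1) (tensor_terms [(1, 3)] [(1, 5), (- 2, 0)] [(1, 6)])) @
     scale_terms (- 1) (tensor_terms [(1, 5)] [(1, 3), (- 2, 1)] [(1, 1)])) @
     tensor_terms [(1, 6), (1, 7)] [(1, 4), (- 2, 2)] [(1, 1)]) @
     tensor_terms [(1, 4), (1, 5)] [(1, 4), (- 2, 2)] [(1, 2)]) @
     scale_terms (- 1) (tensor_terms [(1, 7)] [(1, 5), (- 2, 0)] [(1, 2)])) @
     scale_terms (- 1) (tensor_terms [(1, 6)] [(1, 3), (- 2, 1)] [(1, 3)])) @
     scale_terms (- 1) (tensor_terms [(1, 4)] [(1, 5), (- 2, 0)] [(1, 3)])) @
     scale_terms (- 1) (tensor_terms [(1, 10)] [(1, 5), (- 2, 0)] [(1, 0)])) @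
     scale_terms (- 1) (tensor_terms [(1, 9)] [(1, 3), (- 2, 1)] [(1, 0)])) @
     tensor_terms [(1, 8)] [(1, 4), (- 2, 2)] [(1, 0)]"

lemma f0_value_terms: "f0_value = eval_kos 3 f0_terms"
proof -
  have u: "eval_terms dual_scale (dual_gen 3) [(1, i), (- 2, j)] = dual_gen 3 i - dual_scale 2 (dual_gen 3 j)" for i j
    by (simp add: eval_terms_simps
        module.scale_minus_left[OF module_iff_vector_space[THEN iffD2, OF vector_space_dual_scale]]
        module.scale_one[OF module_iff_vector_space[THEN iffD2, OF vector_space_dual_scale]])
  have neg: "eval_kos 3 (scale_terms (- 1) L) = - eval_kos 3 L" for L
    by (simp add: eval_scale_terms[OF vector_space_kos_scale] kos.scale_minus_left)
  show ?thesis
    unfolding f0_terms_def eval_terms_simps(3) neg eval_tensor_terms u f0_value_def Let_def dual_basis_small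
      eval_fk_simps fk_basis_simps
    by (simp add: mult.assoc)
qed

lemma f0_terms_check: "vanishes res_less (f0_terms @ scale_terms (- 1) (diff_table 4 1 0))"
  by code_simp

lemma f0_terms_index: "list_all (\<lambda>(c, k, i, u, j). k = 0) f0_terms"
  by code_simp

lemma eval_res_vanishes:
  assumes "vanishes res_less (L @ scale_terms (- c) M)"
  shows "eval_res n L = res_scale (of_int c) (eval_res n M)"
  using eval_vanishes[OF vector_space_res_scale assms, of "res_term n"]
  by (simp add: eval_terms_simps eval_scale_terms[OF vector_space_res_scale]
      module.scale_minus_left[OF module_res_scale])

lemma res_diff_f0:
  assumes f: "\<And>m. f m 0 = 0" and f0: "f 0 (kos_pure 1 (dual_basis 0 1) 1) = f0_value"
  shows "res_diff f (Suc 3) (res_gen (Suc 3) 1 0 1 1) = (eval_res 3 (diff_table 4 1 0) :: nat \<Rightarrow> 'k::field kos)"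
proof -
  have "res_diff f (Suc 3) (res_gen (Suc 3) 1 0 1 1) = kos_embed f0_value"
    using f0 by (auto simp: res_diff_def res_gen_def kos_embed_def fun_eq_iff f kos_diff_def[of 0]
        zero_fun_apply linearD[OF linear_kos_diff] dual_basis_small)
  also have "\<dots> = eval_res 3 f0_terms"
  proof -
    have "kos_embed (eval_kos 3 L) = eval_res 3 L" if "list_all (\<lambda>(c, k, i, u, j). k = 0) L" for L
      using that by (induction L) (auto simp: eval_terms_simps linearD[OF linear_kos_embed] res_term_def res_gen_embed)
    then show ?thesis unfolding f0_value_terms using f0_terms_index by blast
  qed
  also have "\<dots> = eval_res 3 (diff_table 4 1 0)"
    by (simp add: eval_res_vanishes[OF f0_terms_check] module.scale_one[OF module_res_scale])
  finally show ?thesis .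
qed

lemma diff_table_check:
  "list_all (\<lambda>n. list_all (\<lambda>u. vanishes res_less (diff_terms n u @ scale_terms (- 1) (diff_table (Suc n) 0 u)))
    [0..<basis_size (Suc n)]) [0, 1, 2, 3]"
  by code_simp

lemma diff_table_valid: "n < 4 \<Longrightarrow> valid_table (Suc n) n (diff_table (Suc n))"
proof -
  have "list_all (\<lambda>n. valid_table (Suc n) n (diff_table (Suc n))) [0, 1, 2, 3]" by code_simp
  then show "n < 4 \<Longrightarrow> valid_table (Suc n) n (diff_table (Suc n))" by (auto simp: less_Suc_eq numeral_eq_Suc)
qed

context comparison
begin

lemma f_0: "f m 0 = 0"
proof -
  have "f m \<in> bimod_hom (kos_bimod m) (kos_bimod (m + 3))"
    using res[unfolded fk_resolution_def, THEN conjunct1] by (rule spec)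
  then show ?thesis by (rule bimod_hom_more(2)[OF bimodule_kos bimodule_kos])
qed

text \<open>Through degree 4 the only summand with k > 0 is \<omega>_1 in degree 4. So of all the
  f_j only the value of f_0 on its generator enters, and that is prescribed by
  \<open>fk_resolution\<close>.\<close>

lemma res_diff_table:
  assumes "n < 4" "(k, u) \<in> res_index (Suc n)"
  shows "res_diff f (Suc n) (res_gen (Suc n) k u 1 1) = eval_res n (diff_table (Suc n) k u)"
proof (cases "k = 0")
  case True
  have n: "n \<in> set [0, 1, 2, 3]" and u: "u \<in> set [0..<basis_size (Suc n)]"
    using assms True by (auto simp: res_index_def)
  have v: "vanishes res_less (diff_terms n u @ scale_terms (- 1) (diff_table (Suc n) 0 u))"
    using diff_table_check n u unfolding list_all_iff by blast
  have "eval_res n (diff_terms n u) = (eval_res n (diff_table (Suc n) 0 u) :: nat \<Rightarrow> 'k kos)"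
    by (simp add: eval_res_vanishes[OF v] module.scale_one[OF module_res_scale])
  then show ?thesis
    using assms True res_diff_gen[of f n u, OF f_0] by (simp add: res_index_def)
next
  case False
  then have k: "n = 3" "k = 1" using assms by (auto simp: res_index_def)
  then have "u = 0" using assms by (simp add: res_index_def basis_size_def words_basis_small)
  moreover have "f 0 (kos_pure 1 (dual_basis 0 1) 1) = f0_value"
    by (rule res[unfolded fk_resolution_def, THEN conjunct2, THEN conjunct2, THEN conjunct1])
  ultimately show ?thesis using res_diff_f0[of f, OF f_0] k by simp
qed

end

subsection \<open>Operators over a derivation\<close>

text \<open>D on the two outer coefficients: the operator over D that kills every 1|u|1. It has the
  Leibniz behaviour but need not commute with the differential.\<close>

definition kos_der :: "'k::field cochain \<Rightarrow> 'k kos \<Rightarrow> 'k kos"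
  where "kos_der D = kos_ext kos_scale (\<lambda>x u y. kos_pure (D [x]) u y + kos_pure x u (D [y]))"

lemma tlin_kos_der:
  "multilinear D \<Longrightarrow> tlin kos_scale (\<lambda>x u y. kos_pure (D [x]) u y + kos_pure x u (D [y]))"
  by (simp add: tlin_def linearD[OF derivation_linear] kos_pure_simps kos.scale_right_distrib)

lemma kos_der_pure:
  "multilinear D \<Longrightarrow> kos_der D (kos_pure x u y) = kos_pure (D [x]) u y + kos_pure x u (D [y])"
  by (simp add: kos_der_def kos_ext_pure[OF vector_space_kos_scale tlin_kos_der])

lemma linear_kos_der: "multilinear D \<Longrightarrow> Vector_Spaces.linear kos_scale kos_scale (kos_der D)"
  unfolding kos_der_def by (rule linear_kos_ext[OF vector_space_kos_scale tlin_kos_der])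

lemma kos_der_act:
  assumes "multilinear D" "hoch_diff D = 0"
  shows "kos_der D (kos_lact z t) = kos_lact (D [z]) t + kos_lact z (kos_der D t)"
    "kos_der D (kos_ract t z) = kos_ract t (D [z]) + kos_ract (kos_der D t) z"
proof -
  note l = linear_kos_act(1) and r = linear_kos_act(2) and d = linear_kos_der[OF assms(1)]
  show "kos_der D (kos_lact z t) = kos_lact (D [z]) t + kos_lact z (kos_der D t)"
    by (rule kos_linear_eqI[OF linear_comp[OF l d] linear_plus[OF l linear_comp[OF d l]]])
      (simp add: kos_der_pure assms derivation_cocycle kos_pure_simps add.assoc)
  show "kos_der D (kos_ract t z) = kos_ract t (D [z]) + kos_ract (kos_der D t) z"
    by (rule kos_linear_eqI[OF linear_comp[OF r d] linear_plus[OF r linear_comp[OF d r]]])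
      (simp add: kos_der_pure assms derivation_cocycle kos_pure_simps ac_simps)
qed

lemma kos_der_carrier:
  assumes D: "multilinear D" and t: "t \<in> bcarrier (kos_bimod n)"
  shows "kos_der D t \<in> bcarrier (kos_bimod n)"
proof -
  note C = bimodule.carrier_closed[OF bimodule_kos]
  have "t \<in> kos.span {kos_pure x u y |x u y. u \<in> dual_component n}" using t by (simp add: kos_bimod_def)
  then show ?thesis
  proof (induction rule: kos.span_induct_alt)
    case base
    show ?case by (simp add: linearD[OF linear_kos_der[OF D]] C)
  next
    case (step c s t)
    then obtain x u y where s: "s = kos_pure x u y" "u \<in> dual_component n" by auto
    have "kos_der D s \<in> bcarrier (kos_bimod n)"
      unfolding s kos_der_pure[OF D] by (intro C(2) kos_carrier s)
    then show ?case using step by (simp add: linearD[OF linear_kos_der[OF D]] C)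
  qed
qed

text \<open>Two operators over the same D differ by a bimodule morphism, so adding a morphism to
  \<open>kos_der\<close> gives the general form. It is determined by its values on generators, which
  \<open>G\<close> lists after multiplication by \<open>N\<close>.\<close>

definition res_op :: "'k::field cochain \<Rightarrow> int \<Rightarrow> nat \<Rightarrow> res_index table \<Rightarrow> (nat \<Rightarrow> 'k kos) \<Rightarrow> nat \<Rightarrow> 'k kos"
  where "res_op D N n G \<rho> = res_scale (1 / of_int N)
    (res_hom res_scale (res_bimod n) n (\<lambda>k u. eval_res n (G k u)) \<rho>) + (\<lambda>l. kos_der D (\<rho> l))"

lemma res_op:
  assumes D: "multilinear D" "hoch_diff D = 0" and n: "n \<le> 4" and G: "valid_table n n G"
  shows "res_der D n (res_op D N n G)"
    "(k, u) \<in> res_index n \<Longrightarrow> res_op D N n G (res_gen n k u 1 1)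
      = res_scale (1 / of_int N) (eval_res n (G k u) :: nat \<Rightarrow> 'k::field kos)"
proof -
  let ?h = "res_hom res_scale (res_bimod n) n (\<lambda>k u. eval_res n (G k u) :: nat \<Rightarrow> 'k kos)"
  let ?d = "\<lambda>(\<rho> :: nat \<Rightarrow> 'k kos) l. kos_der D (\<rho> l)"
  note h = res_hom[where v = "\<lambda>k u. eval_res n (G k u) :: nat \<Rightarrow> 'k kos",
      OF bimodule_res n valid_terms_carrier[OF n valid_tableD[OF G]]]
  note C = bimodule.carrier_closed[OF bimodule_res] and act = bimodule.act_simps[OF bimodule_res]
  note k = linearD[OF linear_kos_der[OF D(1)]]
  have h1: "?h \<in> bimod_hom (res_bimod n) (res_bimod n)" by (rule h)
  have d: "?d \<rho> \<in> bcarrier (res_bimod n)" if "\<rho> \<in> bcarrier (res_bimod n)" for \<rho>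
    using that kos_der_carrier[OF D(1)] by (auto simp: res_bimod_def k)
  have d': "?d (\<rho> + \<rho>') = ?d \<rho> + ?d \<rho>'"
    "?d (lact (res_bimod n) x \<rho>) = lact (res_bimod n) (D [x]) \<rho> + lact (res_bimod n) x (?d \<rho>)"
    "?d (ract (res_bimod n) \<rho> x) = ract (res_bimod n) \<rho> (D [x]) + ract (res_bimod n) (?d \<rho>) x" for \<rho> \<rho>' x
    by (simp_all add: fun_eq_iff plus_fun_apply k res_bimod_def kos_der_act[OF D])
  show "res_der D n (res_op D N n G)"
    unfolding res_der_def
  proof (intro ballI conjI allI)
    fix \<rho> \<rho>' :: "nat \<Rightarrow> 'k kos" assume \<rho>: "\<rho> \<in> bcarrier (res_bimod n)" and \<rho>': "\<rho>' \<in> bcarrier (res_bimod n)"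
    show "res_op D N n G (\<rho> + \<rho>') = res_op D N n G \<rho> + res_op D N n G \<rho>'"
      unfolding res_op_def d' bimod_homD(2)[OF h1 \<rho> \<rho>'] res_scale_simps by (simp add: ac_simps)
  next
    fix \<rho> :: "nat \<Rightarrow> 'k kos" and x assume \<rho>: "\<rho> \<in> bcarrier (res_bimod n)"
    show "res_op D N n G \<rho> \<in> bcarrier (res_bimod n)"
      unfolding res_op_def by (intro C(2) C(5) bimod_homD(1)[OF h1] d \<rho>)
    show "res_op D N n G (lact (res_bimod n) x \<rho>)
        = lact (res_bimod n) (D [x]) \<rho> + lact (res_bimod n) x (res_op D N n G \<rho>)"
      unfolding res_op_def d' bimod_homD(3)[OF h1 \<rho>] by (simp add: act ac_simps)
    show "res_op D N n G (ract (res_bimod n) \<rho> x)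
        = ract (res_bimod n) \<rho> (D [x]) + ract (res_bimod n) (res_op D N n G \<rho>) x"
      unfolding res_op_def d' bimod_homD(4)[OF h1 \<rho>] by (simp add: act ac_simps)
  qed
  have D1: "D [1] = 0" using derivation_cocycle[OF D, of 1 1] by simp
  have "?d (res_gen n k u 1 1) = 0"
    by (auto simp: res_gen_def fun_eq_iff k kos_der_pure[OF D(1)] D1 kos_pure_simps zero_fun_apply)
  moreover assume ku: "(k, u) \<in> res_index n"
  then have "?h (res_gen n k u 1 1) = eval_res n (G k u)"
    using h(2)[of k u 1 1] by (simp add: bimodule.lact_one[OF bimodule_res] bimodule.ract_one[OF bimodule_res] C
      valid_terms_carrier[OF n valid_tableD[OF G]])
  ultimately show "res_op D N n G (res_gen n k u 1 1) = res_scale (1 / of_int N) (eval_res n (G k u) :: nat \<Rightarrow> 'k kos)"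
    by (simp add: res_op_def)
qed

context comparison
begin

text \<open>In d\<delta> - \<delta>d the Leibniz terms cancel, so it is a bimodule morphism and
  vanishes once it does on generators. A denominator is allowed in the upper degree only, and the
  check is stated after clearing it.\<close>

lemma res_op_chain:
  fixes D :: "'k cochain"
  assumes D: "multilinear D" "hoch_diff D = 0" and Dt: "\<And>i. i < 12 \<Longrightarrow> D [fk_basis i] = eval_fk (Dt i)"
    and n: "n < 4" and G: "valid_table n n G" and G': "valid_table (Suc n) (Suc n) G'"
    and N: "(of_int N :: 'k) \<noteq> 0"
    and check: "list_all (\<lambda>(k, u). vanishes res_less (map_terms (diff_table (Suc n)) (G' k u)
      @ scale_terms (- N) (der_terms Dt G (diff_table (Suc n) k u)))) (index_list (Suc n))"
    and \<rho>: "\<rho> \<in> bcarrier (res_bimod (Suc n))"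
  shows "res_diff f (Suc n) (res_op D N (Suc n) G' \<rho>) = res_op D 1 n G (res_diff f (Suc n) \<rho>)"
proof -
  let ?d = "res_diff f (Suc n)" and ?T' = "res_op D N (Suc n) G'" and ?T = "res_op D 1 n G"
  have n': "n \<le> 4" "Suc n \<le> 4" using n by simp_all
  note T = res_op(1)[OF D n'(1) G, of 1] and T' = res_op(1)[OF D n'(2) G', of N]
  note d = bimod_homD[OF P.d_hom[of n]]
  note C = bimodule.carrier_closed[OF bimodule_res] and act = bimodule.act_simps[OF bimodule_res]
  let ?\<phi> = "\<lambda>\<rho>. ?d (?T' \<rho>) - ?T (?d \<rho>)"
  have hom: "?\<phi> \<in> bimod_hom (res_bimod (Suc n)) (res_bimod n)"
  proof (rule bimod_homI)
    fix \<rho> \<rho>' :: "nat \<Rightarrow> 'k kos" and x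
    assume \<rho>: "\<rho> \<in> bcarrier (res_bimod (Suc n))"
    note d\<rho> = d(1)[OF \<rho>] and T\<rho> = res_derD(1)[OF T' \<rho>]
    show "?\<phi> \<rho> \<in> bcarrier (res_bimod n)" by (intro C(3) d(1) T\<rho> res_derD(1)[OF T] d\<rho>)
    show "?\<phi> (lact (res_bimod (Suc n)) x \<rho>) = lact (res_bimod n) x (?\<phi> \<rho>)"
      by (simp add: res_derD(3)[OF T' \<rho>] d \<rho> T\<rho> C res_derD(3)[OF T d\<rho>] act)
    show "?\<phi> (ract (res_bimod (Suc n)) \<rho> x) = ract (res_bimod n) (?\<phi> \<rho>) x"
      by (simp add: res_derD(4)[OF T' \<rho>] d \<rho> T\<rho> C res_derD(4)[OF T d\<rho>] act)
    assume \<rho>': "\<rho>' \<in> bcarrier (res_bimod (Suc n))"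
    show "?\<phi> (\<rho> + \<rho>') = ?\<phi> \<rho> + ?\<phi> \<rho>'"
      by (simp add: res_derD(2)[OF T' \<rho> \<rho>'] d \<rho> \<rho>' T\<rho> res_derD(1)[OF T' \<rho>'] res_derD(2)[OF T d\<rho> d(1)[OF \<rho>']])
  qed
  have gen0: "?\<phi> (res_gen (Suc n) k u 1 1) = 0" if ku: "(k, u) \<in> res_index (Suc n)" for k u
  proof -
    have G'v: "valid_terms (Suc n) (G' k u)" by (rule valid_tableD[OF G' ku])
    have v: "vanishes res_less (map_terms (diff_table (Suc n)) (G' k u)
        @ scale_terms (- N) (der_terms Dt G (diff_table (Suc n) k u)))"
      using check ku index_list[of k u "Suc n"] unfolding list_all_iff by blast
    have one: "res_scale 1 \<rho> = \<rho>" for \<rho> :: "nat \<Rightarrow> 'k kos" by (rule module.scale_one[OF module_res_scale])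
    have 1: "?d (eval_res (Suc n) (G' k u)) = eval_res n (map_terms (diff_table (Suc n)) (G' k u))"
      using eval_map_terms[OF n'(2) P.d_hom, where N = 1 and G = "diff_table (Suc n)"]
        res_diff_table[OF n] diff_table_valid[OF n] G'v by (simp add: one)
    have Tg: "?T (res_gen n k u 1 1) = eval_res n (G k u)" if "(k, u) \<in> res_index n" for k u
      using res_op(2)[OF D n'(1) G that, of 1] by (simp add: one)
    have 2: "?T (?d (res_gen (Suc n) k u 1 1)) = eval_res n (der_terms Dt G (diff_table (Suc n) k u))"
      unfolding res_diff_table[OF n ku]
      by (rule eval_der_terms[OF n'(1) D T Dt Tg G valid_tableD[OF diff_table_valid[OF n] ku]])
    have "?d (?T' (res_gen (Suc n) k u 1 1)) = res_scale (1 / of_int N) (?d (eval_res (Suc n) (G' k u)))"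
      unfolding res_op(2)[OF D n'(2) G' ku]
      using bimod_hom_more(1)[OF bimodule_res bimodule_res P.d_hom] valid_terms_carrier[OF n'(2) G'v] by blast
    also have "\<dots> = eval_res n (der_terms Dt G (diff_table (Suc n) k u))"
      unfolding 1 eval_res_vanishes[OF v] using N by (simp add: res_scale_simps one)
    finally show ?thesis by (simp add: 2)
  qed
  have gen: "?\<phi> g = 0" if "g \<in> (\<lambda>(k, u). res_gen (Suc n) k u 1 1) ` res_index (Suc n)" for g
  proof -
    from that obtain k u where g: "(k, u) \<in> res_index (Suc n)" "g = res_gen (Suc n) k u 1 1" by auto
    show ?thesis unfolding g(2) by (rule gen0[OF g(1)])
  qed
  have "?\<phi> \<rho> = 0"
    by (rule bimod_hom_eq_generated[OF bimodule_res bimodule_res res_generated[OF n'(2)] hom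
          bimod_hom_zero[OF bimodule_res] gen \<rho>])
  then show ?thesis by simp
qed

text \<open>On generators both sides are 0: a derivation kills 1, and with an empty table the
  operator kills 1|\<epsilon>|1.\<close>

lemma res_op_aug:
  fixes D :: "'k cochain"
  assumes D: "multilinear D" "hoch_diff D = 0" and \<rho>: "\<rho> \<in> bcarrier (res_bimod 0)"
  shows "res_aug (res_op D 1 0 (\<lambda>k u. []) \<rho>) = D [res_aug \<rho>]"
proof -
  let ?T = "res_op D 1 0 (\<lambda>k u. [])"
  have G: "valid_table 0 0 (\<lambda>k u. [])" by (simp add: valid_table_def valid_terms_simps list_all_iff)
  have D1: "D [1] = 0" using derivation_cocycle[OF D, of 1 1] by simp
  have "D [res_aug (res_gen 0 k u 1 1)] - res_aug (?T (res_gen 0 k u 1 1)) = 0" if "(k, u) \<in> res_index 0" for k u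
  proof -
    have "res_aug (res_gen 0 k u 1 1) = fk_scale (dual_app (dual_gen 0 u) 1) (1 :: 'k fk3)"
      using that by (simp add: res_index_def res_gen_def res_aug_def kos_ext_pure[OF vector_space_fk_scale tlin_aug])
    moreover have "?T (res_gen 0 k u 1 1) = 0"
      using res_op(2)[OF D _ G that] by (simp add: eval_terms_simps res_scale_simps)
    ultimately show ?thesis
      by (simp add: linearD[OF derivation_linear[OF D(1)]] D1
          bimod_hom_more(2)[OF bimodule_res bimodule_fk res_aug_hom])
  qed
  then have "D [res_aug \<rho>] - res_aug (?T \<rho>) = 0"
    by (intro bimod_hom_eq_generated[OF bimodule_res bimodule_fk res_generated
        res_der_commutator_hom[OF D res_op(1)[OF D _ G] res_aug_hom] bimod_hom_zero[OF bimodule_fk] _ \<rho>]) auto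
  then show ?thesis by simp
qed

end

subsection \<open>Classes of degree one as derivations\<close>

lemma vector_space_hh_scale: "vector_space (hh_scale :: 'k::field \<Rightarrow> 'k hh \<Rightarrow> 'k hh)"
proof -
  have eq: "cohomologous g h" if "h \<in> cocycles" "g = h" for g h :: "'k cochain"
    using that cohomologous_refl by blast
  have sc: "(\<lambda>xs. fk_scale c (g xs)) \<in> cocycles" if "g \<in> cocycles" for c and g :: "'k cochain"
    using that by (rule cocycles_closed)
  show ?thesis
  proof (unfold_locales)
    fix a b :: 'k and x y :: "'k hh"
    show "a \<cdot> (x + y) = a \<cdot> x + a \<cdot> y"
      by transfer (rule eq; simp add: cohomologous_def sc cocycles_closed fun_eq_iff plus_fun_apply fk.scale_right_distrib)
    show "(a + b) \<cdot> x = a \<cdot> x + b \<cdot> x"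
      by transfer (rule eq; simp add: cohomologous_def sc cocycles_closed fun_eq_iff plus_fun_apply fk.scale_left_distrib)
    show "a \<cdot> b \<cdot> x = (a * b) \<cdot> x"
      by transfer (rule eq; simp add: cohomologous_def sc cocycles_closed fun_eq_iff)
    show "1 \<cdot> x = x"
      by transfer (rule eq; simp add: cohomologous_def)
  qed
qed

interpretation hhv: vector_space hh_scale by (rule vector_space_hh_scale)

context comparison
begin

lemma res_diff_1:
  assumes "u < 3"
  shows "res_diff f (Suc 0) (res_gen (Suc 0) 0 u 1 1)
    = ract (res_bimod 0) (res_gen 0 0 0 1 1) (fk_basis (Suc u))
      - lact (res_bimod 0) (fk_basis (Suc u)) (res_gen 0 0 0 1 1)"
proof -
  have "u = 0 \<or> u = 1 \<or> u = 2" using assms by linarith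
  moreover have "(0, u) \<in> res_index (Suc 0)" using assms by (simp add: res_index_def basis_size_def words_basis_small)
  ultimately show ?thesis
    using res_diff_table[of 0 0 u]
    by (elim disjE) (simp_all add: diff_table_def eval_terms_simps res_term_def res_gen_act
        module.scale_one[OF module_res_scale] module.scale_minus_left[OF module_res_scale] numeral_eq_Suc)
qed

lemma res_aug_gen: "res_aug (res_gen 0 0 0 1 1) = (1 :: 'k fk3)"
  using dual_gen_app[of 0 0 0, where ?'a = 'k]
  by (simp add: res_gen_def res_aug_def kos_ext_pure[OF vector_space_fk_scale tlin_aug] basis_size_def
      words_basis_small fkd_word_simps)

text \<open>On the bar resolution $x|y\mapsto g(x)y$ is a contraction of the cocycle \<open>g\<close>. It turns
  \<open>cochain_ext g \<circ> \<iota>\<close> on the generators into $-g$ up to an inner derivation.\<close>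

lemma represents_derivation:
  fixes \<phi> :: "(nat \<Rightarrow> 'k kos) \<Rightarrow> 'k fk3"
  assumes x: "represents 1 \<phi> x"
  obtains D where "D \<in> cochains_deg 1" "hoch_diff D = 0" "x = abs_hh D"
    "\<And>u. u < 3 \<Longrightarrow> D [fk_basis (Suc u)] = - \<phi> (res_gen 1 0 u 1 1)"
proof -
  obtain g where g: "g \<in> cochains_deg 1" "hoch_diff g = 0" "x = abs_hh g"
    "cob (Suc 0) (\<lambda>\<rho>. cochain_ext g (\<iota> (Suc 0) \<rho>) - \<phi> \<rho>)"
    using x unfolding represents_def One_nat_def by blast
  obtain \<psi> where \<psi>: "\<psi> \<in> bimod_hom (res_bimod 0) fk_bimod"
    "\<And>\<rho>. \<rho> \<in> bcarrier (res_bimod (Suc 0)) \<Longrightarrow> cochain_ext g (\<iota> (Suc 0) \<rho>) - \<phi> \<rho> = \<psi> (res_diff f (Suc 0) \<rho>)"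
    using g(4) by (rule cobE) blast
  have m: "multilinear g" by (rule cochains_deg_multilinear[OF g(1)])
  note R = linear_cochain_right[OF m]
  note der = derivation_cocycle[OF m g(2)]
  let ?e = "res_gen 0 0 0 1 1 :: nat \<Rightarrow> 'k kos"
  let ?w = "\<iota> 0 ?e" and ?r = "cochain_right g (\<iota> 0 ?e)"
  have i0: "(0, 0) \<in> res_index 0" by (simp add: res_index_def basis_size_def words_basis_small)
  have e: "?e \<in> bcarrier (res_bimod 0)" by (rule res_gen_carrier[OF _ i0]) simp
  have w: "?w \<in> bar_len (Suc (Suc 0))" by (rule iota_len[OF e])
  have aug: "bar_aug ?w = 1" using iota_aug[OF e] res_aug_gen by simp
  have 1: "cochain_ext g t = cochain_right g (bar_diff t)" if "t \<in> bar_len (Suc (Suc (Suc 0)))" for t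
    by (rule bar_len_linear_eq[OF linear_cochain_ext[OF m] linear_comp[OF linear_bar_diff R] _ that])
      (auto simp: length_Suc_conv cochain_ext_pure[OF m] cochain_right_pure[OF m] linearD[OF R] der distrib_right mult.assoc)
  have 2: "cochain_right g (bar_lact y t) = g [y] * bar_aug t + y * cochain_right g t"
    if "t \<in> bar_len (Suc (Suc 0))" for t y
    by (rule bar_len_linear_eq[OF linear_comp[OF linear_bar_lact R] linear_plus[OF linear_comp[OF linear_bar_aug linear_fk_mult(1)]
          linear_comp[OF R linear_fk_mult(1)]] _ that])
      (auto simp: length_Suc_conv cochain_right_pure[OF m] der distrib_right mult.assoc)
  note h0 = bimod_homD[OF iota_hom[of 0]] bimod_hom_more[OF bimodule_res bimodule_bar iota_hom[of 0]]
  note h\<psi> = bimod_homD[OF \<psi>(1)] bimod_hom_more[OF bimodule_res bimodule_fk \<psi>(1)]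
  note C = bimodule.carrier_closed[OF bimodule_res]
  \<comment> \<open>One term comes from the coboundary relating \<open>g\<close> to
    \<open>\<phi>\<close>, the other from the unknown value of \<open>\<iota>\<close> in degree 0;
    together they change -\<phi> by the inner derivation x \<mapsto> xs - sx.\<close>
  define s where "s = \<psi> ?e - ?r"
  have key: "g [fk_basis (Suc u)] = - \<phi> (res_gen 1 0 u 1 1) + fk_basis (Suc u) * s - s * fk_basis (Suc u)"
    if u: "u < 3" for u
  proof -
    let ?x = "fk_basis (Suc u) :: 'k fk3" and ?g = "res_gen (Suc 0) 0 u 1 1 :: nat \<Rightarrow> 'k kos"
    have "(0, u) \<in> res_index (Suc 0)" using u by (simp add: res_index_def basis_size_def words_basis_small)
    then have c: "?g \<in> bcarrier (res_bimod (Suc 0))" by (intro res_gen_carrier) simp_all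
    have "cochain_ext g (\<iota> (Suc 0) ?g) = cochain_right g (\<iota> 0 (res_diff f (Suc 0) ?g))"
      by (simp add: 1[OF iota_len[OF c]] iota_diff[OF c])
    also have "\<iota> 0 (res_diff f (Suc 0) ?g) = bar_ract ?w ?x - bar_lact ?x ?w"
      unfolding res_diff_1[OF u] using e by (simp add: h0 C)
    also have "cochain_right g \<dots> = ?r * ?x - (g [?x] + ?x * ?r)"
      by (simp add: linearD[OF R] cochain_right_ract[OF m w] 2[OF w] aug)
    finally have "cochain_ext g (\<iota> (Suc 0) ?g) = ?r * ?x - (g [?x] + ?x * ?r)" .
    moreover have "\<psi> (res_diff f (Suc 0) ?g) = \<psi> ?e * ?x - ?x * \<psi> ?e"
      unfolding res_diff_1[OF u] using e by (simp add: h\<psi> C)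
    ultimately have "?r * ?x - (g [?x] + ?x * ?r) - \<phi> ?g = \<psi> ?e * ?x - ?x * \<psi> ?e"
      using \<psi>(2)[OF c] by simp
    then show ?thesis unfolding s_def One_nat_def by (simp add: algebra_simps)
  qed
  \<comment> \<open>The element s as a cochain of degree 0; subtracting its coboundary removes the
    inner derivation and leaves the class unchanged.\<close>
  define c where "c = (\<lambda>xs :: 'k fk3 list. if xs = [] then s else 0)"
  have c: "c \<in> cochains_deg 0"
    by (simp add: cochains_deg_def multilinear_def c_def linear_zero[OF vector_space_fk_scale vector_space_fk_scale])
  have mc: "multilinear c" by (rule cochains_deg_multilinear[OF c])
  have dc: "hoch_diff c [y] = y * s - s * y" for y
    using hoch_diff_list[OF mc, of "[y]"] by (simp add: c_def fk.scale_minus_left)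
  have dc1: "hoch_diff c \<in> cochains_deg 1" using hoch_diff_cochains_deg[OF c] by simp
  define D where "D = (\<lambda>xs. g xs - hoch_diff c xs)"
  have D: "D \<in> cochains_deg 1" unfolding D_def by (rule cochains_deg_diff(1)[OF g(1) dc1])
  have dD: "hoch_diff D = 0"
    using hoch_diff_comb[of 1 g 1 "hoch_diff c"]
    by (simp add: D_def g(2) hoch_diff_hoch_diff[OF mc] fun_eq_iff zero_fun_apply)
  have "g - D = hoch_diff c" by (simp add: D_def fun_eq_iff)
  moreover have "c \<in> cochains" using c cochains_deg_subset by blast
  ultimately have "g - D \<in> coboundaries" unfolding coboundaries_def by simp
  then have "x = abs_hh D"
    unfolding g(3) using abs_hh_eq_iff[OF cocycle_deg[OF g(1,2)] cocycle_deg[OF D dD]] by simp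
  moreover have "D [fk_basis (Suc u)] = - \<phi> (res_gen 1 0 u 1 1)" if "u < 3" for u
    unfolding D_def key[OF that] dc by simp
  ultimately show thesis using D dD by (intro that)
qed

end

subsection \<open>Classes given by tables\<close>

definition fk_hom :: "nat \<Rightarrow> nat table \<Rightarrow> (nat \<Rightarrow> 'k::field kos) \<Rightarrow> 'k fk3"
  where "fk_hom n T = res_hom fk_scale fk_bimod n (\<lambda>k u. eval_fk (T k u))"

lemma fk_hom:
  assumes "n \<le> 4"
  shows "(fk_hom n T :: (nat \<Rightarrow> 'k::field kos) \<Rightarrow> _) \<in> bimod_hom (res_bimod n) fk_bimod"
    "(k, u) \<in> res_index n \<Longrightarrow> fk_hom n T (res_gen n k u 1 1) = (eval_fk (T k u) :: 'k fk3)"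
  unfolding fk_hom_def
  using res_hom[where v = "\<lambda>k u. eval_fk (T k u) :: 'k fk3", OF bimodule_fk assms] by simp_all

lemma fk_hom_eqI:
  fixes \<phi> \<psi> :: "(nat \<Rightarrow> 'k::field kos) \<Rightarrow> 'k fk3"
  assumes "n \<le> 4" "\<phi> \<in> bimod_hom (res_bimod n) fk_bimod" "\<psi> \<in> bimod_hom (res_bimod n) fk_bimod"
    "\<And>k u. (k, u) \<in> res_index n \<Longrightarrow> \<phi> (res_gen n k u 1 1) = \<psi> (res_gen n k u 1 1)"
    "\<rho> \<in> bcarrier (res_bimod n)"
  shows "\<phi> \<rho> = \<psi> \<rho>"
  by (rule bimod_hom_eq_generated[OF bimodule_res bimodule_fk res_generated[OF assms(1)] assms(2,3) _ assms(5)])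
    (use assms(4) in auto)

text \<open>On every generator, \<open>T\<close> is \<open>S\<close> plus the morphism with table
  \<open>Psi\<close> composed with the differential: the two cocycles differ by an explicit
  coboundary, and in degree 0 they coincide.\<close>

definition table_eq :: "nat \<Rightarrow> nat table \<Rightarrow> nat table \<Rightarrow> nat table \<Rightarrow> bool"
  where "table_eq n T S Psi \<longleftrightarrow> (n = 0 \<or> valid_fk_table (n - 1) Psi) \<and>
    list_all (\<lambda>(k, u). vanishes (<) (T k u @ scale_terms (- 1) (S k u) @
      (if n = 0 then [] else scale_terms (- 1) (map_fk Psi (diff_table n k u))))) (index_list n)"

text \<open>The three conditions are well-formedness, compatibility with the differentials on
  generators, and compatibility with the augmentation, which is the morphism on P_0 with value 1 on
  the generator.\<close>

definition lift_check :: "nat \<Rightarrow> nat \<Rightarrow> nat table \<Rightarrow> (nat \<Rightarrow> res_index table) \<Rightarrow> bool"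
  where "lift_check n m S L \<longleftrightarrow> list_all (\<lambda>k. valid_table (n + k) k (L k)) [0..<Suc m] \<and>
    list_all (\<lambda>k. list_all (\<lambda>(l, u). vanishes res_less (map_terms (diff_table (Suc k)) (L (Suc k) l u)
      @ scale_terms (- 1) (map_terms (L k) (diff_table (Suc (n + k)) l u)))) (index_list (Suc (n + k)))) [0..<m] \<and>
    list_all (\<lambda>(l, u). vanishes (<) (map_fk (\<lambda>k u. [(1, 0)]) (L 0 l u) @ scale_terms (- 1) (S l u))) (index_list n)"

text \<open>The factors are required to be 1 below degree n, since \<open>res_op_chain\<close>
  allows a denominator in the top degree only.\<close>

definition op_check :: "nat \<Rightarrow> (nat \<Rightarrow> int) \<Rightarrow> (nat \<Rightarrow> (int \<times> nat) list) \<Rightarrow> (nat \<Rightarrow> res_index table) \<Rightarrow> bool"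
  where "op_check n N Dt G \<longleftrightarrow> list_all (\<lambda>k. valid_table k k (G k)) [0..<Suc n] \<and>
    list_all (\<lambda>k. N k = 1 \<and> list_all (\<lambda>(l, u). vanishes res_less (map_terms (diff_table (Suc k)) (G (Suc k) l u)
      @ scale_terms (- N (Suc k)) (der_terms Dt (G k) (diff_table (Suc k) l u)))) (index_list (Suc k))) [0..<n]"

lemma eval_fk_vanishes:
  assumes "vanishes (<) (L @ scale_terms (- 1) M)" shows "eval_fk L = eval_fk M"
  using eval_vanishes[OF vector_space_fk_scale assms, of fk_basis]
  by (simp add: eval_fk_simps fk.scale_minus_left flip: eval_fk_def)

context comparison
begin

definition has_table :: "nat \<Rightarrow> nat table \<Rightarrow> 'k hh \<Rightarrow> bool"
  where "has_table n T x \<longleftrightarrow> represents n (fk_hom n T) x"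

lemma has_tableI:
  fixes \<phi> :: "(nat \<Rightarrow> 'k kos) \<Rightarrow> 'k fk3"
  assumes "represents n \<phi> x" "n \<le> 4" "\<phi> \<in> bimod_hom (res_bimod n) fk_bimod"
    "\<And>k u. (k, u) \<in> res_index n \<Longrightarrow> \<phi> (res_gen n k u 1 1) = eval_fk (T k u)"
  shows "has_table n T x"
  unfolding has_table_def
  by (rule represents_cong[OF assms(1)], rule fk_hom_eqI[OF assms(2,3) fk_hom(1)[OF assms(2)]])
    (simp_all add: fk_hom(2) assms(2,4))

lemma has_table_add:
  assumes "n \<le> 4" "has_table n T x" "has_table n S y"
  shows "has_table n (\<lambda>k u. T k u @ S k u) (x + y)"
  by (rule has_tableI[OF represents_add[OF assms(2,3)[unfolded has_table_def]] assms(1)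
        bimod_hom_add[OF bimodule_fk fk_hom(1)[OF assms(1)] fk_hom(1)[OF assms(1)]]])
    (simp add: fk_hom(2)[OF assms(1)] eval_fk_simps)

lemma has_table_scale:
  assumes "n \<le> 4" "has_table n T x"
  shows "has_table n (\<lambda>k u. scale_terms c (T k u)) (of_int c \<cdot> x)"
  by (rule has_tableI[OF represents_scale[OF assms(2)[unfolded has_table_def]] assms(1)
        bimod_hom_scale[OF bimodule_fk fk_hom(1)[OF assms(1)]]])
    (simp add: fk_hom(2)[OF assms(1)] eval_fk_simps)

lemma has_table_zero: "n \<le> 4 \<Longrightarrow> has_table n (\<lambda>k u. []) 0"
  by (rule has_tableI[OF represents_zero _ bimod_hom_zero[OF bimodule_fk]]) (simp_all add: eval_fk_simps)

lemma has_table_unique: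
  assumes n: "n \<le> 4" and x: "has_table n T x" and y: "has_table n S y" and c: "table_eq n T S Psi"
  shows "x = y"
proof (rule represents_unique[OF x[unfolded has_table_def] y[unfolded has_table_def]])
  let ?\<phi> = "\<lambda>\<rho>. fk_hom n T \<rho> - fk_hom n S \<rho> :: 'k fk3"
  have hom: "?\<phi> \<in> bimod_hom (res_bimod n) fk_bimod"
    by (rule bimod_hom_diff[OF bimodule_fk fk_hom(1)[OF n] fk_hom(1)[OF n]])
  have ch: "vanishes (<) (T k u @ scale_terms (- 1) (S k u) @
      (if n = 0 then [] else scale_terms (- 1) (map_fk Psi (diff_table n k u))))" if "(k, u) \<in> res_index n" for k u
    using c that index_list[of k u n] unfolding table_eq_def list_all_iff by blast
  have ev: "eval_fk (T k u @ scale_terms (- 1) (S k u) @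
      (if n = 0 then [] else scale_terms (- 1) (map_fk Psi (diff_table n k u)))) = (0 :: 'k fk3)"
    if "(k, u) \<in> res_index n" for k u
    unfolding eval_fk_def by (rule eval_vanishes[OF vector_space_fk_scale ch[OF that]])
  show "cob n ?\<phi>"
  proof (cases n)
    case 0
    have "?\<phi> \<rho> = 0" if "\<rho> \<in> bcarrier (res_bimod n)" for \<rho>
      by (rule fk_hom_eqI[OF n hom bimod_hom_zero[OF bimodule_fk] _ that])
        (use ev 0 in \<open>simp add: fk_hom(2) eval_fk_simps fk.scale_minus_left\<close>)
    then show ?thesis unfolding 0 cob_0 by blast
  next
    case (Suc m)
    have m: "m < 4" "m \<le> 4" using n Suc by simp_all
    have v: "valid_fk_table m Psi" using c Suc by (simp add: table_eq_def)
    note h = fk_hom[OF m(2), where T = Psi and ?'k = 'k]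
    have P: "(\<lambda>\<rho>. fk_hom m Psi (res_diff f (Suc m) \<rho>)) \<in> bimod_hom (res_bimod n) fk_bimod"
      unfolding Suc by (rule bimod_hom_comp[OF P.d_hom h(1)])
    have "?\<phi> \<rho> = fk_hom m Psi (res_diff f (Suc m) \<rho>)" if "\<rho> \<in> bcarrier (res_bimod n)" for \<rho>
    proof (rule fk_hom_eqI[OF n hom P _ that])
      fix k u assume ku: "(k, u) \<in> res_index n"
      have "fk_hom m Psi (res_diff f (Suc m) (res_gen n k u 1 1)) = (eval_fk (map_fk Psi (diff_table n k u)) :: 'k fk3)"
        using res_diff_table[OF m(1) ku[unfolded Suc]] eval_map_fk[OF m(2) h v valid_tableD[OF diff_table_valid[OF m(1)] ku[unfolded Suc]]]
        by (simp add: Suc)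
      then show "?\<phi> (res_gen n k u 1 1) = fk_hom m Psi (res_diff f (Suc m) (res_gen n k u 1 1))"
        using ev[OF ku] Suc n ku
        by (simp add: fk_hom(2) eval_fk_simps fk.scale_minus_left algebra_simps)
    qed
    then show ?thesis unfolding Suc by (intro cobI[OF h(1)]) simp
  qed
qed

lemma has_table_prod:
  assumes x: "has_table m T x" and y: "has_table n S y" and mn: "n + m \<le> 4"
    and T: "valid_fk_table m T" and L: "lift_check n m S L"
  shows "has_table (n + m) (\<lambda>k u. map_fk T (L m k u)) (x * y)"
proof -
  have le: "m \<le> 4" "n \<le> 4" using mn by simp_all
  have one: "res_scale 1 \<rho> = \<rho>" for \<rho> :: "nat \<Rightarrow> 'k kos" by (rule module.scale_one[OF module_res_scale])
  have valid: "valid_table (n + k) k (L k)" if "k \<le> m" for k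
    using L that unfolding lift_check_def list_all_iff by auto
  define \<Psi> where "\<Psi> k = (res_hom res_scale (res_bimod k) (n + k) (\<lambda>l u. eval_res k (L k l u))
    :: (nat \<Rightarrow> 'k kos) \<Rightarrow> nat \<Rightarrow> 'k kos)" for k
  have \<Psi>: "\<Psi> k \<in> bimod_hom (res_bimod (n + k)) (res_bimod k)"
    "\<And>l u. (l, u) \<in> res_index (n + k) \<Longrightarrow> \<Psi> k (res_gen (n + k) l u 1 1) = eval_res k (L k l u)" if k: "k \<le> m" for k
  proof -
    have k4: "k \<le> 4" "n + k \<le> 4" using k mn by simp_all
    have car: "(eval_res k (L k l u) :: nat \<Rightarrow> 'k kos) \<in> bcarrier (res_bimod k)" if "(l, u) \<in> res_index (n + k)" for l u
      by (rule valid_terms_carrier[OF k4(1) valid_tableD[OF valid[OF k] that]])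
    note h = res_hom[where v = "\<lambda>l u. eval_res k (L k l u) :: nat \<Rightarrow> 'k kos", OF bimodule_res k4(2) car]
    show "\<Psi> k \<in> bimod_hom (res_bimod (n + k)) (res_bimod k)" unfolding \<Psi>_def by (rule h(1))
    show "\<Psi> k (res_gen (n + k) l u 1 1) = eval_res k (L k l u)" if "(l, u) \<in> res_index (n + k)" for l u
      unfolding \<Psi>_def using h(2)[of l u 1 1] that car[OF that]
      by (simp add: bimodule.lact_one[OF bimodule_res] bimodule.ract_one[OF bimodule_res])
  qed
  have chain: "res_diff f (Suc k) (\<Psi> (Suc k) \<rho>) = \<Psi> k (res_diff f (Suc (n + k)) \<rho>)"
    if k: "k < m" and \<rho>: "\<rho> \<in> bcarrier (res_bimod (Suc (n + k)))" for k \<rho>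
  proof -
    have k4: "k < 4" "n + k < 4" "n + k \<le> 4" "Suc k \<le> 4" "Suc (n + k) \<le> 4" using k mn by simp_all
    have km: "Suc k \<le> m" "k \<le> m" using k by simp_all
    have S: "\<Psi> (Suc k) \<in> bimod_hom (res_bimod (Suc (n + k))) (res_bimod (Suc k))" using \<Psi>(1)[OF km(1)] by simp
    have gen: "res_diff f (Suc k) (\<Psi> (Suc k) (res_gen (Suc (n + k)) l u 1 1))
        = \<Psi> k (res_diff f (Suc (n + k)) (res_gen (Suc (n + k)) l u 1 1))" if lu: "(l, u) \<in> res_index (Suc (n + k))" for l u
    proof -
      have v: "vanishes res_less (map_terms (diff_table (Suc k)) (L (Suc k) l u)
          @ scale_terms (- 1) (map_terms (L k) (diff_table (Suc (n + k)) l u)))"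
        using L k lu index_list[of l u "Suc (n + k)"] unfolding lift_check_def list_all_iff by fastforce
      have lv: "valid_terms (Suc k) (L (Suc k) l u)" using valid_tableD[OF valid[OF km(1)]] lu by simp
      have "res_diff f (Suc k) (eval_res (Suc k) (L (Suc k) l u)) = eval_res k (map_terms (diff_table (Suc k)) (L (Suc k) l u))"
        using eval_map_terms[OF k4(4) P.d_hom, where N = 1 and G = "diff_table (Suc k)"]
          res_diff_table[OF k4(1)] diff_table_valid[OF k4(1)] lv by (simp add: one)
      moreover have "\<Psi> k (eval_res (n + k) (diff_table (Suc (n + k)) l u))
          = eval_res k (map_terms (L k) (diff_table (Suc (n + k)) l u))"
        using eval_map_terms[OF k4(3) \<Psi>(1)[OF km(2)], where N = 1 and G = "L k"]
          \<Psi>(2)[OF km(2)] valid[OF km(2)] valid_tableD[OF diff_table_valid[OF k4(2)] lu] by (simp add: one)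
      moreover have "\<Psi> (Suc k) (res_gen (Suc (n + k)) l u 1 1) = eval_res (Suc k) (L (Suc k) l u)"
        using \<Psi>(2)[OF km(1), of l u] lu by simp
      ultimately show ?thesis
        by (simp add: res_diff_table[OF k4(2) lu] eval_res_vanishes[OF v] one)
    qed
    show ?thesis
      by (rule bimod_hom_eq_generated[OF bimodule_res bimodule_res res_generated[OF k4(5)]
            bimod_hom_comp[OF S P.d_hom] bimod_hom_comp[OF P.d_hom \<Psi>(1)[OF km(2)]] _ \<rho>]) (use gen in auto)
  qed
  have aug: "res_aug (\<Psi> 0 \<rho>) = fk_hom n S \<rho>" if \<rho>: "\<rho> \<in> bcarrier (res_bimod n)" for \<rho>
  proof -
    have P0: "\<Psi> 0 \<in> bimod_hom (res_bimod n) (res_bimod 0)" using \<Psi>(1)[of 0] by simp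
    show ?thesis
    proof (rule fk_hom_eqI[OF le(2) bimod_hom_comp[OF P0 res_aug_hom] fk_hom(1)[OF le(2)] _ \<rho>])
      fix l u assume lu: "(l, u) \<in> res_index n"
      have v: "vanishes (<) (map_fk (\<lambda>k u. [(1, 0)]) (L 0 l u) @ scale_terms (- 1) (S l u))"
        using L lu index_list[of l u n] unfolding lift_check_def list_all_iff by blast
      have lv: "valid_terms 0 (L 0 l u)" using valid_tableD[OF valid[of 0]] lu by simp
      have a: "res_aug (res_gen 0 k u 1 1) = (eval_fk [(1, 0)] :: 'k fk3)" if "(k, u) \<in> res_index 0" for k u
        using that res_aug_gen by (simp add: res_index_def basis_size_def words_basis_small eval_fk_simps)
      have vt: "valid_fk_table 0 (\<lambda>k u. [(1, 0)])" by (simp add: valid_fk_table_def valid_fk_def list_all_iff)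
      have "res_aug (eval_res 0 (L 0 l u)) = (eval_fk (map_fk (\<lambda>k u. [(1, 0)]) (L 0 l u)) :: 'k fk3)"
        by (rule eval_map_fk[OF _ res_aug_hom a vt lv]) simp_all
      then show "res_aug (\<Psi> 0 (res_gen n l u 1 1)) = fk_hom n S (res_gen n l u 1 1)"
        using \<Psi>(2)[of 0 l u] lu by (simp add: fk_hom(2)[OF le(2)] eval_fk_vanishes[OF v])
    qed
  qed
  have "represents (n + m) (\<lambda>\<rho>. fk_hom m T (\<Psi> m \<rho>)) (x * y)"
    using cup_represents[OF x[unfolded has_table_def] fk_hom(1)[OF le(1)] y[unfolded has_table_def] mn \<Psi>(1) chain aug]
    by blast
  moreover have "(\<lambda>\<rho>. fk_hom m T (\<Psi> m \<rho>)) \<in> bimod_hom (res_bimod (n + m)) fk_bimod"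
    by (rule bimod_hom_comp[OF \<Psi>(1)[OF order_refl] fk_hom(1)[OF le(1)]])
  moreover have "fk_hom m T (\<Psi> m (res_gen (n + m) k u 1 1)) = (eval_fk (map_fk T (L m k u)) :: 'k fk3)"
    if "(k, u) \<in> res_index (n + m)" for k u
    unfolding \<Psi>(2)[OF order_refl that]
    by (rule eval_map_fk[OF le(1) fk_hom[OF le(1)] T valid_tableD[OF valid[OF order_refl] that]])
  ultimately show ?thesis using mn by (intro has_tableI)
qed

text \<open>The bracket is stated after multiplication by \<open>N n\<close>, which keeps every
  table integral.\<close>

lemma has_table_bracket:
  fixes D :: "'k cochain"
  assumes D: "D \<in> cochains_deg 1" "hoch_diff D = 0" and Dt: "\<And>i. i < 12 \<Longrightarrow> D [fk_basis i] = eval_fk (Dt i)"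
    and n: "n \<le> 4" and G: "op_check n N Dt G" and G0: "G 0 = (\<lambda>k u. [])" and N0: "N 0 = 1"
    and N: "\<And>k. k \<le> n \<Longrightarrow> (of_int (N k) :: 'k) \<noteq> 0"
    and T: "valid_fk_table n T" and y: "has_table n T y"
  shows "has_table n (\<lambda>k u. scale_terms (N n) (der_fk Dt (T k u)) @ scale_terms (- 1) (map_fk T (G n k u)))
    (of_int (N n) \<cdot> hh_bracket (abs_hh D) y)"
proof -
  have m: "multilinear D" by (rule cochains_deg_multilinear[OF D(1)])
  note DD = m D(2)
  have valid: "valid_table k k (G k)" if "k \<le> n" for k
    using G that unfolding op_check_def list_all_iff by auto
  define \<delta> where "\<delta> k = res_op D (N k) k (G k)" for k
  have \<delta>: "res_der D k (\<delta> k)" if "k \<le> n" for k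
    unfolding \<delta>_def using that n by (intro res_op(1)[OF DD _ valid]) simp_all
  have chain: "res_diff f (Suc k) (\<delta> (Suc k) \<rho>) = \<delta> k (res_diff f (Suc k) \<rho>)"
    if k: "k < n" and \<rho>: "\<rho> \<in> bcarrier (res_bimod (Suc k))" for k \<rho>
  proof -
    have "k \<in> set [0..<n]" using k by simp
    then have c: "N k = 1" "list_all (\<lambda>(l, u). vanishes res_less (map_terms (diff_table (Suc k)) (G (Suc k) l u)
      @ scale_terms (- N (Suc k)) (der_terms Dt (G k) (diff_table (Suc k) l u)))) (index_list (Suc k))"
      using G[unfolded op_check_def, THEN conjunct2] unfolding list_all_iff by blast+
    have k4: "k < 4" "k \<le> n" "Suc k \<le> n" using k n by simp_all
    show ?thesis
      unfolding \<delta>_def c(1)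
      by (rule res_op_chain[OF DD Dt k4(1) valid[OF k4(2)] valid[OF k4(3)] N[OF k4(3)] c(2) \<rho>])
  qed
  have aug: "res_aug (\<delta> 0 \<rho>) = D [res_aug \<rho>]" if "\<rho> \<in> bcarrier (res_bimod 0)" for \<rho>
    unfolding \<delta>_def G0 N0 by (rule res_op_aug[OF DD that])
  note h = fk_hom[OF n, where T = T and ?'k = 'k]
  let ?\<phi> = "\<lambda>\<rho>. fk_scale (of_int (N n)) (D [fk_hom n T \<rho>] - fk_hom n T (\<delta> n \<rho>))"
  have "represents n ?\<phi> (of_int (N n) \<cdot> hh_bracket (abs_hh D) y)"
    by (rule represents_scale[OF bracket_represents[OF D n \<delta> chain aug h(1) y[unfolded has_table_def]]])
  moreover have "?\<phi> \<in> bimod_hom (res_bimod n) fk_bimod"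
    by (rule bimod_hom_scale[OF bimodule_fk res_der_commutator_hom[OF DD \<delta>[OF order_refl] h(1)]])
  moreover have "?\<phi> (res_gen n k u 1 1) = eval_fk (scale_terms (N n) (der_fk Dt (T k u)) @ scale_terms (- 1) (map_fk T (G n k u)))"
    if ku: "(k, u) \<in> res_index n" for k u
  proof -
    have Gv: "valid_terms n (G n k u)" by (rule valid_tableD[OF valid[OF order_refl] ku])
    have "\<delta> n (res_gen n k u 1 1) = res_scale (1 / of_int (N n)) (eval_res n (G n k u))"
      unfolding \<delta>_def by (rule res_op(2)[OF DD n valid[OF order_refl] ku])
    then have "fk_hom n T (\<delta> n (res_gen n k u 1 1)) = fk_scale (1 / of_int (N n)) (fk_hom n T (eval_res n (G n k u)))"
      using bimod_hom_more(1)[OF bimodule_res bimodule_fk h(1) valid_terms_carrier[OF n Gv]] by simp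
    also have "fk_hom n T (eval_res n (G n k u)) = (eval_fk (map_fk T (G n k u)) :: 'k fk3)"
      by (rule eval_map_fk[OF n h T Gv])
    finally have 1: "fk_hom n T (\<delta> n (res_gen n k u 1 1))
        = fk_scale (1 / of_int (N n)) (eval_fk (map_fk T (G n k u)) :: 'k fk3)" .
    have 2: "D [eval_fk (T k u)] = eval_fk (der_fk Dt (T k u))"
      by (rule eval_der_fk[OF m Dt valid_fk_tableD[OF T ku]])
    show ?thesis
      unfolding 1 h(2)[OF ku] 2
      using N[OF order_refl] by (simp add: eval_fk_simps fk.scale_right_diff_distrib fk.scale_minus_left)
  qed
  ultimately show ?thesis using n by (intro has_tableI)
qed

end

subsection \<open>The classes and their operators\<close>

text \<open>The tables below were found by solving the linear systems that the checks express: \<open>del_table i n\<close>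
  lifts the derivation of $X_i$ to $P_n$ (multiplied by \<open>del_factor i n\<close>), \<open>lift_table j m\<close> lifts
  $X_j$ to a morphism of degree \<open>m\<close>, and \<open>psi_table i j\<close> bounds the difference of the two sides for
  $[X_i,X_j]$.\<close>

definition phi_table :: "nat \<Rightarrow> nat table"
  where "phi_table j k u = [[[[(1, 4), (1, 6)]]],
   [[[(1, 4), (1, 5), (- 1, 7)]]],
   [[[(1, 11)]]],
   [[[(1, 10)],
    [],
    []]],
   [[[],
    [(1, 9)],
    []]],
   [[[],
    [],
    [(1, 8)]]],
   [[[(1, 8), (- 1, 9)],
    [],
    []]],
   [[[(1, 1)],
    [(1, 2)],
    [(1, 3)]]],
   [[[(1, 0)],
    [],
    [],
    [],
    []]],
   [[[],
    [(1, 0)],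
    [],
    [],
    []]],
   [[[],
    [],
    [(1, 0)],
    [],
    []]],
   [[[],
    [],
    [],
    [(1, 0)],
    [(1, 0)]]],
   [[[(1, 1)],
    [(1, 2)],
    [(1, 3)],
    [],
    [],
    []]],
   [[[],
    [],
    [],
    [],
    [],
    []],
   [[(1, 0)]]]] ! (j - 1) ! k ! u"

text \<open>Rows belong to X_4 to X_7, columns to the twelve basis elements. The values on a, b, c
  are minus those of the cocycle and have degree 3; the rest follows by the Leibniz rule, and only
  basis elements of degree 1 or 2 can have a nonzero image.\<close>

definition der_table :: "nat \<Rightarrow> nat \<Rightarrow> (int \<times> nat) list"
  where "der_table i t = [[[], [(- 1, 10)], [], [], [], [], [], [], [], [], [], []],
   [[], [], [(- 1, 9)], [], [], [], [], [], [], [], [], []],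
   [[], [], [], [(- 1, 8)], [], [], [], [], [], [], [], []],
   [[], [(- 1, 8), (1, 9)], [], [], [(- 1, 11)], [], [(1, 11)], [(- 1, 11)], [], [], [], []]] ! (i
    - 4) ! t"

definition del_table :: "nat \<Rightarrow> nat \<Rightarrow> res_index table"
  where "del_table i n k u = (if n = 0 then [] else [[[[[(- 1, 0, 0, 1, 7), (- 1, 0, 2, 0, 3), (-
    1, 0, 6, 2, 0)],
    [],
    []]],
   [[[(- 1, 0, 0, 3, 7), (1, 0, 2, 0, 2), (1, 0, 2, 3, 3), (1, 0, 3, 0, 3), (- 1, 0, 6, 3, 0)],
    [],
    [],
    [(- 1, 0, 0, 0, 5), (1, 0, 0, 1, 4), (- 1, 0, 0, 4, 7), (1, 0, 1, 3, 3), (1, 0, 2, 0, 3), (- 1,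
    0, 2, 4, 2), (- 1, 0, 4, 2, 0), (1, 0, 5, 1, 0)],
    [(- 1, 0, 0, 1, 7), (- 1, 0, 6, 2, 0)]]],
   [[[(1, 0, 0, 1, 7), (1, 0, 0, 4, 5), (1, 0, 1, 4, 3), (1, 0, 2, 2, 2), (1, 0, 2, 3, 1), (1, 0,
    2, 5, 3), (- 1, 0, 3, 0, 2), (1, 0, 3, 1, 3), (1, 0, 5, 3, 0), (1, 0, 6, 2, 0)],
    [],
    [],
    [(- 2, 0, 0, 0, 5), (1, 0, 0, 4, 6), (- 1, 0, 0, 4, 7), (- 1, 0, 1, 2, 1), (- 1, 0, 1, 3, 3),
    (- 1, 0, 1, 5, 2), (1, 0, 2, 3, 2), (1, 0, 2, 5, 1), (- 2, 0, 3, 0, 3), (1, 0, 3, 1, 1), (- 2,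
    0, 4, 2, 0), (1, 0, 5, 4, 0), (- 1, 0, 7, 5, 0)],
    [(1, 0, 0, 0, 6), (2, 0, 0, 1, 4), (1, 0, 0, 3, 5), (1, 0, 1, 2, 2), (1, 0, 1, 3, 1), (1, 0, 1,
    5, 3), (- 1, 0, 2, 0, 2), (1, 0, 2, 2, 1), (2, 0, 2, 3, 3), (1, 0, 2, 5, 2), (1, 0, 3, 4, 3),
    (1, 0, 4, 0, 0), (1, 0, 5, 5, 0), (1, 0, 6, 1, 0), (1, 0, 7, 3, 0)],
    [(- 3, 0, 0, 1, 7), (- 1, 0, 0, 3, 7), (1, 0, 0, 4, 4), (- 1, 0, 0, 4, 5), (1, 0, 1, 3, 2), (-
    1, 0, 1, 4, 3), (- 2, 0, 2, 0, 3), (- 1, 0, 2, 2, 2), (- 1, 0, 2, 3, 1), (- 2, 0, 2, 5, 3), (1,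
    0, 3, 0, 2), (- 1, 0, 3, 1, 3), (1, 0, 5, 1, 0), (- 1, 0, 5, 3, 0), (- 3, 0, 6, 2, 0), (- 1, 0,
    6, 4, 0)]]],
   [[[(- 1, 0, 0, 3, 6), (- 1, 0, 0, 4, 4), (1, 0, 1, 3, 2), (2, 0, 1, 4, 3), (3, 0, 1, 5, 1), (1,
    0, 2, 0, 2), (- 2, 0, 2, 2, 2), (2, 0, 2, 4, 1), (1, 0, 2, 5, 2), (- 3, 0, 3, 1, 3), (- 1, 0,
    6, 3, 0), (- 2, 0, 7, 3, 0), (- 1, 1, 0, 0, 0)],
    [],
    [],
    [(- 6, 0, 0, 0, 5), (9, 0, 0, 1, 4), (3, 0, 0, 4, 6), (- 3, 0, 0, 4, 7), (- 3, 0, 0, 5, 4), (-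
    6, 0, 0, 5, 5), (6, 0, 2, 0, 3), (- 3, 0, 2, 4, 2), (6, 0, 2, 5, 3), (- 3, 0, 3, 1, 1), (- 3,
    0, 3, 5, 1), (3, 0, 4, 0, 0), (- 6, 0, 4, 2, 0), (6, 0, 5, 1, 0)],
    [(3, 0, 0, 0, 6), (- 9, 0, 0, 1, 7), (6, 0, 0, 3, 4), (- 6, 0, 0, 5, 6), (- 12, 0, 0, 5, 7),
    (9, 0, 1, 5, 3), (3, 0, 2, 2, 1), (3, 0, 2, 4, 3), (3, 0, 2, 5, 1), (- 6, 0, 3, 5, 2), (3, 0,
    6, 1, 0), (- 9, 0, 6, 2, 0), (- 6, 0, 6, 5, 0), (- 6, 0, 7, 5, 0)],
    [(4, 0, 0, 3, 6), (- 3, 0, 0, 3, 7), (4, 0, 0, 4, 4), (3, 0, 1, 2, 1), (- 4, 0, 1, 3, 2), (- 2,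
    0, 1, 4, 3), (- 6, 0, 1, 5, 1), (8, 0, 2, 0, 2), (5, 0, 2, 2, 2), (3, 0, 2, 3, 3), (- 2, 0, 2,
    4, 1), (- 1, 0, 2, 5, 2), (9, 0, 3, 0, 3), (3, 0, 3, 1, 3), (3, 0, 3, 5, 3), (- 5, 0, 6, 3, 0),
    (2, 0, 7, 3, 0), (4, 1, 0, 0, 0)]],
   [[(6, 0, 0, 0, 11), (- 6, 0, 0, 1, 11), (9, 0, 0, 5, 11), (6, 0, 1, 2, 10), (- 9, 0, 1, 3, 9),
    (- 6, 0, 2, 0, 9), (9, 0, 2, 3, 8), (9, 0, 2, 4, 10), (- 6, 0, 2, 5, 9), (3, 0, 3, 0, 8), (6,
    0, 3, 1, 8), (9, 0, 4, 0, 6), (3, 0, 4, 0, 7), (12, 0, 4, 2, 6), (3, 0, 4, 5, 7), (- 9, 0, 5,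
    1, 6), (- 18, 0, 5, 1, 7), (- 9, 0, 5, 5, 6), (- 3, 0, 5, 5, 7), (6, 0, 6, 1, 4), (- 3, 0, 6,
    1, 5), (3, 0, 6, 2, 4), (- 6, 0, 6, 2, 5), (- 15, 0, 6, 5, 4), (- 3, 0, 6, 5, 5), (3, 0, 7, 0,
    5), (- 9, 0, 7, 5, 4), (3, 0, 8, 5, 3), (- 6, 0, 9, 1, 2), (- 9, 0, 9, 5, 2), (- 3, 0, 10, 0,
    1), (- 12, 0, 10, 5, 1), (- 12, 0, 11, 5, 0)]]]],
   [[[[],
    [(- 1, 0, 0, 0, 5), (- 1, 0, 1, 1, 3), (- 1, 0, 4, 2, 0)],
    []]],
   [[[],
    [(1, 0, 0, 3, 7), (- 1, 0, 1, 2, 1), (- 1, 0, 1, 3, 2), (- 1, 0, 1, 4, 3), (- 1, 0, 2, 3, 3),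
    (- 1, 0, 3, 0, 3), (1, 0, 7, 3, 0)],
    [],
    [(- 1, 0, 0, 0, 5), (- 1, 0, 4, 2, 0)],
    [(1, 0, 0, 0, 6), (- 1, 0, 0, 1, 7), (- 1, 0, 0, 3, 5), (1, 0, 1, 1, 3), (- 1, 0, 1, 3, 1), (1,
    0, 2, 4, 3), (- 1, 0, 6, 2, 0), (1, 0, 7, 0, 0)]]],
   [[[],
    [(1, 0, 0, 0, 5), (- 1, 0, 0, 4, 6), (1, 0, 1, 2, 1), (1, 0, 1, 3, 3), (- 1, 0, 2, 3, 2), (- 1,
    0, 2, 4, 3), (- 1, 0, 2, 5, 1), (1, 0, 3, 0, 3), (- 1, 0, 3, 1, 1), (1, 0, 4, 2, 0), (- 1, 0,
    5, 4, 0), (1, 0, 7, 5, 0)],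
    [],
    [(- 3, 0, 0, 0, 5), (1, 0, 0, 4, 6), (- 1, 0, 0, 4, 7), (- 1, 0, 0, 5, 5), (- 2, 0, 1, 1, 3),
    (- 1, 0, 1, 2, 1), (- 2, 0, 1, 3, 3), (- 1, 0, 1, 5, 2), (- 1, 0, 2, 4, 3), (1, 0, 2, 5, 1), (-
    1, 0, 3, 0, 3), (1, 0, 3, 1, 1), (- 3, 0, 4, 2, 0), (- 1, 0, 4, 4, 0), (1, 0, 7, 0, 0), (- 1,
    0, 7, 5, 0)],
    [(2, 0, 0, 0, 6), (1, 0, 0, 1, 4), (- 1, 0, 0, 3, 5), (- 1, 0, 1, 1, 1), (1, 0, 1, 2, 2), (1,
    0, 1, 3, 1), (1, 0, 2, 2, 1), (1, 0, 2, 5, 2), (- 1, 0, 3, 4, 3), (1, 0, 4, 0, 0), (- 1, 0, 4,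
    5, 0), (1, 0, 6, 1, 0), (1, 0, 7, 3, 0)],
    [(- 2, 0, 0, 1, 7), (- 2, 0, 0, 4, 5), (- 2, 0, 1, 4, 3), (- 1, 0, 1, 5, 1), (- 1, 0, 2, 2, 2),
    (- 1, 0, 2, 3, 1), (- 1, 0, 2, 5, 3), (1, 0, 3, 0, 2), (- 2, 0, 3, 1, 3), (- 1, 0, 4, 3, 0), (-
    1, 0, 5, 3, 0), (- 2, 0, 6, 2, 0)]]],
   [[[],
    [(- 1, 0, 0, 3, 6), (- 1, 0, 0, 4, 4), (- 3, 0, 1, 2, 1), (1, 0, 1, 3, 2), (- 1, 0, 1, 4, 3),
    (- 2, 0, 2, 0, 2), (- 2, 0, 2, 2, 2), (- 1, 0, 2, 4, 1), (- 2, 0, 2, 5, 2), (- 3, 0, 3, 0, 3),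
    (2, 0, 6, 3, 0), (1, 0, 7, 3, 0), (- 1, 1, 0, 0, 0)],
    [],
    [(- 9, 0, 0, 0, 5), (3, 0, 0, 1, 4), (6, 0, 0, 4, 6), (- 3, 0, 0, 5, 4), (- 9, 0, 0, 5, 5), (3,
    0, 1, 2, 2), (3, 0, 1, 3, 3), (3, 0, 2, 5, 3), (- 6, 0, 3, 5, 1), (3, 0, 4, 0, 0), (- 9, 0, 4,
    2, 0), (- 6, 0, 4, 5, 0), (- 3, 0, 5, 5, 0)],
    [(9, 0, 0, 0, 6), (- 6, 0, 0, 1, 7), (3, 0, 0, 3, 4), (- 3, 0, 0, 3, 5), (- 3, 0, 0, 5, 7), (6,
    0, 1, 1, 3), (- 3, 0, 1, 3, 1), (- 3, 0, 2, 5, 1), (- 3, 0, 3, 0, 2), (- 3, 0, 3, 5, 2), (3, 0,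
    6, 1, 0), (- 6, 0, 6, 2, 0), (6, 0, 7, 0, 0), (3, 0, 7, 5, 0)],
    [(4, 0, 0, 3, 6), (3, 0, 0, 3, 7), (4, 0, 0, 4, 4), (3, 0, 1, 1, 1), (- 7, 0, 1, 3, 2), (- 5,
    0, 1, 4, 3), (- 9, 0, 1, 5, 1), (2, 0, 2, 0, 2), (5, 0, 2, 2, 2), (- 3, 0, 2, 3, 3), (- 2, 0,
    2, 4, 1), (- 4, 0, 2, 5, 2), (6, 0, 3, 1, 3), (- 3, 0, 3, 5, 3), (- 2, 0, 6, 3, 0), (5, 0, 7,
    3, 0), (4, 1, 0, 0, 0)]],
   [[(- 15, 0, 0, 0, 11), (- 3, 0, 0, 1, 11), (12, 0, 0, 5, 11), (- 6, 0, 1, 1, 10), (9, 0, 1, 3,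
    9), (- 15, 0, 1, 5, 10), (6, 0, 2, 2, 9), (- 9, 0, 2, 3, 8), (- 9, 0, 2, 4, 10), (- 18, 0, 2,
    5, 9), (- 3, 0, 3, 0, 8), (- 6, 0, 3, 1, 8), (6, 0, 4, 0, 6), (- 3, 0, 4, 0, 7), (3, 0, 4, 2,
    6), (- 6, 0, 4, 2, 7), (15, 0, 4, 5, 7), (3, 0, 5, 1, 7), (3, 0, 5, 5, 7), (9, 0, 6, 1, 4), (3,
    0, 6, 1, 5), (12, 0, 6, 2, 4), (15, 0, 6, 5, 4), (12, 0, 6, 5, 5), (- 9, 0, 7, 0, 4), (- 18, 0,
    7, 0, 5), (9, 0, 7, 5, 4), (- 12, 0, 8, 5, 3), (- 3, 0, 9, 1, 2), (- 6, 0, 9, 5, 2), (- 6, 0,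
    10, 0, 1), (6, 0, 10, 5, 1)]]]],
   [[[[],
    [],
    [(- 1, 0, 0, 0, 6), (- 1, 0, 1, 1, 1), (- 1, 0, 4, 0, 0)]]],
   [[[],
    [],
    [(- 1, 0, 0, 3, 6), (- 1, 0, 0, 3, 7), (1, 0, 1, 1, 1), (1, 0, 2, 0, 2), (1, 0, 2, 3, 3), (1,
    0, 2, 4, 1), (1, 0, 3, 0, 3), (- 1, 0, 6, 3, 0)],
    [(- 1, 0, 0, 1, 4), (- 1, 0, 0, 1, 5), (- 1, 0, 2, 3, 1), (- 1, 0, 3, 0, 1), (- 2, 0, 4, 0, 0)],
    [(- 1, 0, 0, 0, 6), (1, 0, 0, 1, 6), (1, 0, 0, 1, 7), (- 1, 0, 0, 3, 4), (1, 0, 2, 3, 2), (1,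
    0, 3, 0, 2), (- 1, 0, 6, 1, 0)]]],
   [[[],
    [],
    [(1, 0, 0, 1, 4), (1, 0, 0, 3, 5), (- 1, 0, 0, 5, 6), (- 1, 0, 1, 1, 1), (1, 0, 1, 2, 2), (1,
    0, 1, 5, 3), (1, 0, 2, 2, 1), (2, 0, 2, 3, 3), (1, 0, 2, 5, 2), (1, 0, 3, 4, 3), (1, 0, 5, 5,
    0), (1, 0, 6, 1, 0), (1, 0, 6, 3, 0), (1, 0, 7, 3, 0)],
    [(2, 0, 0, 0, 5), (- 1, 0, 0, 4, 6), (1, 0, 0, 4, 7), (- 1, 0, 0, 5, 4), (1, 0, 1, 1, 3), (2,
    0, 1, 2, 1), (2, 0, 1, 3, 3), (1, 0, 1, 5, 2), (- 1, 0, 3, 0, 3), (- 2, 0, 3, 1, 1), (2, 0, 4,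
    2, 0), (1, 0, 4, 4, 0), (1, 0, 7, 0, 0), (2, 0, 7, 5, 0)],
    [(- 2, 0, 0, 0, 6), (- 1, 0, 0, 1, 4), (- 1, 0, 0, 1, 5), (- 1, 0, 1, 1, 1), (- 1, 0, 1, 2, 2),
    (- 1, 0, 1, 3, 1), (- 1, 0, 1, 5, 3), (1, 0, 3, 0, 1), (- 4, 0, 4, 0, 0), (- 1, 0, 4, 5, 0), (-
    1, 0, 6, 1, 0), (- 1, 0, 7, 3, 0)],
    [(1, 0, 0, 1, 6), (3, 0, 0, 1, 7), (- 1, 0, 0, 4, 4), (1, 0, 1, 4, 3), (1, 0, 1, 5, 1), (2, 0,
    2, 2, 2), (2, 0, 2, 3, 1), (2, 0, 2, 5, 3), (- 3, 0, 3, 0, 2), (1, 0, 3, 1, 3), (2, 0, 5, 3,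
    0), (2, 0, 6, 2, 0)]]],
   [[[],
    [],
    [(- 2, 0, 0, 3, 6), (- 3, 0, 0, 3, 7), (1, 0, 0, 4, 4), (3, 0, 1, 1, 1), (- 1, 0, 1, 3, 2), (1,
    0, 1, 4, 3), (2, 0, 2, 0, 2), (- 1, 0, 2, 2, 2), (3, 0, 2, 3, 3), (1, 0, 2, 4, 1), (- 1, 0, 2,
    5, 2), (3, 0, 3, 0, 3), (3, 0, 3, 5, 3), (- 2, 0, 6, 3, 0), (- 1, 0, 7, 3, 0), (1, 1, 0, 0, 0)],
    [(6, 0, 0, 0, 5), (- 3, 0, 0, 1, 5), (- 6, 0, 0, 4, 6), (3, 0, 0, 5, 5), (- 6, 0, 1, 2, 2), (-
    6, 0, 2, 5, 3), (- 3, 0, 3, 0, 1), (6, 0, 3, 1, 1), (6, 0, 3, 5, 1), (- 15, 0, 4, 0, 0), (6, 0,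
    4, 2, 0), (6, 0, 5, 5, 0)],
    [(- 9, 0, 0, 0, 6), (6, 0, 0, 1, 6), (12, 0, 0, 1, 7), (- 6, 0, 0, 3, 4), (- 3, 0, 0, 5, 6),
    (3, 0, 0, 5, 7), (- 3, 0, 1, 1, 3), (3, 0, 1, 3, 1), (- 6, 0, 2, 2, 1), (3, 0, 2, 3, 2), (12,
    0, 3, 0, 2), (3, 0, 3, 5, 2), (- 3, 0, 6, 1, 0), (6, 0, 6, 2, 0), (3, 0, 6, 5, 0), (3, 0, 7, 0,
    0), (3, 0, 7, 5, 0)],
    [(- 4, 0, 0, 3, 6), (- 4, 0, 0, 4, 4), (3, 0, 1, 1, 1), (- 3, 0, 1, 2, 1), (7, 0, 1, 3, 2), (2,
    0, 1, 4, 3), (9, 0, 1, 5, 1), (1, 0, 2, 0, 2), (- 5, 0, 2, 2, 2), (3, 0, 2, 3, 3), (5, 0, 2, 4,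
    1), (4, 0, 2, 5, 2), (6, 0, 3, 0, 3), (- 6, 0, 3, 1, 3), (- 1, 0, 6, 3, 0), (- 5, 0, 7, 3, 0),
    (- 4, 1, 0, 0, 0)]],
   [[(9, 0, 0, 0, 11), (9, 0, 0, 1, 11), (3, 0, 0, 5, 11), (3, 0, 1, 1, 10), (- 3, 0, 1, 3, 9), (-
    6, 0, 1, 5, 10), (3, 0, 2, 3, 8), (3, 0, 2, 4, 10), (- 3, 0, 2, 5, 9), (12, 0, 3, 0, 8), (6, 0,
    3, 1, 8), (- 12, 0, 4, 0, 6), (12, 0, 4, 0, 7), (3, 0, 4, 2, 6), (12, 0, 4, 5, 6), (6, 0, 4, 5,
    7), (3, 0, 5, 1, 6), (3, 0, 5, 1, 7), (6, 0, 5, 5, 6), (3, 0, 5, 5, 7), (- 18, 0, 6, 1, 4), (3,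
    0, 6, 1, 5), (6, 0, 6, 5, 4), (6, 0, 6, 5, 5), (- 6, 0, 7, 0, 4), (- 3, 0, 7, 0, 5), (3, 0, 7,
    5, 4), (3, 0, 7, 5, 5), (- 9, 0, 8, 5, 3), (9, 0, 9, 1, 2), (6, 0, 9, 5, 2), (6, 0, 10, 0, 1),
    (6, 0, 11, 5, 0)]]]],
   [[[[(1, 0, 0, 0, 5), (- 1, 0, 0, 0, 6), (- 1, 0, 1, 1, 1), (1, 0, 1, 1, 3), (- 1, 0, 4, 0, 0),
    (1, 0, 4, 2, 0)],
    [],
    []]],
   [[[(1, 0, 0, 0, 5), (- 2, 0, 0, 0, 6), (1, 0, 1, 3, 1), (- 1, 0, 4, 0, 0), (- 1, 0, 7, 0, 0)],
    [],
    [],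
    [(1, 0, 0, 1, 6), (2, 0, 0, 1, 7), (- 1, 0, 0, 3, 4), (1, 0, 0, 3, 5), (- 1, 0, 0, 3, 6), (- 1,
    0, 0, 3, 7), (1, 0, 1, 1, 1), (- 1, 0, 1, 1, 3), (1, 0, 1, 2, 1), (1, 0, 1, 3, 2), (1, 0, 1, 4,
    3), (1, 0, 2, 0, 2), (1, 0, 2, 3, 2), (1, 0, 2, 3, 3), (1, 0, 2, 4, 1), (- 1, 0, 2, 4, 3), (1,
    0, 3, 0, 2), (1, 0, 3, 0, 3), (- 1, 0, 6, 1, 0), (1, 0, 6, 2, 0), (- 1, 0, 6, 3, 0), (- 1, 0,
    7, 3, 0)],
    [(- 1, 0, 0, 1, 4), (- 1, 0, 0, 1, 5), (- 1, 0, 0, 3, 7), (- 1, 0, 2, 3, 1), (1, 0, 2, 3, 3),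
    (- 1, 0, 3, 0, 1), (1, 0, 3, 0, 3), (- 1, 0, 4, 0, 0), (1, 0, 4, 2, 0)]]],
   [[[(1, 0, 0, 0, 5), (- 2, 0, 0, 0, 6), (- 1, 0, 4, 0, 0), (- 1, 0, 7, 0, 0)],
    [],
    [],
    [(- 2, 0, 0, 0, 6), (2, 0, 0, 1, 7), (1, 0, 0, 3, 5), (- 1, 0, 0, 4, 4), (- 1, 0, 1, 1, 1), (-
    2, 0, 1, 2, 2), (- 2, 0, 1, 3, 1), (1, 0, 1, 4, 3), (1, 0, 1, 5, 1), (- 1, 0, 1, 5, 3), (2, 0,
    2, 2, 2), (2, 0, 2, 3, 1), (1, 0, 2, 3, 3), (2, 0, 2, 5, 3), (- 2, 0, 3, 0, 2), (1, 0, 3, 1,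
    3), (1, 0, 3, 4, 3), (- 3, 0, 4, 0, 0), (- 1, 0, 4, 5, 0), (2, 0, 5, 3, 0), (3, 0, 6, 2, 0), (-
    2, 0, 7, 3, 0)],
    [(2, 0, 0, 0, 5), (1, 0, 0, 1, 6), (3, 0, 0, 1, 7), (2, 0, 0, 4, 5), (- 2, 0, 0, 4, 6), (2, 0,
    1, 1, 3), (2, 0, 1, 2, 1), (2, 0, 1, 3, 3), (2, 0, 1, 4, 3), (1, 0, 1, 5, 1), (2, 0, 1, 5, 2),
    (1, 0, 2, 2, 2), (1, 0, 2, 3, 1), (1, 0, 2, 3, 2), (1, 0, 2, 4, 3), (1, 0, 2, 5, 3), (- 2, 0,
    3, 0, 2), (- 1, 0, 3, 0, 3), (- 2, 0, 3, 1, 1), (2, 0, 3, 1, 3), (2, 0, 4, 2, 0), (1, 0, 4, 3,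
    0), (2, 0, 4, 4, 0), (1, 0, 5, 3, 0), (1, 0, 5, 4, 0), (1, 0, 6, 2, 0), (1, 0, 7, 0, 0), (2, 0,
    7, 5, 0)],
    [(1, 0, 0, 0, 5), (- 1, 0, 0, 1, 4), (- 1, 0, 0, 1, 5), (1, 0, 0, 3, 5), (1, 0, 0, 4, 6), (2,
    0, 0, 4, 7), (- 1, 0, 0, 5, 4), (1, 0, 0, 5, 5), (- 1, 0, 0, 5, 6), (1, 0, 1, 1, 3), (1, 0, 1,
    2, 2), (1, 0, 1, 3, 3), (1, 0, 1, 5, 3), (1, 0, 2, 3, 3), (1, 0, 2, 4, 3), (1, 0, 3, 0, 1), (1,
    0, 3, 4, 3), (- 1, 0, 4, 0, 0), (2, 0, 4, 2, 0), (1, 0, 4, 5, 0), (1, 0, 5, 5, 0), (- 1, 0, 6,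
    1, 0), (1, 0, 6, 3, 0), (1, 0, 7, 3, 0)]]],
   [[[(1, 0, 0, 0, 5), (- 2, 0, 0, 0, 6), (- 1, 0, 4, 0, 0), (- 1, 0, 7, 0, 0)],
    [],
    [],
    [(- 4, 0, 0, 0, 6), (1, 0, 0, 1, 6), (2, 0, 0, 1, 7), (1, 0, 0, 3, 5), (- 2, 0, 0, 3, 6), (- 1,
    0, 0, 3, 7), (- 1, 0, 0, 4, 4), (- 1, 0, 0, 5, 6), (- 1, 0, 1, 1, 3), (2, 0, 1, 3, 1), (1, 0,
    1, 3, 2), (3, 0, 1, 5, 1), (- 1, 0, 2, 0, 2), (- 3, 0, 2, 2, 2), (1, 0, 2, 4, 3), (1, 0, 2, 5,
    1), (1, 0, 2, 5, 2), (2, 0, 3, 0, 2), (1, 0, 3, 0, 3), (- 3, 0, 3, 1, 3), (- 1, 0, 3, 5, 2),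
    (1, 0, 3, 5, 3), (- 1, 0, 6, 1, 0), (2, 0, 6, 2, 0), (1, 0, 6, 3, 0), (- 1, 0, 7, 0, 0), (- 2,
    0, 7, 3, 0), (- 1, 1, 0, 0, 0)],
    [(4, 0, 0, 0, 5), (1, 0, 0, 1, 4), (1, 0, 0, 1, 5), (- 1, 0, 0, 3, 6), (- 1, 0, 0, 3, 7), (- 1,
    0, 0, 4, 4), (- 4, 0, 0, 4, 6), (2, 0, 0, 5, 4), (3, 0, 0, 5, 5), (1, 0, 1, 1, 1), (- 2, 0, 1,
    2, 2), (3, 0, 1, 3, 2), (- 2, 0, 1, 3, 3), (3, 0, 1, 4, 3), (3, 0, 1, 5, 1), (2, 0, 2, 0, 2),
    (2, 0, 2, 3, 1), (3, 0, 2, 3, 3), (3, 0, 2, 4, 1), (2, 0, 2, 5, 2), (- 1, 0, 2, 5, 3), (1, 0,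
    3, 0, 1), (3, 0, 3, 0, 3), (2, 0, 3, 1, 1), (- 1, 0, 3, 1, 3), (4, 0, 3, 5, 1), (1, 0, 3, 5,
    3), (- 2, 0, 4, 0, 0), (4, 0, 4, 2, 0), (2, 0, 4, 5, 0), (1, 0, 5, 5, 0), (- 2, 0, 6, 3, 0), (-
    2, 0, 7, 3, 0), (- 1, 1, 0, 0, 0)],
    [(- 2, 0, 0, 1, 4), (- 2, 0, 0, 1, 5), (1, 0, 0, 1, 6), (4, 0, 0, 1, 7), (- 3, 0, 0, 3, 4), (-
    1, 0, 0, 5, 4), (1, 0, 0, 5, 5), (2, 0, 0, 5, 7), (- 2, 0, 1, 1, 3), (- 1, 0, 1, 2, 2), (1, 0,
    1, 3, 3), (- 2, 0, 2, 2, 1), (- 2, 0, 2, 3, 1), (1, 0, 2, 3, 2), (- 1, 0, 2, 4, 3), (- 2, 0, 2,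
    5, 3), (- 2, 0, 3, 0, 1), (3, 0, 3, 0, 2), (3, 0, 3, 5, 2), (- 3, 0, 4, 0, 0), (1, 0, 4, 2, 0),
    (2, 0, 5, 5, 0), (- 1, 0, 6, 1, 0), (2, 0, 6, 2, 0), (1, 0, 6, 5, 0), (1, 0, 7, 0, 0)]],
   [[(- 2, 0, 0, 3, 11), (- 2, 0, 1, 1, 8), (2, 0, 1, 1, 9), (4, 0, 1, 2, 8), (- 2, 0, 1, 2, 9), (-
    2, 0, 1, 5, 8), (- 2, 0, 2, 0, 8), (2, 0, 2, 0, 10), (- 2, 0, 2, 2, 8), (1, 0, 2, 3, 9), (1, 0,
    2, 3, 10), (1, 0, 2, 4, 8), (1, 0, 2, 4, 9), (1, 0, 3, 0, 9), (7, 0, 3, 0, 10), (- 5, 0, 3, 1,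
    9), (- 1, 0, 3, 1, 10), (- 5, 0, 4, 0, 4), (- 2, 0, 4, 0, 5), (- 3, 0, 4, 2, 4), (- 3, 0, 4, 2,
    5), (5, 0, 4, 5, 4), (6, 0, 4, 5, 5), (1, 0, 5, 1, 4), (1, 0, 5, 1, 5), (- 1, 0, 5, 5, 4), (3,
    0, 6, 1, 6), (5, 0, 6, 1, 7), (6, 0, 6, 2, 7), (- 1, 0, 6, 3, 6), (- 4, 0, 6, 5, 7), (- 5, 0,
    7, 0, 6), (3, 0, 7, 5, 6), (1, 0, 7, 5, 7), (- 2, 0, 8, 2, 1), (4, 0, 8, 2, 2), (- 1, 0, 8, 3,
    3), (1, 0, 8, 5, 1), (- 1, 0, 8, 5, 2), (- 4, 0, 9, 1, 1), (2, 0, 9, 1, 3), (- 1, 0, 9, 4, 3),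
    (2, 0, 9, 5, 1), (6, 0, 10, 0, 2), (- 1, 0, 10, 0, 3), (- 1, 0, 10, 5, 3), (1, 0, 11, 3, 0), (-
    3, 1, 1, 0, 3), (- 3, 1, 2, 0, 1), (3, 1, 2, 0, 3)]]]]] ! (i - 4) ! (n - 1) ! k ! u)"

definition lift_table :: "nat \<Rightarrow> nat \<Rightarrow> res_index table"
  where "lift_table j m k u = [[[[[(1, 0, 0, 0, 0)],
    [],
    [],
    [],
    []]],
   [[[(1, 0, 0, 0, 0)],
    [],
    [],
    [(1, 0, 0, 1, 0)],
    [(1, 0, 0, 2, 0)],
    []]],
   [[[(1, 0, 0, 0, 0)],
    [],
    [],
    [(1, 0, 0, 3, 0)],
    [(1, 0, 0, 4, 0)],
    [(1, 0, 0, 1, 0), (1, 0, 0, 2, 0)]],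
   [[(2, 0, 0, 3, 6), (3, 0, 0, 3, 7), (- 1, 0, 0, 4, 4), (1, 0, 1, 3, 2), (- 1, 0, 1, 4, 3), (- 2,
    0, 2, 0, 2), (1, 0, 2, 2, 2), (- 3, 0, 2, 3, 3), (- 1, 0, 2, 4, 1), (- 3, 0, 3, 0, 3), (2, 0,
    6, 3, 0), (1, 0, 7, 3, 0)]]]],
   [[[[],
    [(1, 0, 0, 0, 0)],
    [],
    [],
    []]],
   [[[],
    [(1, 0, 0, 1, 0)],
    [],
    [],
    [(1, 0, 0, 2, 0)],
    [(1, 0, 0, 0, 0)]]],
   [[[],
    [(1, 0, 0, 1, 0)],
    [],
    [(1, 0, 0, 3, 0)],
    [(1, 0, 0, 4, 0)],
    [(1, 0, 0, 0, 0), (1, 0, 0, 2, 0)]],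
   [[(- 1, 0, 0, 3, 6), (- 3, 0, 0, 3, 7), (2, 0, 0, 4, 4), (3, 0, 1, 2, 1), (1, 0, 1, 3, 2), (2,
    0, 1, 4, 3), (1, 0, 2, 0, 2), (1, 0, 2, 2, 2), (3, 0, 2, 3, 3), (2, 0, 2, 4, 1), (3, 0, 3, 0,
    3), (- 1, 0, 6, 3, 0), (- 2, 0, 7, 3, 0)]]]],
   [[[[],
    [],
    [(1, 0, 0, 0, 0)],
    [],
    []]],
   [[[],
    [],
    [(1, 0, 0, 2, 0)],
    [(1, 0, 0, 1, 0)],
    [],
    [(1, 0, 0, 0, 0)]]],
   [[[],
    [],
    [(1, 0, 0, 2, 0)],
    [(1, 0, 0, 3, 0)],
    [(1, 0, 0, 4, 0)],
    [(1, 0, 0, 0, 0), (1, 0, 0, 1, 0)]],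
   [[(- 1, 0, 0, 3, 6), (- 1, 0, 0, 4, 4), (- 3, 0, 1, 2, 1), (- 2, 0, 1, 3, 2), (- 1, 0, 1, 4, 3),
    (1, 0, 2, 0, 2), (- 2, 0, 2, 2, 2), (- 1, 0, 2, 4, 1), (- 1, 0, 6, 3, 0), (1, 0, 7, 3, 0)]]]],
   [[[[],
    [],
    [],
    [(1, 0, 0, 0, 0)],
    [(1, 0, 0, 0, 0)]]],
   [[[],
    [],
    [],
    [(1, 0, 0, 0, 0), (1, 0, 0, 2, 0)],
    [(1, 0, 0, 0, 0), (1, 0, 0, 1, 0)],
    [(1, 0, 0, 1, 0), (1, 0, 0, 2, 0)]]],
   [[[],
    [],
    [],
    [(1, 0, 0, 0, 0), (1, 0, 0, 1, 0), (1, 0, 0, 2, 0), (1, 0, 0, 4, 0)],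
    [(1, 0, 0, 0, 0), (1, 0, 0, 1, 0), (1, 0, 0, 2, 0), (1, 0, 0, 3, 0)],
    [(1, 0, 0, 3, 0), (1, 0, 0, 4, 0)]],
   [[(- 1, 0, 0, 0, 5), (1, 0, 0, 0, 6), (1, 0, 0, 0, 7), (1, 0, 0, 1, 4), (1, 0, 0, 1, 5), (- 1,
    0, 0, 1, 7), (- 1, 0, 0, 2, 4), (- 1, 0, 0, 2, 6), (1, 0, 1, 1, 2), (- 1, 0, 1, 1, 3), (- 1, 0,
    1, 2, 2), (1, 0, 2, 0, 1), (- 1, 0, 2, 0, 3), (- 1, 0, 2, 2, 1), (1, 0, 3, 0, 1), (- 1, 0, 3,
    0, 2), (- 1, 0, 3, 1, 1), (1, 0, 3, 1, 2), (1, 0, 4, 0, 0), (- 1, 0, 4, 2, 0), (1, 0, 5, 1, 0),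
    (1, 0, 6, 1, 0), (- 1, 0, 6, 2, 0), (1, 0, 7, 0, 0)]]]],
   [[[[(1, 0, 1, 0, 0)],
    [(1, 0, 2, 0, 0)],
    [(1, 0, 3, 0, 0)],
    [],
    [],
    []]]]] ! (j - 9) ! m ! k ! u"

text \<open>A pair without an entry gets the empty table: there the two sides agree as cocycles,
  without a coboundary. This is so for all brackets with X_14.\<close>

definition psi_table :: "nat \<Rightarrow> nat \<Rightarrow> nat table"
  where "psi_table i j k u = (case map_of [
   ((4, 10), [[[(1, 1)],
    [],
    [(1, 3)]]]),
   ((4, 11), [[[],
    [],
    [(- 1, 3)]]]),
   ((4, 12), [[[(- 1, 2), (1, 3)],
    [],
    []]]),
   ((4, 13), [[[],
    [],
    [],
    [(2, 4), (2, 5)],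
    []]]),
   ((5, 9), [[[(- 1, 1)],
    [],
    []]]),
   ((5, 11), [[[],
    [],
    [(- 1, 3)]]]),
   ((5, 12), [[[],
    [(- 1, 1), (1, 3)],
    []]]),
   ((5, 13), [[[],
    [],
    [],
    [(8, 4), (2, 5)],
    []]]),
   ((6, 9), [[[(1, 1)],
    [],
    [(- 1, 3)]]]),
   ((6, 10), [[[(- 1, 1)],
    [],
    [(- 1, 3)]]]),
   ((6, 12), [[[(- 2, 2)],
    [(- 2, 1)],
    [(- 1, 2)]]]),
   ((6, 13), [[[],
    [],
    [],
    [(- 9, 4), (- 8, 5)],
    []]]),
   ((7, 9), [[[(- 2, 2), (1, 3)],
    [],
    []]]),
   ((7, 10), [[[],
    [(- 1, 1)],
    []]]),
   ((7, 11), [[[(1, 2)],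
    [(1, 1)],
    []]]),
   ((7, 12), [[[(1, 1), (- 1, 2)],
    [],
    []]]),
   ((7, 13), [[[(- 5, 4), (- 3, 5)],
    [(4, 5)],
    [(- 4, 5)],
    [(1, 6), (- 3, 7)],
    []]])] (i, j) of
    None \<Rightarrow> [] | Some t \<Rightarrow> t ! k ! u)"

text \<open>For X_4, X_5, X_6 the solution in degree 4 has denominator 3. On K_4 its
  \<omega>_1-component is -1/3 at \<alpha>_4, \<beta>_4, \<gamma>_4 respectively and 4/3 at
  \<alpha>_2\<beta>_2, with both signs reversed for X_6. X_14 reads off just this component, which
  explains the coefficients of its brackets.\<close>

definition del_factor :: "nat \<Rightarrow> nat \<Rightarrow> int"
  where "del_factor i n = (if n = 4 \<and> i < 7 then 3 else 1)"

definition prod_table :: "nat \<Rightarrow> nat \<Rightarrow> nat table"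
  where "prod_table p q k u = map_fk (phi_table p) (lift_table q (X_degree p) k u)"

definition bracket_table :: "nat \<Rightarrow> nat \<Rightarrow> nat table"
  where "bracket_table i j k u = scale_terms (del_factor i (X_degree j)) (der_fk (der_table i) (phi_table j k u))
    @ scale_terms (- 1) (map_fk (phi_table j) (del_table i (X_degree j) k u))"

lemma res_cochain_gen:
  "res_cochain i w x (res_gen n k u 1 1)
    = (if k = i then fk_scale (dual_app (dual_gen (n - 4 * k) u) w) x else (0 :: 'k::field fk3))"
  and res_cochain_hom: "res_cochain i w x \<in> bimod_hom (res_bimod n) (fk_bimod :: ('k, 'k fk3) bimod)"
  and kos_ext_cochain: "kos_ext fk_scale (\<lambda>y v z. y * fk_scale (dual_app v w) x * z) (kos_pure y v z)
    = y * fk_scale (dual_app v w) (x :: 'k fk3) * z"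
  and linear_cochain: "Vector_Spaces.linear kos_scale fk_scale
    (kos_ext fk_scale (\<lambda>y v z. y * fk_scale (dual_app v w) x * z))"
proof -
  let ?T = "kos_ext fk_scale (\<lambda>y v z. y * fk_scale (dual_app v w) x * z)"
  have t: "tlin fk_scale (\<lambda>y v z. y * fk_scale (dual_app v w) (x :: 'k fk3) * z)"
    by (simp add: tlin_def dual_app_simps fk_scale_mult algebra_simps fk.scale_left_distrib fk.scale_right_distrib)
  note L = linear_kos_ext[OF vector_space_fk_scale t] and E = kos_ext_pure[OF vector_space_fk_scale t]
  show "?T (kos_pure y v z) = y * fk_scale (dual_app v w) x * z" by (rule E)
  show "Vector_Spaces.linear kos_scale fk_scale ?T" by (rule L)
  show "res_cochain i w x (res_gen n k u 1 1)
      = (if k = i then fk_scale (dual_app (dual_gen (n - 4 * k) u) w) x else (0 :: 'k fk3))"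
    by (simp add: res_cochain_def res_gen_def E linearD[OF L])
  have act1: "?T (kos_lact z s) = z * ?T s" for z s
    by (rule kos_linear_eqI[OF linear_comp[OF linear_kos_act(1) L] linear_comp[OF L linear_fk_mult(1)]])
      (simp only: kos_act_pure E, simp only: mult.assoc)
  have act2: "?T (kos_ract s z) = ?T s * z" for z s
    by (rule kos_linear_eqI[OF linear_comp[OF linear_kos_act(2) L] linear_comp[OF L linear_fk_mult(2)]])
      (simp only: kos_act_pure E, simp only: mult.assoc)
  show "res_cochain i w x \<in> bimod_hom (res_bimod n) (fk_bimod :: ('k, 'k fk3) bimod)"
    by (rule bimod_homI) (simp_all add: res_cochain_def plus_fun_apply linearD[OF L] res_bimod_def act1 act2)
qed

lemma X_cocycle_hom: "X_cocycle j \<in> bimod_hom (res_bimod n) fk_bimod"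
  unfolding X_cocycle_def Let_def plus_fun_def
  by (auto intro!: res_cochain_hom bimod_hom_add[OF bimodule_fk])

lemma dual_app_gen_small:
  "dual_app (dual_gen 0 0) 1 = (1 :: 'k::field)"
  "u < 3 \<Longrightarrow> dual_app (dual_gen (Suc 0) u) fkd_A = (if u = 0 then 1 else 0 :: 'k)"
  "u < 3 \<Longrightarrow> dual_app (dual_gen (Suc 0) u) fkd_B = (if u = 1 then 1 else 0 :: 'k)"
  "u < 3 \<Longrightarrow> dual_app (dual_gen (Suc 0) u) fkd_C = (if u = 2 then 1 else 0 :: 'k)"
  "u < 5 \<Longrightarrow> dual_app (dual_gen 2 u) (fkd_A * fkd_A) = (if u = 0 then 1 else 0 :: 'k)"
  "u < 5 \<Longrightarrow> dual_app (dual_gen 2 u) (fkd_B * fkd_B) = (if u = 1 then 1 else 0 :: 'k)"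
  "u < 5 \<Longrightarrow> dual_app (dual_gen 2 u) (fkd_C * fkd_C) = (if u = 2 then 1 else 0 :: 'k)"
  "u < 5 \<Longrightarrow> dual_app (dual_gen 2 u) (fkd_A * fkd_B) = (if u = 3 then 1 else 0 :: 'k)"
  "u < 5 \<Longrightarrow> dual_app (dual_gen 2 u) (fkd_A * fkd_C) = (if u = 4 then 1 else 0 :: 'k)"
  "u < 6 \<Longrightarrow> dual_app (dual_gen 3 u) (fkd_A * (fkd_A * fkd_A)) = (if u = 0 then 1 else 0 :: 'k)"
  "u < 6 \<Longrightarrow> dual_app (dual_gen 3 u) (fkd_B * (fkd_B * fkd_B)) = (if u = 1 then 1 else 0 :: 'k)"
  "u < 6 \<Longrightarrow> dual_app (dual_gen 3 u) (fkd_C * (fkd_C * fkd_C)) = (if u = 2 then 1 else 0 :: 'k)"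
  using dual_gen_app[of 0 0 0, where ?'a = 'k] dual_gen_app[of "Suc 0" u 0, where ?'a = 'k]
    dual_gen_app[of "Suc 0" u 1, where ?'a = 'k] dual_gen_app[of "Suc 0" u 2, where ?'a = 'k]
    dual_gen_app[of 2 u 0, where ?'a = 'k] dual_gen_app[of 2 u 1, where ?'a = 'k]
    dual_gen_app[of 2 u 2, where ?'a = 'k] dual_gen_app[of 2 u 3, where ?'a = 'k] dual_gen_app[of 2 u 4, where ?'a = 'k]
    dual_gen_app[of 3 u 0, where ?'a = 'k] dual_gen_app[of 3 u 1, where ?'a = 'k] dual_gen_app[of 3 u 2, where ?'a = 'k]
  by (simp_all add: basis_size_def words_basis_small fkd_word_simps)

lemma less_15: "j \<in> {1..14} \<longleftrightarrow> j = 1 \<or> j = 2 \<or> j = 3 \<or> j = 4 \<or> j = 5 \<or> j = 6 \<or> j = 7 \<or>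
    j = 8 \<or> j = 9 \<or> j = 10 \<or> j = 11 \<or> j = 12 \<or> j = 13 \<or> j = (14 :: nat)"
  by (simp add: atLeastAtMost_iff) presburger

lemma X_cocycle_table:
  assumes j: "j \<in> {1..14}" and ku: "(k, u) \<in> res_index (X_degree j)"
  shows "X_cocycle j (res_gen (X_degree j) k u 1 1) = (eval_fk (phi_table j k u) :: 'k::field fk3)"
proof -
  have il: "index_list 0 = [(0, 0)]" "index_list (Suc 0) = [(0, 0), (0, 1), (0, 2)]"
    "index_list 2 = [(0, 0), (0, 1), (0, 2), (0, 3), (0, 4)]"
    "index_list 3 = [(0, 0), (0, 1), (0, 2), (0, 3), (0, 4), (0, 5)]"
    "index_list 4 = [(0, 0), (0, 1), (0, 2), (0, 3), (0, 4), (0, 5), (1, 0)]"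
    by code_simp+
  note defs = X_cocycle_def plus_fun_apply res_cochain_gen dual_app_gen_small phi_table_def power2_eq_square
    power3_eq_cube mult.assoc eval_fk_simps fk.scale_minus_left Let_def add_diff_eq add.assoc
  have ku': "(k, u) \<in> set (index_list (X_degree j))" using ku by (simp only: index_list)
  from j[unfolded less_15] ku' show ?thesis
    by (elim disjE) (auto simp: X_degree_def il defs)
qed

section \<open>Verified computations\<close>

lemma phi_table_check:
  "list_all (\<lambda>j. valid_fk_table (X_degree j) (phi_table j)) [1..<15]"
  "list_all (\<lambda>j. list_all (\<lambda>(k, u). vanishes (<) (map_fk (phi_table j) (diff_table (Suc (X_degree j)) k u)))
    (index_list (Suc (X_degree j)))) [1..<14]"
  by code_simp+

text \<open>The computational core: the listed operators commute with the differential on all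
  generators of P_1 to P_4, \<omega>_1 included.\<close>

lemma op_checks: "op_check 4 (del_factor 4) (der_table 4) (del_table 4)"
  "op_check 4 (del_factor 5) (der_table 5) (del_table 5)"
  "op_check 4 (del_factor 6) (der_table 6) (del_table 6)"
  "op_check 4 (del_factor 7) (der_table 7) (del_table 7)"
  by code_simp+

text \<open>The last check concerns the class X_9 + X_10: its product with X_1 is computed from a
  lift of the sum, namely the sum of the two lifts, rather than by distributivity in
  cohomology.\<close>

lemma lift_checks:
  "lift_check 2 2 (phi_table 9) (lift_table 9)" "lift_check 2 2 (phi_table 10) (lift_table 10)"
  "lift_check 2 2 (phi_table 11) (lift_table 11)" "lift_check 2 2 (phi_table 12) (lift_table 12)"
  "lift_check 3 0 (phi_table 13) (lift_table 13)"
  "lift_check 2 0 (\<lambda>k u. phi_table 9 k u @ phi_table 10 k u) (\<lambda>m k u. lift_table 9 m k u @ lift_table 10 m k u)"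
  by code_simp+

lemma bracket_zero_checks:
  "list_all (\<lambda>(i, j). table_eq (X_degree j) (bracket_table i j) (\<lambda>k u. []) (psi_table i j))
    (List.product [4, 5, 6, 7] [1, 2, 3, 4, 5, 6, 7] @ List.product [4, 5, 6] [9, 10, 11])"
  by code_simp

text \<open>For the brackets of X_4, X_5, X_6 with X_14 both sides are three times those of the
  theorem, as \<open>bracket_table\<close> contains the factor \<open>del_factor\<close>.\<close>

lemma bracket_checks:
  "list_all (\<lambda>i. table_eq 1 (bracket_table i 8) (\<lambda>k u. scale_terms 2 (phi_table i k u)) (psi_table i 8)) [4, 5, 6, 7]"
  "table_eq 2 (bracket_table 7 9) (\<lambda>k u. scale_terms 4 (prod_table 1 9 k u)) (psi_table 7 9)"
  "table_eq 2 (bracket_table 7 10) (prod_table 1 10) (psi_table 7 10)"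
  "table_eq 2 (bracket_table 7 11) (\<lambda>k u. scale_terms (- 1) (map_fk (phi_table 1) (lift_table 9 0 k u @ lift_table 10 0 k u)))
    (psi_table 7 11)"
  "table_eq 2 (bracket_table 4 12) (\<lambda>k u. scale_terms 2 (prod_table 1 9 k u)) (psi_table 4 12)"
  "table_eq 2 (bracket_table 5 12) (\<lambda>k u. scale_terms 2 (prod_table 1 10 k u)) (psi_table 5 12)"
  "table_eq 2 (bracket_table 6 12) (\<lambda>k u. scale_terms 2 (map_fk (phi_table 1) (lift_table 9 0 k u @ lift_table 10 0 k u)))
    (psi_table 6 12)"
  "table_eq 2 (bracket_table 7 12) (prod_table 1 9) (psi_table 7 12)"
  "table_eq 3 (bracket_table 4 13) (\<lambda>k u. scale_terms 8 (prod_table 4 10 k u)) (psi_table 4 13)"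
  "table_eq 3 (bracket_table 5 13) (\<lambda>k u. scale_terms 8 (prod_table 4 10 k u)) (psi_table 5 13)"
  "table_eq 3 (bracket_table 6 13) (\<lambda>k u. scale_terms (- 8) (prod_table 4 10 k u)) (psi_table 6 13)"
  "table_eq 3 (bracket_table 7 13) (\<lambda>k u. scale_terms 4 (prod_table 1 13 k u) @ scale_terms (- 4) (prod_table 2 13 k u)
    @ scale_terms (- 8) (prod_table 4 12 k u)) (psi_table 7 13)"
  "table_eq 4 (bracket_table 4 14) (\<lambda>k u. scale_terms 1 (prod_table 9 9 k u) @ scale_terms (- 4) (prod_table 9 10 k u)) (psi_table 4 14)"
  "table_eq 4 (bracket_table 5 14) (\<lambda>k u. scale_terms 1 (prod_table 10 10 k u) @ scale_terms (- 4) (prod_table 9 10 k u)) (psi_table 5 14)"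
  "table_eq 4 (bracket_table 6 14) (\<lambda>k u. scale_terms (- 1) (prod_table 11 11 k u) @ scale_terms 4 (prod_table 9 10 k u)) (psi_table 6 14)"
  "table_eq 4 (bracket_table 7 14) (prod_table 9 12) (psi_table 7 14)"
  by code_simp+

subsection \<open>The brackets\<close>

lemma op_check_mono: "op_check n N Dt G \<Longrightarrow> m \<le> n \<Longrightarrow> op_check m N Dt G"
  unfolding op_check_def list_all_iff set_upt by (meson atLeastLessThan_iff less_le_trans Suc_le_mono)

lemma lift_check_mono: "lift_check n m S L \<Longrightarrow> m' \<le> m \<Longrightarrow> lift_check n m' S L"
  unfolding lift_check_def list_all_iff set_upt by (meson atLeastLessThan_iff less_le_trans Suc_le_mono)

lemma X_degree_le: "X_degree j \<le> 4"
  by (simp add: X_degree_def)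

context comparison
begin

abbreviation "X \<equiv> X_class f \<iota>"

text \<open>The \<omega>_1-component of the differential in degree 5 is d_1, and the cocycle reads
  only this component, so f_1 is invisible to it. On 1|u|1 the two parts of d_1 give the same
  multiples of the generators with opposite signs.\<close>

lemma X_cocycle_14: "X_cocycle 14 (res_diff f 5 \<rho>) = 0"
proof -
  define T where "T = kos_ext fk_scale (\<lambda>y v z. y * fk_scale (dual_app v 1) (1 :: 'k fk3) * z)"
  have lin: "Vector_Spaces.linear kos_scale fk_scale T"
    unfolding T_def by (rule linear_cochain)
  have pure: "T (kos_pure y v z) = y * fk_scale (dual_app v 1) 1 * z" for y v z
    unfolding T_def by (rule kos_ext_cochain)
  have "T (kos_diff (Suc 0) t) = 0" for t
  proof (rule kos_linear_eqI[OF linear_comp[OF linear_kos_diff lin]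
        linear_zero[OF vector_space_kos_scale vector_space_fk_scale]])
    fix x y :: "'k fk3" and u
    show "T (kos_diff (Suc 0) (kos_pure x u y)) = 0"
      by (simp add: kos_diff_pure linearD[OF lin] pure dual_app_shift fk_scale_mult mult.assoc
          fk.scale_minus_left)
  qed
  then show ?thesis by (simp add: X_cocycle_def res_cochain_def res_diff_def T_def)
qed

lemma represents_X: "j \<in> {1..14} \<Longrightarrow> represents (X_degree j) (X_cocycle j) (X j)"
  unfolding X_class_def
proof (rule represents_hh_of_res[OF X_degree_le X_cocycle_hom])
  fix \<rho> :: "nat \<Rightarrow> 'k kos"
  assume j: "j \<in> {1..14}" and \<rho>: "\<rho> \<in> bcarrier (res_bimod (Suc (X_degree j)))"
  show "X_cocycle j (res_diff f (Suc (X_degree j)) \<rho>) = 0"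
  proof (cases "j = 14")
    case True
    then show ?thesis using X_cocycle_14 by (simp add: X_degree_def numeral_eq_Suc)
  next
    case False
    let ?n = "X_degree j"
    have n: "?n < 4" "?n \<le> 4" "Suc ?n \<le> 4" and j': "j \<in> set [1..<14]" "j \<in> set [1..<15]"
      using j False by (auto simp: X_degree_def)
    have v: "valid_fk_table ?n (phi_table j)" using phi_table_check(1) j'(2) unfolding list_all_iff by blast
    show ?thesis
    proof (rule fk_hom_eqI[OF n(3) bimod_hom_comp[OF P.d_hom X_cocycle_hom] bimod_hom_zero[OF bimodule_fk] _ \<rho>])
      fix k u assume ku: "(k, u) \<in> res_index (Suc ?n)"
      have "vanishes (<) (map_fk (phi_table j) (diff_table (Suc ?n) k u))"
        using phi_table_check(2) j'(1) ku index_list[of k u "Suc ?n"] unfolding list_all_iff by blast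
      then have "eval_fk (map_fk (phi_table j) (diff_table (Suc ?n) k u)) = (0 :: 'k fk3)"
        unfolding eval_fk_def by (rule eval_vanishes[OF vector_space_fk_scale])
      moreover have "X_cocycle j (eval_res ?n (diff_table (Suc ?n) k u))
          = (eval_fk (map_fk (phi_table j) (diff_table (Suc ?n) k u)) :: 'k fk3)"
        by (rule eval_map_fk[OF n(2) X_cocycle_hom X_cocycle_table[OF j] v valid_tableD[OF diff_table_valid[OF n(1)] ku]])
      ultimately show "X_cocycle j (res_diff f (Suc ?n) (res_gen (Suc ?n) k u 1 1)) = 0"
        by (simp add: res_diff_table[OF n(1) ku])
    qed
  qed
qed

lemma X_has_table: "j \<in> {1..14} \<Longrightarrow> has_table (X_degree j) (phi_table j) (X j)"
  by (rule has_tableI[OF represents_X X_degree_le X_cocycle_hom X_cocycle_table])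

lemma X_valid: "j \<in> {1..14} \<Longrightarrow> valid_fk_table (X_degree j) (phi_table j)"
  using phi_table_check(1) unfolding list_all_iff by simp

lemma X_derivation:
  assumes i: "i \<in> {4..7}"
  obtains D where "D \<in> cochains_deg 1" "hoch_diff D = 0" "X i = abs_hh D"
    "\<And>t. t < 12 \<Longrightarrow> D [fk_basis t] = (eval_fk (der_table i t) :: 'k fk3)"
proof -
  have n: "X_degree i = 1" and i': "i \<in> {1..14}" using i by (auto simp: X_degree_def)
  obtain D where D: "D \<in> cochains_deg 1" "hoch_diff D = 0" "X i = abs_hh D"
    "\<And>u. u < 3 \<Longrightarrow> D [fk_basis (Suc u)] = - X_cocycle i (res_gen 1 0 u 1 1)"
    using represents_derivation[OF represents_X[OF i', unfolded n]] by blast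
  have m: "multilinear D" by (rule cochains_deg_multilinear[OF D(1)])
  have D1: "D [1] = 0" using derivation_cocycle[OF m D(2), of 1 1] by simp
  have gen: "D [fk_basis (Suc u)] = - (eval_fk (phi_table i 0 u) :: 'k fk3)" if "u < 3" for u
    using D(4)[OF that] X_cocycle_table[OF i', of 0 u, unfolded n] that
    by (simp add: res_index_def basis_size_def words_basis_small)
  have g: "D [fk_a] = - (eval_fk (phi_table i 0 0) :: 'k fk3)" "D [fk_b] = - (eval_fk (phi_table i 0 1) :: 'k fk3)"
    "D [fk_c] = - (eval_fk (phi_table i 0 2) :: 'k fk3)"
    using gen[of 0] gen[of 1] gen[of 2] by (simp_all add: numeral_eq_Suc fk_basis_def)
  have "D [fk_basis t] = (eval_fk (der_table i t) :: 'k fk3)" if "t < 12" for t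
  proof -
    have "i = 4 \<or> i = 5 \<or> i = 6 \<or> i = 7" using i by auto
    then show ?thesis
      using that unfolding less_12
      by (elim disjE; simp add: derivation_cocycle[OF m D(2)] D1 g der_table_def phi_table_def eval_fk_simps
          fk.scale_minus_left; simp add: fk_normal algebra_simps)
  qed
  then show thesis using D by (intro that)
qed

lemma X_bracket:
  assumes three: "(3 :: 'k) \<noteq> 0" and i: "i \<in> {4..7}" and j: "j \<in> {1..14}"
  shows "has_table (X_degree j) (bracket_table i j)
    (of_int (del_factor i (X_degree j)) \<cdot> hh_bracket (X i) (X j))"
proof -
  obtain D where D: "D \<in> cochains_deg 1" "hoch_diff D = 0" "X i = abs_hh D"
    "\<And>t. t < 12 \<Longrightarrow> D [fk_basis t] = (eval_fk (der_table i t) :: 'k fk3)"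
    using X_derivation[OF i] by blast
  have "i = 4 \<or> i = 5 \<or> i = 6 \<or> i = 7" using i by auto
  then have "op_check 4 (del_factor i) (der_table i) (del_table i)" using op_checks by auto
  then have c: "op_check (X_degree j) (del_factor i) (der_table i) (del_table i)"
    by (rule op_check_mono[OF _ X_degree_le])
  have G0: "del_table i 0 = (\<lambda>k u. [])" and N0: "del_factor i 0 = 1"
    by (simp_all add: del_table_def del_factor_def fun_eq_iff)
  have N: "(of_int (del_factor i k) :: 'k) \<noteq> 0" for k using three by (simp add: del_factor_def)
  show ?thesis
    unfolding D(3) bracket_table_def[abs_def]
    by (rule has_table_bracket[OF D(1,2,4) X_degree_le c G0 N0 N X_valid[OF j] X_has_table[OF j]])
qed

lemma X_bracket_eq:
  assumes "(3 :: 'k) \<noteq> 0" "i \<in> {4..7}" "j \<in> {1..14}" "X_degree j = n"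
    "has_table n T y" "table_eq n (bracket_table i j) T (psi_table i j)"
  shows "of_int (del_factor i n) \<cdot> hh_bracket (X i) (X j) = y"
  using has_table_unique[OF X_degree_le X_bracket[OF assms(1-3)]] assms(4-6) by blast

lemma X_prod:
  assumes "lift_check 2 2 (phi_table q) (lift_table q)" "q \<in> {9..12}" "p \<in> {1..12}" "X_degree p = m"
  shows "has_table (2 + m) (prod_table p q) (X p * X q)"
proof -
  have q: "X_degree q = 2" and m: "m \<le> 2" using assms(2-4) by (auto simp: X_degree_def)
  have p: "has_table m (phi_table p) (X p)" "valid_fk_table m (phi_table p)"
    using X_has_table[of p] X_valid[of p] assms(3,4) by auto
  have y: "has_table 2 (phi_table q) (X q)" using X_has_table[of q] assms(2) q by auto
  show ?thesis
    using has_table_prod[OF p(1) y _ p(2) lift_check_mono[OF assms(1) m]] m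
    unfolding prod_table_def[abs_def] assms(4) by simp
qed

lemma X_prod_13:
  assumes "p \<in> {1, 2}" shows "has_table 3 (prod_table p 13) (X p * X 13)"
proof -
  have d: "X_degree p = 0" "X_degree 13 = 3" using assms by (auto simp: X_degree_def)
  have p: "has_table 0 (phi_table p) (X p)" "valid_fk_table 0 (phi_table p)"
    using X_has_table[of p] X_valid[of p] assms d by auto
  have y: "has_table 3 (phi_table 13) (X 13)" using X_has_table[of 13] d by auto
  show ?thesis
    using has_table_prod[OF p(1) y _ p(2) lift_checks(5)] unfolding prod_table_def[abs_def] d(1) by simp
qed

lemma X_prod_sum: "has_table 2 (\<lambda>k u. map_fk (phi_table 1) (lift_table 9 0 k u @ lift_table 10 0 k u)) (X 1 * (X 9 + X 10))"
proof -
  have d: "X_degree 1 = 0" "X_degree 9 = 2" "X_degree 10 = 2" by (simp_all add: X_degree_def)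
  have y: "has_table 2 (\<lambda>k u. phi_table 9 k u @ phi_table 10 k u) (X 9 + X 10)"
    using X_has_table[of 9] X_has_table[of 10] d by (intro has_table_add) simp_all
  have "has_table 0 (phi_table 1) (X 1)" "valid_fk_table 0 (phi_table 1)"
    using X_has_table[of 1] X_valid[of 1] d by simp_all
  from has_table_prod[OF this(1) y _ this(2) lift_checks(6)] show ?thesis by simp
qed

end

theorem proposition4p10:
  fixes f :: "nat \<Rightarrow> 'k::field kos \<Rightarrow> 'k kos"
    and \<iota> :: "nat \<Rightarrow> (nat \<Rightarrow> 'k kos) \<Rightarrow> 'k bar"
    and X :: "nat \<Rightarrow> 'k hh"
    and \<tau> :: "nat \<Rightarrow> 'k"
    and i j :: nat
  assumes char: "CHAR('k) \<noteq> 2" "CHAR('k) \<noteq> 3"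
    and res: "fk_resolution f"
    and comp: "fk_comparison f \<iota>"
    and X: "X = X_class f \<iota>"
    and tau: "\<tau> 4 = 1" "\<tau> 5 = 1" "\<tau> 6 = - 1"
    and ij: "i \<in> {4..7}" "j \<in> {1..14}"
  shows "hh_bracket (X i) (X j) =
    (if (i, j) \<in> ({4..7} \<times> {1..7}) \<union> ({4..6} \<times> {9..11}) then 0
     else if j = 8 then 2 \<cdot> X i
     else if i = 7 \<and> j = 9 then 4 \<cdot> (X 1 * X 9)
     else if i = 7 \<and> j = 10 then X 1 * X 10
     else if i = 7 \<and> j = 11 then - (X 1 * (X 9 + X 10))
     else if i \<in> {4, 5} \<and> j = 12 then 2 \<cdot> (X 1 * X (i + 5))
     else if i = 6 \<and> j = 12 then 2 \<cdot> (X 1 * (X 9 + X 10))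
     else if i = 7 \<and> j = 12 then X 1 * X 9
     else if i \<in> {4, 5, 6} \<and> j = 13 then (8 * \<tau> i) \<cdot> (X 4 * X 10)
     else if i = 7 \<and> j = 13 then 4 \<cdot> (X 1 * X 13) - 4 \<cdot> (X 2 * X 13) - 8 \<cdot> (X 4 * X 12)
     else if i \<in> {4, 5, 6} \<and> j = 14
       then \<tau> i \<cdot> ((1 / 3) \<cdot> (X (i + 5) * X (i + 5)) - (4 / 3) \<cdot> (X 9 * X 10))
     else X 9 * X 12)"
proof -
  interpret comparison f \<iota> by unfold_locales (rule res, rule comp)
  have three: "(3 :: 'k) \<noteq> 0"
  proof
    assume "(3 :: 'k) = 0"
    \<comment> \<open>A characteristic dividing 3 is nonzero and at most 3; it is not 1 because 1
      and 0 differ, and 2 and 3 are excluded by assumption.\<close>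
    then have "CHAR('k) dvd 3" using of_nat_eq_0_iff_char_dvd[of 3, where 'a = 'k] by simp
    moreover from this have "CHAR('k) \<le> 3" by (rule dvd_imp_le) simp
    moreover have "CHAR('k) \<noteq> 0" using calculation(1) by (metis dvd_0_left zero_neq_numeral)
    moreover have "CHAR('k) \<noteq> 1" using of_nat_CHAR[where 'a = 'k] by (auto simp del: of_nat_CHAR)
    ultimately show False using char by linarith
  qed
  note eq = X_bracket_eq[OF three, folded X]
  note table = X_has_table[folded X] and p = X_prod[folded X] and p13 = X_prod_13[folded X]
    and psum = X_prod_sum[folded X]
  have deg: "X_degree 9 = 2" "X_degree 10 = 2" "X_degree 11 = 2" "X_degree 12 = 2" "X_degree 13 = 3" "X_degree 14 = 4"
    "X_degree 8 = 1" "X_degree 1 = 0" "X_degree 4 = 1"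
    by (simp_all add: X_degree_def)
  have zero: "hh_bracket (X i) (X j) = 0"
    if "(i, j) \<in> set (List.product [4, 5, 6, 7] [1, 2, 3, 4, 5, 6, 7] @ List.product [4, 5, 6] [9, 10, 11])" for i j
  proof -
    have "table_eq (X_degree j) (bracket_table i j) (\<lambda>k u. []) (psi_table i j)"
      using bracket_zero_checks that unfolding list_all_iff by blast
    moreover have r: "i \<in> {4..7}" "j \<in> {1..14}" and d: "X_degree j \<le> 2" using that by (auto simp: X_degree_def)
    ultimately have "of_int (del_factor i (X_degree j)) \<cdot> hh_bracket (X i) (X j) = 0"
      by (intro eq[OF r refl has_table_zero[OF X_degree_le]])
    then show ?thesis using d by (simp add: del_factor_def)
  qed
  have b8: "hh_bracket (X i) (X 8) = 2 \<cdot> X i" if "i \<in> set [4, 5, 6, 7]" for i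
  proof -
    have d: "X_degree i = 1" and r: "i \<in> {4..7}" "i \<in> {1..14}" using that by (auto simp: X_degree_def)
    have "table_eq 1 (bracket_table i 8) (\<lambda>k u. scale_terms 2 (phi_table i k u)) (psi_table i 8)"
      using bracket_checks(1) that unfolding list_all_iff by blast
    from eq[OF r(1) _ deg(7) has_table_scale[OF _ table[OF r(2), unfolded d]] this]
    show ?thesis by (simp add: del_factor_def)
  qed
  note pr = p[OF lift_checks(1) _ _ deg(8)] p[OF lift_checks(2) _ _ deg(8)]
    p[OF lift_checks(2) _ _ deg(9)] p[OF lift_checks(4) _ _ deg(9)]
    p[OF lift_checks(1) _ _ deg(1)] p[OF lift_checks(2) _ _ deg(2)] p[OF lift_checks(3) _ _ deg(3)]
    p[OF lift_checks(2) _ _ deg(1)] p[OF lift_checks(4) _ _ deg(1)]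
  have P: "has_table 2 (prod_table 1 9) (X 1 * X 9)" "has_table 2 (prod_table 1 10) (X 1 * X 10)"
    "has_table 3 (prod_table 4 10) (X 4 * X 10)" "has_table 3 (prod_table 4 12) (X 4 * X 12)"
    "has_table 4 (prod_table 9 9) (X 9 * X 9)" "has_table 4 (prod_table 10 10) (X 10 * X 10)"
    "has_table 4 (prod_table 11 11) (X 11 * X 11)" "has_table 4 (prod_table 9 10) (X 9 * X 10)"
    "has_table 4 (prod_table 9 12) (X 9 * X 12)"
    using pr by simp_all
  note S = has_table_scale and A = has_table_add
  have b: "hh_bracket (X 7) (X 9) = 4 \<cdot> (X 1 * X 9)" "hh_bracket (X 7) (X 10) = X 1 * X 10"
    "hh_bracket (X 7) (X 11) = - (X 1 * (X 9 + X 10))"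
    "hh_bracket (X 4) (X 12) = 2 \<cdot> (X 1 * X 9)" "hh_bracket (X 5) (X 12) = 2 \<cdot> (X 1 * X 10)"
    "hh_bracket (X 6) (X 12) = 2 \<cdot> (X 1 * (X 9 + X 10))" "hh_bracket (X 7) (X 12) = X 1 * X 9"
    "hh_bracket (X 4) (X 13) = 8 \<cdot> (X 4 * X 10)" "hh_bracket (X 5) (X 13) = 8 \<cdot> (X 4 * X 10)"
    "hh_bracket (X 6) (X 13) = - (8 \<cdot> (X 4 * X 10))"
    "hh_bracket (X 7) (X 13) = 4 \<cdot> (X 1 * X 13) - 4 \<cdot> (X 2 * X 13) - 8 \<cdot> (X 4 * X 12)"
    "hh_bracket (X 7) (X 14) = X 9 * X 12"
    using eq[OF _ _ deg(1) S[OF _ P(1)] bracket_checks(2)] eq[OF _ _ deg(2) P(2) bracket_checks(3)]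
      eq[OF _ _ deg(3) S[OF _ psum] bracket_checks(4)] eq[OF _ _ deg(4) S[OF _ P(1)] bracket_checks(5)]
      eq[OF _ _ deg(4) S[OF _ P(2)] bracket_checks(6)] eq[OF _ _ deg(4) S[OF _ psum] bracket_checks(7)]
      eq[OF _ _ deg(4) P(1) bracket_checks(8)] eq[OF _ _ deg(5) S[OF _ P(3)] bracket_checks(9)]
      eq[OF _ _ deg(5) S[OF _ P(3)] bracket_checks(10)] eq[OF _ _ deg(5) S[OF _ P(3)] bracket_checks(11)]
      eq[OF _ _ deg(5) A[OF _ S[OF _ p13] A[OF _ S[OF _ p13] S[OF _ P(4)]]] bracket_checks(12)]
      eq[OF _ _ deg(6) P(9) bracket_checks(16)]
    by (simp_all add: del_factor_def hhv.scale_minus_left)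
  \<comment> \<open>The checks with X_14 yield three times the bracket; invertibility of 3 recovers
    the bracket itself.\<close>
  have third: "x = (1 / 3) \<cdot> y" if "3 \<cdot> x = y" for x y :: "'k hh"
    using that three by (simp add: hhv.scale_scale flip: that)
  have c: "3 \<cdot> hh_bracket (X 4) (X 14) = X 9 * X 9 - 4 \<cdot> (X 9 * X 10)"
    "3 \<cdot> hh_bracket (X 5) (X 14) = X 10 * X 10 - 4 \<cdot> (X 9 * X 10)"
    "3 \<cdot> hh_bracket (X 6) (X 14) = - (X 11 * X 11) + 4 \<cdot> (X 9 * X 10)"
    using eq[OF _ _ deg(6) A[OF _ S[OF _ P(5)] S[OF _ P(8)]] bracket_checks(13)]
      eq[OF _ _ deg(6) A[OF _ S[OF _ P(6)] S[OF _ P(8)]] bracket_checks(14)]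
      eq[OF _ _ deg(6) A[OF _ S[OF _ P(7)] S[OF _ P(8)]] bracket_checks(15)]
    by (simp_all add: del_factor_def hhv.scale_minus_left)
  have b14: "hh_bracket (X 4) (X 14) = (1 / 3) \<cdot> (X 9 * X 9) - (4 / 3) \<cdot> (X 9 * X 10)"
    "hh_bracket (X 5) (X 14) = (1 / 3) \<cdot> (X 10 * X 10) - (4 / 3) \<cdot> (X 9 * X 10)"
    "hh_bracket (X 6) (X 14) = - ((1 / 3) \<cdot> (X 11 * X 11) - (4 / 3) \<cdot> (X 9 * X 10))"
    using c[THEN third] by (simp_all add: hhv.scale_right_diff_distrib hhv.scale_right_distrib hhv.scale_minus_right)
  have "i = 4 \<or> i = 5 \<or> i = 6 \<or> i = 7" using ij by auto
  then show ?thesis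
    using ij(2) unfolding less_15
    by (elim disjE; simp add: zero b8 b b14 tau hhv.scale_minus_left)
qed

end
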